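(* Let $n\ge 3$, let $M$ be a closed (connected) smooth $n$-dimensional manifold, let $g$ be a unit-volume Riemannian metric on $M$ with constant sectional curvature $0$, and let $s,\tau\in\mathbb{R}$. When the variation is restricted to transverse-traceless directions, the second variation of $\mathcal{F}_{s,\tau}$ at $g$ is non-negative if $s>-4$ and non-positive if $s<-4$; that is, for every transverse-traceless $h\in S^2(M)$ one has $D^2\mathcal{F}_{s,\tau}(h)\ge 0$ if $s>-4$, and $D^2\mathcal{F}_{s,\tau}(h)\le 0$ if $s<-4$.
   Context: For a Riemannian metric $\bar g$ on $M$ let $Rm$, $Ric$, $R$ denote its Riemann curvature tensor, Ricci tensor and scalar curvature, with $|Rm|^2=R_{ijkl}R^{ijkl}$ and $|Ric|^2=R_{ij}R^{ij}$, and set $$\mathcal{F}_{s,\tau}[\bar g]=\int_M|Rm|^2\,dV_{\bar g}+s\int_M|Ric|^2\,dV_{\bar g}+\tau\int_M R^2\,dV_{\bar g}.$$ The functional is considered on the space $\mathscr{M}_1$ of smooth Riemannian metrics on $M$ with unit volume. $S^2(M)$ is the space of smooth symmetric $(0,2)$-tensor fields. A tensor $h\in S^2(M)$ is transverse-traceless (TT) if $\delta_g h=0$ and $\mathrm{tr}_g h=0$, where $(\delta_g h)_j=g^{pq}\nabla_q h_{pj}$. For a TT tensor $h$, the second variation is $D^2\mathcal{F}_{s,\tau}(h)=\frac{d^2}{dt^2}\big|_{t=0}\mathcal{F}_{s,\tau}[g(t)]$, where $g(t)$ is any smooth curve in $\mathscr{M}_1$ with $g(0)=g$ and $g'(0)=h$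 (the value depends only on $h$, since $g$ is a critical point of $\mathcal{F}_{s,\tau}$ on $\mathscr{M}_1$). *)

theory Defs
  imports "HOL-Analysis.Analysis"
begin

section \<open>Smooth maps on open subsets of normed spaces\<close>

text \<open>Only meant for open \<open>S\<close>; \<open>frechet_derivative f (at x) v\<close> is then the directional
  derivative of \<open>f\<close> at \<open>x\<close> along \<open>v\<close>.\<close>

primrec Ck_on :: "nat \<Rightarrow> 'a::real_normed_vector set \<Rightarrow> ('a \<Rightarrow> 'b::real_normed_vector) \<Rightarrow> bool" where
  "Ck_on 0 S f \<longleftrightarrow> continuous_on S f"
| "Ck_on (Suc k) S f \<longleftrightarrow>
     (\<forall>x\<in>S. f differentiable (at x)) \<and> (\<forall>v. Ck_on k S (\<lambda>x. frechet_derivative f (at x) v))"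

definition smooth_on :: "'a::real_normed_vector set \<Rightarrow> ('a \<Rightarrow> 'b::real_normed_vector) \<Rightarrow> bool" where
  "smooth_on S f \<longleftrightarrow> (\<forall>k. Ck_on k S f)"

section \<open>Closed manifolds\<close>

text \<open>The underlying set of the manifold is a whole type \<open>'a\<close>, of dimension \<open>CARD('n)\<close>. A chart is a
  pair of its domain and its coordinate map; the values of the coordinate map outside the domain
  carry no meaning.\<close>

type_synonym ('a, 'n) chart = "'a set \<times> ('a \<Rightarrow> real ^ 'n)"

abbreviation dom_chart :: "('a, 'n) chart \<Rightarrow> 'a set" where
  "dom_chart c \<equiv> fst c"

abbreviation img_chart :: "('a, 'n) chart \<Rightarrow> (real ^ 'n) set" where
  "img_chart c \<equiv> snd c ` fst c"

definition overlap :: "('a, 'n) chart \<Rightarrow> ('a, 'n) chart \<Rightarrow> (real ^ 'n) set" where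
  "overlap c d = snd c ` (fst c \<inter> fst d)"

definition transition :: "('a, 'n) chart \<Rightarrow> ('a, 'n) chart \<Rightarrow> real ^ 'n \<Rightarrow> real ^ 'n" where
  "transition c d = snd d \<circ> inv_into (fst c) (snd c)"

definition is_chart :: "('a::topological_space, 'n::finite) chart \<Rightarrow> bool" where
  "is_chart c \<longleftrightarrow> open (dom_chart c) \<and> open (img_chart c) \<and>
     (\<exists>\<psi>. homeomorphism (dom_chart c) (img_chart c) (snd c) \<psi>)"

definition smooth_atlas :: "('a::topological_space, 'n::finite) chart set \<Rightarrow> bool" where
  "smooth_atlas A \<longleftrightarrow> (\<forall>c\<in>A. is_chart c) \<and> (\<Union>c\<in>A. dom_chart c) = UNIV \<and>
     (\<forall>c\<in>A. \<forall>d\<in>A. smooth_on (overlap c d) (transition c d))"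

text \<open>Second countability is implied by compactness.\<close>

definition closed_connected_manifold :: "('a::t2_space, 'n::finite) chart set \<Rightarrow> bool" where
  "closed_connected_manifold A \<longleftrightarrow>
     smooth_atlas A \<and> compact (UNIV :: 'a set) \<and> connected (UNIV :: 'a set)"

section \<open>Symmetric (0,2)-tensor fields and Riemannian metrics\<close>

text \<open>A (0,2)-tensor field is given by its matrix of components in each chart, as a function of
  the coordinates. The components in chart \<open>c\<close> are meaningful on \<open>img_chart c\<close> only, and fields
  have to be compared there.\<close>

type_synonym ('a, 'n) tensor2 = "('a, 'n) chart \<Rightarrow> real ^ 'n \<Rightarrow> real ^ 'n ^ 'n"

definition jacobian_matrix :: "(real ^ 'n \<Rightarrow> real ^ 'n) \<Rightarrow> real ^ 'n \<Rightarrow> real ^ 'n ^ 'n::finite" where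
  "jacobian_matrix f x = matrix (frechet_derivative f (at x))"

definition sym_tensor :: "('a, 'n::finite) chart set \<Rightarrow> ('a, 'n) tensor2 \<Rightarrow> bool" where
  "sym_tensor A h \<longleftrightarrow>
     (\<forall>c\<in>A. smooth_on (img_chart c) (h c)) \<and>
     (\<forall>c\<in>A. \<forall>x\<in>img_chart c. transpose (h c x) = h c x) \<and>
     (\<forall>c\<in>A. \<forall>d\<in>A. \<forall>x\<in>overlap c d.
        h c x = transpose (jacobian_matrix (transition c d) x) **
                h d (transition c d x) ** jacobian_matrix (transition c d) x)"

definition riemannian_metric :: "('a, 'n::finite) chart set \<Rightarrow> ('a, 'n) tensor2 \<Rightarrow> bool" where
  "riemannian_metric A g \<longleftrightarrow> sym_tensor A g \<and>
     (\<forall>c\<in>A. \<forall>x\<in>img_chart c. \<forall>v. v \<noteq> 0 \<longrightarrow> 0 < v \<bullet> (g c x *v v))"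

section \<open>Curvature in local coordinates\<close>

text \<open>In this section \<open>G\<close> is the component matrix of a metric in one chart.\<close>

definition pd :: "'n \<Rightarrow> (real ^ 'n \<Rightarrow> real) \<Rightarrow> real ^ 'n \<Rightarrow> real" where
  "pd i f x = frechet_derivative f (at x) (axis i 1)"

definition ginv :: "(real ^ 'n \<Rightarrow> real ^ 'n ^ 'n) \<Rightarrow> real ^ 'n \<Rightarrow> 'n::finite \<Rightarrow> 'n \<Rightarrow> real" where
  "ginv G x i j = matrix_inv (G x) $ i $ j"

text \<open>\<open>christoffel G x k i j\<close> is \<open>\<Gamma>\<close> with upper index \<open>k\<close> and lower indices \<open>i\<close>, \<open>j\<close>.\<close>

definition christoffel ::
    "(real ^ 'n \<Rightarrow> real ^ 'n ^ 'n) \<Rightarrow> real ^ 'n \<Rightarrow> 'n::finite \<Rightarrow> 'n \<Rightarrow> 'n \<Rightarrow> real" where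
  "christoffel G x k i j = (\<Sum>l\<in>UNIV. ginv G x k l *
     (pd i (\<lambda>y. G y $ j $ l) x + pd j (\<lambda>y. G y $ i $ l) x - pd l (\<lambda>y. G y $ i $ j) x)) / 2"

text \<open>\<open>riem_up G x i j k l\<close> is the coefficient of \<open>\<partial>\<^sub>l\<close> in \<open>R(\<partial>\<^sub>i, \<partial>\<^sub>j)\<partial>\<^sub>k\<close>, where
  \<open>R(X,Y)Z = \<nabla>\<^sub>X\<nabla>\<^sub>Y Z - \<nabla>\<^sub>Y\<nabla>\<^sub>X Z - \<nabla>\<^bsub>[X,Y]\<^esub> Z\<close>, and \<open>riem G x i j k l\<close> is
  \<open>g(R(\<partial>\<^sub>i, \<partial>\<^sub>j)\<partial>\<^sub>k, \<partial>\<^sub>l)\<close>.\<close>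

definition riem_up ::
    "(real ^ 'n \<Rightarrow> real ^ 'n ^ 'n) \<Rightarrow> real ^ 'n \<Rightarrow> 'n::finite \<Rightarrow> 'n \<Rightarrow> 'n \<Rightarrow> 'n \<Rightarrow> real" where
  "riem_up G x i j k l =
     pd i (\<lambda>y. christoffel G y l j k) x - pd j (\<lambda>y. christoffel G y l i k) x
     + (\<Sum>m\<in>UNIV. christoffel G x l i m * christoffel G x m j k
                 - christoffel G x l j m * christoffel G x m i k)"

definition riem ::
    "(real ^ 'n \<Rightarrow> real ^ 'n ^ 'n) \<Rightarrow> real ^ 'n \<Rightarrow> 'n::finite \<Rightarrow> 'n \<Rightarrow> 'n \<Rightarrow> 'n \<Rightarrow> real" where
  "riem G x i j k l = (\<Sum>m\<in>UNIV. G x $ l $ m * riem_up G x i j k m)"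

definition ricci ::
    "(real ^ 'n \<Rightarrow> real ^ 'n ^ 'n) \<Rightarrow> real ^ 'n \<Rightarrow> 'n::finite \<Rightarrow> 'n \<Rightarrow> real" where
  "ricci G x j k = (\<Sum>i\<in>UNIV. riem_up G x i j k i)"

definition scal :: "(real ^ 'n \<Rightarrow> real ^ 'n ^ 'n) \<Rightarrow> real ^ 'n::finite \<Rightarrow> real" where
  "scal G x = (\<Sum>j\<in>UNIV. \<Sum>k\<in>UNIV. ginv G x j k * ricci G x j k)"

definition riem_norm2 :: "(real ^ 'n \<Rightarrow> real ^ 'n ^ 'n) \<Rightarrow> real ^ 'n::finite \<Rightarrow> real" where
  "riem_norm2 G x =
     (\<Sum>i\<in>UNIV. \<Sum>j\<in>UNIV. \<Sum>k\<in>UNIV. \<Sum>l\<in>UNIV. \<Sum>p\<in>UNIV. \<Sum>q\<in>UNIV. \<Sum>r\<in>UNIV. \<Sum>u\<in>UNIV.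
        ginv G x i p * ginv G x j q * ginv G x k r * ginv G x l u *
        riem G x i j k l * riem G x p q r u)"

definition ricci_norm2 :: "(real ^ 'n \<Rightarrow> real ^ 'n ^ 'n) \<Rightarrow> real ^ 'n::finite \<Rightarrow> real" where
  "ricci_norm2 G x =
     (\<Sum>i\<in>UNIV. \<Sum>j\<in>UNIV. \<Sum>p\<in>UNIV. \<Sum>q\<in>UNIV.
        ginv G x i p * ginv G x j q * ricci G x i j * ricci G x p q)"

text \<open>Sectional curvature of the plane spanned by \<open>u\<close> and \<open>v\<close>, normalised so that round spheres
  have positive curvature.\<close>

definition sec_curv ::
    "(real ^ 'n \<Rightarrow> real ^ 'n ^ 'n) \<Rightarrow> real ^ 'n \<Rightarrow> real ^ 'n \<Rightarrow> real ^ 'n::finite \<Rightarrow> real" where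
  "sec_curv G x u v =
     (\<Sum>i\<in>UNIV. \<Sum>j\<in>UNIV. \<Sum>k\<in>UNIV. \<Sum>l\<in>UNIV. riem G x i j k l * u $ i * v $ j * v $ k * u $ l) /
     ((u \<bullet> (G x *v u)) * (v \<bullet> (G x *v v)) - (u \<bullet> (G x *v v))\<^sup>2)"

definition constant_sectional_curvature ::
    "('a, 'n::finite) chart set \<Rightarrow> ('a, 'n) tensor2 \<Rightarrow> real \<Rightarrow> bool" where
  "constant_sectional_curvature A g \<kappa> \<longleftrightarrow>
     (\<forall>c\<in>A. \<forall>x\<in>img_chart c. \<forall>u v. u \<noteq> v \<and> independent {u, v} \<longrightarrow> sec_curv (g c) x u v = \<kappa>)"

section \<open>Transverse-traceless tensors\<close>

text \<open>\<open>nabla2 G H x q p j\<close> is the component \<open>\<nabla>\<^sub>q h\<^bsub>pj\<^esub>\<close>, with \<open>\<nabla>\<close> the Levi-Civita connection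
  of \<open>G\<close>.\<close>

definition nabla2 :: "(real ^ 'n \<Rightarrow> real ^ 'n ^ 'n) \<Rightarrow> (real ^ 'n \<Rightarrow> real ^ 'n ^ 'n) \<Rightarrow> real ^ 'n \<Rightarrow>
    'n::finite \<Rightarrow> 'n \<Rightarrow> 'n \<Rightarrow> real" where
  "nabla2 G H x q p j = pd q (\<lambda>y. H y $ p $ j) x
     - (\<Sum>m\<in>UNIV. christoffel G x m q p * H x $ m $ j + christoffel G x m q j * H x $ p $ m)"

definition div2 :: "(real ^ 'n \<Rightarrow> real ^ 'n ^ 'n) \<Rightarrow> (real ^ 'n \<Rightarrow> real ^ 'n ^ 'n) \<Rightarrow> real ^ 'n \<Rightarrow>
    'n::finite \<Rightarrow> real" where
  "div2 G H x j = (\<Sum>p\<in>UNIV. \<Sum>q\<in>UNIV. ginv G x p q * nabla2 G H x q p j)"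

definition tr2 :: "(real ^ 'n \<Rightarrow> real ^ 'n ^ 'n) \<Rightarrow> (real ^ 'n \<Rightarrow> real ^ 'n ^ 'n) \<Rightarrow>
    real ^ 'n::finite \<Rightarrow> real" where
  "tr2 G H x = (\<Sum>p\<in>UNIV. \<Sum>q\<in>UNIV. ginv G x p q * H x $ p $ q)"

definition TT_tensor ::
    "('a, 'n::finite) chart set \<Rightarrow> ('a, 'n) tensor2 \<Rightarrow> ('a, 'n) tensor2 \<Rightarrow> bool" where
  "TT_tensor A g h \<longleftrightarrow> sym_tensor A h \<and>
     (\<forall>c\<in>A. \<forall>x\<in>img_chart c. (\<forall>j. div2 (g c) (h c) x j = 0) \<and> tr2 (g c) (h c) x = 0)"

section \<open>Volume measure and the curvature functional\<close>

text \<open>The Riemannian volume is the unique Borel measure that is given by \<open>\<surd>(det g) dx\<close> in every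
  chart.\<close>

definition volume_measure ::
    "('a::topological_space, 'n::finite) chart set \<Rightarrow> ('a, 'n) tensor2 \<Rightarrow> 'a measure" where
  "volume_measure A g = (THE \<mu>. sets \<mu> = sets borel \<and>
     (\<forall>c\<in>A. \<forall>B\<in>sets borel. B \<subseteq> dom_chart c \<longrightarrow>
        emeasure \<mu> B = (\<integral>\<^sup>+x\<in>snd c ` B. ennreal (sqrt (det (g c x))) \<partial>lborel)))"

text \<open>Turns a coordinate expression \<open>S\<close> for a scalar into a function on the manifold, by evaluating
  it in some chart around the point; it is applied to coordinate-invariant expressions only.\<close>

definition scalar_field ::
    "('a, 'n::finite) chart set \<Rightarrow> (('a, 'n) chart \<Rightarrow> real ^ 'n \<Rightarrow> real) \<Rightarrow> 'a \<Rightarrow> real" where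
  "scalar_field A S p = (let c = (SOME c. c \<in> A \<and> p \<in> dom_chart c) in S c (snd c p))"

definition curv_functional ::
    "('a::topological_space, 'n::finite) chart set \<Rightarrow> real \<Rightarrow> real \<Rightarrow> ('a, 'n) tensor2 \<Rightarrow> real" where
  "curv_functional A s \<tau> g =
     (LINT p|volume_measure A g. scalar_field A (\<lambda>c. riem_norm2 (g c)) p)
     + s * (LINT p|volume_measure A g. scalar_field A (\<lambda>c. ricci_norm2 (g c)) p)
     + \<tau> * (LINT p|volume_measure A g. scalar_field A (\<lambda>c x. (scal (g c) x)\<^sup>2) p)"

section \<open>Second variation\<close>

definition unit_volume_metric ::
    "('a::topological_space, 'n::finite) chart set \<Rightarrow> ('a, 'n) tensor2 \<Rightarrow> bool" where
  "unit_volume_metric A g \<longleftrightarrow> riemannian_metric A g \<and> emeasure (volume_measure A g) UNIV = 1"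

text \<open>Smooth curves of unit-volume metrics through \<open>g\<close> with velocity \<open>h\<close>: the components are jointly
  smooth in the parameter and the coordinates. The curve only needs to be defined near \<open>0\<close>.\<close>

definition unit_volume_curve :: "('a::topological_space, 'n::finite) chart set \<Rightarrow>
    ('a, 'n) tensor2 \<Rightarrow> ('a, 'n) tensor2 \<Rightarrow> (real \<Rightarrow> ('a, 'n) tensor2) \<Rightarrow> bool" where
  "unit_volume_curve A g h \<gamma> \<longleftrightarrow>
     (\<exists>\<epsilon>>0. (\<forall>t\<in>{-\<epsilon><..<\<epsilon>}. unit_volume_metric A (\<gamma> t)) \<and>
        (\<forall>c\<in>A. smooth_on ({-\<epsilon><..<\<epsilon>} \<times> img_chart c) (\<lambda>(t, x). \<gamma> t c x))) \<and>
     (\<forall>c\<in>A. \<forall>x\<in>img_chart c. \<gamma> 0 c x = g c x \<and>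
        ((\<lambda>t. \<gamma> t c x) has_vector_derivative h c x) (at 0))"

definition has_second_derivative :: "(real \<Rightarrow> real) \<Rightarrow> real \<Rightarrow> real \<Rightarrow> bool" where
  "has_second_derivative f D t \<longleftrightarrow>
     (\<exists>f'. (\<forall>\<^sub>F u in nhds t. (f has_real_derivative f' u) (at u)) \<and>
           (f' has_real_derivative D) (at t))"

text \<open>The common value of the second derivative of the functional along all curves as above. If it
  did not exist, or if there were no such curve, nothing could be derived about this constant.\<close>

definition second_variation :: "('a::topological_space, 'n::finite) chart set \<Rightarrow> real \<Rightarrow> real \<Rightarrow>
    ('a, 'n) tensor2 \<Rightarrow> ('a, 'n) tensor2 \<Rightarrow> real" where
  "second_variation A s \<tau> g h =
     (THE D. \<forall>\<gamma>. unit_volume_curve A g h \<gamma> \<longrightarrow>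
        has_second_derivative (\<lambda>t. curv_functional A s \<tau> (\<gamma> t)) D 0)"

end

theory Submission
  imports Defs
begin

text \<open>At a flat metric the curvature vanishes, so the second variation along \<open>h\<close> is
  \<open>2 \<integral> (|Rm'|\<^sup>2 + s |Ric'|\<^sup>2 + \<tau> R'\<^sup>2)\<close>, where \<open>Rm'\<close>, \<open>Ric'\<close>, \<open>R'\<close> are the linearizations of the
  curvatures in the direction \<open>h\<close>. Covariant derivatives commute. For transverse-traceless \<open>h\<close> this
  gives \<open>Ric' = - \<Delta>h / 2\<close> and \<open>R' = 0\<close>, and \<open>|Rm'|\<^sup>2 - 4 |Ric'|\<^sup>2\<close> is the divergence of a vector field
  built from \<open>\<nabla>h\<close> and \<open>\<nabla>\<nabla>h\<close>. By the divergence theorem the second variation is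
  \<open>2 (4 + s) \<integral> |Ric'|\<^sup>2\<close>. A unit-volume curve with velocity \<open>h\<close> exists: rescale \<open>g + t h\<close> pointwise to
  keep the volume form fixed.\<close>

section \<open>Calculus of smooth functions\<close>

text \<open>The constant 4 comes from integration by parts. For transverse h on a flat manifold,
  |Rm'|^2 is |nabla nabla h|^2 plus two kinds of cross terms. Up to divergences the former equals
  |Delta h|^2 = 4 |Ric'|^2, and in each cross term a derivative can be moved so as to form div h =
  0. Collecting all boundary terms in one explicit covector field leaves a single integration, but
  that field must be shown independent of the chart. Hence tensors of every rank are functions on
  lists of vectors, with one covariant derivative and one transformation lemma for all ranks. The
  acceleration of a curve contributes nothing: every term of the functional is quadratic in the
  curvature, which vanishes at g, so only first derivatives of curvature survive. The volume
  measure, scalar fields and the second variation are given by choice or definite description; each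
  must be shown to be well determined before it can be computed. Integrals are reduced to fixed
  compact boxes in charts, with weights that do not depend on the metric, so that differentiation
  under the integral takes place box by box.\<close>

abbreviation dd :: "'a::real_normed_vector \<Rightarrow> ('a \<Rightarrow> 'b::real_normed_vector) \<Rightarrow> 'a \<Rightarrow> 'b" where
  "dd v f x \<equiv> frechet_derivative f (at x) v"

lemma dd_eqI: "(f has_derivative f') (at x) \<Longrightarrow> dd v f x = f' v"
  using frechet_derivative_at by metis

lemma dd_linear: "f differentiable (at x) \<Longrightarrow> linear (\<lambda>v. dd v f x)"
  by (rule linear_frechet_derivative)

lemma dd_cong:
  assumes "open S" "x \<in> S" "\<And>y. y \<in> S \<Longrightarrow> f y = g y"
  shows "dd v f x = dd v g x"
proof (cases "f differentiable (at x)")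
  case True
  then show ?thesis using frechet_derivative_transform_within_open[OF True assms(1,2)] assms(3) by simp
next
  case False
  \<comment> \<open>Both functions have the same candidate derivatives, here none, and
    \<open>frechet_derivative\<close> is a choice depending only on the set of candidates.\<close>
  have "(f has_derivative D) (at x) \<longleftrightarrow> (g has_derivative D) (at x)" for D
    using has_derivative_transform_within_open[OF _ assms(1,2)] assms(3) by metis
  then show ?thesis unfolding frechet_derivative_def by simp
qed

lemma differentiable_cong:
  assumes "open S" "x \<in> S" "\<And>y. y \<in> S \<Longrightarrow> f y = g y"
  shows "f differentiable (at x) \<longleftrightarrow> g differentiable (at x)"
  unfolding differentiable_def
  using has_derivative_transform_within_open[OF _ assms(1,2)] assms(3) by metis

lemma Ck_on_cong:
  assumes "open S" "\<And>y. y \<in> S \<Longrightarrow> f y = g y"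
  shows "Ck_on k S f \<longleftrightarrow> Ck_on k S g"
  using assms(2)
proof (induction k arbitrary: f g)
  case 0
  then show ?case using continuous_on_cong by auto
next
  case (Suc k)
  have "Ck_on k S (\<lambda>x. dd v f x) \<longleftrightarrow> Ck_on k S (\<lambda>x. dd v g x)" for v
    by (rule Suc.IH, rule dd_cong[OF assms(1)], assumption, rule Suc.prems)
  moreover have "f differentiable (at x) \<longleftrightarrow> g differentiable (at x)" if "x \<in> S" for x
    by (rule differentiable_cong[OF assms(1) that]) (rule Suc.prems)
  ultimately show ?case by simp
qed

lemma Ck_on_congD: "open S \<Longrightarrow> (\<And>y. y \<in> S \<Longrightarrow> f y = g y) \<Longrightarrow> Ck_on k S g \<Longrightarrow> Ck_on k S f"
  by (subst Ck_on_cong[where g = g])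

lemma Ck_on_subset: "Ck_on k S f \<Longrightarrow> T \<subseteq> S \<Longrightarrow> Ck_on k T f"
  by (induction k arbitrary: f) (auto intro: continuous_on_subset)

text \<open>Meant for functions extended by zero: near each point they coincide with one of two
  expressions whose regularity is known on an open set.\<close>

lemma Ck_on_local:
  assumes "\<And>x. x \<in> S \<Longrightarrow> \<exists>T. open T \<and> x \<in> T \<and> Ck_on k T f"
  shows "Ck_on k S f"
  using assms
proof (induction k arbitrary: f)
  case 0
  have "continuous (at x) f" if "x \<in> S" for x
    using 0[OF that] continuous_on_eq_continuous_at by auto
  then show ?case by (simp add: continuous_at_imp_continuous_on)
next
  case (Suc k)
  have "f differentiable (at x)" if "x \<in> S" for x using Suc.prems[OF that] by auto
  moreover have "Ck_on k S (\<lambda>x. dd v f x)" for v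
  proof (rule Suc.IH)
    fix x assume "x \<in> S"
    then show "\<exists>T. open T \<and> x \<in> T \<and> Ck_on k T (\<lambda>x. dd v f x)" using Suc.prems[of x] by auto
  qed
  ultimately show ?case by simp
qed

lemma Ck_on_SucD: "Ck_on (Suc k) S f \<Longrightarrow> Ck_on k S f"
proof (induction k arbitrary: f)
  case 0
  then show ?case
    by (simp add: continuous_at_imp_continuous_on differentiable_imp_continuous_within)
next
  case (Suc k)
  then show ?case by simp
qed

lemma Ck_on_mono: "Ck_on m S f \<Longrightarrow> k \<le> m \<Longrightarrow> Ck_on k S f"
  by (induction m) (use Ck_on_SucD le_Suc_eq in \<open>auto simp del: Ck_on.simps(2)\<close>)

lemma Ck_on_const: "Ck_on k S (\<lambda>x. c)"
  by (induction k arbitrary: c) (auto)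

lemma Ck_on_linear: "bounded_linear f \<Longrightarrow> Ck_on k S f"
proof (cases k)
  case 0
  assume "bounded_linear f"
  then show ?thesis using 0 linear_continuous_on by auto
next
  case (Suc m)
  assume f: "bounded_linear f"
  then have d: "(f has_derivative f) (at x)" for x by (rule bounded_linear_imp_has_derivative)
  then have "dd v f x = f v" for v x by (rule dd_eqI)
  then have "dd v f = (\<lambda>x. f v)" for v by (simp add: fun_eq_iff)
  then show ?thesis using Suc differentiableI[OF d] by (simp add: Ck_on_const)
qed

lemma Ck_on_add:
  assumes "open S" "Ck_on k S f" "Ck_on k S g"
  shows "Ck_on k S (\<lambda>x. f x + g x)"
  using assms(2,3)
proof (induction k arbitrary: f g)
  case 0 then show ?case by (auto intro: continuous_on_add)
next
  case (Suc k)
  have "Ck_on k S (\<lambda>x. dd v (\<lambda>x. f x + g x) x)" for v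
  proof -
    have "Ck_on k S (\<lambda>x. dd v f x + dd v g x)" using Suc by (intro Suc.IH) auto
    moreover have "dd v (\<lambda>x. f x + g x) x = dd v f x + dd v g x" if "x \<in> S" for x
      using Suc.prems that by (intro dd_eqI has_derivative_add) (auto simp flip: frechet_derivative_works)
    ultimately show ?thesis by (auto intro: Ck_on_congD[OF assms(1)])
  qed
  then show ?case using Suc.prems by auto
qed

lemma Ck_on_bilinear:
  assumes "bounded_bilinear B" "open S" "Ck_on k S f" "Ck_on k S g"
  shows "Ck_on k S (\<lambda>x. B (f x) (g x))"
  using assms(3,4)
proof (induction k arbitrary: f g)
  case 0 then show ?case using bounded_bilinear.continuous_on[OF assms(1)] by auto
next
  case (Suc k)
  have d: "((\<lambda>x. B (f x) (g x)) has_derivative (\<lambda>v. B (f x) (dd v g x) + B (dd v f x) (g x))) (at x)"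
    if "x \<in> S" for x
    using Suc.prems that
    by (intro bounded_bilinear.FDERIV[OF assms(1)]) (auto simp flip: frechet_derivative_works)
  have "Ck_on k S (\<lambda>x. dd v (\<lambda>x. B (f x) (g x)) x)" for v
  proof -
    have "Ck_on k S (\<lambda>x. B (f x) (dd v g x) + B (dd v f x) (g x))"
      using Suc.prems Suc.prems[THEN Ck_on_SucD] by (intro Ck_on_add assms Suc.IH) simp_all
    moreover have "dd v (\<lambda>x. B (f x) (g x)) x = B (f x) (dd v g x) + B (dd v f x) (g x)" if "x \<in> S" for x
      using d[OF that] by (rule dd_eqI)
    ultimately show ?thesis by (auto intro: Ck_on_congD[OF assms(2)])
  qed
  then show ?case using d by (auto simp: differentiable_def)
qed

lemmas Ck_on_mult = Ck_on_bilinear[OF bounded_bilinear_mult]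
lemmas Ck_on_scaleR = Ck_on_bilinear[OF bounded_bilinear_scaleR]

lemma Ck_on_sum:
  assumes "open S" "\<And>i. i \<in> I \<Longrightarrow> Ck_on k S (f i)"
  shows "Ck_on k S (\<lambda>x. \<Sum>i\<in>I. f i x)"
  using assms(2)
proof (induction I rule: infinite_finite_induct)
  case (insert i I)
  then show ?case by (simp add: Ck_on_add[OF assms(1)])
qed (simp_all add: Ck_on_const)

lemma Ck_on_prod:
  fixes f :: "'i \<Rightarrow> 'a::real_normed_vector \<Rightarrow> real"
  assumes "open S" "\<And>i. i \<in> I \<Longrightarrow> Ck_on k S (f i)"
  shows "Ck_on k S (\<lambda>x. \<Prod>i\<in>I. f i x)"
  using assms(2)
proof (induction I rule: infinite_finite_induct)
  case (insert i I)
  then show ?case by (simp add: Ck_on_mult[OF assms(1)])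
qed (simp_all add: Ck_on_const)

lemma Ck_on_bounded_linear:
  assumes "open S" "bounded_linear L" "Ck_on k S f"
  shows "Ck_on k S (\<lambda>x. L (f x))"
  using assms(3)
proof (induction k arbitrary: f)
  case 0 then show ?case
    using linear_continuous_on[OF assms(2)] by (auto intro: continuous_on_compose2)
next
  case (Suc k)
  have d: "((\<lambda>x. L (f x)) has_derivative (\<lambda>v. L (dd v f x))) (at x)" if "x \<in> S" for x
    using Suc.prems that
    by (intro bounded_linear.has_derivative[OF assms(2)]) (auto simp flip: frechet_derivative_works)
  have "Ck_on k S (\<lambda>x. dd v (\<lambda>x. L (f x)) x)" for v
  proof -
    have "Ck_on k S (\<lambda>x. L (dd v f x))" using Suc by auto
    then show ?thesis by (rule Ck_on_congD[OF assms(1), rotated]) (rule dd_eqI[OF d])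
  qed
  then show ?case using d by (auto simp: differentiable_def)
qed

lemma Ck_on_minus: "open S \<Longrightarrow> Ck_on k S f \<Longrightarrow> Ck_on k S (\<lambda>x. - f x)"
  by (rule Ck_on_bounded_linear[OF _ bounded_linear_minus[OF bounded_linear_ident]])

lemma Ck_on_diff: "open S \<Longrightarrow> Ck_on k S f \<Longrightarrow> Ck_on k S g \<Longrightarrow> Ck_on k S (\<lambda>x. f x - g x)"
  using Ck_on_add[of S k f "\<lambda>x. - g x"] Ck_on_minus[of S k g] by simp

lemma dd_compose:
  assumes "f differentiable (at x)" "g differentiable (at (f x))"
  shows "dd v (\<lambda>x. g (f x)) x = dd (dd v f x) g (f x)"
  using frechet_derivative_compose[OF assms] by (simp add: o_def)

text \<open>The derivative of the composition is a derivative of \<open>g\<close> in the moving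
  direction \<open>dd v f x\<close>. Expanding that direction in \<open>Basis\<close> leaves
  products with derivatives of \<open>g\<close> in fixed directions, to which the induction
  hypothesis applies.\<close>

lemma Ck_on_compose:
  fixes f :: "'a::real_normed_vector \<Rightarrow> 'b::euclidean_space"
  assumes "open S" "open T" "f ` S \<subseteq> T" "Ck_on k S f" "Ck_on k T g"
  shows "Ck_on k S (\<lambda>x. g (f x))"
  using assms(4,5)
proof (induction k arbitrary: g)
  case 0 then show ?case using assms(3) by (auto intro: continuous_on_compose2)
next
  case (Suc k)
  have df: "f differentiable (at x)" "g differentiable (at (f x))" if "x \<in> S" for x
    using Suc.prems that assms(3) by auto
  have "Ck_on k S (\<lambda>x. dd v (\<lambda>x. g (f x)) x)" for v
  proof -
    have "Ck_on k S (\<lambda>x. \<Sum>b\<in>Basis. (dd v f x \<bullet> b) *\<^sub>R dd b g (f x))"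
      using Suc.prems Ck_on_SucD[of k S f]
      by (intro Ck_on_sum Ck_on_scaleR assms Suc.IH Ck_on_bounded_linear[OF assms(1) bounded_linear_inner_left])
         auto
    moreover have "dd v (\<lambda>x. g (f x)) x = (\<Sum>b\<in>Basis. (dd v f x \<bullet> b) *\<^sub>R dd b g (f x))" if "x \<in> S" for x
    proof -
      have "dd v (\<lambda>x. g (f x)) x = dd (\<Sum>b\<in>Basis. (dd v f x \<bullet> b) *\<^sub>R b) g (f x)"
        using dd_compose[OF df[OF that]] by (simp add: euclidean_representation)
      also have "\<dots> = (\<Sum>b\<in>Basis. (dd v f x \<bullet> b) *\<^sub>R dd b g (f x))"
        using linear_frechet_derivative[OF df(2)[OF that]] by (simp add: linear_sum linear_scale)
      finally show ?thesis .
    qed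
    ultimately show ?thesis by (auto intro: Ck_on_congD[OF assms(1)])
  qed
  moreover have "(\<lambda>x. g (f x)) differentiable (at x)" if "x \<in> S" for x
    using differentiable_compose[OF df(2)[OF that] df(1)[OF that]] by (simp add: o_def)
  ultimately show ?case by auto
qed

text \<open>The exponent is arbitrary because differentiation lowers it by 1. Reciprocals, square
  roots and the conformal factor are all obtained from this one family.\<close>

lemma Ck_on_powr: "Ck_on k {0<..} (\<lambda>x::real. x powr a)"
proof (induction k arbitrary: a)
  case 0 show ?case by (auto intro!: continuous_intros)
next
  case (Suc k)
  have d: "((\<lambda>x. x powr a) has_derivative (\<lambda>v. v * (a * x powr (a - 1)))) (at x)" if "x > 0" for x
    using has_real_derivative_powr[OF that, of a]
    by (simp add: has_field_derivative_def mult_commute_abs)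
  have "Ck_on k {0<..} (\<lambda>x. dd v (\<lambda>x. x powr a) x)" for v
  proof -
    have "Ck_on k {0<..} (\<lambda>x. v * (a * x powr (a - 1)))"
      by (intro Ck_on_mult Ck_on_const Suc) auto
    then show ?thesis by (rule Ck_on_congD[OF open_greaterThan, rotated]) (rule dd_eqI[OF d], simp)
  qed
  then show ?case using d by (auto simp: differentiable_def)
qed

lemma smooth_on_Ck: "smooth_on S f \<Longrightarrow> Ck_on k S f"
  by (simp add: smooth_on_def)

lemma smooth_on_cong: "open S \<Longrightarrow> (\<And>y. y \<in> S \<Longrightarrow> f y = g y) \<Longrightarrow> smooth_on S f \<longleftrightarrow> smooth_on S g"
  using Ck_on_cong[of S f g] by (simp add: smooth_on_def)

lemma smooth_on_subset: "smooth_on S f \<Longrightarrow> T \<subseteq> S \<Longrightarrow> smooth_on T f"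
  by (auto simp: smooth_on_def intro: Ck_on_subset)

lemma smooth_on_continuous: "smooth_on S f \<Longrightarrow> continuous_on S f"
  using smooth_on_Ck[of S f 0] by simp

lemma smooth_on_differentiable: "smooth_on S f \<Longrightarrow> x \<in> S \<Longrightarrow> f differentiable (at x)"
  using smooth_on_Ck[of S f "Suc 0"] by simp

lemma smooth_on_dd:
  assumes "smooth_on S f"
  shows "smooth_on S (\<lambda>x. dd v f x)"
  unfolding smooth_on_def
proof
  fix k show "Ck_on k S (\<lambda>x. dd v f x)" using smooth_on_Ck[OF assms, of "Suc k"] by simp
qed

lemma smooth_on_const: "smooth_on S (\<lambda>x. c)"
  by (simp add: smooth_on_def Ck_on_const)

lemma smooth_on_linear: "bounded_linear f \<Longrightarrow> smooth_on S f"
  by (simp add: smooth_on_def Ck_on_linear)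

context
  fixes S :: "'a::real_normed_vector set"
  assumes S: "open S"
begin

lemma smooth_on_add: "smooth_on S f \<Longrightarrow> smooth_on S g \<Longrightarrow> smooth_on S (\<lambda>x. f x + g x)"
  by (simp add: smooth_on_def Ck_on_add[OF S])

lemma smooth_on_diff: "smooth_on S f \<Longrightarrow> smooth_on S g \<Longrightarrow> smooth_on S (\<lambda>x. f x - g x)"
  by (simp add: smooth_on_def Ck_on_diff[OF S])

lemma smooth_on_mult:
  fixes f g :: "'a \<Rightarrow> real"
  shows "smooth_on S f \<Longrightarrow> smooth_on S g \<Longrightarrow> smooth_on S (\<lambda>x. f x * g x)"
  by (simp add: smooth_on_def Ck_on_mult[OF S])

lemma smooth_on_scaleR: "smooth_on S f \<Longrightarrow> smooth_on S g \<Longrightarrow> smooth_on S (\<lambda>x. f x *\<^sub>R g x)"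
  by (simp add: smooth_on_def Ck_on_scaleR[OF S])

lemma smooth_on_sum: "(\<And>i. i \<in> I \<Longrightarrow> smooth_on S (f i)) \<Longrightarrow> smooth_on S (\<lambda>x. \<Sum>i\<in>I. f i x)"
  by (simp add: smooth_on_def Ck_on_sum[OF S])

lemma smooth_on_prod:
  fixes f :: "'i \<Rightarrow> 'a \<Rightarrow> real"
  shows "(\<And>i. i \<in> I \<Longrightarrow> smooth_on S (f i)) \<Longrightarrow> smooth_on S (\<lambda>x. \<Prod>i\<in>I. f i x)"
  by (simp add: smooth_on_def Ck_on_prod[OF S])

lemma smooth_on_bounded_linear: "bounded_linear L \<Longrightarrow> smooth_on S f \<Longrightarrow> smooth_on S (\<lambda>x. L (f x))"
  by (simp add: smooth_on_def Ck_on_bounded_linear[OF S])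

lemma smooth_on_compose:
  fixes f :: "'a \<Rightarrow> 'b::euclidean_space"
  shows "open T \<Longrightarrow> f ` S \<subseteq> T \<Longrightarrow> smooth_on S f \<Longrightarrow> smooth_on T g \<Longrightarrow> smooth_on S (\<lambda>x. g (f x))"
  using Ck_on_compose[OF S, where f = f and g = g and T = T] by (simp add: smooth_on_def)

lemma smooth_on_powr:
  fixes f :: "'a \<Rightarrow> real"
  assumes "smooth_on S f" "\<And>x. x \<in> S \<Longrightarrow> f x > 0"
  shows "smooth_on S (\<lambda>x. f x powr a)"
  using assms smooth_on_compose[of "{0<..}" f "\<lambda>x. x powr a"] Ck_on_powr
  by (auto simp: smooth_on_def)

lemma smooth_on_inverse:
  fixes f :: "'a \<Rightarrow> real"
  assumes "smooth_on S f" "\<And>x. x \<in> S \<Longrightarrow> f x > 0"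
  shows "smooth_on S (\<lambda>x. inverse (f x))"
  using smooth_on_powr[OF assms, of "- 1"] smooth_on_cong[OF S, of "\<lambda>x. inverse (f x)" "\<lambda>x. f x powr -1"] assms(2)
  by (fastforce simp: powr_minus)

lemma smooth_on_divide:
  fixes f :: "'a \<Rightarrow> real"
  assumes "smooth_on S g" "smooth_on S f" "\<And>x. x \<in> S \<Longrightarrow> f x > 0"
  shows "smooth_on S (\<lambda>x. g x / f x)"
  using smooth_on_mult[OF assms(1) smooth_on_inverse[OF assms(2,3)]] by (simp add: divide_inverse)

lemma smooth_on_sqrt:
  fixes f :: "'a \<Rightarrow> real"
  assumes "smooth_on S f" "\<And>x. x \<in> S \<Longrightarrow> f x > 0"
  shows "smooth_on S (\<lambda>x. sqrt (f x))"
  using smooth_on_powr[OF assms, of "1/2"] smooth_on_cong[OF S, of "\<lambda>x. sqrt (f x)" "\<lambda>x. f x powr (1/2)"] assms(2)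
  by (fastforce simp: powr_half_sqrt)

lemma smooth_on_vec_iff:
  fixes f :: "'a \<Rightarrow> 'b::euclidean_space ^ 'n::finite"
  shows "smooth_on S f \<longleftrightarrow> (\<forall>i. smooth_on S (\<lambda>x. f x $ i))"
proof
  show "smooth_on S f \<Longrightarrow> \<forall>i. smooth_on S (\<lambda>x. f x $ i)"
    using smooth_on_bounded_linear[OF bounded_linear_vec_nth] by blast
  have bl: "bounded_linear (axis i :: 'b \<Rightarrow> 'b ^ 'n)" for i
    by (intro linear_conv_bounded_linear[THEN iffD1]) (auto intro!: linearI simp: axis_def vec_eq_iff)
  assume "\<forall>i. smooth_on S (\<lambda>x. f x $ i)"
  then have "smooth_on S (\<lambda>x. \<Sum>i\<in>UNIV. axis i (f x $ i))"
    by (intro smooth_on_sum smooth_on_bounded_linear[OF bl]) auto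
  moreover have "(\<Sum>i\<in>UNIV. axis i (f x $ i)) = f x" for x
    by (simp add: vec_eq_iff axis_def sum.delta)
  ultimately show "smooth_on S f" by simp
qed

lemmas smooth_on_vecI = smooth_on_vec_iff[THEN iffD2, rule_format]
lemmas smooth_on_nth = smooth_on_vec_iff[THEN iffD1, rule_format]

lemma smooth_on_det:
  fixes f :: "'a \<Rightarrow> real ^ 'n ^ 'n::finite"
  assumes "\<And>i j. smooth_on S (\<lambda>x. f x $ i $ j)"
  shows "smooth_on S (\<lambda>x. det (f x))"
  unfolding det_def by (intro smooth_on_sum smooth_on_mult smooth_on_prod smooth_on_const assms)

end

section \<open>Rules for directional derivatives at a point\<close>

context
  fixes f :: "'a::real_normed_vector \<Rightarrow> 'b::real_normed_vector" and x :: 'a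
  assumes f: "f differentiable (at x)"
begin

lemma has_derivative_dd: "(f has_derivative (\<lambda>v. dd v f x)) (at x)"
  using f unfolding frechet_derivative_works .

lemma dd_scale_dir: "dd (c *\<^sub>R u) f x = c *\<^sub>R dd u f x"
  using dd_linear[OF f] by (simp add: linear_scale)

lemma dd_bounded_linear: "bounded_linear L \<Longrightarrow> dd v (\<lambda>x. L (f x)) x = L (dd v f x)"
  by (rule dd_eqI, erule bounded_linear.has_derivative) (rule has_derivative_dd)

lemma dd_add: "g differentiable (at x) \<Longrightarrow> dd v (\<lambda>x. f x + g x) x = dd v f x + dd v g x"
  by (rule dd_eqI, rule has_derivative_add) (rule has_derivative_dd, simp flip: frechet_derivative_works)

lemma dd_diff: "g differentiable (at x) \<Longrightarrow> dd v (\<lambda>x. f x - g x) x = dd v f x - dd v g x"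
  by (rule dd_eqI, rule has_derivative_diff) (rule has_derivative_dd, simp flip: frechet_derivative_works)

end

lemma dd_mult:
  fixes f g :: "'a::real_normed_vector \<Rightarrow> real"
  assumes "f differentiable (at x)" "g differentiable (at x)"
  shows "dd v (\<lambda>x. f x * g x) x = f x * dd v g x + dd v f x * g x"
  by (rule dd_eqI, rule has_derivative_mult) (rule assms[THEN has_derivative_dd])+

lemma dd_scaleR:
  assumes "f differentiable (at x)" "g differentiable (at x)"
  shows "dd v (\<lambda>x. f x *\<^sub>R g x) x = f x *\<^sub>R dd v g x + dd v f x *\<^sub>R g x"
  by (rule dd_eqI, rule has_derivative_scaleR) (rule assms[THEN has_derivative_dd])+

lemma dd_sum:
  assumes "\<And>i. i \<in> I \<Longrightarrow> f i differentiable (at x)"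
  shows "dd v (\<lambda>x. \<Sum>i\<in>I. f i x) x = (\<Sum>i\<in>I. dd v (f i) x)"
  by (rule dd_eqI, rule has_derivative_sum) (rule assms[THEN has_derivative_dd])

lemma dd_cmult:
  fixes f :: "'a::real_normed_vector \<Rightarrow> real"
  shows "f differentiable (at x) \<Longrightarrow> dd v (\<lambda>x. c * f x) x = c * dd v f x"
  by (rule dd_bounded_linear[OF _ bounded_linear_mult_right])

lemma dd_nth:
  fixes f :: "'a::real_normed_vector \<Rightarrow> 'b::real_normed_vector ^ 'n::finite"
  shows "f differentiable (at x) \<Longrightarrow> dd v (\<lambda>x. f x $ i) x = dd v f x $ i"
  by (rule dd_bounded_linear[OF _ bounded_linear_vec_nth])

lemma dd_basis:
  fixes f :: "real ^ 'n::finite \<Rightarrow> 'b::real_normed_vector"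
  assumes "f differentiable (at x)"
  shows "dd v f x = (\<Sum>i\<in>UNIV. v $ i *\<^sub>R dd (axis i 1) f x)"
proof -
  have "dd v f x = dd (\<Sum>i\<in>UNIV. v $ i *\<^sub>R axis i 1) f x"
    using basis_expansion[of v] by (simp add: scalar_mult_eq_scaleR)
  also have "\<dots> = (\<Sum>i\<in>UNIV. v $ i *\<^sub>R dd (axis i 1) f x)"
    using dd_linear[OF assms] by (simp add: linear_sum linear_scale)
  finally show ?thesis .
qed

text \<open>Both iterated derivatives are limits of the same second difference quotient.\<close>

lemma dd_symmetric_real:
  fixes f :: "'a::real_normed_vector \<Rightarrow> real"
  assumes S: "open S" "x \<in> S" and f: "smooth_on S f"
  shows "dd u (\<lambda>y. dd v f y) x = dd v (\<lambda>y. dd u f y) x"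
proof (rule ccontr)
  \<comment> \<open>The mean value theorem twice: along \<open>u\<close> for the difference of
    \<open>f\<close> on two parallel segments, then along \<open>v\<close> for
    \<open>dd u f\<close>. The second difference on the left is symmetric in \<open>u\<close> and
    \<open>v\<close>, so the same quantity also produces the derivatives in the other order.\<close>
  have mv: "\<exists>a b. 0 < a \<and> a < r \<and> 0 < b \<and> b < r \<and>
      f (x + r *\<^sub>R u + r *\<^sub>R v) - f (x + r *\<^sub>R u) - f (x + r *\<^sub>R v) + f x
      = r * r * dd v (\<lambda>y. dd u f y) (x + a *\<^sub>R u + b *\<^sub>R v)"
    if r: "r > 0" and rS: "\<And>a b. 0 \<le> a \<Longrightarrow> a \<le> r \<Longrightarrow> 0 \<le> b \<Longrightarrow> b \<le> r \<Longrightarrow> x + a *\<^sub>R u + b *\<^sub>R v \<in> S" for r u v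
  proof -
    have D: "((\<lambda>a. g (p + a *\<^sub>R w)) has_real_derivative dd w g (p + a *\<^sub>R w)) (at a)"
      if "g differentiable (at (p + a *\<^sub>R w))" for g :: "'a \<Rightarrow> real" and p w a
    proof -
      have "((\<lambda>a. p + a *\<^sub>R w) has_derivative (\<lambda>h. h *\<^sub>R w)) (at a)"
        by (auto intro!: derivative_eq_intros)
      from has_derivative_compose[OF this has_derivative_dd[OF that]]
      have "((\<lambda>a. g (p + a *\<^sub>R w)) has_derivative (\<lambda>h. dd (h *\<^sub>R w) g (p + a *\<^sub>R w))) (at a)" .
      then show ?thesis unfolding has_field_derivative_def
        by (simp add: dd_scale_dir[OF that] mult_commute_abs)
    qed
    have "\<exists>z>0. z < r \<and> (f ((x + r *\<^sub>R v) + r *\<^sub>R u) - f (x + r *\<^sub>R u)) - (f ((x + r *\<^sub>R v) + 0 *\<^sub>R u) - f (x + 0 *\<^sub>R u))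
       = (r - 0) * (dd u f ((x + r *\<^sub>R v) + z *\<^sub>R u) - dd u f (x + z *\<^sub>R u))"
    proof (intro MVT2 r DERIV_diff D smooth_on_differentiable[OF f])
      fix a assume "0 \<le> a" "a \<le> r"
      then show "x + r *\<^sub>R v + a *\<^sub>R u \<in> S" "x + a *\<^sub>R u \<in> S"
        using rS[of a r] rS[of a 0] r by (auto simp: algebra_simps)
    qed
    then obtain a where a: "0 < a" "a < r"
      and e1: "(f ((x + r *\<^sub>R v) + r *\<^sub>R u) - f (x + r *\<^sub>R u)) - (f ((x + r *\<^sub>R v) + 0 *\<^sub>R u) - f (x + 0 *\<^sub>R u))
       = (r - 0) * (dd u f ((x + r *\<^sub>R v) + a *\<^sub>R u) - dd u f (x + a *\<^sub>R u))"
      by blast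
    have "\<exists>z>0. z < r \<and> dd u f ((x + a *\<^sub>R u) + r *\<^sub>R v) - dd u f ((x + a *\<^sub>R u) + 0 *\<^sub>R v)
       = (r - 0) * dd v (\<lambda>y. dd u f y) ((x + a *\<^sub>R u) + z *\<^sub>R v)"
    proof (intro MVT2 r D smooth_on_differentiable[OF smooth_on_dd[OF f]])
      fix b assume "0 \<le> b" "b \<le> r"
      then show "x + a *\<^sub>R u + b *\<^sub>R v \<in> S" using rS[of a b] a by auto
    qed
    then obtain b where "0 < b" "b < r" "dd u f ((x + a *\<^sub>R u) + r *\<^sub>R v) - dd u f ((x + a *\<^sub>R u) + 0 *\<^sub>R v)
       = (r - 0) * dd v (\<lambda>y. dd u f y) ((x + a *\<^sub>R u) + b *\<^sub>R v)" by blast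
    with e1 a show ?thesis by (intro exI[of _ a] exI[of _ b]) (auto simp: algebra_simps)
  qed
  define p where "p = dd u (\<lambda>y. dd v f y)"
  define q where "q = dd v (\<lambda>y. dd u f y)"
  assume "dd u (\<lambda>y. dd v f y) x \<noteq> dd v (\<lambda>y. dd u f y) x"
  then have ne: "p x \<noteq> q x" by (simp add: p_def q_def)
  define e where "e = \<bar>p x - q x\<bar> / 2"
  have e: "e > 0" using ne by (simp add: e_def)
  have cp: "continuous (at x) p" and cq: "continuous (at x) q"
    using smooth_on_continuous[OF smooth_on_dd[OF smooth_on_dd[OF f]]] S
    by (auto simp: p_def q_def continuous_on_eq_continuous_at)
  obtain d1 where d1: "d1 > 0" "\<And>y. dist y x < d1 \<Longrightarrow> dist (p y) (p x) < e"
    using cp e unfolding continuous_at_eps_delta by blast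
  obtain d2 where d2: "d2 > 0" "\<And>y. dist y x < d2 \<Longrightarrow> dist (q y) (q x) < e"
    using cq e unfolding continuous_at_eps_delta by blast
  obtain d3 where d3: "d3 > 0" "ball x d3 \<subseteq> S" using S openE by blast
  define d where "d = min d1 (min d2 d3)"
  \<comment> \<open>Small enough that the parallelogram with sides \<open>r *\<^sub>R u\<close> and
    \<open>r *\<^sub>R v\<close> stays inside \<open>S\<close> and inside both continuity radii; the
    summand 1 keeps the denominator positive.\<close>
  define r where "r = d / (2 * (norm u + norm v + 1))"
  have d: "d > 0" using d1 d2 d3 by (simp add: d_def)
  have nn: "norm u + norm v + 1 > 0" using norm_ge_zero[of u] norm_ge_zero[of v] by linarith
  have r: "r > 0" using d nn by (simp add: r_def)
  have near: "dist (x + a *\<^sub>R u + b *\<^sub>R v) x < d" if "0 \<le> a" "a \<le> r" "0 \<le> b" "b \<le> r" for a b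
  proof -
    have "dist (x + a *\<^sub>R u + b *\<^sub>R v) x = norm (a *\<^sub>R u + b *\<^sub>R v)" by (simp add: dist_norm add.assoc)
    also have "\<dots> \<le> norm (a *\<^sub>R u) + norm (b *\<^sub>R v)" by (rule norm_triangle_ineq)
    also have "\<dots> = a * norm u + b * norm v" using that by simp
    also have "\<dots> \<le> r * norm u + r * norm v" using that by (intro add_mono mult_right_mono) auto
    also have "\<dots> \<le> r * (norm u + norm v + 1)" using r by (simp add: algebra_simps)
    also have "\<dots> = d / 2"
      unfolding r_def using nn nonzero_mult_divide_mult_cancel_right[of "norm u + norm v + 1" d 2] by simp
    finally show ?thesis using d by linarith
  qed
  have inS: "x + a *\<^sub>R u + b *\<^sub>R v \<in> S" if "0 \<le> a" "a \<le> r" "0 \<le> b" "b \<le> r" for a b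
  proof -
    have "dist (x + a *\<^sub>R u + b *\<^sub>R v) x < d3" using near[OF that] by (simp add: d_def)
    then have "x + a *\<^sub>R u + b *\<^sub>R v \<in> ball x d3" by (simp add: dist_commute)
    then show ?thesis using d3(2) by (rule rev_subsetD)
  qed
  obtain a b where ab: "0 < a" "a < r" "0 < b" "b < r" and
    1: "f (x + r *\<^sub>R u + r *\<^sub>R v) - f (x + r *\<^sub>R u) - f (x + r *\<^sub>R v) + f x = r * r * dd v (\<lambda>y. dd u f y) (x + a *\<^sub>R u + b *\<^sub>R v)"
    using mv[OF r, where u = u and v = v] inS by blast
  have inS': "x + a *\<^sub>R v + b *\<^sub>R u \<in> S" if "0 \<le> a" "a \<le> r" "0 \<le> b" "b \<le> r" for a b
    using inS[of b a] that by (simp add: algebra_simps)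
  obtain a' b' where ab': "0 < a'" "a' < r" "0 < b'" "b' < r" and
    2: "f (x + r *\<^sub>R v + r *\<^sub>R u) - f (x + r *\<^sub>R v) - f (x + r *\<^sub>R u) + f x = r * r * dd u (\<lambda>y. dd v f y) (x + a' *\<^sub>R v + b' *\<^sub>R u)"
    using mv[OF r, where u = v and v = u] inS' by blast
  have "r * r * q (x + a *\<^sub>R u + b *\<^sub>R v) = r * r * p (x + a' *\<^sub>R v + b' *\<^sub>R u)"
    using 1 2 unfolding p_def q_def by (simp add: algebra_simps)
  then have "q (x + a *\<^sub>R u + b *\<^sub>R v) = p (x + b' *\<^sub>R u + a' *\<^sub>R v)" using r by (simp add: algebra_simps)
  moreover have "dist (q (x + a *\<^sub>R u + b *\<^sub>R v)) (q x) < e"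
    using near[of a b] ab by (intro d2) (auto simp: d_def)
  moreover have "dist (p (x + b' *\<^sub>R u + a' *\<^sub>R v)) (p x) < e"
    using near[of b' a'] ab' by (intro d1) (auto simp: d_def)
  ultimately have "\<bar>p x - q x\<bar> < e + e" by (simp only: dist_real_def)
  then show False by (simp add: e_def)
qed

lemma dd_symmetric:
  fixes f :: "'a::real_normed_vector \<Rightarrow> 'b::euclidean_space"
  assumes S: "open S" "x \<in> S" and f: "smooth_on S f"
  shows "dd u (\<lambda>y. dd v f y) x = dd v (\<lambda>y. dd u f y) x"
proof (rule euclidean_eqI)
  fix b :: 'b
  have bl: "bounded_linear (\<lambda>y::'b. y \<bullet> b)" by (rule bounded_linear_inner_left)
  have *: "dd u (\<lambda>y. dd v f y) x \<bullet> b = dd u (\<lambda>y. dd v (\<lambda>z. f z \<bullet> b) y) x" for u v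
  proof -
    have "dd u (\<lambda>y. dd v f y) x \<bullet> b = dd u (\<lambda>y. dd v f y \<bullet> b) x"
      by (rule dd_bounded_linear[OF _ bl, symmetric])
         (rule smooth_on_differentiable[OF smooth_on_dd[OF f] S(2)])
    also have "\<dots> = dd u (\<lambda>y. dd v (\<lambda>z. f z \<bullet> b) y) x"
      by (rule dd_cong[OF S], rule dd_bounded_linear[OF _ bl, symmetric])
         (rule smooth_on_differentiable[OF f])
    finally show ?thesis .
  qed
  show "dd u (\<lambda>y. dd v f y) x \<bullet> b = dd v (\<lambda>y. dd u f y) x \<bullet> b"
    unfolding * by (rule dd_symmetric_real[OF S smooth_on_bounded_linear[OF S(1) bl f]])
qed

section \<open>Covariant differentiation of multilinear functions\<close>

text \<open>A covariant tensor of rank \<open>k\<close> at a point is a function on lists of \<open>k\<close> vectors that is linear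
  in each entry. It carries no meaning on lists of other lengths.\<close>

primrec mlin :: "nat \<Rightarrow> ('v::real_vector list \<Rightarrow> real) \<Rightarrow> bool" where
  "mlin 0 f \<longleftrightarrow> True"
| "mlin (Suc k) f \<longleftrightarrow> (\<forall>vs. length vs = k \<longrightarrow> linear (\<lambda>w. f (w # vs))) \<and> (\<forall>w. mlin k (\<lambda>vs. f (w # vs)))"

text \<open>\<open>dermap A B f vs\<close> is the sum over all slots \<open>r\<close> of the value of \<open>f\<close> at the list obtained from
  \<open>vs\<close> by applying \<open>B\<close> in slot \<open>r\<close> and \<open>A\<close> in all other slots.\<close>

fun dermap :: "('w \<Rightarrow> 'v) \<Rightarrow> ('w \<Rightarrow> 'v) \<Rightarrow> ('v list \<Rightarrow> real) \<Rightarrow> 'w list \<Rightarrow> real" where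
  "dermap A B f [] = 0"
| "dermap A B f (v # vs) = f (B v # map A vs) + dermap A B (\<lambda>ws. f (A v # ws)) vs"

text \<open>The derivation by which an endomorphism acts on covariant tensors. Connection terms and
  the curvature term of the Ricci identity have this form. The second map in \<open>dermap\<close>
  is there for pullbacks: differentiating \<open>f (map J vs)\<close> puts the derivative of
  \<open>J\<close> in one slot and leaves \<open>J\<close> in the others.\<close>

abbreviation der :: "('v \<Rightarrow> 'v) \<Rightarrow> ('v list \<Rightarrow> real) \<Rightarrow> 'v list \<Rightarrow> real" where
  "der \<equiv> dermap (\<lambda>x. x)"

lemma dermap_cong:
  "(\<And>ws. length ws = length vs \<Longrightarrow> f ws = g ws) \<Longrightarrow> dermap A B f vs = dermap A B g vs"
proof (induction vs arbitrary: f g)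
  case (Cons v vs)
  have "dermap A B (\<lambda>ws. f (A v # ws)) vs = dermap A B (\<lambda>ws. g (A v # ws)) vs"
    by (rule Cons.IH) (simp add: Cons.prems)
  then show ?case by (simp add: Cons.prems)
qed simp

lemma dermap_add: "dermap A B (\<lambda>vs. f vs + g vs) vs = dermap A B f vs + dermap A B g vs"
  by (induction vs arbitrary: f g) simp_all

lemma dermap_diff: "dermap A B (\<lambda>vs. f vs - g vs) vs = dermap A B f vs - dermap A B g vs"
  by (induction vs arbitrary: f g) simp_all

lemma dermap_cmul: "dermap A B (\<lambda>vs. c * f vs) vs = c * dermap A B f vs"
  by (induction vs arbitrary: f) (simp_all add: distrib_left)

lemma mlin_Cons:
  assumes "mlin (Suc k) f" "length vs = k"
  shows "f ((a + b) # vs) = f (a # vs) + f (b # vs)" "f ((a - b) # vs) = f (a # vs) - f (b # vs)"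
    "f ((c *\<^sub>R a) # vs) = c * f (a # vs)"
proof -
  have "linear (\<lambda>w. f (w # vs))" using assms by simp
  from linear_add[OF this] linear_diff[OF this] linear_scale[OF this]
  show "f ((a + b) # vs) = f (a # vs) + f (b # vs)" "f ((a - b) # vs) = f (a # vs) - f (b # vs)"
    "f ((c *\<^sub>R a) # vs) = c * f (a # vs)" by auto
qed

lemma mlin_tail: "mlin (Suc k) f \<Longrightarrow> mlin k (\<lambda>vs. f (w # vs))"
  by simp

lemma dermap_add_op:
  "mlin (length vs) f \<Longrightarrow> dermap A (\<lambda>v. B v + C v) f vs = dermap A B f vs + dermap A C f vs"
  by (induction vs arbitrary: f) (simp_all add: mlin_Cons mlin_tail del: mlin.simps)

lemma dermap_diff_op:
  "mlin (length vs) f \<Longrightarrow> dermap A (\<lambda>v. B v - C v) f vs = dermap A B f vs - dermap A C f vs"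
  by (induction vs arbitrary: f) (simp_all add: mlin_Cons mlin_tail del: mlin.simps)

lemma dermap_scale_op:
  "mlin (length vs) f \<Longrightarrow> dermap A (\<lambda>v. c *\<^sub>R B v) f vs = c * dermap A B f vs"
  by (induction vs arbitrary: f) (simp_all add: mlin_Cons mlin_tail distrib_left del: mlin.simps)

text \<open>Together with \<open>der_map\<close> it brings a derivation before and after a pullback
  by \<open>J\<close> to the common form \<open>dermap J\<close>, in which the two can be compared
  slot by slot.\<close>

lemma der_map_arg: "der L (\<lambda>ws. f (map J ws)) vs = dermap J (\<lambda>v. J (L v)) f vs"
proof (induction vs arbitrary: f)
  case (Cons v vs)
  show ?case using Cons.IH[of "\<lambda>ws. f (J v # ws)"] by simp
qed simp

lemma der_map: "der M f (map J vs) = dermap J (\<lambda>v. M (J v)) f vs"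
proof (induction vs arbitrary: f)
  case (Cons v vs)
  show ?case using Cons.IH[of "\<lambda>ws. f (J v # ws)"] by simp
qed simp

text \<open>Terms with \<open>L\<close> and \<open>M\<close> in different slots cancel; in a common
  slot the commutator remains. The order of composition is reversed because endomorphisms act on the
  arguments.\<close>

lemma der_commute:
  "der L (der M f) vs - der M (der L f) vs = der (\<lambda>v. M (L v)) f vs - der (\<lambda>v. L (M v)) f vs"
proof (induction vs arbitrary: f)
  case (Cons v vs)
  show ?case using Cons.IH[of "\<lambda>ws. f (v # ws)"] by (simp add: dermap_add)
qed simp

lemma mlin_add: "mlin k f \<Longrightarrow> mlin k g \<Longrightarrow> mlin k (\<lambda>vs. f vs + g vs)"
proof (induction k arbitrary: f g)
  case (Suc k)
  then show ?case by (auto intro!: linear_compose_add)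
qed simp

lemma mlin_cmul: "mlin k f \<Longrightarrow> mlin k (\<lambda>vs. c * f vs)"
proof (induction k arbitrary: f)
  case (Suc k)
  have "linear (\<lambda>w. c * f (w # vs))" if "length vs = k" for vs
    using linear_compose_scale_right[of "\<lambda>w. f (w # vs)" c] Suc.prems that by simp
  with Suc show ?case by simp
qed simp

lemma mlin_diff: "mlin k f \<Longrightarrow> mlin k g \<Longrightarrow> mlin k (\<lambda>vs. f vs - g vs)"
  using mlin_add[of k f "\<lambda>vs. (-1) * g vs"] mlin_cmul[of k g "-1"] by simp

lemma mlin_der:
  assumes "linear L" "mlin k f"
  shows "mlin k (der L f)"
  using assms(2)
proof (induction k arbitrary: f)
  case (Suc k)
  have lin: "linear (\<lambda>w. der L f (w # vs))" if "length vs = k" for vs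
  proof -
    have 1: "linear (\<lambda>w. f (L w # vs))"
      using linear_compose[OF assms(1), of "\<lambda>w. f (w # vs)"] Suc.prems that by (simp add: o_def)
    have "linear (\<lambda>w. der L (\<lambda>ws. f (w # ws)) vs)"
    proof (rule linearI)
      fix a b :: 'a and c :: real
      have "der L (\<lambda>ws. f ((a + b) # ws)) vs = der L (\<lambda>ws. f (a # ws) + f (b # ws)) vs"
        using Suc.prems that by (intro dermap_cong) (simp add: mlin_Cons del: mlin.simps)
      then show "der L (\<lambda>ws. f ((a + b) # ws)) vs = der L (\<lambda>ws. f (a # ws)) vs + der L (\<lambda>ws. f (b # ws)) vs"
        by (simp add: dermap_add)
      have "der L (\<lambda>ws. f ((c *\<^sub>R a) # ws)) vs = der L (\<lambda>ws. c * f (a # ws)) vs"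
        using Suc.prems that by (intro dermap_cong) (simp add: mlin_Cons del: mlin.simps)
      then show "der L (\<lambda>ws. f ((c *\<^sub>R a) # ws)) vs = c *\<^sub>R der L (\<lambda>ws. f (a # ws)) vs"
        by (simp add: dermap_cmul)
    qed
    from linear_compose_add[OF 1 this] show ?thesis by simp
  qed
  have "mlin k (\<lambda>vs. der L f (w # vs))" for w
    using Suc by (simp add: mlin_add)
  with lin show ?case by simp
qed simp

section \<open>Smooth tensor fields and product rules for moving arguments\<close>

definition stens :: "nat \<Rightarrow> 'a::real_normed_vector set \<Rightarrow> ('a \<Rightarrow> 'v::real_vector list \<Rightarrow> real) \<Rightarrow> bool" where
  "stens k U T \<longleftrightarrow> (\<forall>x\<in>U. mlin k (T x)) \<and> (\<forall>vs. length vs = k \<longrightarrow> smooth_on U (\<lambda>x. T x vs))"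

lemma stens_mlin: "stens k U T \<Longrightarrow> x \<in> U \<Longrightarrow> mlin k (T x)"
  by (simp add: stens_def)

lemma stens_smooth: "stens k U T \<Longrightarrow> length vs = k \<Longrightarrow> smooth_on U (\<lambda>x. T x vs)"
  by (simp add: stens_def)

lemma stens_diff: "stens k U T \<Longrightarrow> length vs = k \<Longrightarrow> x \<in> U \<Longrightarrow> (\<lambda>x. T x vs) differentiable (at x)"
  by (rule smooth_on_differentiable[OF stens_smooth])

lemma stens_Cons: "stens (Suc k) U T \<Longrightarrow> stens k U (\<lambda>x vs. T x (w # vs))"
  by (simp add: stens_def)

lemma stens_linear: "stens (Suc k) U T \<Longrightarrow> x \<in> U \<Longrightarrow> length vs = k \<Longrightarrow> linear (\<lambda>w. T x (w # vs))"
  by (simp add: stens_def)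

text \<open>Smoothness of \<open>S\<close> is assumed for fixed arguments only. Linearity lets the
  moving argument be expanded in the standard basis, so the product rule for finitely many scalar
  coefficients suffices. The base space is general because the lemma is also applied in the time
  variable.\<close>

lemma
  fixes S :: "'a::real_normed_vector \<Rightarrow> real ^ 'n::finite \<Rightarrow> 'c::real_normed_vector"
  assumes U: "open U"
    and lin: "\<And>y. y \<in> U \<Longrightarrow> linear (S y)"
    and S: "\<And>w. smooth_on U (\<lambda>y. S y w)"
    and a: "smooth_on U a"
  shows smooth_on_apply: "smooth_on U (\<lambda>y. S y (a y))"
    and dd_apply: "x \<in> U \<Longrightarrow> dd u (\<lambda>y. S y (a y)) x = dd u (\<lambda>y. S y (a x)) x + S x (dd u a x)"
proof -
  have exp: "S y w = (\<Sum>i\<in>UNIV. w $ i *\<^sub>R S y (axis i 1))" if "y \<in> U" for y w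
  proof -
    have "S y w = S y (\<Sum>i\<in>UNIV. w $ i *\<^sub>R axis i 1)"
      using basis_expansion[of w] by (simp add: scalar_mult_eq_scaleR)
    then show ?thesis using lin[OF that] by (simp add: linear_sum linear_scale)
  qed
  have "smooth_on U (\<lambda>y. \<Sum>i\<in>UNIV. a y $ i *\<^sub>R S y (axis i 1))"
    by (intro smooth_on_sum smooth_on_scaleR U S smooth_on_nth a)
  then show "smooth_on U (\<lambda>y. S y (a y))"
    by (rule smooth_on_cong[OF U, THEN iffD2, rotated]) (rule exp)
  assume x: "x \<in> U"
  note d = smooth_on_differentiable[OF _ x]
  note da = d[OF smooth_on_nth[OF U a]] and dS = d[OF S]
  have "dd u (\<lambda>y. S y (a y)) x = dd u (\<lambda>y. \<Sum>i\<in>UNIV. a y $ i *\<^sub>R S y (axis i 1)) x"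
    by (rule dd_cong[OF U x]) (rule exp)
  also have "\<dots> = (\<Sum>i\<in>UNIV. dd u (\<lambda>y. a y $ i *\<^sub>R S y (axis i 1)) x)"
    by (rule dd_sum) (rule d[OF smooth_on_scaleR[OF U smooth_on_nth[OF U a] S]])
  also have "\<dots> = (\<Sum>i\<in>UNIV. a x $ i *\<^sub>R dd u (\<lambda>y. S y (axis i 1)) x) + (\<Sum>i\<in>UNIV. dd u a x $ i *\<^sub>R S x (axis i 1))"
    by (simp add: dd_scaleR[OF da dS] sum.distrib dd_nth[OF d[OF a]])
  also have "(\<Sum>i\<in>UNIV. dd u a x $ i *\<^sub>R S x (axis i 1)) = S x (dd u a x)"
    by (rule exp[OF x, symmetric])
  also have "(\<Sum>i\<in>UNIV. a x $ i *\<^sub>R dd u (\<lambda>y. S y (axis i 1)) x) = (\<Sum>i\<in>UNIV. dd u (\<lambda>y. a x $ i *\<^sub>R S y (axis i 1)) x)"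
    by (simp add: dd_bounded_linear[OF dS bounded_linear_scaleR_right])
  also have "\<dots> = dd u (\<lambda>y. \<Sum>i\<in>UNIV. a x $ i *\<^sub>R S y (axis i 1)) x"
    by (rule dd_sum[symmetric]) (rule d[OF smooth_on_scaleR[OF U smooth_on_const S]])
  also have "\<dots> = dd u (\<lambda>y. S y (a x)) x"
    by (rule dd_cong[OF U x]) (rule exp[symmetric])
  finally show "dd u (\<lambda>y. S y (a y)) x = dd u (\<lambda>y. S y (a x)) x + S x (dd u a x)" .
qed

lemma stens_map:
  fixes T :: "'a::real_normed_vector \<Rightarrow> (real ^ 'n::finite) list \<Rightarrow> real"
  assumes U: "open U" and A: "\<And>v. smooth_on U (\<lambda>y. A y v)" and T: "stens (length vs) U T"
  shows "smooth_on U (\<lambda>y. T y (map (A y) vs))"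
  using T
proof (induction vs arbitrary: T)
  case Nil
  then show ?case using stens_smooth[OF Nil, of "[]"] by simp
next
  case (Cons v vs)
  have "smooth_on U (\<lambda>y. T y (A y v # map (A y) vs))"
  proof (rule smooth_on_apply[OF U, where S = "\<lambda>y w. T y (w # map (A y) vs)"])
    fix w show "smooth_on U (\<lambda>y. T y (w # map (A y) vs))"
      using Cons.prems by (intro Cons.IH[of "\<lambda>y ws. T y (w # ws)"] stens_Cons) simp
  next
    fix y assume "y \<in> U"
    then show "linear (\<lambda>w. T y (w # map (A y) vs))" by (rule stens_linear[OF Cons.prems[simplified]]) simp
  qed (rule A)
  then show ?case by simp
qed

text \<open>Product rule for a pullback whose map moves with the point. When \<open>A y\<close> is a
  Jacobian, the \<open>dermap\<close> term carries the second derivatives of the coordinate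
  change.\<close>

lemma dd_stens_map:
  fixes T :: "'a::real_normed_vector \<Rightarrow> (real ^ 'n::finite) list \<Rightarrow> real"
  assumes U: "open U" "x \<in> U" and A: "\<And>v. smooth_on U (\<lambda>y. A y v)" and T: "stens (length vs) U T"
  shows "dd u (\<lambda>y. T y (map (A y) vs)) x = dd u (\<lambda>y. T y (map (A x) vs)) x
     + dermap (A x) (\<lambda>v. dd u (\<lambda>y. A y v) x) (T x) vs"
  using T
proof (induction vs arbitrary: T)
  case Nil
  show ?case by simp
next
  case (Cons v vs)
  have "dd u (\<lambda>y. T y (A y v # map (A y) vs)) x
      = dd u (\<lambda>y. T y (A x v # map (A y) vs)) x + T x (dd u (\<lambda>y. A y v) x # map (A x) vs)"
  proof (rule dd_apply[OF U(1) _ _ A U(2), where S = "\<lambda>y w. T y (w # map (A y) vs)"])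
    fix w show "smooth_on U (\<lambda>y. T y (w # map (A y) vs))"
      using Cons.prems by (intro stens_map[of U A vs "\<lambda>y ws. T y (w # ws)"] U A stens_Cons) simp
  next
    fix y assume "y \<in> U"
    then show "linear (\<lambda>w. T y (w # map (A y) vs))" by (rule stens_linear[OF Cons.prems[simplified]]) simp
  qed
  also have "dd u (\<lambda>y. T y (A x v # map (A y) vs)) x = dd u (\<lambda>y. T y (A x v # map (A x) vs)) x
     + dermap (A x) (\<lambda>v. dd u (\<lambda>y. A y v) x) (\<lambda>ws. T x (A x v # ws)) vs"
    using Cons.prems by (intro Cons.IH[of "\<lambda>y ws. T y (A x v # ws)"] stens_Cons) simp
  finally show ?case by simp
qed

lemma
  fixes T :: "'a::real_normed_vector \<Rightarrow> (real ^ 'n::finite) list \<Rightarrow> real"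
  assumes U: "open U" and A: "\<And>v. smooth_on U (\<lambda>y. A y v)" and T: "stens (length vs) U T"
  shows smooth_on_der: "smooth_on U (\<lambda>y. der (A y) (T y) vs)"
    and dd_der: "x \<in> U \<Longrightarrow> dd u (\<lambda>y. der (A y) (T y) vs) x
     = der (A x) (\<lambda>ws. dd u (\<lambda>y. T y ws) x) vs + der (\<lambda>v. dd u (\<lambda>y. A y v) x) (T x) vs"
  using T
proof (induction vs arbitrary: T)
  case Nil
  {
    case 1 show ?case by (simp add: smooth_on_const)
  next
    case 2 show ?case by simp
  }
next
  case (Cons v vs)
  {
    case 1
    have "smooth_on U (\<lambda>y. T y (A y v # vs))"
      by (rule smooth_on_apply[OF U _ _ A, where S = "\<lambda>y w. T y (w # vs)"])
         (use stens_linear[OF 1[simplified]] stens_smooth[OF 1] in simp_all)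
    moreover have "smooth_on U (\<lambda>y. der (A y) (\<lambda>ws. T y (v # ws)) vs)"
      using 1 by (intro Cons.IH stens_Cons) simp
    ultimately show ?case using smooth_on_add[OF U] by simp
  next
    case 2
    have s1: "smooth_on U (\<lambda>y. T y (A y v # vs))"
      by (rule smooth_on_apply[OF U _ _ A, where S = "\<lambda>y w. T y (w # vs)"])
         (use stens_linear[OF 2(2)[simplified]] stens_smooth[OF 2(2)] in simp_all)
    have s2: "smooth_on U (\<lambda>y. der (A y) (\<lambda>ws. T y (v # ws)) vs)"
      using 2 by (intro Cons.IH stens_Cons) simp
    have "dd u (\<lambda>y. T y (A y v # vs)) x = dd u (\<lambda>y. T y (A x v # vs)) x + T x (dd u (\<lambda>y. A y v) x # vs)"
      by (rule dd_apply[OF U _ _ A 2(1), where S = "\<lambda>y w. T y (w # vs)"])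
         (use stens_linear[OF 2(2)[simplified]] stens_smooth[OF 2(2)] in simp_all)
    moreover have "dd u (\<lambda>y. der (A y) (\<lambda>ws. T y (v # ws)) vs) x
      = der (A x) (\<lambda>ws. dd u (\<lambda>y. T y (v # ws)) x) vs + der (\<lambda>v. dd u (\<lambda>y. A y v) x) (\<lambda>ws. T x (v # ws)) vs"
      using 2 by (intro Cons.IH stens_Cons) simp_all
    ultimately show ?case
      using dd_add[OF smooth_on_differentiable[OF s1 2(1)] smooth_on_differentiable[OF s2 2(1)]] by simp
  }
qed

lemma mlin_dd:
  fixes T :: "'a::real_normed_vector \<Rightarrow> 'v::real_vector list \<Rightarrow> real"
  assumes U: "open U" "x \<in> U" and T: "stens k U T"
  shows "mlin k (\<lambda>vs. dd u (\<lambda>y. T y vs) x)"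
  using T
proof (induction k arbitrary: T)
  case (Suc k)
  have "linear (\<lambda>w. dd u (\<lambda>y. T y (w # vs)) x)" if l: "length vs = k" for vs
  proof (rule linearI)
    fix a b :: 'v and c :: real
    have d: "(\<lambda>y. T y (w # vs)) differentiable (at x)" for w
      by (rule stens_diff[OF Suc.prems _ U(2)]) (simp add: l)
    have "dd u (\<lambda>y. T y ((a + b) # vs)) x = dd u (\<lambda>y. T y (a # vs) + T y (b # vs)) x"
      by (rule dd_cong[OF U]) (rule mlin_Cons[OF stens_mlin[OF Suc.prems] l])
    then show "dd u (\<lambda>y. T y ((a + b) # vs)) x = dd u (\<lambda>y. T y (a # vs)) x + dd u (\<lambda>y. T y (b # vs)) x"
      by (simp add: dd_add[OF d d])
    have "dd u (\<lambda>y. T y ((c *\<^sub>R a) # vs)) x = dd u (\<lambda>y. c * T y (a # vs)) x"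
      by (rule dd_cong[OF U]) (rule mlin_Cons[OF stens_mlin[OF Suc.prems] l])
    then show "dd u (\<lambda>y. T y ((c *\<^sub>R a) # vs)) x = c *\<^sub>R dd u (\<lambda>y. T y (a # vs)) x"
      by (simp add: dd_cmult[OF d])
  qed
  moreover have "mlin k (\<lambda>vs. dd u (\<lambda>y. T y (w # vs)) x)" for w
    using Suc.IH[OF stens_Cons[OF Suc.prems]] .
  ultimately show ?case by simp
qed simp

text \<open>The direction of differentiation is prepended, so in iterated derivatives the last
  differentiation is leftmost. The result has rank at least 1 and the value at the empty list is a
  placeholder.\<close>

fun cov :: "(real ^ 'n \<Rightarrow> real ^ 'n \<Rightarrow> real ^ 'n \<Rightarrow> real ^ 'n::finite) \<Rightarrow>
    (real ^ 'n \<Rightarrow> (real ^ 'n) list \<Rightarrow> real) \<Rightarrow> real ^ 'n \<Rightarrow> (real ^ 'n) list \<Rightarrow> real" where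
  "cov \<Gamma> T x [] = 0"
| "cov \<Gamma> T x (v # vs) = dd v (\<lambda>y. T y vs) x - der (\<Gamma> x v) (T x) vs"

lemma cov_cong:
  assumes "open U" "x \<in> U" "\<And>y vs. y \<in> U \<Longrightarrow> Suc (length vs) = length ws \<Longrightarrow> S y vs = T y vs"
  shows "cov \<Gamma> S x ws = cov \<Gamma> T x ws"
proof (cases ws)
  case (Cons v vs)
  have "dd v (\<lambda>y. S y vs) x = dd v (\<lambda>y. T y vs) x"
    by (rule dd_cong[OF assms(1,2)]) (simp add: assms(3) Cons)
  moreover have "der (\<Gamma> x v) (S x) vs = der (\<Gamma> x v) (T x) vs"
    by (rule dermap_cong) (simp add: assms Cons)
  ultimately show ?thesis by (simp add: Cons)
qed simp

section \<open>Torsion-free connections: Ricci identity and change of coordinates\<close>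

locale connection =
  fixes U :: "(real ^ 'n::finite) set" and \<Gamma> :: "real ^ 'n \<Rightarrow> real ^ 'n \<Rightarrow> real ^ 'n \<Rightarrow> real ^ 'n"
  assumes open_U: "open U"
    and lin1: "\<And>x v. x \<in> U \<Longrightarrow> linear (\<lambda>u. \<Gamma> x u v)"
    and lin2: "\<And>x u. x \<in> U \<Longrightarrow> linear (\<Gamma> x u)"
    and sym: "\<And>x u v. x \<in> U \<Longrightarrow> \<Gamma> x u v = \<Gamma> x v u"
    and smooth: "\<And>u v. smooth_on U (\<lambda>x. \<Gamma> x u v)"
begin

text \<open>The curvature R(u,v)w for vector fields with constant coordinates, whose Lie bracket
  vanishes.\<close>

definition curv :: "real ^ 'n \<Rightarrow> real ^ 'n \<Rightarrow> real ^ 'n \<Rightarrow> real ^ 'n \<Rightarrow> real ^ 'n" where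
  "curv x u v w = dd u (\<lambda>y. \<Gamma> y v w) x - dd v (\<lambda>y. \<Gamma> y u w) x + \<Gamma> x u (\<Gamma> x v w) - \<Gamma> x v (\<Gamma> x u w)"

lemma stens_cov:
  assumes T: "stens k U T"
  shows "stens (Suc k) U (cov \<Gamma> T)"
  unfolding stens_def
proof (intro conjI ballI allI impI)
  fix x assume x: "x \<in> U"
  have "linear (\<lambda>v. dd v (\<lambda>y. T y vs) x - der (\<Gamma> x v) (T x) vs)" if l: "length vs = k" for vs
  proof (rule linear_compose_sub)
    show "linear (\<lambda>v. dd v (\<lambda>y. T y vs) x)" by (rule dd_linear[OF stens_diff[OF T l x]])
    have m: "mlin (length vs) (T x)" using stens_mlin[OF T x] l by simp
    show "linear (\<lambda>v. der (\<Gamma> x v) (T x) vs)"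
    proof (rule linearI)
      fix a b :: "real ^ 'n" and c :: real
      have "\<Gamma> x (a + b) = (\<lambda>v. \<Gamma> x a v + \<Gamma> x b v)" "\<Gamma> x (c *\<^sub>R a) = (\<lambda>v. c *\<^sub>R \<Gamma> x a v)"
        using linear_add[OF lin1[OF x]] linear_scale[OF lin1[OF x]] by auto
      then show "der (\<Gamma> x (a + b)) (T x) vs = der (\<Gamma> x a) (T x) vs + der (\<Gamma> x b) (T x) vs"
        "der (\<Gamma> x (c *\<^sub>R a)) (T x) vs = c *\<^sub>R der (\<Gamma> x a) (T x) vs"
        by (simp_all add: dermap_add_op[OF m] dermap_scale_op[OF m])
    qed
  qed
  moreover have "mlin k (\<lambda>vs. dd v (\<lambda>y. T y vs) x - der (\<Gamma> x v) (T x) vs)" for v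
    by (intro mlin_diff mlin_dd[OF open_U x T] mlin_der lin2 x stens_mlin[OF T])
  ultimately show "mlin (Suc k) (cov \<Gamma> T x)" by simp
next
  fix vs :: "(real ^ 'n) list" assume "length vs = Suc k"
  then obtain w ws where vs: "vs = w # ws" and l: "length ws = k" by (cases vs) auto
  have "smooth_on U (\<lambda>x. dd w (\<lambda>y. T y ws) x - der (\<Gamma> x w) (T x) ws)"
    using smooth_on_dd[OF stens_smooth[OF T l]] smooth_on_der[OF open_U smooth[of w], where vs = ws and T = T] T l
    by (intro smooth_on_diff open_U) auto
  then show "smooth_on U (\<lambda>x. cov \<Gamma> T x vs)" by (simp add: vs)
qed

text \<open>Antisymmetrising kills the second partial derivatives, the first-order terms, which are
  symmetric in \<open>u\<close> and \<open>v\<close>, and the term with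
  \<open>\<Gamma> x u v\<close>, because the connection is torsion-free. What is left are the
  derivatives of \<open>\<Gamma>\<close> and the commutator from \<open>der_commute\<close>, which
  make up \<open>curv\<close>.\<close>

lemma ricci_identity:
  assumes T: "stens k U T" and l: "length vs = k" and x: "x \<in> U"
  shows "cov \<Gamma> (cov \<Gamma> T) x (u # v # vs) - cov \<Gamma> (cov \<Gamma> T) x (v # u # vs) = - der (curv x u v) (T x) vs"
proof -
  have T': "stens (length vs) U T" using T l by simp
  have m: "mlin (length vs) (T x)" using stens_mlin[OF T' x] .
  have *: "cov \<Gamma> (cov \<Gamma> T) x (u # v # vs) = dd u (\<lambda>y. dd v (\<lambda>y. T y vs) y) x
      - der (\<Gamma> x v) (\<lambda>ws. dd u (\<lambda>y. T y ws) x) vs - der (\<lambda>w. dd u (\<lambda>y. \<Gamma> y v w) x) (T x) vs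
      - cov \<Gamma> T x (\<Gamma> x u v # vs) - der (\<Gamma> x u) (\<lambda>ws. dd v (\<lambda>y. T y ws) x) vs
      + der (\<Gamma> x u) (der (\<Gamma> x v) (T x)) vs" for u v
  proof -
    have "dd u (\<lambda>y. cov \<Gamma> T y (v # vs)) x = dd u (\<lambda>y. dd v (\<lambda>y. T y vs) y) x - dd u (\<lambda>y. der (\<Gamma> y v) (T y) vs) x"
      unfolding cov.simps
      by (intro dd_diff smooth_on_differentiable[OF _ x] smooth_on_dd stens_smooth[OF T l] smooth_on_der open_U smooth T')
    then show ?thesis using dd_der[OF open_U smooth[of v] T' x, where u = u]
      by (simp add: dermap_diff)
  qed
  have "dd u (\<lambda>y. dd v (\<lambda>y. T y vs) y) x = dd v (\<lambda>y. dd u (\<lambda>y. T y vs) y) x"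
    by (rule dd_symmetric[OF open_U x stens_smooth[OF T l]])
  moreover have "der (curv x u v) (T x) vs = der (\<lambda>w. dd u (\<lambda>y. \<Gamma> y v w) x) (T x) vs
     - der (\<lambda>w. dd v (\<lambda>y. \<Gamma> y u w) x) (T x) vs + der (\<lambda>w. \<Gamma> x u (\<Gamma> x v w)) (T x) vs
     - der (\<lambda>w. \<Gamma> x v (\<Gamma> x u w)) (T x) vs"
    unfolding curv_def by (simp add: dermap_diff_op[OF m] dermap_add_op[OF m])
  ultimately show ?thesis
    using *[of u v] *[of v u] der_commute[where L = "\<Gamma> x u" and M = "\<Gamma> x v" and f = "T x" and vs = vs] sym[OF x, where u = u and v = v]
    by simp
qed

lemma bianchi1:
  assumes x: "x \<in> U"
  shows "curv x u v w + curv x v w u + curv x w u v = 0"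
proof -
  have s: "dd u (\<lambda>y. \<Gamma> y v w) x = dd u (\<lambda>y. \<Gamma> y w v) x" for u v w
    by (rule dd_cong[OF open_U x]) (rule sym)
  have l: "linear (\<lambda>v. \<Gamma> x u v)" for u using lin2[OF x] by (simp add: eta_contract_eq)
  show ?thesis
    using s[of u v w] s[of v w u] s[of w u v] sym[OF x, where u = v and v = w] sym[OF x, where u = u and v = w] sym[OF x, where u = u and v = v]
    by (simp add: curv_def)
qed

lemma curv_antisym: "curv x u v w = - curv x v u w"
  by (simp add: curv_def)

lemma linear_curv:
  assumes x: "x \<in> U"
  shows "linear (\<lambda>u. curv x u v w)" "linear (\<lambda>v. curv x u v w)" "linear (\<lambda>w. curv x u v w)"
proof -
  have d: "(\<lambda>y. \<Gamma> y u v) differentiable (at x)" for u v by (rule smooth_on_differentiable[OF smooth x])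
  have dl1: "linear (\<lambda>v. dd u (\<lambda>y. \<Gamma> y v w) x)" for u w
  proof (rule linearI)
    fix a b :: "real ^ 'n" and c :: real
    have "dd u (\<lambda>y. \<Gamma> y (a + b) w) x = dd u (\<lambda>y. \<Gamma> y a w + \<Gamma> y b w) x"
      by (rule dd_cong[OF open_U x]) (rule linear_add[OF lin1])
    then show "dd u (\<lambda>y. \<Gamma> y (a + b) w) x = dd u (\<lambda>y. \<Gamma> y a w) x + dd u (\<lambda>y. \<Gamma> y b w) x"
      by (simp add: dd_add[OF d d])
    have "dd u (\<lambda>y. \<Gamma> y (c *\<^sub>R a) w) x = dd u (\<lambda>y. c *\<^sub>R \<Gamma> y a w) x"
      by (rule dd_cong[OF open_U x]) (rule linear_scale[OF lin1])
    then show "dd u (\<lambda>y. \<Gamma> y (c *\<^sub>R a) w) x = c *\<^sub>R dd u (\<lambda>y. \<Gamma> y a w) x"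
      by (simp add: dd_bounded_linear[OF d bounded_linear_scaleR_right])
  qed
  have dl2: "linear (\<lambda>w. dd u (\<lambda>y. \<Gamma> y v w) x)" for u v
  proof -
    have "(\<lambda>w. dd u (\<lambda>y. \<Gamma> y v w) x) = (\<lambda>w. dd u (\<lambda>y. \<Gamma> y w v) x)"
      by (rule ext, rule dd_cong[OF open_U x]) (rule sym)
    then show ?thesis using dl1 by simp
  qed
  have l2: "linear (\<lambda>v. \<Gamma> x u v)" for u using lin2[OF x] by (simp add: eta_contract_eq)
  have c1: "linear (\<lambda>u. \<Gamma> x w (\<Gamma> x u v))" "linear (\<lambda>u. \<Gamma> x w (\<Gamma> x v u))" for v w
    using linear_compose[OF lin1[OF x] l2] linear_compose[OF l2 l2] by (simp_all add: o_def)
  show "linear (\<lambda>u. curv x u v w)" unfolding curv_def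
    by (intro linear_compose_sub linear_compose_add dd_linear d dl1 c1 lin1 x)
  show "linear (\<lambda>v. curv x u v w)" unfolding curv_def
    by (intro linear_compose_sub linear_compose_add dd_linear d dl1 c1 lin1 x)
  show "linear (\<lambda>w. curv x u v w)" unfolding curv_def
    by (intro linear_compose_sub linear_compose_add dl2 c1)
qed

end

text \<open>The last assumption is the inhomogeneous transformation law of Christoffel symbols, with
  the Hessian of \<open>\<phi>\<close> as the extra term.\<close>

locale connection_map = dom: connection U \<Gamma> + cod: connection V \<Delta>
  for U V :: "(real ^ 'n::finite) set" and \<Gamma> \<Delta> +
  fixes \<phi> :: "real ^ 'n \<Rightarrow> real ^ 'n"
  assumes \<phi>_smooth: "smooth_on U \<phi>" and \<phi>_into: "\<phi> ` U \<subseteq> V"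
    and \<phi>_conn: "\<And>x u v. x \<in> U \<Longrightarrow>
      dd (\<Gamma> x u v) \<phi> x = \<Delta> (\<phi> x) (dd u \<phi> x) (dd v \<phi> x) + dd u (\<lambda>y. dd v \<phi> y) x"
begin

text \<open>The Hessian of \<open>\<phi>\<close> occurs twice, once from differentiating the
  Jacobians in the pullback and once from the law for \<open>\<Gamma>\<close>, and the two
  contributions cancel.\<close>

lemma cov_transform:
  assumes T: "stens k V T" and x: "x \<in> U" and l: "length vs = Suc k"
    and S: "\<And>y vs. y \<in> U \<Longrightarrow> length vs = k \<Longrightarrow> S y vs = T (\<phi> y) (map (\<lambda>v. dd v \<phi> y) vs)"
  shows "cov \<Gamma> S x vs = cov \<Delta> T (\<phi> x) (map (\<lambda>v. dd v \<phi> x) vs)"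
proof -
  let ?J = "\<lambda>x v. dd v \<phi> x"
  obtain v ws where vs: "vs = v # ws" and lw: "length ws = k" using l by (cases vs) auto
  have fx: "\<phi> x \<in> V" using x \<phi>_into by auto
  have m: "mlin (length ws) (T (\<phi> x))" using stens_mlin[OF T fx] lw by simp
  have T\<phi>: "stens (length ws) U (\<lambda>y. T (\<phi> y))"
    using T lw \<phi>_into unfolding stens_def
    by (auto intro!: smooth_on_compose[OF dom.open_U cod.open_U \<phi>_into \<phi>_smooth])
  have "dd v (\<lambda>y. S y ws) x = dd v (\<lambda>y. T (\<phi> y) (map (?J y) ws)) x"
    by (rule dd_cong[OF dom.open_U x]) (simp add: S lw)
  also have "\<dots> = dd v (\<lambda>y. T (\<phi> y) (map (?J x) ws)) x + dermap (?J x) (\<lambda>w. dd v (\<lambda>y. ?J y w) x) (T (\<phi> x)) ws"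
    by (rule dd_stens_map[OF dom.open_U x smooth_on_dd[OF \<phi>_smooth] T\<phi>])
  also have "dd v (\<lambda>y. T (\<phi> y) (map (?J x) ws)) x = dd (?J x v) (\<lambda>z. T z (map (?J x) ws)) (\<phi> x)"
    by (rule dd_compose[where g = "\<lambda>z. T z (map (?J x) ws)", OF smooth_on_differentiable[OF \<phi>_smooth x] stens_diff[OF T _ fx]])
       (simp add: lw)
  finally have 1: "dd v (\<lambda>y. S y ws) x = dd (?J x v) (\<lambda>z. T z (map (?J x) ws)) (\<phi> x)
     + dermap (?J x) (\<lambda>w. dd v (\<lambda>y. ?J y w) x) (T (\<phi> x)) ws" .
  have "der (\<Gamma> x v) (S x) ws = der (\<Gamma> x v) (\<lambda>ws. T (\<phi> x) (map (?J x) ws)) ws"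
    by (rule dermap_cong) (simp add: S x lw)
  also have "\<dots> = dermap (?J x) (\<lambda>w. ?J x (\<Gamma> x v w)) (T (\<phi> x)) ws"
    by (rule der_map_arg)
  also have "\<dots> = der (\<Delta> (\<phi> x) (?J x v)) (T (\<phi> x)) (map (?J x) ws)
     + dermap (?J x) (\<lambda>w. dd v (\<lambda>y. ?J y w) x) (T (\<phi> x)) ws"
    by (simp add: \<phi>_conn[OF x] dermap_add_op[OF m] der_map)
  finally show ?thesis using 1 by (simp add: vs)
qed

text \<open>No third derivatives of \<open>\<phi>\<close> are computed: the Ricci identity expresses
  curvature through two covariant derivatives of a covector, and these are already known to
  transform as tensors.\<close>

lemma curv_transform:
  assumes x: "x \<in> U"
  shows "dd (dom.curv x u v w) \<phi> x = cod.curv (\<phi> x) (dd u \<phi> x) (dd v \<phi> x) (dd w \<phi> x)"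
proof (rule euclidean_eqI)
  fix e :: "real ^ 'n"
  \<comment> \<open>A constant covector on the target side; pairing with all such covectors
    determines the curvature vector.\<close>
  define T :: "real ^ 'n \<Rightarrow> (real ^ 'n) list \<Rightarrow> real" where "T = (\<lambda>z ws. hd ws \<bullet> e)"
  define S where "S = (\<lambda>y vs. T (\<phi> y) (map (\<lambda>v. dd v \<phi> y) vs))"
  have fx: "\<phi> x \<in> V" using x \<phi>_into by auto
  have T: "stens (Suc 0) V T"
    unfolding stens_def T_def by (auto intro!: smooth_on_const bounded_linear.linear bounded_linear_inner_left)
  have S: "stens (Suc 0) U S"
    unfolding stens_def
  proof (intro conjI ballI allI impI)
    fix y assume y: "y \<in> U"
    have "linear (\<lambda>v. dd v \<phi> y \<bullet> e)"
      using linear_compose[OF dd_linear[OF smooth_on_differentiable[OF \<phi>_smooth y]] bounded_linear.linear[OF bounded_linear_inner_left[of e]]]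
      by (simp add: o_def)
    then show "mlin (Suc 0) (S y)" by (simp add: S_def T_def)
  next
    fix vs :: "(real ^ 'n) list" assume "length vs = Suc 0"
    then obtain v where vs: "vs = [v]" by (cases vs) auto
    show "smooth_on U (\<lambda>x. S x vs)" unfolding S_def T_def vs
      using smooth_on_bounded_linear[OF dom.open_U bounded_linear_inner_left smooth_on_dd[OF \<phi>_smooth]] by simp
  qed
  have c1: "cov \<Gamma> S y vs = cov \<Delta> T (\<phi> y) (map (\<lambda>v. dd v \<phi> y) vs)" if "y \<in> U" "length vs = Suc (Suc 0)" for y vs
    by (rule cov_transform[OF T that]) (simp add: S_def)
  have c2: "cov \<Gamma> (cov \<Gamma> S) x vs = cov \<Delta> (cov \<Delta> T) (\<phi> x) (map (\<lambda>v. dd v \<phi> x) vs)" if "length vs = Suc (Suc (Suc 0))" for vs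
    by (rule cov_transform[OF cod.stens_cov[OF T] x that]) (rule c1)
  have "der (dom.curv x u v) (S x) [w] = der (cod.curv (\<phi> x) (dd u \<phi> x) (dd v \<phi> x)) (T (\<phi> x)) [dd w \<phi> x]"
    using dom.ricci_identity[OF S _ x, of "[w]" u v] cod.ricci_identity[OF T _ fx, of "[dd w \<phi> x]" "dd u \<phi> x" "dd v \<phi> x"]
      c2[of "[u, v, w]"] c2[of "[v, u, w]"] by simp
  then show "dd (dom.curv x u v w) \<phi> x \<bullet> e = cod.curv (\<phi> x) (dd u \<phi> x) (dd v \<phi> x) (dd w \<phi> x) \<bullet> e"
    by (simp add: S_def T_def)
qed

end

section \<open>Orthonormal frames and metric traces\<close>

definition spd :: "real ^ 'n ^ 'n::finite \<Rightarrow> bool" where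
  "spd M \<longleftrightarrow> transpose M = M \<and> (\<forall>v. v \<noteq> 0 \<longrightarrow> 0 < v \<bullet> (M *v v))"

abbreviation ip :: "real ^ 'n ^ 'n::finite \<Rightarrow> real ^ 'n \<Rightarrow> real ^ 'n \<Rightarrow> real" where
  "ip M u v \<equiv> u \<bullet> (M *v v)"

definition frame :: "real ^ 'n ^ 'n::finite \<Rightarrow> ('n \<Rightarrow> real ^ 'n) \<Rightarrow> bool" where
  "frame M E \<longleftrightarrow> (\<forall>a b. ip M (E a) (E b) = (if a = b then 1 else 0))"

definition trM :: "real ^ 'n ^ 'n::finite \<Rightarrow> (real ^ 'n \<Rightarrow> real ^ 'n \<Rightarrow> real) \<Rightarrow> real" where
  "trM M B = (\<Sum>p\<in>UNIV. \<Sum>q\<in>UNIV. matrix_inv M $ p $ q * B (axis p 1) (axis q 1))"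

lemma linear_ip: "linear (\<lambda>u. ip M u v)" "linear (\<lambda>v. ip M u v)"
  by (auto intro!: linearI simp: inner_left_distrib inner_right_distrib matrix_vector_right_distrib
        matrix_vector_mult_scaleR)

lemma ip_sums:
  fixes M :: "real ^ 'n ^ 'n::finite"
  shows "ip M u v = (\<Sum>i\<in>UNIV. \<Sum>j\<in>UNIV. u $ i * v $ j * M $ i $ j)"
  by (simp add: inner_vec_def matrix_vector_mult_def sum_distrib_left mult_ac)

lemma ip_axis: "ip M (axis i 1) (axis j 1) = M $ i $ j"
  by (simp add: matrix_vector_mult_basis inner_axis' column_def)

lemma linear_expand:
  fixes f :: "real ^ 'n::finite \<Rightarrow> 'c::real_vector"
  assumes "linear f"
  shows "f v = (\<Sum>i\<in>UNIV. v $ i *\<^sub>R f (axis i 1))"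
proof -
  have "f v = f (\<Sum>i\<in>UNIV. v $ i *\<^sub>R axis i 1)"
    using basis_expansion[of v] by (simp add: scalar_mult_eq_scaleR)
  then show ?thesis using assms by (simp add: linear_sum linear_scale)
qed

lemma spd_ip_sym: "spd M \<Longrightarrow> ip M u v = ip M v u"
  by (metis spd_def dot_lmul_matrix inner_commute vector_transpose_matrix)

lemma spd_frame_exists:
  fixes M :: "real ^ 'n ^ 'n::finite"
  assumes "spd M"
  obtains E where "frame M E"
proof -
  have "\<exists>E. \<forall>a\<in>A. \<forall>b\<in>A. ip M (E a) (E b) = (if a = b then 1 else 0)" for A :: "'n set"
    using finite[of A]
  proof (induction A rule: finite_induct)
    case (insert a A)
    then obtain E where E: "\<And>a b. a \<in> A \<Longrightarrow> b \<in> A \<Longrightarrow> ip M (E a) (E b) = (if a = b then 1 else 0)" by blast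
    \<comment> \<open>One step of Gram-Schmidt: Euclidean orthogonality to \<open>M *v E b\<close>
      is orthogonality to \<open>E b\<close> for the inner product of \<open>M\<close>, and fewer
      than n conditions leave a nonzero solution.\<close>
    let ?S = "(\<lambda>b. M *v E b) ` A"
    have "card A < CARD('n)" using insert.hyps by (intro psubset_card_mono) auto
    then have "dim ?S < DIM(real ^ 'n)"
      using dim_le_card'[of ?S] card_image_le[of A "\<lambda>b. M *v E b"] insert.hyps by simp
    then obtain v where v: "v \<noteq> 0" "\<And>y. y \<in> span ?S \<Longrightarrow> orthogonal v y"
      by (rule orthogonal_to_subspace_exists) blast
    define r where "r = sqrt (ip M v v)"
    have pos: "ip M v v > 0" using assms v by (auto simp: spd_def)
    then have rr: "r * r = ip M v v" "r > 0" by (simp_all add: r_def)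
    have vE: "ip M v (E b) = 0" if "b \<in> A" for b
      using v(2)[OF span_base] that by (auto simp: orthogonal_def)
    define E' where "E' = E(a := (1 / r) *\<^sub>R v)"
    have "ip M (E' c) (E' d) = (if c = d then 1 else 0)" if cd: "c \<in> insert a A" "d \<in> insert a A" for c d
    proof -
      have "ip M (E' a) (E' a) = 1"
        using rr by (simp add: E'_def matrix_vector_mult_scaleR flip: rr(1))
      moreover have "ip M (E' a) (E' b) = 0" "ip M (E' b) (E' a) = 0" "ip M (E' b) (E' b') = (if b = b' then 1 else 0)"
        if "b \<in> A" "b' \<in> A" for b b'
      proof -
        have "b \<noteq> a" "b' \<noteq> a" using that insert.hyps by auto
        then show "ip M (E' a) (E' b) = 0" "ip M (E' b) (E' a) = 0" "ip M (E' b) (E' b') = (if b = b' then 1 else 0)"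
          using vE[OF that(1)] E that spd_ip_sym[OF assms, of v "E b"]
          by (simp_all add: E'_def matrix_vector_mult_scaleR)
      qed
      ultimately show ?thesis using cd insert.hyps by auto
    qed
    then show ?case by blast
  qed simp
  from this[of UNIV] show ?thesis using that by (auto simp: frame_def)
qed

text \<open>With \<open>B\<close> the matrix of columns \<open>E a\<close>, orthonormality says that
  the transpose of \<open>B\<close> times \<open>M\<close> times \<open>B\<close> is the identity.
  Since one-sided inverses of square matrices are two-sided, the inverse of \<open>M\<close> is
  \<open>B\<close> times its transpose.\<close>

lemma
  fixes M :: "real ^ 'n ^ 'n::finite"
  assumes E: "frame M E"
  shows frame_inv: "matrix_inv M $ p $ q = (\<Sum>a\<in>UNIV. E a $ p * E a $ q)"
    and frame_mult_inv: "M ** matrix_inv M = mat 1"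
    and frame_det: "det M > 0"
proof -
  define B :: "real ^ 'n ^ 'n" where "B = (\<chi> i a. E a $ i)"
  have col: "B *v axis a 1 = E a" for a
    by (simp add: matrix_vector_mult_basis column_def B_def vec_eq_iff)
  have "transpose B ** M ** B = mat 1"
  proof -
    have "(transpose B ** M ** B) $ a $ b = ip M (E a) (E b)" for a b
      unfolding ip_sums
      apply (simp add: matrix_matrix_mult_def transpose_def B_def sum_distrib_right)
      apply (subst sum.swap)
      apply (simp add: mult_ac)
      done
    then show ?thesis using E by (simp add: vec_eq_iff mat_def frame_def)
  qed
  then have BB: "B ** (transpose B ** M) = mat 1"
    by (rule matrix_left_right_inverse[THEN iffD1])
  then have 1: "(B ** transpose B) ** M = mat 1" by (simp add: matrix_mul_assoc)
  then have 2: "M ** (B ** transpose B) = mat 1" by (rule matrix_left_right_inverse[THEN iffD1])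
  have "\<exists>A'. M ** A' = mat 1 \<and> A' ** M = mat 1" using 1 2 by blast
  then have inv: "M ** matrix_inv M = mat 1 \<and> matrix_inv M ** M = mat 1"
    unfolding matrix_inv_def by (rule someI_ex)
  then show "M ** matrix_inv M = mat 1" by simp
  have "matrix_inv M = (B ** transpose B) ** (M ** matrix_inv M)"
    using 1 by (simp add: matrix_mul_assoc)
  then have "matrix_inv M = B ** transpose B" using inv by simp
  then show "matrix_inv M $ p $ q = (\<Sum>a\<in>UNIV. E a $ p * E a $ q)"
    by (simp add: matrix_matrix_mult_def transpose_def B_def)
  have "det (transpose B ** M ** B) = 1" using \<open>transpose B ** M ** B = mat 1\<close> by simp
  then have "det B * det B * det M = 1" by (simp add: det_mul det_transpose mult_ac)
  then show "det M > 0"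
    using zero_less_mult_iff[of "det B * det B" "det M"] not_square_less_zero[of "det B"] by simp
qed

lemma spd_det: "spd M \<Longrightarrow> det M > 0"
  by (erule spd_frame_exists) (rule frame_det)

lemma spd_mult_inv: "spd M \<Longrightarrow> M ** matrix_inv M = mat 1"
  by (erule spd_frame_exists) (rule frame_mult_inv)

lemma spd_inv_mult: "spd M \<Longrightarrow> matrix_inv M ** M = mat 1"
  by (rule matrix_left_right_inverse[THEN iffD1], rule spd_mult_inv)

lemma spd_inv_sym:
  assumes "spd M" shows "matrix_inv M $ p $ q = matrix_inv M $ q $ p"
proof -
  obtain E where "frame M E" using spd_frame_exists[OF assms] .
  then show ?thesis by (simp add: frame_inv mult.commute)
qed

lemma spd_eqI:
  assumes "spd M" "\<And>w. ip M w u = ip M w v"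
  shows "u = v"
proof -
  have "M *v u = M *v v" by (rule vector_eq_rdot[THEN iffD1]) (simp add: assms(2) inner_commute[of "M *v _"])
  then have "matrix_inv M *v (M *v u) = matrix_inv M *v (M *v v)" by simp
  then show ?thesis by (simp add: matrix_vector_mul_assoc spd_inv_mult[OF assms(1)])
qed

text \<open>Replaces contraction with the inverse metric by a plain sum over a frame: norms become
  sums of squares, and tensor identities become identities of indexed numbers with all indices
  down.\<close>

lemma trM_frame:
  assumes "frame M E" "bilinear B"
  shows "trM M B = (\<Sum>a\<in>UNIV. B (E a) (E a))"
proof -
  have B: "B u v = (\<Sum>p\<in>UNIV. \<Sum>q\<in>UNIV. u $ p * v $ q * B (axis p 1) (axis q 1))" for u v
  proof -
    have "B u v = (\<Sum>p\<in>UNIV. u $ p *\<^sub>R B (axis p 1) v)"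
      by (rule linear_expand[of "\<lambda>u. B u v"]) (use assms(2) in \<open>simp add: bilinear_def\<close>)
    also have "\<dots> = (\<Sum>p\<in>UNIV. u $ p *\<^sub>R (\<Sum>q\<in>UNIV. v $ q *\<^sub>R B (axis p 1) (axis q 1)))"
      by (intro sum.cong refl arg_cong2[where f = scaleR] linear_expand[of "B c" v for c])
         (use assms(2) in \<open>simp add: bilinear_def\<close>)
    finally show ?thesis by (simp add: sum_distrib_left mult.assoc)
  qed
  have "(\<Sum>a\<in>UNIV. B (E a) (E a)) = (\<Sum>a\<in>UNIV. \<Sum>p\<in>UNIV. \<Sum>q\<in>UNIV. E a $ p * E a $ q * B (axis p 1) (axis q 1))"
    by (intro sum.cong refl B)
  also have "\<dots> = (\<Sum>p\<in>UNIV. \<Sum>a\<in>UNIV. \<Sum>q\<in>UNIV. E a $ p * E a $ q * B (axis p 1) (axis q 1))"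
    by (rule sum.swap)
  also have "\<dots> = (\<Sum>p\<in>UNIV. \<Sum>q\<in>UNIV. \<Sum>a\<in>UNIV. E a $ p * E a $ q * B (axis p 1) (axis q 1))"
    by (intro sum.cong refl sum.swap)
  finally show ?thesis by (simp add: trM_def frame_inv[OF assms(1)] sum_distrib_right)
qed

lemma trM_cong: "(\<And>u v. B u v = C u v) \<Longrightarrow> trM M B = trM M C"
  by (simp add: trM_def)

lemma trM_add: "trM M (\<lambda>p q. B p q + C p q) = trM M B + trM M C"
  by (simp add: trM_def distrib_left sum.distrib)

lemma trM_diff: "trM M (\<lambda>p q. B p q - C p q) = trM M B - trM M C"
  by (simp add: trM_def right_diff_distrib sum_subtractf)

lemma trM_cmul: "trM M (\<lambda>p q. c * B p q) = c * trM M B"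
  by (simp add: trM_def sum_distrib_left mult.left_commute)

lemma trM_zero: "trM M (\<lambda>p q. 0) = 0"
  by (simp add: trM_def)

lemma trM_flip:
  assumes "spd M" shows "trM M (\<lambda>p q. B q p) = trM M B"
  unfolding trM_def by (subst sum.swap) (simp add: spd_inv_sym[OF assms])

lemma linear_trM:
  assumes "\<And>p q. linear (\<lambda>u. B u p q)"
  shows "linear (\<lambda>u. trM M (B u))"
  using linear_add[OF assms] linear_scale[OF assms]
  by (intro linearI) (simp_all add: trM_def distrib_left sum.distrib sum_distrib_left mult.left_commute)

lemma frame_map:
  fixes M N :: "real ^ 'n ^ 'n::finite"
  assumes "frame M E" "\<And>u v. ip M u v = ip N (J u) (J v)"
  shows "frame N (\<lambda>a. J (E a))"
  using assms by (simp add: frame_def)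

text \<open>\<open>J\<close> carries an orthonormal frame of \<open>M\<close> to one of
  \<open>N\<close>, and both traces are sums over these frames.\<close>

lemma trM_pullback:
  fixes M N :: "real ^ 'n ^ 'n::finite"
  assumes M: "spd M" and J: "linear J" "\<And>u v. ip M u v = ip N (J u) (J v)" and B: "bilinear B"
  shows "trM M (\<lambda>u v. B (J u) (J v)) = trM N B"
proof -
  obtain E where E: "frame M E" using spd_frame_exists[OF M] .
  have 1: "linear (\<lambda>u. B (J u) (J v))" "linear (\<lambda>v. B (J u) (J v))" for u v
    using linear_compose[OF J(1), of "\<lambda>u. B u (J v)"] linear_compose[OF J(1), of "\<lambda>v. B (J u) v"] B
    by (simp_all add: bilinear_def o_def)
  then have "bilinear (\<lambda>u v. B (J u) (J v))" by (simp add: bilinear_def)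
  then show ?thesis using trM_frame[OF E] trM_frame[OF frame_map[where M = M and N = N and E = E and J = J, OF E J(2)] B] by simp
qed

lemma spd_scaleR: "c > 0 \<Longrightarrow> spd M \<Longrightarrow> spd (c *\<^sub>R M)"
  by (simp add: spd_def transpose_scalar flip: scaleR_matrix_vector_assoc)

text \<open>Brings each index next to the one it is contracted with, so that the norm becomes a nest
  of four traces.\<close>

lemma sum8_regroup:
  fixes F :: "'n::finite \<Rightarrow> 'n \<Rightarrow> 'n \<Rightarrow> 'n \<Rightarrow> 'n \<Rightarrow> 'n \<Rightarrow> 'n \<Rightarrow> 'n \<Rightarrow> real"
  shows "(\<Sum>i\<in>UNIV. \<Sum>j\<in>UNIV. \<Sum>k\<in>UNIV. \<Sum>l\<in>UNIV. \<Sum>p\<in>UNIV. \<Sum>q\<in>UNIV. \<Sum>r\<in>UNIV. \<Sum>u\<in>UNIV. F i j k l p q r u)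
    = (\<Sum>i\<in>UNIV. \<Sum>p\<in>UNIV. \<Sum>j\<in>UNIV. \<Sum>q\<in>UNIV. \<Sum>k\<in>UNIV. \<Sum>r\<in>UNIV. \<Sum>l\<in>UNIV. \<Sum>u\<in>UNIV. F i j k l p q r u)"
  unfolding sum.cartesian_product
  by (rule sum.reindex_bij_witness[where i = "\<lambda>(i,p,j,q,k,r,l,u). (i,j,k,l,p,q,r,u)"
        and j = "\<lambda>(i,j,k,l,p,q,r,u). (i,p,j,q,k,r,l,u)"]) auto

lemma trM4_regroup:
  fixes R S :: "real ^ 'n \<Rightarrow> real ^ 'n \<Rightarrow> real ^ 'n \<Rightarrow> real ^ 'n::finite \<Rightarrow> real"
  shows "(\<Sum>i\<in>UNIV. \<Sum>j\<in>UNIV. \<Sum>k\<in>UNIV. \<Sum>l\<in>UNIV. \<Sum>p\<in>UNIV. \<Sum>q\<in>UNIV. \<Sum>r\<in>UNIV. \<Sum>u\<in>UNIV.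
      matrix_inv M $ i $ p * matrix_inv M $ j $ q * matrix_inv M $ k $ r * matrix_inv M $ l $ u *
      R (axis i 1) (axis j 1) (axis k 1) (axis l 1) * S (axis p 1) (axis q 1) (axis r 1) (axis u 1))
    = trM M (\<lambda>a a'. trM M (\<lambda>b b'. trM M (\<lambda>c c'. trM M (\<lambda>d d'. R a b c d * S a' b' c' d'))))"
  unfolding trM_def sum_distrib_left by (subst sum8_regroup) (simp only: mult_ac)

lemma trM2_regroup:
  fixes R S :: "real ^ 'n \<Rightarrow> real ^ 'n::finite \<Rightarrow> real"
  shows "(\<Sum>i\<in>UNIV. \<Sum>j\<in>UNIV. \<Sum>p\<in>UNIV. \<Sum>q\<in>UNIV.
      matrix_inv M $ i $ p * matrix_inv M $ j $ q * R (axis i 1) (axis j 1) * S (axis p 1) (axis q 1))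
    = trM M (\<lambda>a a'. trM M (\<lambda>b b'. R a b * S a' b'))"
  unfolding trM_def sum_distrib_left
  by (subst sum.swap[of _ UNIV UNIV]) (simp only: mult_ac)

lemma bilinear_mult:
  fixes f g :: "'a::real_vector \<Rightarrow> real"
  shows "linear f \<Longrightarrow> linear g \<Longrightarrow> bilinear (\<lambda>u v. f u * g v)"
  by (auto simp: bilinear_def intro!: linearI simp: linear_add linear_scale algebra_simps)

lemma bilinear_sum': "(\<And>d. bilinear (B d)) \<Longrightarrow> bilinear (\<lambda>u v. \<Sum>d\<in>D. B d u v)"
  by (simp add: bilinear_def linear_compose_sum)

lemma trM4_frame:
  assumes E: "frame M E"
    and R: "\<And>b c d. linear (\<lambda>a. R a b c d)" "\<And>a c d. linear (\<lambda>b. R a b c d)" "\<And>a b d. linear (\<lambda>c. R a b c d)" "\<And>a b c. linear (\<lambda>d. R a b c d)"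
    and S: "\<And>b c d. linear (\<lambda>a. S a b c d)" "\<And>a c d. linear (\<lambda>b. S a b c d)" "\<And>a b d. linear (\<lambda>c. S a b c d)" "\<And>a b c. linear (\<lambda>d. S a b c d)"
  shows "trM M (\<lambda>a a'. trM M (\<lambda>b b'. trM M (\<lambda>c c'. trM M (\<lambda>d d'. R a b c d * S a' b' c' d'))))
    = (\<Sum>a\<in>UNIV. \<Sum>b\<in>UNIV. \<Sum>c\<in>UNIV. \<Sum>d\<in>UNIV. R (E a) (E b) (E c) (E d) * S (E a) (E b) (E c) (E d))"
proof -
  have 1: "trM M (\<lambda>d d'. R a b c d * S a' b' c' d') = (\<Sum>d\<in>UNIV. R a b c (E d) * S a' b' c' (E d))" for a b c a' b' c'
    by (rule trM_frame[OF E]) (rule bilinear_mult[OF R(4) S(4)])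
  have 2: "trM M (\<lambda>c c'. \<Sum>d\<in>UNIV. R a b c (E d) * S a' b' c' (E d)) = (\<Sum>c\<in>UNIV. \<Sum>d\<in>UNIV. R a b (E c) (E d) * S a' b' (E c) (E d))" for a b a' b'
    by (rule trM_frame[OF E]) (intro bilinear_sum' bilinear_mult R S)
  have 3: "trM M (\<lambda>b b'. \<Sum>c\<in>UNIV. \<Sum>d\<in>UNIV. R a b (E c) (E d) * S a' b' (E c) (E d))
     = (\<Sum>b\<in>UNIV. \<Sum>c\<in>UNIV. \<Sum>d\<in>UNIV. R a (E b) (E c) (E d) * S a' (E b) (E c) (E d))" for a a'
    by (rule trM_frame[OF E]) (intro bilinear_sum' bilinear_mult R S)
  have 4: "trM M (\<lambda>a a'. \<Sum>b\<in>UNIV. \<Sum>c\<in>UNIV. \<Sum>d\<in>UNIV. R a (E b) (E c) (E d) * S a' (E b) (E c) (E d))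
     = (\<Sum>a\<in>UNIV. \<Sum>b\<in>UNIV. \<Sum>c\<in>UNIV. \<Sum>d\<in>UNIV. R (E a) (E b) (E c) (E d) * S (E a) (E b) (E c) (E d))"
    by (rule trM_frame[OF E]) (intro bilinear_sum' bilinear_mult R S)
  show ?thesis by (simp only: 1 2 3 4)
qed

lemma trM2_frame:
  assumes E: "frame M E"
    and R: "\<And>b. linear (\<lambda>a. R a b)" "\<And>a. linear (\<lambda>b. R a b)"
    and S: "\<And>b. linear (\<lambda>a. S a b)" "\<And>a. linear (\<lambda>b. S a b)"
  shows "trM M (\<lambda>a a'. trM M (\<lambda>b b'. R a b * S a' b')) = (\<Sum>a\<in>UNIV. \<Sum>b\<in>UNIV. R (E a) (E b) * S (E a) (E b))"
proof -
  have 1: "trM M (\<lambda>d d'. R a d * S a' d') = (\<Sum>d\<in>UNIV. R a (E d) * S a' (E d))" for a a'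
    by (rule trM_frame[OF E]) (rule bilinear_mult[OF R(2) S(2)])
  have 2: "trM M (\<lambda>a a'. \<Sum>b\<in>UNIV. R a (E b) * S a' (E b)) = (\<Sum>a\<in>UNIV. \<Sum>b\<in>UNIV. R (E a) (E b) * S (E a) (E b))"
    by (rule trM_frame[OF E]) (intro bilinear_sum' bilinear_mult R S)
  show ?thesis by (simp only: 1 2)
qed

text \<open>Cramer's rule presents each entry of the inverse as a quotient of determinants, with
  positive denominator.\<close>

lemma smooth_on_matrix_inv:
  fixes F :: "'a::real_normed_vector \<Rightarrow> real ^ 'n ^ 'n::finite"
  assumes S: "open S" "smooth_on S F" and spd: "\<And>x. x \<in> S \<Longrightarrow> spd (F x)"
  shows "smooth_on S (\<lambda>x. matrix_inv (F x) $ i $ j)"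
proof -
  have Fs: "smooth_on S (\<lambda>x. F x $ a $ b)" for a b
    using smooth_on_nth[OF S(1) smooth_on_nth[OF S]] .
  have "smooth_on S (\<lambda>x. det (\<chi> a b. if b = i then axis j 1 $ a else F x $ a $ b) / det (F x))"
  proof (intro smooth_on_divide smooth_on_det S(1))
    fix a b show "smooth_on S (\<lambda>x. (\<chi> a b. if b = i then axis j 1 $ a else F x $ a $ b) $ a $ b)"
      using Fs by (cases "b = i") (simp_all add: smooth_on_const)
  qed (use Fs spd_det spd in auto)
  moreover have "matrix_inv (F x) $ i $ j = det (\<chi> a b. if b = i then axis j 1 $ a else F x $ a $ b) / det (F x)"
    if x: "x \<in> S" for x
  proof -
    have 1: "F x *v (matrix_inv (F x) *v axis j 1) = axis j 1"
      by (simp add: matrix_vector_mul_assoc spd_mult_inv[OF spd[OF x]])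
    have 2: "det (F x) \<noteq> 0" using spd_det[OF spd[OF x]] by simp
    have "matrix_inv (F x) *v axis j 1 = (\<chi> k. det (\<chi> a b. if b = k then axis j 1 $ a else F x $ a $ b) / det (F x))"
      by (rule cramer[OF 2, THEN iffD1, OF 1])
    then show ?thesis by (simp add: matrix_vector_mult_basis column_def vec_eq_iff)
  qed
  ultimately show ?thesis by (rule smooth_on_cong[OF S(1), THEN iffD2, rotated])
qed

section \<open>Families of metrics in a chart\<close>

text \<open>Joint smoothness in curried form, so that a family can be sliced at a fixed time or at a
  fixed point and differentiated in either variable.\<close>

definition jsm :: "real set \<Rightarrow> (real ^ 'n::finite) set \<Rightarrow> (real \<Rightarrow> real ^ 'n \<Rightarrow> 'c::real_normed_vector) \<Rightarrow> bool" where
  "jsm I U f \<longleftrightarrow> smooth_on (I \<times> U) (\<lambda>p. f (fst p) (snd p))"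

lemma
  assumes "f differentiable (at (t, x))"
  shows dd_slice_snd: "dd v (\<lambda>y. f (t, y)) x = dd (0, v) f (t, x)"
    and dd_slice_fst: "dd r (\<lambda>s. f (s, x)) t = dd (r, 0) f (t, x)"
proof -
  have 1: "((\<lambda>y. (t, y)) has_derivative (\<lambda>v. (0, v))) (at x)"
    by (intro has_derivative_Pair has_derivative_const has_derivative_ident)
  have 2: "((\<lambda>s. (s, x)) has_derivative (\<lambda>v. (v, 0))) (at t)"
    by (intro has_derivative_Pair has_derivative_const has_derivative_ident)
  have d1: "((\<lambda>y. f (t, y)) has_derivative (\<lambda>v. dd (0, v) f (t, x))) (at x)"
    by (rule has_derivative_compose[OF 1 has_derivative_dd[OF assms]])
  have d2: "((\<lambda>s. f (s, x)) has_derivative (\<lambda>v. dd (v, 0) f (t, x))) (at t)"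
    by (rule has_derivative_compose[OF 2 has_derivative_dd[OF assms]])
  show "dd v (\<lambda>y. f (t, y)) x = dd (0, v) f (t, x)" by (rule dd_eqI[OF d1])
  show "dd r (\<lambda>s. f (s, x)) t = dd (r, 0) f (t, x)" by (rule dd_eqI[OF d2])
qed

context
  fixes I :: "real set" and U :: "(real ^ 'n::finite) set"
  assumes IU: "open I" "open U"
begin

lemma open_IU: "open (I \<times> U)"
  using IU by (rule open_Times)

lemma jsm_const: "jsm I U (\<lambda>t x. c)"
  unfolding jsm_def by (rule smooth_on_const)

lemma jsm_add: "jsm I U f \<Longrightarrow> jsm I U g \<Longrightarrow> jsm I U (\<lambda>t x. f t x + g t x)"
  unfolding jsm_def by (rule smooth_on_add[OF open_IU])

lemma jsm_diff: "jsm I U f \<Longrightarrow> jsm I U g \<Longrightarrow> jsm I U (\<lambda>t x. f t x - g t x)"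
  unfolding jsm_def by (rule smooth_on_diff[OF open_IU])

lemma jsm_mult:
  fixes f g :: "real \<Rightarrow> real ^ 'n \<Rightarrow> real"
  shows "jsm I U f \<Longrightarrow> jsm I U g \<Longrightarrow> jsm I U (\<lambda>t x. f t x * g t x)"
  unfolding jsm_def by (rule smooth_on_mult[OF open_IU])

lemma jsm_sum: "(\<And>i. i \<in> A \<Longrightarrow> jsm I U (f i)) \<Longrightarrow> jsm I U (\<lambda>t x. \<Sum>i\<in>A. f i t x)"
  unfolding jsm_def by (rule smooth_on_sum[OF open_IU])

lemma jsm_divide_const:
  fixes f :: "real \<Rightarrow> real ^ 'n \<Rightarrow> real"
  shows "jsm I U f \<Longrightarrow> jsm I U (\<lambda>t x. f t x / c)"
  using jsm_mult[OF _ jsm_const, of f "inverse c"] by (simp add: divide_inverse)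

lemma jsm_differentiable: "jsm I U f \<Longrightarrow> t \<in> I \<Longrightarrow> x \<in> U \<Longrightarrow> (\<lambda>p. f (fst p) (snd p)) differentiable (at (t, x))"
  unfolding jsm_def by (rule smooth_on_differentiable) auto

lemma jsm_cong:
  "(\<And>t x. t \<in> I \<Longrightarrow> x \<in> U \<Longrightarrow> f t x = g t x) \<Longrightarrow> jsm I U g \<Longrightarrow> jsm I U f"
  unfolding jsm_def
  using smooth_on_cong[OF open_IU, of "\<lambda>p. f (fst p) (snd p)" "\<lambda>p. g (fst p) (snd p)"] by auto

lemma jsm_pd:
  assumes "jsm I U f" shows "jsm I U (\<lambda>t x. pd i (\<lambda>y. f t y) x)"
proof (rule jsm_cong)
  show "jsm I U (\<lambda>t x. dd (0, axis i 1) (\<lambda>p. f (fst p) (snd p)) (t, x))"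
    using smooth_on_dd[OF assms[unfolded jsm_def]] by (simp add: jsm_def)
  fix t x assume "t \<in> I" "x \<in> U"
  from dd_slice_snd[OF jsm_differentiable[OF assms this]]
  show "pd i (\<lambda>y. f t y) x = dd (0, axis i 1) (\<lambda>p. f (fst p) (snd p)) (t, x)" by (simp add: pd_def)
qed

lemma jsm_dd:
  assumes "jsm I U f" shows "jsm I U (\<lambda>t x. dd v (\<lambda>y. f t y) x)" "jsm I U (\<lambda>t x. dd r (\<lambda>s. f s x) t)"
proof -
  show "jsm I U (\<lambda>t x. dd v (\<lambda>y. f t y) x)"
  proof (rule jsm_cong)
    show "jsm I U (\<lambda>t x. dd (0, v) (\<lambda>p. f (fst p) (snd p)) (t, x))"
      using smooth_on_dd[OF assms[unfolded jsm_def]] by (simp add: jsm_def)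
    fix t x assume "t \<in> I" "x \<in> U"
    from dd_slice_snd[OF jsm_differentiable[OF assms this]]
    show "dd v (\<lambda>y. f t y) x = dd (0, v) (\<lambda>p. f (fst p) (snd p)) (t, x)" by simp
  qed
  show "jsm I U (\<lambda>t x. dd r (\<lambda>s. f s x) t)"
  proof (rule jsm_cong)
    show "jsm I U (\<lambda>t x. dd (r, 0) (\<lambda>p. f (fst p) (snd p)) (t, x))"
      using smooth_on_dd[OF assms[unfolded jsm_def]] by (simp add: jsm_def)
    fix t x assume "t \<in> I" "x \<in> U"
    from dd_slice_fst[OF jsm_differentiable[OF assms this]]
    show "dd r (\<lambda>s. f s x) t = dd (r, 0) (\<lambda>p. f (fst p) (snd p)) (t, x)" by simp
  qed
qed

text \<open>Symmetry of second derivatives on the product space, for the directions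
  \<open>(r, 0)\<close> and \<open>(0, v)\<close>.\<close>

lemma dd_time_space_commute:
  fixes f :: "real \<Rightarrow> real ^ 'n \<Rightarrow> 'c::euclidean_space"
  assumes f: "jsm I U f" and tx: "t \<in> I" "x \<in> U"
  shows "dd r (\<lambda>s. dd v (\<lambda>y. f s y) x) t = dd v (\<lambda>y. dd r (\<lambda>s. f s y) t) x"
proof -
  let ?f = "\<lambda>p. f (fst p) (snd p)"
  note sm = f[unfolded jsm_def]
  have p: "(t, x) \<in> I \<times> U" using tx by simp
  have "dd r (\<lambda>s. dd v (\<lambda>y. f s y) x) t = dd r (\<lambda>s. dd (0, v) ?f (s, x)) t"
    by (rule dd_cong[OF IU(1) tx(1)]) (use dd_slice_snd[OF jsm_differentiable[OF f _ tx(2)]] in simp)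
  also have "\<dots> = dd (r, 0) (\<lambda>p. dd (0, v) ?f p) (t, x)"
    by (rule dd_slice_fst[OF smooth_on_differentiable[OF smooth_on_dd[OF sm] p]])
  also have "\<dots> = dd (0, v) (\<lambda>p. dd (r, 0) ?f p) (t, x)"
    by (rule dd_symmetric[OF open_IU p sm])
  also have "\<dots> = dd v (\<lambda>y. dd (r, 0) ?f (t, y)) x"
    by (rule dd_slice_snd[OF smooth_on_differentiable[OF smooth_on_dd[OF sm] p], symmetric])
  also have "\<dots> = dd v (\<lambda>y. dd r (\<lambda>s. f s y) t) x"
    by (rule dd_cong[OF IU(2) tx(2)]) (use dd_slice_fst[OF jsm_differentiable[OF f tx(1)]] in simp)
  finally show ?thesis .
qed

lemma jsm_slice:
  fixes f :: "real \<Rightarrow> real ^ 'n \<Rightarrow> 'c::real_normed_vector"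
  assumes "jsm I U f"
  shows "t \<in> I \<Longrightarrow> smooth_on U (\<lambda>x. f t x)" "x \<in> U \<Longrightarrow> smooth_on I (\<lambda>t. f t x)"
proof -
  assume t: "t \<in> I"
  have "smooth_on U (\<lambda>x. (0::real, x))"
    by (rule smooth_on_linear) (intro bounded_linear_Pair bounded_linear_zero bounded_linear_ident)
  from smooth_on_add[OF IU(2) smooth_on_const this, of "(t, 0)"]
  have "smooth_on U (\<lambda>x. (t, x))" by simp
  from smooth_on_compose[OF IU(2) open_IU _ this assms[unfolded jsm_def]] t
  show "smooth_on U (\<lambda>x. f t x)" by auto
next
  assume x: "x \<in> U"
  have "smooth_on I (\<lambda>t. (t, 0::real ^ 'n))"
    by (rule smooth_on_linear) (intro bounded_linear_Pair bounded_linear_zero bounded_linear_ident)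
  from smooth_on_add[OF IU(1) smooth_on_const this, of "(0, x)"]
  have "smooth_on I (\<lambda>t. (t, x))" by simp
  from smooth_on_compose[OF IU(1) open_IU _ this assms[unfolded jsm_def]] x
  show "smooth_on I (\<lambda>t. f t x)" by auto
qed

lemma jsm_static:
  assumes "smooth_on U f" shows "jsm I U (\<lambda>t x. f x)"
  unfolding jsm_def
  by (rule smooth_on_compose[OF open_IU IU(2) _ _ assms]) (auto intro: smooth_on_linear bounded_linear_snd)

context
  fixes F :: "real \<Rightarrow> real ^ 'n \<Rightarrow> real ^ 'n ^ 'n"
  assumes F: "jsm I U F" and spd: "\<And>t x. t \<in> I \<Longrightarrow> x \<in> U \<Longrightarrow> spd (F t x)"
begin

lemma jsm_entry: "jsm I U (\<lambda>t x. F t x $ i $ j)"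
  using F unfolding jsm_def by (intro smooth_on_nth open_IU)

lemma jsm_ginv: "jsm I U (\<lambda>t x. ginv (F t) x i j)"
  unfolding jsm_def ginv_def
  by (rule smooth_on_matrix_inv[OF open_IU F[unfolded jsm_def]]) (auto intro: spd)

lemma jsm_christoffel: "jsm I U (\<lambda>t x. christoffel (F t) x k i j)"
  unfolding christoffel_def
  by (intro jsm_divide_const jsm_sum jsm_mult jsm_ginv jsm_add jsm_diff jsm_pd jsm_entry)

lemma jsm_riem_up: "jsm I U (\<lambda>t x. riem_up (F t) x i j k l)"
  unfolding riem_up_def
  by (intro jsm_sum jsm_mult jsm_add jsm_diff jsm_pd jsm_christoffel)

lemma jsm_riem: "jsm I U (\<lambda>t x. riem (F t) x i j k l)"
  unfolding riem_def by (intro jsm_sum jsm_mult jsm_entry jsm_riem_up)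

lemma jsm_ricci: "jsm I U (\<lambda>t x. ricci (F t) x j k)"
  unfolding ricci_def by (intro jsm_sum jsm_riem_up)

lemma jsm_scal: "jsm I U (\<lambda>t x. scal (F t) x)"
  unfolding scal_def by (intro jsm_sum jsm_mult jsm_ginv jsm_ricci)

lemma jsm_riem_norm2: "jsm I U (\<lambda>t x. riem_norm2 (F t) x)"
  unfolding riem_norm2_def by (intro jsm_sum jsm_mult jsm_ginv jsm_riem)

lemma jsm_ricci_norm2: "jsm I U (\<lambda>t x. ricci_norm2 (F t) x)"
  unfolding ricci_norm2_def by (intro jsm_sum jsm_mult jsm_ginv jsm_ricci)

lemma jsm_sqrt_det: "jsm I U (\<lambda>t x. sqrt (det (F t x)))"
  unfolding jsm_def
  by (intro smooth_on_sqrt smooth_on_det open_IU jsm_entry[unfolded jsm_def] spd_det) (auto intro: spd)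

end

end

section \<open>The Levi-Civita connection in a chart\<close>

definition Gam :: "(real ^ 'n \<Rightarrow> real ^ 'n ^ 'n) \<Rightarrow> real ^ 'n \<Rightarrow> real ^ 'n \<Rightarrow> real ^ 'n \<Rightarrow> real ^ 'n::finite" where
  "Gam G x u v = (\<chi> k. \<Sum>i\<in>UNIV. \<Sum>j\<in>UNIV. christoffel G x k i j * u $ i * v $ j)"

lemma jsm_Gam:
  assumes "open I" "open U" "jsm I U F" "\<And>t x. t \<in> I \<Longrightarrow> x \<in> U \<Longrightarrow> spd (F t x)"
  shows "jsm I U (\<lambda>t x. Gam (F t) x u v)"
proof -
  have "jsm I U (\<lambda>t x. \<Sum>i\<in>UNIV. \<Sum>j\<in>UNIV. christoffel (F t) x k i j * u $ i * v $ j)" for k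
    by (intro jsm_sum jsm_mult jsm_christoffel jsm_const assms)
  then show ?thesis unfolding jsm_def Gam_def
    by (intro smooth_on_vecI open_IU assms) simp
qed

definition ten2 :: "(real ^ 'n \<Rightarrow> real ^ 'n ^ 'n::finite) \<Rightarrow> real ^ 'n \<Rightarrow> (real ^ 'n) list \<Rightarrow> real" where
  "ten2 H x vs = ip (H x) (vs ! 0) (vs ! 1)"

lemma smooth_on_ip:
  assumes "open U" "smooth_on U H" shows "smooth_on U (\<lambda>x. ip (H x) u v)"
  unfolding ip_sums
  by (intro smooth_on_sum smooth_on_mult smooth_on_const assms smooth_on_nth)

lemma stens_ten2:
  fixes H :: "real ^ 'n \<Rightarrow> real ^ 'n ^ 'n::finite"
  assumes U: "open U" "smooth_on U H" shows "stens (Suc (Suc 0)) U (ten2 H)"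
  unfolding stens_def
proof (intro conjI ballI allI impI)
  fix x show "mlin (Suc (Suc 0)) (ten2 H x)"
  proof -
    have "linear (\<lambda>w. ten2 H x (w # vs))" if "length vs = Suc 0" for vs
      using linear_ip(1)[of "H x" "vs ! 0"] by (simp add: ten2_def)
    moreover have "linear (\<lambda>w. ten2 H x [u, w])" for u
      using linear_ip(2)[of u "H x"] by (simp add: ten2_def)
    ultimately show ?thesis by simp
  qed
next
  fix vs :: "(real ^ 'n) list"
  show "smooth_on U (\<lambda>x. ten2 H x vs)" unfolding ten2_def by (rule smooth_on_ip[OF U])
qed

locale metric_on =
  fixes U :: "(real ^ 'n::finite) set" and G :: "real ^ 'n \<Rightarrow> real ^ 'n ^ 'n"
  assumes open_dom: "open U" and smooth_G: "smooth_on U G" and spd_G: "\<And>x. x \<in> U \<Longrightarrow> spd (G x)"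
begin

lemma G_sym: "x \<in> U \<Longrightarrow> G x $ i $ j = G x $ j $ i"
  using spd_G[of x] unfolding spd_def transpose_def vec_eq_iff by (metis vec_lambda_beta)

lemma smooth_G_entry: "smooth_on U (\<lambda>x. G x $ i $ j)"
  by (intro smooth_on_nth open_dom smooth_G)

text \<open>A single metric is treated as a constant family, so its smoothness statements are slices
  of those for families.\<close>

lemma jsm_G: "jsm UNIV U (\<lambda>t. G)"
  by (rule jsm_static[OF open_UNIV open_dom smooth_G])

lemma smooth_ginv: "smooth_on U (\<lambda>x. ginv G x i j)"
  using jsm_slice(1)[OF open_UNIV open_dom jsm_ginv[OF open_UNIV open_dom jsm_G spd_G]] by simp

lemma smooth_Gam: "smooth_on U (\<lambda>x. Gam G x u v)"
  using jsm_slice(1)[OF open_UNIV open_dom jsm_Gam[OF open_UNIV open_dom jsm_G spd_G]] by simp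

lemma smooth_scalars:
  "smooth_on U (\<lambda>x. riem_norm2 G x)" "smooth_on U (\<lambda>x. ricci_norm2 G x)" "smooth_on U (\<lambda>x. scal G x)"
  "smooth_on U (\<lambda>x. sqrt (det (G x)))"
  using jsm_slice(1)[OF open_UNIV open_dom jsm_riem_norm2[OF open_UNIV open_dom jsm_G spd_G]]
    jsm_slice(1)[OF open_UNIV open_dom jsm_ricci_norm2[OF open_UNIV open_dom jsm_G spd_G]]
    jsm_slice(1)[OF open_UNIV open_dom jsm_scal[OF open_UNIV open_dom jsm_G spd_G]]
    jsm_slice(1)[OF open_UNIV open_dom jsm_sqrt_det[OF open_UNIV open_dom jsm_G spd_G]]
  by simp_all

lemma christoffel_sym: "x \<in> U \<Longrightarrow> christoffel G x k i j = christoffel G x k j i"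
proof -
  assume x: "x \<in> U"
  have "pd l (\<lambda>y. G y $ i $ j) x = pd l (\<lambda>y. G y $ j $ i) x" for l
    unfolding pd_def by (rule dd_cong[OF open_dom x]) (rule G_sym)
  then show ?thesis unfolding christoffel_def
    by (intro arg_cong2[where f = "(/)"] sum.cong refl) (simp add: add.commute)
qed

lemma linear_Gam: "linear (\<lambda>u. Gam G x u v)" "linear (Gam G x u)"
  by (auto intro!: linearI simp: Gam_def vec_eq_iff distrib_left distrib_right sum.distrib sum_distrib_left mult_ac)

lemma Gam_sym:
  assumes x: "x \<in> U" shows "Gam G x u v = Gam G x v u"
proof -
  have "(\<Sum>i\<in>UNIV. \<Sum>j\<in>UNIV. christoffel G x k i j * u $ i * v $ j) = (\<Sum>i\<in>UNIV. \<Sum>j\<in>UNIV. christoffel G x k i j * v $ i * u $ j)" for k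
    by (subst sum.swap) (intro sum.cong refl, simp add: christoffel_sym[OF x, of k] mult_ac)
  then show "Gam G x u v = Gam G x v u" by (simp add: Gam_def vec_eq_iff)
qed

sublocale connection U "Gam G"
  by (rule connection.intro) (rule open_dom linear_Gam smooth_Gam Gam_sym, assumption?)+

lemma dd_ip_sums:
  assumes x: "x \<in> U" and H: "smooth_on U H"
  shows "dd u (\<lambda>y. ip (H y) v w) x = (\<Sum>i\<in>UNIV. \<Sum>j\<in>UNIV. \<Sum>k\<in>UNIV. u $ i * (v $ j * w $ k * pd i (\<lambda>y. H y $ j $ k) x))"
proof -
  have d: "(\<lambda>y. H y $ j $ k) differentiable (at x)" for j k
    by (rule smooth_on_differentiable[OF _ x]) (intro smooth_on_nth open_dom H)
  have dc: "(\<lambda>y. c * H y $ j $ k) differentiable (at x)" for c j k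
    by (rule smooth_on_differentiable[OF _ x]) (intro smooth_on_mult smooth_on_const smooth_on_nth open_dom H)
  have ds: "(\<lambda>y. \<Sum>k\<in>UNIV. c k * H y $ j $ k) differentiable (at x)" for c j
    by (rule smooth_on_differentiable[OF _ x]) (intro smooth_on_sum smooth_on_mult smooth_on_const smooth_on_nth open_dom H)
  have 1: "dd u (\<lambda>y. ip (H y) v w) x = (\<Sum>i\<in>UNIV. u $ i *\<^sub>R dd (axis i 1) (\<lambda>y. ip (H y) v w) x)"
    by (rule dd_basis[OF smooth_on_differentiable[OF smooth_on_ip[OF open_dom H] x]])
  have 2: "dd (axis i 1) (\<lambda>y. ip (H y) v w) x = (\<Sum>j\<in>UNIV. \<Sum>k\<in>UNIV. v $ j * w $ k * pd i (\<lambda>y. H y $ j $ k) x)" for i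
    unfolding ip_sums by (simp add: dd_sum[OF ds] dd_sum[OF dc] dd_cmult[OF d] pd_def)
  show ?thesis unfolding 1 2 by (simp add: sum_distrib_left)
qed

text \<open>Lowering the index removes the inverse metric. Metric compatibility, the time derivative
  of the connection and its change of charts all start from this form, since the lowered components
  against all \<open>w\<close> determine the vector.\<close>

lemma koszul:
  assumes x: "x \<in> U"
  shows "2 * ip (G x) w (Gam G x u v) = dd u (\<lambda>y. ip (G y) v w) x + dd v (\<lambda>y. ip (G y) u w) x - dd w (\<lambda>y. ip (G y) u v) x"
proof -
  define S where "S i j l = pd i (\<lambda>y. G y $ j $ l) x + pd j (\<lambda>y. G y $ i $ l) x - pd l (\<lambda>y. G y $ i $ j) x" for i j l
  define c where "c i j = (\<chi> k. christoffel G x k i j)" for i j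
  have c: "G x *v c i j = (\<chi> l. S i j l / 2)" for i j
  proof -
    have "c i j = matrix_inv (G x) *v (\<chi> l. S i j l / 2)"
      by (simp add: c_def christoffel_def vec_eq_iff matrix_vector_mult_def ginv_def S_def sum_divide_distrib)
    then show ?thesis by (simp add: matrix_vector_mul_assoc spd_mult_inv[OF spd_G[OF x]])
  qed
  have "Gam G x u v = (\<Sum>i\<in>UNIV. \<Sum>j\<in>UNIV. (u $ i * v $ j) *\<^sub>R c i j)"
    by (simp add: Gam_def c_def vec_eq_iff mult_ac)
  then have "2 * ip (G x) w (Gam G x u v) = 2 * (\<Sum>i\<in>UNIV. \<Sum>j\<in>UNIV. (u $ i * v $ j) * (w \<bullet> (\<chi> l. S i j l / 2)))"
    by (simp only: linear_sum[OF linear_ip(2)] linear_scale[OF linear_ip(2)] c real_scaleR_def)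
  also have "\<dots> = (\<Sum>i\<in>UNIV. \<Sum>j\<in>UNIV. \<Sum>l\<in>UNIV. u $ i * v $ j * w $ l * S i j l)"
    by (simp add: inner_vec_def sum_distrib_left mult_ac)
  also have "\<dots> = (\<Sum>i\<in>UNIV. \<Sum>j\<in>UNIV. \<Sum>l\<in>UNIV. u $ i * (v $ j * w $ l * pd i (\<lambda>y. G y $ j $ l) x))
      + (\<Sum>i\<in>UNIV. \<Sum>j\<in>UNIV. \<Sum>l\<in>UNIV. v $ j * (u $ i * w $ l * pd j (\<lambda>y. G y $ i $ l) x))
      - (\<Sum>i\<in>UNIV. \<Sum>j\<in>UNIV. \<Sum>l\<in>UNIV. w $ l * (u $ i * v $ j * pd l (\<lambda>y. G y $ i $ j) x))"
    by (simp add: S_def algebra_simps sum.distrib sum_subtractf)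
  also have "(\<Sum>i\<in>UNIV. \<Sum>j\<in>UNIV. \<Sum>l\<in>UNIV. v $ j * (u $ i * w $ l * pd j (\<lambda>y. G y $ i $ l) x)) = dd v (\<lambda>y. ip (G y) u w) x"
    unfolding dd_ip_sums[OF x smooth_G] by (rule sum.swap)
  also have "(\<Sum>i\<in>UNIV. \<Sum>j\<in>UNIV. \<Sum>l\<in>UNIV. w $ l * (u $ i * v $ j * pd l (\<lambda>y. G y $ i $ j) x))
     = (\<Sum>i\<in>UNIV. \<Sum>l\<in>UNIV. \<Sum>j\<in>UNIV. w $ l * (u $ i * v $ j * pd l (\<lambda>y. G y $ i $ j) x))"
    by (intro sum.cong refl sum.swap)
  also have "\<dots> = dd w (\<lambda>y. ip (G y) u v) x"
    unfolding dd_ip_sums[OF x smooth_G] by (rule sum.swap)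
  finally show ?thesis unfolding dd_ip_sums[OF x smooth_G, where u = u and v = v and w = w] by simp
qed

lemma ip_sym: "x \<in> U \<Longrightarrow> ip (G x) u v = ip (G x) v u"
  by (rule spd_ip_sym[OF spd_G])

text \<open>Sum of the Koszul formulas for \<open>Gam G x u v\<close> against \<open>w\<close> and
  \<open>Gam G x u w\<close> against \<open>v\<close>; the remaining derivatives of the metric
  cancel.\<close>

lemma metric_compat:
  assumes x: "x \<in> U"
  shows "dd u (\<lambda>y. ip (G y) v w) x = ip (G x) (Gam G x u v) w + ip (G x) v (Gam G x u w)"
proof -
  have s: "dd a (\<lambda>y. ip (G y) b c) x = dd a (\<lambda>y. ip (G y) c b) x" for a b c
    by (rule dd_cong[OF open_dom x]) (rule ip_sym)
  show ?thesis
    using koszul[OF x, where w = w and u = u and v = v] koszul[OF x, where w = v and u = u and v = w] ip_sym[OF x, of "Gam G x u v" w]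
      s[where a = u and b = v and c = w]
    by linarith
qed

definition rm :: "real ^ 'n \<Rightarrow> real ^ 'n \<Rightarrow> real ^ 'n \<Rightarrow> real ^ 'n \<Rightarrow> real ^ 'n \<Rightarrow> real" where
  "rm x u v w z = ip (G x) z (curv x u v w)"

lemma rm_antisym12: "rm x u v w z = - rm x v u w z"
  unfolding rm_def by (subst curv_antisym) (simp add: linear_neg[OF linear_ip(2)])

text \<open>The metric is parallel, so the Ricci identity applied to the tensor
  \<open>ten2 G\<close> has left side 0; its right side is the symmetrisation of \<open>rm\<close>
  in the last two slots.\<close>

lemma rm_antisym34:
  assumes x: "x \<in> U" shows "rm x u v w z = - rm x u v z w"
proof -
  have T: "stens (Suc (Suc 0)) U (ten2 G)" by (rule stens_ten2[OF open_dom smooth_G])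
  have 0: "cov (Gam G) (ten2 G) y vs = 0" if y: "y \<in> U" and l: "length vs = Suc (Suc (Suc 0))" for y vs
  proof -
    obtain a b c where vs: "vs = [a, b, c]" using l by (auto simp: length_Suc_conv)
    show ?thesis using metric_compat[OF y, where u = a and v = b and w = c] by (simp add: vs ten2_def)
  qed
  have "cov (Gam G) (cov (Gam G) (ten2 G)) x [a, b, c, d] = cov (Gam G) (\<lambda>y vs. 0) x [a, b, c, d]" for a b c d
    by (rule cov_cong[OF open_dom x]) (simp add: 0)
  then have "cov (Gam G) (cov (Gam G) (ten2 G)) x [a, b, c, d] = 0" for a b c d by simp
  with ricci_identity[OF T _ x, of "[w, z]" u v] show ?thesis
    by (simp add: ten2_def rm_def ip_sym[OF x, of "curv x u v w" z])
qed

lemma rm_bianchi: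
  assumes x: "x \<in> U" shows "rm x u v w z + rm x v w u z + rm x w u v z = 0"
  unfolding rm_def using bianchi1[OF x, of u v w]
  by (simp flip: inner_add_right matrix_vector_right_distrib)

lemma linear_rm:
  assumes x: "x \<in> U"
  shows "linear (\<lambda>u. rm x u v w z)" "linear (\<lambda>v. rm x u v w z)" "linear (\<lambda>w. rm x u v w z)" "linear (\<lambda>z. rm x u v w z)"
  unfolding rm_def
  using linear_compose[OF linear_curv(1)[OF x] linear_ip(2)] linear_compose[OF linear_curv(2)[OF x] linear_ip(2)]
    linear_compose[OF linear_curv(3)[OF x] linear_ip(2)] linear_ip(1)
  by (simp_all add: o_def)

lemma Gam_axis_nth: "Gam G x (axis i 1) w $ l = (\<Sum>m\<in>UNIV. christoffel G x l i m * w $ m)"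
proof -
  have "Gam G x (axis i 1) w $ l = (\<Sum>k\<in>UNIV. if k = i then \<Sum>m\<in>UNIV. christoffel G x l k m * w $ m else 0)"
    unfolding Gam_def vec_lambda_beta by (intro sum.cong refl) (simp add: axis_def)
  then show ?thesis by (simp add: sum.delta)
qed

lemma Gam_axis_axis_nth: "Gam G x (axis i 1) (axis j 1) $ l = christoffel G x l i j"
proof -
  have "Gam G x (axis i 1) (axis j 1) $ l = (\<Sum>m\<in>UNIV. if m = j then christoffel G x l i m else 0)"
    unfolding Gam_axis_nth by (intro sum.cong refl) (auto simp: axis_def)
  then show ?thesis by (simp add: sum.delta)
qed

lemma riem_up_curv:
  assumes x: "x \<in> U"
  shows "riem_up G x i j k l = curv x (axis i 1) (axis j 1) (axis k 1) $ l"
proof -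
  have d: "dd u (\<lambda>y. Gam G y v w) x $ l = dd u (\<lambda>y. Gam G y v w $ l) x" for u v w
    by (rule dd_nth[OF smooth_on_differentiable[OF smooth_Gam x], symmetric])
  show ?thesis
    unfolding curv_def riem_up_def
    by (simp add: d Gam_axis_axis_nth Gam_axis_nth[where w = "Gam G x v w" for v w] pd_def sum_subtractf)
qed

lemma riem_rm:
  assumes x: "x \<in> U"
  shows "riem G x i j k l = rm x (axis i 1) (axis j 1) (axis k 1) (axis l 1)"
  by (simp add: riem_def rm_def riem_up_curv[OF x] inner_axis' matrix_vector_mult_def)

definition ric :: "real ^ 'n \<Rightarrow> real ^ 'n \<Rightarrow> real ^ 'n \<Rightarrow> real" where
  "ric x v w = trM (G x) (\<lambda>p q. rm x p v w q)"

end

text \<open>The inverse metric cancels the metric used to lower the index. This links the trace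
  defining \<open>ricci\<close>, which contracts an upper with a lower index, to metric
  traces.\<close>

lemma trM_endo:
  assumes "spd M" shows "trM M (\<lambda>p q. ip M q (L p)) = (\<Sum>p\<in>UNIV. L (axis p 1) $ p)"
proof -
  have "trM M (\<lambda>p q. ip M q (L p)) = (\<Sum>p\<in>UNIV. (matrix_inv M *v (M *v L (axis p 1))) $ p)"
    unfolding trM_def matrix_vector_mult_def[of "matrix_inv M"] by (simp add: inner_axis')
  then show ?thesis by (simp add: matrix_vector_mul_assoc spd_inv_mult[OF assms])
qed

context metric_on
begin

lemma ricci_ric:
  assumes x: "x \<in> U"
  shows "ricci G x j k = ric x (axis j 1) (axis k 1)"
  unfolding ric_def rm_def trM_endo[OF spd_G[OF x], where L = "\<lambda>p. curv x p (axis j 1) (axis k 1)"]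
  by (simp add: ricci_def riem_up_curv[OF x])

lemma linear_ric:
  assumes x: "x \<in> U" shows "linear (\<lambda>v. ric x v w)" "linear (\<lambda>w. ric x v w)"
  unfolding ric_def by (intro linear_trM linear_rm x)+

lemma scal_ric: "x \<in> U \<Longrightarrow> scal G x = trM (G x) (ric x)"
  by (simp add: scal_def trM_def ricci_ric ginv_def)

lemma ric_frame:
  assumes x: "x \<in> U" and E: "frame (G x) E"
  shows "ric x v w = (\<Sum>a\<in>UNIV. rm x (E a) v w (E a))"
  unfolding ric_def by (rule trM_frame[OF E]) (simp add: bilinear_def linear_rm[OF x])

lemma norms_frame:
  assumes x: "x \<in> U" and E: "frame (G x) E"
  shows "riem_norm2 G x = (\<Sum>a\<in>UNIV. \<Sum>b\<in>UNIV. \<Sum>c\<in>UNIV. \<Sum>d\<in>UNIV. (rm x (E a) (E b) (E c) (E d))\<^sup>2)"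
    and "ricci_norm2 G x = (\<Sum>a\<in>UNIV. \<Sum>b\<in>UNIV. (ric x (E a) (E b))\<^sup>2)"
    and "scal G x = (\<Sum>a\<in>UNIV. ric x (E a) (E a))"
proof -
  show "riem_norm2 G x = (\<Sum>a\<in>UNIV. \<Sum>b\<in>UNIV. \<Sum>c\<in>UNIV. \<Sum>d\<in>UNIV. (rm x (E a) (E b) (E c) (E d))\<^sup>2)"
    unfolding riem_norm2_def ginv_def riem_rm[OF x] trM4_regroup
    by (subst trM4_frame[OF E]) (simp_all add: linear_rm[OF x] power2_eq_square)
  show "ricci_norm2 G x = (\<Sum>a\<in>UNIV. \<Sum>b\<in>UNIV. (ric x (E a) (E b))\<^sup>2)"
    unfolding ricci_norm2_def ginv_def ricci_ric[OF x] trM2_regroup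
    by (subst trM2_frame[OF E]) (simp_all add: linear_ric[OF x] power2_eq_square)
  show "scal G x = (\<Sum>a\<in>UNIV. ric x (E a) (E a))"
    unfolding scal_ric[OF x] by (rule trM_frame[OF E]) (simp add: bilinear_def linear_ric[OF x])
qed

text \<open>Contraction commutes with covariant differentiation because the metric, hence its
  inverse, is parallel. The computation is done with matrices, where the derivative of the inverse
  follows from that of the metric.\<close>

lemma dd_trM:
  assumes x: "x \<in> U" and lin: "\<And>q. linear (\<lambda>p. B x p q)" "\<And>p. linear (\<lambda>q. B x p q)"
    and B: "\<And>p q. (\<lambda>y. B y p q) differentiable (at x)"
  shows "dd v (\<lambda>y. trM (G y) (B y)) x
    = trM (G x) (\<lambda>p q. dd v (\<lambda>y. B y p q) x - B x (Gam G x v p) q - B x p (Gam G x v q))"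
proof -
  define g where "g = matrix_inv (G x)"
  define A :: "real ^ 'n ^ 'n" where "A = (\<chi> p m. Gam G x v (axis m 1) $ p)"
  define D :: "real ^ 'n ^ 'n" where "D = (\<chi> p q. dd v (\<lambda>y. matrix_inv (G y) $ p $ q) x)"
  define DG :: "real ^ 'n ^ 'n" where "DG = (\<chi> p q. dd v (\<lambda>y. G y $ p $ q) x)"
  have sg: "smooth_on U (\<lambda>y. matrix_inv (G y) $ p $ q)" for p q using smooth_ginv[of p q] by (simp add: ginv_def)
  note dg = smooth_on_differentiable[OF sg x]
  note dG = smooth_on_differentiable[OF smooth_G_entry x]
  have gg: "G x ** g = mat 1" "g ** G x = mat 1"
    using spd_mult_inv[OF spd_G[OF x]] spd_inv_mult[OF spd_G[OF x]] by (simp_all add: g_def)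
  \<comment> \<open>Metric compatibility in matrix form, with \<open>A\<close> the matrix of
    \<open>Gam G x v\<close>.\<close>
  have DGA: "DG = transpose A ** G x + G x ** A"
  proof -
    have "DG $ p $ q = (transpose A ** G x + G x ** A) $ p $ q" for p q
    proof -
      have "ip (G x) w (axis q 1) = (\<Sum>k\<in>UNIV. w $ k * G x $ k $ q)" "ip (G x) (axis p 1) w = (\<Sum>k\<in>UNIV. G x $ p $ k * w $ k)" for w
        by (simp_all add: matrix_vector_mult_basis column_def inner_vec_def inner_axis' matrix_vector_mult_def)
           (simp_all add: axis_def if_distrib[of "\<lambda>r. r * _"] if_distrib[of "\<lambda>r. _ * r"] cong: if_cong)
      with metric_compat[OF x, where u = v and v = "axis p 1" and w = "axis q 1"]
      have "dd v (\<lambda>y. G y $ p $ q) x = (\<Sum>k\<in>UNIV. Gam G x v (axis p 1) $ k * G x $ k $ q) + (\<Sum>k\<in>UNIV. G x $ p $ k * Gam G x v (axis q 1) $ k)"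
        by (simp only: ip_axis)
      then show ?thesis by (simp add: DG_def A_def matrix_matrix_mult_def transpose_def)
    qed
    then show ?thesis by (simp add: vec_eq_iff)
  qed
  \<comment> \<open>The derivative of the constant matrix
    \<open>G y ** matrix_inv (G y)\<close>.\<close>
  have "DG ** g + G x ** D = 0"
  proof -
    have "(DG ** g + G x ** D) $ i $ j = dd v (\<lambda>y. \<Sum>k\<in>UNIV. G y $ i $ k * matrix_inv (G y) $ k $ j) x" for i j
      by (subst dd_sum, rule differentiable_mult[OF dG dg])
         (simp add: dd_mult[OF dG dg] DG_def D_def g_def matrix_matrix_mult_def sum.distrib)
    moreover have "dd v (\<lambda>y. \<Sum>k\<in>UNIV. G y $ i $ k * matrix_inv (G y) $ k $ j) x = dd v (\<lambda>y. mat 1 $ i $ j) x" for i j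
      by (rule dd_cong[OF open_dom x]) (simp flip: spd_mult_inv[OF spd_G], simp add: matrix_matrix_mult_def)
    ultimately show ?thesis by (simp add: vec_eq_iff)
  qed
  then have "g ** (G x ** D) = - (g ** (DG ** g))"
  proof -
    assume "DG ** g + G x ** D = 0"
    then have "g ** (DG ** g + G x ** D) = 0" by (simp add: matrix_matrix_mult_def vec_eq_iff)
    then show ?thesis by (simp add: matrix_add_ldistrib eq_neg_iff_add_eq_0 add.commute)
  qed
  then have "D = - (g ** (DG ** g))" using gg by (simp add: matrix_mul_assoc)
  also have "DG ** g = transpose A + G x ** A ** g"
  proof -
    have "DG ** g = transpose A ** G x ** g + G x ** A ** g"
      unfolding DGA by (simp add: matrix_matrix_mult_def vec_eq_iff distrib_right sum.distrib)
    also have "transpose A ** G x ** g = transpose A" by (simp add: gg flip: matrix_mul_assoc)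
    finally show ?thesis .
  qed
  also have "g ** (transpose A + G x ** A ** g) = g ** transpose A + A ** g"
    by (simp add: matrix_add_ldistrib matrix_mul_assoc gg)
  finally have D: "D $ p $ q = - (\<Sum>m\<in>UNIV. g $ p $ m * A $ q $ m) - (\<Sum>m\<in>UNIV. A $ p $ m * g $ m $ q)" for p q
    by (simp add: matrix_matrix_mult_def transpose_def)
  have e1: "B x (Gam G x v (axis m 1)) (axis q 1) = (\<Sum>p\<in>UNIV. A $ p $ m * B x (axis p 1) (axis q 1))" for m q
    using linear_expand[OF lin(1), of "Gam G x v (axis m 1)" "axis q 1"] by (simp add: A_def)
  have e2: "B x (axis p 1) (Gam G x v (axis m 1)) = (\<Sum>q\<in>UNIV. A $ q $ m * B x (axis p 1) (axis q 1))" for m p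
    using linear_expand[OF lin(2), of "axis p 1" "Gam G x v (axis m 1)"] by (simp add: A_def)
  have "dd v (\<lambda>y. trM (G y) (B y)) x
     = (\<Sum>p\<in>UNIV. \<Sum>q\<in>UNIV. g $ p $ q * dd v (\<lambda>y. B y (axis p 1) (axis q 1)) x + D $ p $ q * B x (axis p 1) (axis q 1))"
  proof -
    have d: "(\<lambda>y. matrix_inv (G y) $ p $ q * B y (axis p 1) (axis q 1)) differentiable (at x)" for p q
      by (rule differentiable_mult[OF dg B])
    have "dd v (\<lambda>y. trM (G y) (B y)) x = (\<Sum>p\<in>UNIV. dd v (\<lambda>y. \<Sum>q\<in>UNIV. matrix_inv (G y) $ p $ q * B y (axis p 1) (axis q 1)) x)"
      unfolding trM_def by (rule dd_sum) (simp add: differentiable_sum d)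
    also have "\<dots> = (\<Sum>p\<in>UNIV. \<Sum>q\<in>UNIV. dd v (\<lambda>y. matrix_inv (G y) $ p $ q * B y (axis p 1) (axis q 1)) x)"
      by (intro sum.cong refl dd_sum d)
    finally show ?thesis by (simp add: dd_mult[OF dg B] D_def g_def)
  qed
  also have "\<dots> = (\<Sum>p\<in>UNIV. \<Sum>q\<in>UNIV. g $ p $ q * dd v (\<lambda>y. B y (axis p 1) (axis q 1)) x)
     - (\<Sum>p\<in>UNIV. \<Sum>q\<in>UNIV. \<Sum>m\<in>UNIV. g $ p $ m * (A $ q $ m * B x (axis p 1) (axis q 1)))
     - (\<Sum>p\<in>UNIV. \<Sum>q\<in>UNIV. \<Sum>m\<in>UNIV. g $ m $ q * (A $ p $ m * B x (axis p 1) (axis q 1)))"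
    by (simp add: D sum.distrib sum_subtractf left_diff_distrib sum_distrib_right sum_distrib_left sum_negf mult_ac algebra_simps)
  also have "(\<Sum>p\<in>UNIV. \<Sum>q\<in>UNIV. \<Sum>m\<in>UNIV. g $ p $ m * (A $ q $ m * B x (axis p 1) (axis q 1)))
     = (\<Sum>p\<in>UNIV. \<Sum>m\<in>UNIV. g $ p $ m * B x (axis p 1) (Gam G x v (axis m 1)))"
    unfolding e2 sum_distrib_left by (intro sum.cong refl sum.swap)
  also have "(\<Sum>p\<in>UNIV. \<Sum>q\<in>UNIV. \<Sum>m\<in>UNIV. g $ m $ q * (A $ p $ m * B x (axis p 1) (axis q 1)))
     = (\<Sum>m\<in>UNIV. \<Sum>q\<in>UNIV. g $ m $ q * B x (Gam G x v (axis m 1)) (axis q 1))"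
  proof -
    have "(\<Sum>p\<in>UNIV. \<Sum>q\<in>UNIV. \<Sum>m\<in>UNIV. g $ m $ q * (A $ p $ m * B x (axis p 1) (axis q 1)))
      = (\<Sum>p\<in>UNIV. \<Sum>m\<in>UNIV. \<Sum>q\<in>UNIV. g $ m $ q * (A $ p $ m * B x (axis p 1) (axis q 1)))"
      by (intro sum.cong refl sum.swap)
    also have "\<dots> = (\<Sum>m\<in>UNIV. \<Sum>p\<in>UNIV. \<Sum>q\<in>UNIV. g $ m $ q * (A $ p $ m * B x (axis p 1) (axis q 1)))"
      by (rule sum.swap)
    also have "\<dots> = (\<Sum>m\<in>UNIV. \<Sum>q\<in>UNIV. \<Sum>p\<in>UNIV. g $ m $ q * (A $ p $ m * B x (axis p 1) (axis q 1)))"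
      by (intro sum.cong refl sum.swap)
    finally show ?thesis by (simp only: e1 sum_distrib_left)
  qed
  finally show ?thesis
    by (simp add: trM_def g_def sum_subtractf right_diff_distrib)
qed

definition trT :: "(real ^ 'n \<Rightarrow> (real ^ 'n) list \<Rightarrow> real) \<Rightarrow> real ^ 'n \<Rightarrow> (real ^ 'n) list \<Rightarrow> real" where
  "trT T x vs = trM (G x) (\<lambda>p q. T x (p # q # vs))"

lemma smooth_trM:
  assumes "\<And>p q. smooth_on U (\<lambda>x. B x p q)" shows "smooth_on U (\<lambda>x. trM (G x) (B x))"
  unfolding trM_def
  by (intro smooth_on_sum smooth_on_mult open_dom assms smooth_ginv[unfolded ginv_def])

lemma stens_trT:
  assumes T: "stens (Suc (Suc k)) U T" shows "stens k U (trT T)"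
  unfolding stens_def
proof (intro conjI ballI allI impI)
  fix x assume x: "x \<in> U"
  have m: "mlin k (\<lambda>vs. T x (p # q # vs))" for p q
    using stens_mlin[OF T x] by simp
  have sum: "mlin k (\<lambda>vs. \<Sum>i\<in>I. f i vs)" if "\<And>i. mlin k (f i)" for f :: "'n \<Rightarrow> (real ^ 'n) list \<Rightarrow> real" and I
  proof (induction I rule: infinite_finite_induct)
    case (insert i I) then show ?case using mlin_add[OF that] by simp
  qed (use mlin_cmul[OF that, of 0] in simp_all)
  show "mlin k (trT T x)" unfolding trT_def trM_def by (intro sum mlin_cmul m)
next
  fix vs :: "(real ^ 'n) list" assume "length vs = k"
  then show "smooth_on U (\<lambda>x. trT T x vs)"
    unfolding trT_def by (intro smooth_trM stens_smooth[OF T]) simp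
qed

lemma der_trM: "der L (\<lambda>vs. trM M (\<lambda>p q. T p q vs)) vs = trM M (\<lambda>p q. der L (T p q) vs)"
proof (induction vs arbitrary: T)
  case (Cons v vs)
  show ?case using Cons.IH[of "\<lambda>p q ws. T p q (v # ws)"] by (simp add: trM_add)
qed (simp add: trM_zero)

lemma cov_trT:
  assumes T: "stens (Suc (Suc k)) U T" and x: "x \<in> U" and l: "length vs = k"
  shows "cov (Gam G) (trT T) x (v # vs) = trM (G x) (\<lambda>p q. cov (Gam G) T x (v # p # q # vs))"
proof -
  have l1: "linear (\<lambda>p. T x (p # q # vs))" for q using stens_linear[OF T x, of "q # vs"] l by simp
  have l2: "linear (\<lambda>q. T x (p # q # vs))" for p using stens_linear[OF stens_Cons[OF T] x, of vs p] l by simp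
  have "dd v (\<lambda>y. trT T y vs) x = trM (G x) (\<lambda>p q. dd v (\<lambda>y. T y (p # q # vs)) x
      - T x (Gam G x v p # q # vs) - T x (p # Gam G x v q # vs))"
    unfolding trT_def using dd_trM[where B = "\<lambda>y p q. T y (p # q # vs)", OF x l1 l2 stens_diff[OF T _ x]] l by simp
  moreover have "der (Gam G x v) (trT T x) vs = trM (G x) (\<lambda>p q. der (Gam G x v) (\<lambda>ws. T x (p # q # ws)) vs)"
    unfolding trT_def[abs_def] by (rule der_trM)
  ultimately show ?thesis by (simp add: trM_diff trM_add)
qed

end

section \<open>Flat metrics\<close>

text \<open>Polarisation: vanishing sectional values make the tensor antisymmetric under further
  exchanges of slots, hence invariant under cyclic permutation of the first three; the Bianchi
  identity then says that three times each value is 0.\<close>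

lemma curvature_tensor_zeroI:
  fixes R :: "'v::real_vector \<Rightarrow> 'v \<Rightarrow> 'v \<Rightarrow> 'v \<Rightarrow> real"
  assumes lin: "\<And>v w z. linear (\<lambda>u. R u v w z)" "\<And>u w z. linear (\<lambda>v. R u v w z)"
      "\<And>u v z. linear (\<lambda>w. R u v w z)" "\<And>u v w. linear (\<lambda>z. R u v w z)"
    and a12: "\<And>u v w z. R u v w z = - R v u w z" and a34: "\<And>u v w z. R u v w z = - R u v z w"
    and bianchi: "\<And>u v w z. R u v w z + R v w u z + R w u v z = 0"
    and sec: "\<And>u v. R u v v u = 0"
  shows "R u v w z = 0"
proof -
  \<comment> \<open>The usual octahedron argument: a combination of four Bianchi identities.\<close>
  have pair: "R u v w z = R w z u v" for u v w z
    using bianchi[of u v w z] bianchi[of v w z u] bianchi[of w z u v] bianchi[of z u v w]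
      a34[of v w z u] a34[of w z v u] a12[of z v w u] a12[of z u w v] a34[of u z w v] a12[of u w z v]
      a34[of w u z v] a12[of z u v w] a34[of u v z w] a34[of v z u w]
    by linarith
  have p1: "R u v w u = 0" for u v w
  proof -
    have "R u (v + w) (v + w) u = R u v v u + R u v w u + (R u w v u + R u w w u)"
      by (simp only: linear_add[OF lin(2)] linear_add[OF lin(3)])
    then have "R u v w u + R u w v u = 0" by (simp add: sec)
    then show ?thesis using pair[of u w v u] a12[of v u u w] a34[of u v u w] by linarith
  qed
  \<comment> \<open>Second polarisation, now in the outer pair of slots.\<close>
  have p2: "R u v w z = - R z v w u" for u v w z
  proof -
    have "R (u + z) v w (u + z) = R u v w u + R u v w z + (R z v w u + R z v w z)"
      by (simp only: linear_add[OF lin(1)] linear_add[OF lin(4)])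
    then show ?thesis by (simp add: p1)
  qed
  have cyc: "R v w u z = R w u v z" for u v w z
    using p2[of v w u z] a34[of z w u v] a12[of z w v u] p2[of w z v u] a12[of u z v w] p2[of z u v w]
    by linarith
  show ?thesis using bianchi[of u v w z] cyc[of v w u z] cyc[of w u v z] cyc[of u v w z] by linarith
qed

context metric_on
begin

lemma rm_sums:
  assumes x: "x \<in> U"
  shows "rm x u v w z = (\<Sum>i\<in>UNIV. \<Sum>j\<in>UNIV. \<Sum>k\<in>UNIV. \<Sum>l\<in>UNIV. riem G x i j k l * u $ i * v $ j * w $ k * z $ l)"
proof -
  note L = linear_rm[OF x]
  have "rm x u v w z = (\<Sum>i\<in>UNIV. u $ i *\<^sub>R rm x (axis i 1) v w z)"
    by (rule linear_expand[OF L(1)])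
  also have "\<dots> = (\<Sum>i\<in>UNIV. u $ i *\<^sub>R (\<Sum>j\<in>UNIV. v $ j *\<^sub>R rm x (axis i 1) (axis j 1) w z))"
    by (subst linear_expand[OF L(2)]) (rule refl)
  also have "\<dots> = (\<Sum>i\<in>UNIV. u $ i *\<^sub>R (\<Sum>j\<in>UNIV. v $ j *\<^sub>R (\<Sum>k\<in>UNIV. w $ k *\<^sub>R rm x (axis i 1) (axis j 1) (axis k 1) z)))"
    by (subst linear_expand[OF L(3)]) (rule refl)
  also have "\<dots> = (\<Sum>i\<in>UNIV. u $ i *\<^sub>R (\<Sum>j\<in>UNIV. v $ j *\<^sub>R (\<Sum>k\<in>UNIV. w $ k *\<^sub>R (\<Sum>l\<in>UNIV. z $ l *\<^sub>R rm x (axis i 1) (axis j 1) (axis k 1) (axis l 1)))))"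
    by (subst linear_expand[OF L(4)]) (rule refl)
  finally show ?thesis by (simp add: sum_distrib_left riem_rm[OF x] mult_ac)
qed

text \<open>The denominator of \<open>sec_curv\<close> is nonzero, so vanishing of the quotient
  really is vanishing of the numerator and not division by zero.\<close>

lemma ip_cauchy_schwarz_strict:
  assumes x: "x \<in> U" and ind: "u \<noteq> v" "independent {u, v}"
  shows "ip (G x) u u * ip (G x) v v - (ip (G x) u v)\<^sup>2 \<noteq> 0"
proof -
  note pos = spd_G[OF x, unfolded spd_def, THEN conjunct2, rule_format]
  have u0: "u \<noteq> 0" using ind dependent_zero by blast
  \<comment> \<open>The part of \<open>v\<close> orthogonal to \<open>u\<close>, multiplied by the
    squared length of \<open>u\<close> to avoid a quotient. Its squared length is that of
    \<open>u\<close> times the Gram determinant.\<close>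
  define w where "w = ip (G x) u u *\<^sub>R v - ip (G x) u v *\<^sub>R u"
  have "w \<noteq> 0"
  proof
    assume "w = 0"
    then have "v = (ip (G x) u v / ip (G x) u u) *\<^sub>R u"
      using pos[OF u0] by (simp add: w_def vec_eq_iff field_simps)
    then have "v \<in> span {u}" by (metis span_base span_scale singletonI)
    moreover have "{u, v} - {v} = {u}" using ind by auto
    ultimately show False using ind(2) unfolding dependent_def by (metis insertI1 insert_commute)
  qed
  then have "0 < ip (G x) w w" by (rule pos)
  also have "ip (G x) w w = ip (G x) u u * (ip (G x) u u * ip (G x) v v - (ip (G x) u v)\<^sup>2)"
    using ip_sym[OF x, of u v]
    by (simp add: w_def inner_diff_left inner_diff_right matrix_vector_mult_diff_distrib matrix_vector_mult_scaleR
        power2_eq_square algebra_simps)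
  finally show ?thesis by auto
qed

lemma flat:
  assumes x: "x \<in> U" and sec: "\<And>u v. u \<noteq> v \<Longrightarrow> independent {u, v} \<Longrightarrow> sec_curv G x u v = 0"
  shows "curv x u v w = 0"
proof -
  have "rm x u v v u = 0" for u v
  proof (cases "u \<noteq> v \<and> independent {u, v}")
    case True
    then have "rm x u v v u / (ip (G x) u u * ip (G x) v v - (ip (G x) u v)\<^sup>2) = 0"
      using sec[of u v] rm_sums[OF x, of u v v u] by (simp add: sec_curv_def)
    then show ?thesis using ip_cauchy_schwarz_strict[OF x, of u v] True by simp
  next
    case False
    \<comment> \<open>For dependent pairs the hypothesis gives no information; there the
      antisymmetry in the first two slots does.\<close>
    have "v = 0 \<or> (\<exists>c. u = c *\<^sub>R v)"
    proof (cases "u = v")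
      case True
      then have "u = 1 *\<^sub>R v" by simp
      then show ?thesis by blast
    next
      case False
      with \<open>\<not> (u \<noteq> v \<and> independent {u, v})\<close> have "dependent {u, v}" by simp
      then show ?thesis using False independent_insert[of u "{v}"] by (auto simp: span_singleton)
    qed
    moreover have "rm x v v v' u' = 0" for v v' u' using rm_antisym12[of x v v v' u'] by simp
    ultimately show ?thesis
      using linear_scale[OF linear_rm(1)[OF x], of _ v v] linear_0[OF linear_rm(2)[OF x]] by auto
  qed
  from curvature_tensor_zeroI[OF linear_rm[OF x] rm_antisym12 rm_antisym34[OF x] rm_bianchi[OF x] this]
  have "rm x u v w z = 0" for z .
  then have "ip (G x) z (curv x u v w) = ip (G x) z 0" for z by (simp add: rm_def)
  then show ?thesis by (rule spd_eqI[OF spd_G[OF x]])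
qed

end

section \<open>Transverse-traceless tensors on a flat chart\<close>

lemma mlin3I:
  assumes "\<And>b c. linear (\<lambda>a. f [a, b, c])" "\<And>a c. linear (\<lambda>b. f [a, b, c])" "\<And>a b. linear (\<lambda>c. f [a, b, c])"
  shows "mlin 3 f"
proof -
  have "linear (\<lambda>w. f (w # vs))" if "length vs = Suc (Suc 0)" for vs
    using that assms(1) by (auto simp: length_Suc_conv)
  moreover have "linear (\<lambda>w. f (u # w # vs))" if "length vs = Suc 0" for u vs
    using that assms(2) by (auto simp: length_Suc_conv)
  ultimately show ?thesis using assms(3) by (simp add: numeral_3_eq_3)
qed

lemma mlin4I:
  assumes "\<And>b c d. linear (\<lambda>a. f [a, b, c, d])" "\<And>a c d. linear (\<lambda>b. f [a, b, c, d])"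
    "\<And>a b d. linear (\<lambda>c. f [a, b, c, d])" "\<And>a b c. linear (\<lambda>d. f [a, b, c, d])"
  shows "mlin 4 f"
proof -
  have "linear (\<lambda>w. f (w # vs))" if "length vs = 3" for vs
    using that assms(1) by (auto simp: length_Suc_conv numeral_3_eq_3)
  moreover have "mlin 3 (\<lambda>vs. f (w # vs))" for w
    by (rule mlin3I) (rule assms)+
  moreover have "4 = Suc 3" by simp
  ultimately show ?thesis by (simp only: mlin.simps) blast
qed

lemma mlin3D:
  assumes "mlin 3 f"
  shows "linear (\<lambda>a. f [a, b, c])" "linear (\<lambda>b. f [a, b, c])" "linear (\<lambda>c. f [a, b, c])"
  using assms by (simp_all add: numeral_3_eq_3)

lemma mlin4D:
  assumes "mlin 4 f"
  shows "linear (\<lambda>a. f [a, b, c, d])" "linear (\<lambda>b. f [a, b, c, d])" "linear (\<lambda>c. f [a, b, c, d])" "linear (\<lambda>d. f [a, b, c, d])"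
  using assms by (simp_all add: eval_nat_numeral)

lemma length_lists:
  "length vs = 2 \<longleftrightarrow> (\<exists>a b. vs = [a, b])"
  "length vs = 3 \<longleftrightarrow> (\<exists>a b c. vs = [a, b, c])"
  "length vs = 4 \<longleftrightarrow> (\<exists>a b c d. vs = [a, b, c, d])"
  "length vs = 5 \<longleftrightarrow> (\<exists>a b c d e. vs = [a, b, c, d, e])"
  "length vs = 6 \<longleftrightarrow> (\<exists>a b c d e f. vs = [a, b, c, d, e, f])"
  "length vs = 7 \<longleftrightarrow> (\<exists>a b c d e f g. vs = [a, b, c, d, e, f, g])"
  by (auto simp: eval_nat_numeral length_Suc_conv)

lemma mlin7I:
  assumes "\<And>b c d e g h. linear (\<lambda>a. f [a, b, c, d, e, g, h])" "\<And>a c d e g h. linear (\<lambda>b. f [a, b, c, d, e, g, h])"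
    "\<And>a b d e g h. linear (\<lambda>c. f [a, b, c, d, e, g, h])" "\<And>a b c e g h. linear (\<lambda>d. f [a, b, c, d, e, g, h])"
    "\<And>a b c d g h. linear (\<lambda>e. f [a, b, c, d, e, g, h])" "\<And>a b c d e h. linear (\<lambda>g. f [a, b, c, d, e, g, h])"
    "\<And>a b c d e g. linear (\<lambda>h. f [a, b, c, d, e, g, h])"
  shows "mlin 7 f"
proof -
  have 4: "mlin 4 (\<lambda>vs. f (a # b # c # vs))" for a b c
    by (rule mlin4I) (rule assms)+
  have 5: "linear (\<lambda>w. f (a # b # w # vs))" if "length vs = 4" for a b vs
    using that assms(3) by (auto simp: length_lists)
  have 6: "linear (\<lambda>w. f (a # w # vs))" if "length vs = 5" for a vs
    using that assms(2) by (auto simp: length_lists)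
  have 7: "linear (\<lambda>w. f (w # vs))" if "length vs = 6" for vs
    using that assms(1) by (auto simp: length_lists)
  have "mlin (Suc (Suc (Suc 4))) f"
    unfolding mlin.simps(2)[of _ f] mlin.simps(2)[of "Suc 4"] mlin.simps(2)[of 4]
    using 4 5 6 7 by simp
  then show ?thesis by simp
qed

lemma dermap_zero_op: "mlin (length vs) f \<Longrightarrow> dermap A (\<lambda>v. 0) f vs = 0"
  using dermap_scale_op[of vs f A 0 "\<lambda>v. 0"] by simp

lemma cov_zero: "cov \<Gamma> (\<lambda>y vs. 0) x ws = 0"
proof -
  have "der L (\<lambda>vs. 0) vs = 0" for L :: "real ^ 'n \<Rightarrow> real ^ 'n" and vs
    using dermap_cmul[of "\<lambda>x. x" L 0 "\<lambda>_. 0" vs] by simp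
  then show ?thesis by (cases ws) simp_all
qed

text \<open>The covariant derivative of h. Both here and in \<open>HH\<close>, the second covariant
  derivative, the differentiation slots come first: \<open>HH\<close> at \<open>[u, v, a, b]\<close>
  is nabla_u nabla_v h(a, b).\<close>

definition NN :: "(real ^ 'n \<Rightarrow> real ^ 'n ^ 'n::finite) \<Rightarrow> (real ^ 'n \<Rightarrow> real ^ 'n ^ 'n) \<Rightarrow> real ^ 'n \<Rightarrow> (real ^ 'n) list \<Rightarrow> real" where
  "NN G H = cov (Gam G) (ten2 H)"

definition HH :: "(real ^ 'n \<Rightarrow> real ^ 'n ^ 'n::finite) \<Rightarrow> (real ^ 'n \<Rightarrow> real ^ 'n ^ 'n) \<Rightarrow> real ^ 'n \<Rightarrow> (real ^ 'n) list \<Rightarrow> real" where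
  "HH G H = cov (Gam G) (NN G H)"

text \<open>\<open>rm1\<close> is the linearization of the curvature tensor at a flat metric and \<open>ric1\<close> its Ricci
  contraction. Three pairwise traces of \<open>WW\<close> give the covector field \<open>XX\<close> whose divergence is
  \<open>|rm1|\<^sup>2 - 4 |ric1|\<^sup>2\<close> for transverse-traceless \<open>H\<close>.\<close>

definition rm1 where
  "rm1 G H x u v w z = (HH G H x [u, w, v, z] - HH G H x [u, z, v, w] - HH G H x [v, w, u, z] + HH G H x [v, z, u, w]) / 2"

definition ric1 where
  "ric1 G H x v w = trM (G x) (\<lambda>p q. rm1 G H x p v w q)"

text \<open>The slots are l, l', k, k', j, j', v. After contraction of the three pairs this is
  nabla_j h_kl (nabla_v nabla_j h_kl - 2 nabla_j nabla_k h_vl + nabla_k nabla_l h_vj) - nabla_v h_kl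
  nabla_j nabla_j h_kl. The divergence of the bracketed part reproduces the three quadratic terms of
  |Rm'|^2, that of the last product gives - |Delta h|^2, and the terms with third derivatives cancel
  or vanish.\<close>

definition WW where
  "WW G H x vs = NN G H x [vs ! 4, vs ! 2, vs ! 0] *
       (HH G H x [vs ! 6, vs ! 5, vs ! 3, vs ! 1] - 2 * HH G H x [vs ! 5, vs ! 3, vs ! 6, vs ! 1] + HH G H x [vs ! 3, vs ! 1, vs ! 6, vs ! 5])
     - NN G H x [vs ! 6, vs ! 2, vs ! 0] * HH G H x [vs ! 4, vs ! 5, vs ! 3, vs ! 1]"

definition XX where
  "XX G H = metric_on.trT G (metric_on.trT G (metric_on.trT G (WW G H)))"

section \<open>Index identities for the norms of the linearized curvature\<close>

lemma sum4_perm: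
  fixes f :: "'n::finite \<Rightarrow> 'n \<Rightarrow> 'n \<Rightarrow> 'n \<Rightarrow> real"
  shows "(\<Sum>a\<in>UNIV. \<Sum>b\<in>UNIV. \<Sum>c\<in>UNIV. \<Sum>d\<in>UNIV. f a b c d) = (\<Sum>a\<in>UNIV. \<Sum>b\<in>UNIV. \<Sum>c\<in>UNIV. \<Sum>d\<in>UNIV. f b a c d)"
    "(\<Sum>a\<in>UNIV. \<Sum>b\<in>UNIV. \<Sum>c\<in>UNIV. \<Sum>d\<in>UNIV. f a b c d) = (\<Sum>a\<in>UNIV. \<Sum>b\<in>UNIV. \<Sum>c\<in>UNIV. \<Sum>d\<in>UNIV. f a c b d)"
    "(\<Sum>a\<in>UNIV. \<Sum>b\<in>UNIV. \<Sum>c\<in>UNIV. \<Sum>d\<in>UNIV. f a b c d) = (\<Sum>a\<in>UNIV. \<Sum>b\<in>UNIV. \<Sum>c\<in>UNIV. \<Sum>d\<in>UNIV. f a b d c)"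
  by (rule sum.swap) (intro sum.cong refl sum.swap)+

text \<open>Index algebra in an orthonormal frame, with \<open>N\<close>, \<open>H\<close>,
  \<open>K\<close> standing for the first three covariant derivatives of h. The symmetries in the
  derivative slots are flatness, the vanishing sums are the transverse-traceless conditions. The
  right side of the last claim is the divergence of the covector field \<open>XX\<close>.\<close>

lemma linearized_curvature_norms:
  fixes H :: "'n::finite \<Rightarrow> 'n \<Rightarrow> 'n \<Rightarrow> 'n \<Rightarrow> real" and K :: "'n \<Rightarrow> 'n \<Rightarrow> 'n \<Rightarrow> 'n \<Rightarrow> 'n \<Rightarrow> real" and N :: "'n \<Rightarrow> 'n \<Rightarrow> 'n \<Rightarrow> real"
  assumes s12: "\<And>a b c d. H a b c d = H b a c d" and s34: "\<And>a b c d. H a b c d = H a b d c"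
    and div: "\<And>b c. (\<Sum>a\<in>UNIV. H b a a c) = 0" and tr: "\<And>b c. (\<Sum>a\<in>UNIV. H b c a a) = 0"
    and k12: "\<And>m a b c d. K m a b c d = K a m b c d" and k23: "\<And>m a b c d. K m a b c d = K m b a c d"
    and kdiv: "\<And>m b c. (\<Sum>a\<in>UNIV. K m b a a c) = 0"
  defines "r \<equiv> \<lambda>a b c d. (H a c b d - H a d b c - H b c a d + H b d a c) / 2"
    and "L \<equiv> \<lambda>c d. \<Sum>m\<in>UNIV. H m m c d"
  shows "(\<Sum>a\<in>UNIV. r a b c a) = - L b c / 2"
    and "(\<Sum>b\<in>UNIV. \<Sum>a\<in>UNIV. r a b b a) = 0"
    and "(\<Sum>a\<in>UNIV. \<Sum>b\<in>UNIV. \<Sum>c\<in>UNIV. \<Sum>d\<in>UNIV. (r a b c d)\<^sup>2) - 4 * (\<Sum>b\<in>UNIV. \<Sum>c\<in>UNIV. (\<Sum>a\<in>UNIV. r a b c a)\<^sup>2)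
      = (\<Sum>i\<in>UNIV. \<Sum>j\<in>UNIV. \<Sum>k\<in>UNIV. \<Sum>l\<in>UNIV.
          H i j k l * (H i j k l - 2 * H j k i l + H k l i j) + N j k l * (K i i j k l - 2 * K i j k i l + K i k l i j)
          - (H i i k l * H j j k l + N i k l * K i j j k l))"
proof -
  let ?S = "\<lambda>f::'n \<Rightarrow> 'n \<Rightarrow> 'n \<Rightarrow> 'n \<Rightarrow> real. \<Sum>a\<in>UNIV. \<Sum>b\<in>UNIV. \<Sum>c\<in>UNIV. \<Sum>d\<in>UNIV. f a b c d"
  show 1: "(\<Sum>a\<in>UNIV. r a b c a) = - L b c / 2" for b c
  proof -
    have "(\<Sum>a\<in>UNIV. H a c b a) = 0" using div[of c b] s12 s34 by simp
    moreover have "(\<Sum>a\<in>UNIV. H b a a c) = 0" by (rule div)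
    moreover have "(\<Sum>a\<in>UNIV. H b c a a) = 0" by (rule tr)
    ultimately show ?thesis
      by (simp add: r_def L_def sum_subtractf sum.distrib flip: sum_divide_distrib)
  qed
  have "(\<Sum>b\<in>UNIV. L b b) = (\<Sum>m\<in>UNIV. \<Sum>b\<in>UNIV. H m m b b)"
    unfolding L_def by (rule sum.swap)
  then have "(\<Sum>b\<in>UNIV. L b b) = 0" by (simp add: tr)
  then show "(\<Sum>b\<in>UNIV. \<Sum>a\<in>UNIV. r a b b a) = 0"
    by (simp add: 1 sum_negf flip: sum_divide_distrib)
  \<comment> \<open>The full square and two cross contractions: every product of two permuted copies
    of \<open>H\<close> occurring in the square of \<open>r\<close> sums to one of these.\<close>
  define Q where "Q = ?S (\<lambda>i j k l. (H i j k l)\<^sup>2)"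
  define T1 where "T1 = ?S (\<lambda>i j k l. H i j k l * H i k j l)"
  define T2 where "T2 = ?S (\<lambda>i j k l. H i j k l * H k l i j)"
  have A: "?S (\<lambda>a b c d. (H a c b d)\<^sup>2) = Q" "?S (\<lambda>a b c d. (H a d b c)\<^sup>2) = Q"
    "?S (\<lambda>a b c d. (H b c a d)\<^sup>2) = Q" "?S (\<lambda>a b c d. (H b d a c)\<^sup>2) = Q"
  proof -
    show e: "?S (\<lambda>a b c d. (H a c b d)\<^sup>2) = Q" unfolding Q_def by (rule sum4_perm(2))
    show e2: "?S (\<lambda>a b c d. (H a d b c)\<^sup>2) = Q" unfolding e[symmetric] by (rule sum4_perm(3))
    show "?S (\<lambda>a b c d. (H b c a d)\<^sup>2) = Q" unfolding e[symmetric] by (rule sum4_perm(1))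
    show "?S (\<lambda>a b c d. (H b d a c)\<^sup>2) = Q" unfolding e2[symmetric] by (rule sum4_perm(1))
  qed
  have T1': "?S (\<lambda>a b c d. H a c b d * H a d b c) = T1"
  proof -
    have "?S (\<lambda>a b c d. H a c b d * H a d b c) = ?S (\<lambda>a c b d. H a c b d * H a d b c)" by (rule sum4_perm(2))
    also have "\<dots> = ?S (\<lambda>a c d b. H a c b d * H a d b c)" by (rule sum4_perm(3))
    finally show ?thesis unfolding T1_def using s34 by simp
  qed
  have T1'': "?S (\<lambda>a b c d. H a c b d * H b c a d) = T1"
  proof -
    have "?S (\<lambda>a b c d. H a c b d * H b c a d) = ?S (\<lambda>a c b d. H a c b d * H b c a d)" by (rule sum4_perm(2))
    also have "\<dots> = ?S (\<lambda>c a b d. H a c b d * H b c a d)" by (rule sum4_perm(1))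
    finally show ?thesis unfolding T1_def using s12 by simp
  qed
  have T1''': "?S (\<lambda>a b c d. H a d b c * H b d a c) = T1"
    unfolding T1''[symmetric] by (rule sum4_perm(3))
  have T1'''': "?S (\<lambda>a b c d. H b c a d * H b d a c) = T1"
    unfolding T1'[symmetric] by (rule sum4_perm(1))
  have T2': "?S (\<lambda>a b c d. H a c b d * H b d a c) = T2" unfolding T2_def by (rule sum4_perm(2))
  have T2'': "?S (\<lambda>a b c d. H a d b c * H b c a d) = T2"
    unfolding T2'[symmetric] by (rule sum4_perm(3))
  have r2: "(r a b c d)\<^sup>2 = ((H a c b d)\<^sup>2 + (H a d b c)\<^sup>2 + (H b c a d)\<^sup>2 + (H b d a c)\<^sup>2
      - 2 * (H a c b d * H a d b c) - 2 * (H a c b d * H b c a d) + 2 * (H a c b d * H b d a c)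
      + 2 * (H a d b c * H b c a d) - 2 * (H a d b c * H b d a c) - 2 * (H b c a d * H b d a c)) / 4" for a b c d
    unfolding r_def by (simp add: power2_eq_square field_simps)
  \<comment> \<open>Of the ten terms in the square, four give \<open>Q\<close>, four give
    \<open>T1\<close> with coefficient -2 and two give \<open>T2\<close> with coefficient 2, all
    divided by 4.\<close>
  have lhs: "?S (\<lambda>a b c d. (r a b c d)\<^sup>2) = Q - 2 * T1 + T2"
    unfolding r2 sum_divide_distrib[symmetric] sum_subtractf sum.distrib sum_distrib_left[symmetric]
      A T1' T1'' T1''' T1'''' T2' T2'' by simp
  have ric: "4 * (\<Sum>b\<in>UNIV. \<Sum>c\<in>UNIV. (\<Sum>a\<in>UNIV. r a b c a)\<^sup>2) = (\<Sum>k\<in>UNIV. \<Sum>l\<in>UNIV. (L k l)\<^sup>2)"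
    unfolding 1 by (simp add: power_divide sum_distrib_left)
  have LL: "?S (\<lambda>i j k l. H i i k l * H j j k l) = (\<Sum>k\<in>UNIV. \<Sum>l\<in>UNIV. (L k l)\<^sup>2)"
  proof -
    have "?S (\<lambda>i j k l. H i i k l * H j j k l) = (\<Sum>i\<in>UNIV. \<Sum>k\<in>UNIV. \<Sum>l\<in>UNIV. H i i k l * L k l)"
      unfolding L_def sum_distrib_left by (rule sum.cong[OF refl], subst sum.swap, rule sum.cong[OF refl], rule sum.swap)
    also have "\<dots> = (\<Sum>k\<in>UNIV. \<Sum>i\<in>UNIV. \<Sum>l\<in>UNIV. H i i k l * L k l)" by (rule sum.swap)
    also have "\<dots> = (\<Sum>k\<in>UNIV. \<Sum>l\<in>UNIV. \<Sum>i\<in>UNIV. H i i k l * L k l)" by (intro sum.cong refl sum.swap)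
    finally show ?thesis by (simp add: L_def power2_eq_square sum_distrib_right)
  qed
  have T1j: "?S (\<lambda>i j k l. H i j k l * H j k i l) = T1"
  proof -
    have "?S (\<lambda>i j k l. H i j k l * H j k i l) = ?S (\<lambda>j i k l. H i j k l * H j k i l)" by (rule sum4_perm(1))
    then show ?thesis unfolding T1_def using s12 by simp
  qed
  \<comment> \<open>The third derivatives from the leading terms of the two groups in
    \<open>XX\<close> coincide after renaming indices, and so cancel in the difference.\<close>
  have K1: "?S (\<lambda>i j k l. N j k l * K i i j k l) = ?S (\<lambda>i j k l. N i k l * K i j j k l)"
  proof -
    have "?S (\<lambda>i j k l. N j k l * K i i j k l) = ?S (\<lambda>j i k l. N j k l * K i i j k l)" by (rule sum4_perm(1))
    moreover have "K i i j k l = K j i i k l" for i j k l using k12 k23 by metis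
    ultimately show ?thesis by simp
  qed
  \<comment> \<open>All three derivative slots of \<open>K\<close> are interchangeable, so the
    derivative index that is contracted with an index of h can be moved next to it; this exposes a
    derivative of div h.\<close>
  have K2: "?S (\<lambda>i j k l. N j k l * K i j k i l) = 0"
  proof -
    have e: "K i j k i l = K j k i i l" for i j k l using k12 k23 by metis
    have "?S (\<lambda>i j k l. N j k l * K i j k i l) = ?S (\<lambda>i j k l. N j k l * K j k i i l)"
      by (rule sum.cong[OF refl])+ (rule arg_cong2[where f = "(*)", OF refl e])
    also have "\<dots> = ?S (\<lambda>j i k l. N j k l * K j k i i l)" by (rule sum4_perm(1))
    also have "\<dots> = ?S (\<lambda>j k i l. N j k l * K j k i i l)" by (rule sum4_perm(2))
    also have "\<dots> = ?S (\<lambda>j k l i. N j k l * K j k i i l)" by (rule sum4_perm(3))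
    also have "\<dots> = 0" by (simp add: kdiv flip: sum_distrib_left)
    finally show ?thesis .
  qed
  have K3: "?S (\<lambda>i j k l. N j k l * K i k l i j) = 0"
  proof -
    have e: "K i k l i j = K k l i i j" for i j k l using k12 k23 by metis
    have "?S (\<lambda>i j k l. N j k l * K i k l i j) = ?S (\<lambda>i j k l. N j k l * K k l i i j)"
      by (rule sum.cong[OF refl])+ (rule arg_cong2[where f = "(*)", OF refl e])
    also have "\<dots> = ?S (\<lambda>j i k l. N j k l * K k l i i j)" by (rule sum4_perm(1))
    also have "\<dots> = ?S (\<lambda>j k i l. N j k l * K k l i i j)" by (rule sum4_perm(2))
    also have "\<dots> = ?S (\<lambda>j k l i. N j k l * K k l i i j)" by (rule sum4_perm(3))
    also have "\<dots> = 0" by (simp add: kdiv flip: sum_distrib_left)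
    finally show ?thesis .
  qed
  have "?S (\<lambda>i j k l. H i j k l * (H i j k l - 2 * H j k i l + H k l i j) + N j k l * (K i i j k l - 2 * K i j k i l + K i k l i j)
          - (H i i k l * H j j k l + N i k l * K i j j k l))
    = ?S (\<lambda>i j k l. (H i j k l)\<^sup>2 - 2 * (H i j k l * H j k i l) + H i j k l * H k l i j + N j k l * K i i j k l
          - 2 * (N j k l * K i j k i l) + N j k l * K i k l i j - H i i k l * H j j k l - N i k l * K i j j k l)"
    by (intro sum.cong refl) (simp add: power2_eq_square algebra_simps)
  also have "\<dots> = Q - 2 * T1 + T2 - (\<Sum>k\<in>UNIV. \<Sum>l\<in>UNIV. (L k l)\<^sup>2)"
    unfolding sum_subtractf sum.distrib sum_distrib_left[symmetric] K1 K2 K3 T1j LL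
    by (simp add: Q_def T2_def)
  finally show "?S (\<lambda>a b c d. (r a b c d)\<^sup>2) - 4 * (\<Sum>b\<in>UNIV. \<Sum>c\<in>UNIV. (\<Sum>a\<in>UNIV. r a b c a)\<^sup>2)
     = ?S (\<lambda>i j k l. H i j k l * (H i j k l - 2 * H j k i l + H k l i j) + N j k l * (K i i j k l - 2 * K i j k i l + K i k l i j)
          - (H i i k l * H j j k l + N i k l * K i j j k l))"
    using lhs ric by simp
qed

lemma dd_WW_shape:
  fixes f f' g1 g2 g3 g4 :: "'a::real_normed_vector \<Rightarrow> real"
  assumes "f differentiable (at x)" "f' differentiable (at x)" "g1 differentiable (at x)" "g2 differentiable (at x)"
    "g3 differentiable (at x)" "g4 differentiable (at x)"
  shows "dd u (\<lambda>y. f y * (g1 y - 2 * g2 y + g3 y) - f' y * g4 y) x =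
    dd u f x * (g1 x - 2 * g2 x + g3 x) + f x * (dd u g1 x - 2 * dd u g2 x + dd u g3 x) - (dd u f' x * g4 x + f' x * dd u g4 x)"
  by (rule dd_eqI, (rule derivative_eq_intros has_derivative_dd assms refl)+) (simp add: algebra_simps)

lemma linear_cmult: "linear f \<Longrightarrow> linear (\<lambda>x. c * f x)" for f :: "'a::real_vector \<Rightarrow> real"
  using linear_compose_scale_right[of f c] by simp

lemma linear_multc: "linear f \<Longrightarrow> linear (\<lambda>x. f x * c)" for f :: "'a::real_vector \<Rightarrow> real"
  using linear_cmult[of f c] by (simp add: mult.commute)

section \<open>Covariant derivatives of a symmetric tensor and the field \<open>XX\<close>\<close>

locale metric_tensor = metric_on U G for U :: "(real ^ 'n::finite) set" and G +
  fixes H :: "real ^ 'n \<Rightarrow> real ^ 'n ^ 'n"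
  assumes smooth_H: "smooth_on U H" and H_sym: "\<And>x. x \<in> U \<Longrightarrow> transpose (H x) = H x"
begin

lemma stens_N: "stens 3 U (NN G H)"
  unfolding NN_def using stens_cov[OF stens_ten2[OF open_dom smooth_H]] by (simp add: numeral_3_eq_3)

lemma stens_H: "stens 4 U (HH G H)"
  unfolding HH_def using stens_cov[OF stens_N] by simp

lemmas N_linear = mlin3D[OF stens_mlin[OF stens_N]]
lemmas H_linear = mlin4D[OF stens_mlin[OF stens_H]]

lemma N_smooth: "smooth_on U (\<lambda>y. NN G H y [a, b, c])"
  by (rule stens_smooth[OF stens_N]) simp

lemma H_smooth: "smooth_on U (\<lambda>y. HH G H y [a, b, c, d])"
  by (rule stens_smooth[OF stens_H]) simp

lemma ten2_sym: "x \<in> U \<Longrightarrow> ten2 H x [a, b] = ten2 H x [b, a]"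
  by (simp add: ten2_def) (metis H_sym dot_lmul_matrix inner_commute vector_transpose_matrix)

lemma N_sym: "x \<in> U \<Longrightarrow> NN G H x [v, a, b] = NN G H x [v, b, a]"
proof -
  assume x: "x \<in> U"
  have "dd v (\<lambda>y. ten2 H y [a, b]) x = dd v (\<lambda>y. ten2 H y [b, a]) x"
    by (rule dd_cong[OF open_dom x]) (rule ten2_sym)
  then show ?thesis
    by (simp add: NN_def ten2_sym[OF x, of "Gam G x v a" b] ten2_sym[OF x, of a "Gam G x v b"])
qed

lemma H_sym34: "x \<in> U \<Longrightarrow> HH G H x [u, v, a, b] = HH G H x [u, v, b, a]"
proof -
  assume x: "x \<in> U"
  have "dd u (\<lambda>y. NN G H y [v, a, b]) x = dd u (\<lambda>y. NN G H y [v, b, a]) x"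
    by (rule dd_cong[OF open_dom x]) (rule N_sym)
  then show ?thesis
    by (simp add: HH_def N_sym[OF x, of "Gam G x u v" a b] N_sym[OF x, of v "Gam G x u a" b] N_sym[OF x, of v a "Gam G x u b"])
qed

lemma stens_WW: "stens 7 U (WW G H)"
  unfolding stens_def
proof (intro conjI ballI allI impI)
  fix x assume x: "x \<in> U"
  show "mlin 7 (WW G H x)"
    by (rule mlin7I; simp add: WW_def)
       (intro linear_compose_sub linear_compose_add linear_cmult linear_multc N_linear[OF x] H_linear[OF x])+
next
  fix vs :: "(real ^ 'n) list"
  show "smooth_on U (\<lambda>x. WW G H x vs)" unfolding WW_def
    by (intro smooth_on_diff smooth_on_add smooth_on_mult smooth_on_const open_dom N_smooth H_smooth)
qed

lemma stens_XX: "stens 1 U (XX G H)"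
proof -
  have "stens (Suc (Suc 5)) U (WW G H)" using stens_WW by simp
  from stens_trT[OF this] have "stens (Suc (Suc 3)) U (trT (WW G H))" by (simp add: eval_nat_numeral)
  from stens_trT[OF this] have "stens (Suc (Suc 1)) U (trT (trT (WW G H)))" by (simp add: eval_nat_numeral)
  from stens_trT[OF this] show ?thesis unfolding XX_def .
qed

lemma cov_trT_frame:
  assumes T: "stens (Suc (Suc k)) U T" and x: "x \<in> U" and l: "length vs = k" and E: "frame (G x) E"
  shows "cov (Gam G) (trT T) x (v # vs) = (\<Sum>a\<in>UNIV. cov (Gam G) T x (v # E a # E a # vs))"
proof -
  have m: "mlin (Suc (Suc (Suc k))) (cov (Gam G) T x)" by (rule stens_mlin[OF stens_cov[OF T] x])
  have "bilinear (\<lambda>p q. cov (Gam G) T x (v # p # q # vs))"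
    using m l unfolding bilinear_def by (simp del: cov.simps)
  from trM_frame[OF E this] show ?thesis unfolding cov_trT[OF T x l] .
qed

text \<open>The Leibniz rule for \<open>WW\<close>. In each product every slot feeds exactly one
  factor, so the seven connection terms distribute over the factors and complete their partial
  derivatives to covariant ones.\<close>

lemma cov_WW:
  assumes x: "x \<in> U"
  shows "cov (Gam G) (WW G H) x [u, l, l', k, k', j, j', v] =
    HH G H x [u, j, k, l] * (HH G H x [v, j', k', l'] - 2 * HH G H x [j', k', v, l'] + HH G H x [k', l', v, j'])
    + NN G H x [j, k, l] * (cov (Gam G) (HH G H) x [u, v, j', k', l'] - 2 * cov (Gam G) (HH G H) x [u, j', k', v, l'] + cov (Gam G) (HH G H) x [u, k', l', v, j'])
    - (HH G H x [u, v, k, l] * HH G H x [j, j', k', l'] + NN G H x [v, k, l] * cov (Gam G) (HH G H) x [u, j, j', k', l'])"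
proof -
  have d: "(\<lambda>y. NN G H y [a, b, c]) differentiable (at x)" "(\<lambda>y. HH G H y [a, b, c, d]) differentiable (at x)" for a b c d
    by (rule smooth_on_differentiable[OF N_smooth x] smooth_on_differentiable[OF H_smooth x])+
  have e: "HH G H x [u, a, b, c] = dd u (\<lambda>y. NN G H y [a, b, c]) x
     - (NN G H x [Gam G x u a, b, c] + NN G H x [a, Gam G x u b, c] + NN G H x [a, b, Gam G x u c])" for a b c
    by (simp add: HH_def)
  have "dd u (\<lambda>y. WW G H y [l, l', k, k', j, j', v]) x =
     dd u (\<lambda>y. NN G H y [j, k, l]) x * (HH G H x [v, j', k', l'] - 2 * HH G H x [j', k', v, l'] + HH G H x [k', l', v, j'])
    + NN G H x [j, k, l] * (dd u (\<lambda>y. HH G H y [v, j', k', l']) x - 2 * dd u (\<lambda>y. HH G H y [j', k', v, l']) x + dd u (\<lambda>y. HH G H y [k', l', v, j']) x)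
    - (dd u (\<lambda>y. NN G H y [v, k, l]) x * HH G H x [j, j', k', l'] + NN G H x [v, k, l] * dd u (\<lambda>y. HH G H y [j, j', k', l']) x)"
    unfolding WW_def by (simp add: dd_WW_shape[OF d(1) d(1) d(2) d(2) d(2) d(2)])
  then show ?thesis by (simp add: WW_def e) (simp add: algebra_simps)
qed

text \<open>Traces commute with the covariant derivative, so the divergence of \<open>XX\<close> is
  the complete contraction of the covariant derivative of \<open>WW\<close>.\<close>

lemma div_XX_frame:
  assumes x: "x \<in> U" and E: "frame (G x) E"
  shows "trM (G x) (\<lambda>p q. cov (Gam G) (XX G H) x [p, q]) = (\<Sum>i\<in>UNIV. \<Sum>j\<in>UNIV. \<Sum>k\<in>UNIV. \<Sum>l\<in>UNIV.
     cov (Gam G) (WW G H) x [E i, E l, E l, E k, E k, E j, E j, E i])"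
proof -
  have T7: "stens (Suc (Suc 5)) U (WW G H)" using stens_WW by simp
  have T5: "stens (Suc (Suc 3)) U (trT (WW G H))" using stens_trT[OF T7] by (simp add: eval_nat_numeral)
  have T3: "stens (Suc (Suc 1)) U (trT (trT (WW G H)))" using stens_trT[OF T5] by (simp add: eval_nat_numeral)
  have "cov (Gam G) (XX G H) x [u, v] = (\<Sum>j\<in>UNIV. \<Sum>k\<in>UNIV. \<Sum>l\<in>UNIV.
     cov (Gam G) (WW G H) x [u, E l, E l, E k, E k, E j, E j, v])" for u v
    unfolding XX_def
    by (simp add: cov_trT_frame[OF T3 x _ E] cov_trT_frame[OF T5 x _ E] cov_trT_frame[OF T7 x _ E] del: cov.simps)
  moreover have "bilinear (\<lambda>p q. cov (Gam G) (XX G H) x [p, q])"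
    using stens_mlin[OF stens_cov[OF stens_XX] x] unfolding bilinear_def by (simp del: cov.simps)
  ultimately show ?thesis by (simp only: trM_frame[OF E])
qed

lemma nabla2_NN: "x \<in> U \<Longrightarrow> nabla2 G H x q p j = NN G H x [axis q 1, axis p 1, axis j 1]"
proof -
  assume x: "x \<in> U"
  have "ip (H x) u (axis j 1) = (\<Sum>m\<in>UNIV. u $ m * H x $ m $ j)" "ip (H x) (axis p 1) u = (\<Sum>m\<in>UNIV. u $ m * H x $ p $ m)" for u
    by (simp_all add: matrix_vector_mult_basis column_def inner_vec_def inner_axis' matrix_vector_mult_def mult.commute)
       (simp_all add: axis_def if_distrib[of "\<lambda>r. r * _"] if_distrib[of "\<lambda>r. _ * r"] cong: if_cong)
  then show ?thesis
    by (simp only: NN_def cov.simps dermap.simps ten2_def nabla2_def) (simp add: ip_axis pd_def Gam_axis_axis_nth sum.distrib mult.commute)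
qed

end

locale flat_TT = metric_tensor U G H for U :: "(real ^ 'n::finite) set" and G H +
  assumes flat0: "\<And>x u v w. x \<in> U \<Longrightarrow> curv x u v w = 0"
    and div0: "\<And>x j. x \<in> U \<Longrightarrow> div2 G H x j = 0" and tr0: "\<And>x. x \<in> U \<Longrightarrow> tr2 G H x = 0"
begin

text \<open>The Ricci identity with zero curvature term. The same argument one order higher gives
  \<open>K_sym12\<close>.\<close>

lemma H_sym12: "x \<in> U \<Longrightarrow> HH G H x [u, v, a, b] = HH G H x [v, u, a, b]"
proof -
  assume x: "x \<in> U"
  have T: "stens (Suc (Suc 0)) U (ten2 H)" by (rule stens_ten2[OF open_dom smooth_H])
  have "curv x u v = (\<lambda>w. 0)" using flat0[OF x] by auto
  then have "der (curv x u v) (ten2 H x) [a, b] = 0"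
    using dermap_zero_op[of "[a, b]" "ten2 H x"] stens_mlin[OF T x] by simp
  then show ?thesis
    using ricci_identity[OF T _ x, of "[a, b]" u v] by (simp add: HH_def NN_def del: cov.simps)
qed

lemma K_sym12: "x \<in> U \<Longrightarrow> cov (Gam G) (HH G H) x [u, v, a, b, c] = cov (Gam G) (HH G H) x [v, u, a, b, c]"
proof -
  assume x: "x \<in> U"
  have "curv x u v = (\<lambda>w. 0)" using flat0[OF x] by auto
  then have "der (curv x u v) (NN G H x) [a, b, c] = 0"
    using dermap_zero_op[of "[a, b, c]" "NN G H x"] stens_mlin[OF stens_N x] by (simp add: numeral_3_eq_3 del: mlin.simps)
  then show ?thesis
    using ricci_identity[OF stens_N _ x, of "[a, b, c]" u v] by (simp add: HH_def del: cov.simps)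
qed

lemma K_sym23: "x \<in> U \<Longrightarrow> cov (Gam G) (HH G H) x [u, v, a, b, c] = cov (Gam G) (HH G H) x [u, a, v, b, c]"
proof -
  assume x: "x \<in> U"
  have "dd u (\<lambda>y. HH G H y [v, a, b, c]) x = dd u (\<lambda>y. HH G H y [a, v, b, c]) x"
    by (rule dd_cong[OF open_dom x]) (rule H_sym12)
  then show ?thesis
    by (simp add: H_sym12[OF x, of "Gam G x u v" a] H_sym12[OF x, of v "Gam G x u a"] H_sym12[OF x, of v a])
qed

text \<open>Since contraction commutes with differentiation, a tensor field that is trace-free on
  all of \<open>U\<close> has a trace-free covariant derivative. In this way the conditions on h
  propagate to its second and third derivatives.\<close>

lemma cov_trace_zero:
  assumes T: "stens (Suc (Suc k)) U T" and x: "x \<in> U" and l: "length vs = k" and E: "frame (G x) E"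
    and 0: "\<And>y ws. y \<in> U \<Longrightarrow> length ws = k \<Longrightarrow> trT T y ws = 0"
  shows "(\<Sum>a\<in>UNIV. cov (Gam G) T x (v # E a # E a # vs)) = 0"
proof -
  have "cov (Gam G) (trT T) x (v # vs) = cov (Gam G) (\<lambda>y vs. 0) x (v # vs)"
    by (rule cov_cong[OF open_dom x]) (simp add: 0 l)
  then show ?thesis using cov_trT_frame[OF T x l E] by (simp only: cov_zero)
qed

lemma trT_frame:
  assumes T: "stens (Suc (Suc k)) U T" and x: "x \<in> U" and l: "length vs = k" and E: "frame (G x) E"
  shows "trT T x vs = (\<Sum>a\<in>UNIV. T x (E a # E a # vs))"
  unfolding trT_def
  by (rule trM_frame[OF E]) (use stens_mlin[OF T x] l in \<open>simp add: bilinear_def\<close>)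

lemma trace_N: "x \<in> U \<Longrightarrow> frame (G x) E \<Longrightarrow> (\<Sum>a\<in>UNIV. NN G H x [v, E a, E a]) = 0"
proof -
  assume x: "x \<in> U" and E: "frame (G x) E"
  have "trT (ten2 H) y ws = 0" if "y \<in> U" "length ws = 0" for y ws
    using tr0[OF that(1)] that(2) by (simp add: trT_def trM_def tr2_def ginv_def ten2_def ip_axis)
  from cov_trace_zero[OF stens_ten2[OF open_dom smooth_H] x _ E this, of "[]" v]
  show ?thesis by (simp add: NN_def del: cov.simps)
qed

lemma trace_H: "x \<in> U \<Longrightarrow> frame (G x) E \<Longrightarrow> (\<Sum>a\<in>UNIV. HH G H x [u, v, E a, E a]) = 0"
proof -
  assume x: "x \<in> U" and E: "frame (G x) E"
  \<comment> \<open>\<open>trT\<close> contracts the first two slots, so the slots of nabla h are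
    permuted to put the arguments of h in front.\<close>
  define T where "T = (\<lambda>x vs. NN G H x [vs ! 2, vs ! 0, vs ! 1])"
  have "mlin 3 (T y)" if "y \<in> U" for y
    unfolding T_def by (rule mlin3I) (simp_all add: N_linear[OF that])
  then have T: "stens (Suc (Suc 1)) U T"
    unfolding stens_def by (simp add: T_def N_smooth numeral_3_eq_3)
  have "trT T y ws = 0" if y: "y \<in> U" and l: "length ws = 1" for y ws
  proof -
    obtain E' where E': "frame (G y) E'" using spd_frame_exists[OF spd_G[OF y]] .
    show ?thesis using trT_frame[OF T y l E'] trace_N[OF y E', of "ws ! 0"] by (simp add: T_def)
  qed
  from cov_trace_zero[OF T x _ E this, of "[v]" u]
  show ?thesis by (simp add: T_def HH_def add_ac)
qed

lemma div_N: "x \<in> U \<Longrightarrow> trT (NN G H) x [v] = 0"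
proof -
  assume x: "x \<in> U"
  have lin: "linear (\<lambda>v. trT (NN G H) x [v])" unfolding trT_def by (intro linear_trM N_linear[OF x])
  have "trT (NN G H) x [axis j 1] = 0" for j
  proof -
    have "trT (NN G H) x [axis j 1] = trM (G x) (\<lambda>p q. NN G H x [q, p, axis j 1])"
      unfolding trT_def by (rule trM_flip[OF spd_G[OF x]])
    also have "\<dots> = div2 G H x j" by (simp add: trM_def div2_def ginv_def nabla2_NN[OF x])
    finally show ?thesis using div0[OF x] by simp
  qed
  then show ?thesis using linear_expand[OF lin, of v] by simp
qed

lemma div_H: "x \<in> U \<Longrightarrow> frame (G x) E \<Longrightarrow> (\<Sum>a\<in>UNIV. HH G H x [u, E a, E a, v]) = 0"
proof -
  assume x: "x \<in> U" and E: "frame (G x) E"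
  have T: "stens (Suc (Suc 1)) U (NN G H)" using stens_N by (simp add: numeral_3_eq_3)
  have "trT (NN G H) y ws = 0" if "y \<in> U" "length ws = 1" for y ws
    using div_N[OF that(1)] that(2) by (auto simp: length_Suc_conv)
  from cov_trace_zero[OF T x _ E this, of "[v]" u]
  show ?thesis by (simp add: HH_def del: cov.simps)
qed

lemma div_K: "x \<in> U \<Longrightarrow> frame (G x) E \<Longrightarrow> (\<Sum>a\<in>UNIV. cov (Gam G) (HH G H) x [m, u, E a, E a, v]) = 0"
proof -
  assume x: "x \<in> U" and E: "frame (G x) E"
  define T where "T = (\<lambda>x vs. HH G H x [vs ! 2, vs ! 0, vs ! 1, vs ! 3])"
  have "mlin 4 (T y)" if "y \<in> U" for y
    unfolding T_def by (rule mlin4I) (simp_all add: H_linear[OF that])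
  then have T: "stens (Suc (Suc 2)) U T"
    unfolding stens_def by (simp add: T_def H_smooth)
  have "trT T y ws = 0" if y: "y \<in> U" and l: "length ws = 2" for y ws
  proof -
    obtain E' where E': "frame (G y) E'" using spd_frame_exists[OF spd_G[OF y]] .
    show ?thesis using trT_frame[OF T y l E'] div_H[OF y E', of "ws ! 0" "ws ! 1"] by (simp add: T_def)
  qed
  from cov_trace_zero[OF T x _ E this, of "[u, v]" m]
  show ?thesis by (simp add: T_def add_ac)
qed

lemma ric1_frame: "x \<in> U \<Longrightarrow> frame (G x) E \<Longrightarrow> ric1 G H x v w = (\<Sum>a\<in>UNIV. rm1 G H x (E a) v w (E a))"
  unfolding ric1_def
proof (rule trM_frame)
  assume x: "x \<in> U"
  show "bilinear (\<lambda>p q. rm1 G H x p v w q)"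
    unfolding rm1_def bilinear_def divide_inverse
    by (intro conjI allI linear_multc linear_compose_sub linear_compose_add H_linear[OF x])
qed

lemma pointwise_identity:
  assumes x: "x \<in> U" and E: "frame (G x) E"
  shows "(\<Sum>b\<in>UNIV. ric1 G H x (E b) (E b)) = 0"
    and "(\<Sum>a\<in>UNIV. \<Sum>b\<in>UNIV. \<Sum>c\<in>UNIV. \<Sum>d\<in>UNIV. (rm1 G H x (E a) (E b) (E c) (E d))\<^sup>2)
      = 4 * (\<Sum>b\<in>UNIV. \<Sum>c\<in>UNIV. (ric1 G H x (E b) (E c))\<^sup>2) + trM (G x) (\<lambda>p q. cov (Gam G) (XX G H) x [p, q])"
proof -
  note id = H_sym12[OF x] H_sym34[OF x] div_H[OF x E] trace_H[OF x E] K_sym12[OF x] K_sym23[OF x] div_K[OF x E]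
  note id2 = linearized_curvature_norms(2)[where H = "\<lambda>a b c d. HH G H x [E a, E b, E c, E d]"
      and K = "\<lambda>m a b c d. cov (Gam G) (HH G H) x [E m, E a, E b, E c, E d]", OF id, folded rm1_def]
  note id3 = linearized_curvature_norms(3)[where H = "\<lambda>a b c d. HH G H x [E a, E b, E c, E d]"
      and K = "\<lambda>m a b c d. cov (Gam G) (HH G H) x [E m, E a, E b, E c, E d]"
      and N = "\<lambda>b c d. NN G H x [E b, E c, E d]", OF id, folded rm1_def]
  show "(\<Sum>b\<in>UNIV. ric1 G H x (E b) (E b)) = 0"
    unfolding ric1_frame[OF x E] by (rule id2)
  show "(\<Sum>a\<in>UNIV. \<Sum>b\<in>UNIV. \<Sum>c\<in>UNIV. \<Sum>d\<in>UNIV. (rm1 G H x (E a) (E b) (E c) (E d))\<^sup>2)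
      = 4 * (\<Sum>b\<in>UNIV. \<Sum>c\<in>UNIV. (ric1 G H x (E b) (E c))\<^sup>2) + trM (G x) (\<lambda>p q. cov (Gam G) (XX G H) x [p, q])"
    unfolding ric1_frame[OF x E] div_XX_frame[OF x E] cov_WW[OF x] using id3 by (simp del: cov.simps)
qed

end

section \<open>Linearization of the curvature\<close>

text \<open>Bundles smoothness with the value of the second derivative at 0, so that the long sums
  in the curvature norms are handled by one rule for each operation.\<close>

definition smooth_dd2 :: "real set \<Rightarrow> (real \<Rightarrow> real) \<Rightarrow> real \<Rightarrow> bool" where
  "smooth_dd2 I f c \<longleftrightarrow> smooth_on I f \<and> dd 1 (\<lambda>t. dd 1 f t) 0 = c"

lemma smooth_dd2_add:
  assumes I: "open I" "0 \<in> I" and f: "smooth_dd2 I f c" and g: "smooth_dd2 I g d"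
  shows "smooth_dd2 I (\<lambda>t. f t + g t) (c + d)"
proof -
  have fs: "smooth_on I f" and gs: "smooth_on I g" using f g by (auto simp: smooth_dd2_def)
  have "dd 1 (\<lambda>t. dd 1 (\<lambda>t. f t + g t) t) 0 = dd 1 (\<lambda>t. dd 1 f t + dd 1 g t) 0"
    by (rule dd_cong[OF I]) (rule dd_add[OF smooth_on_differentiable[OF fs] smooth_on_differentiable[OF gs]])
  also have "\<dots> = c + d"
    using dd_add[OF smooth_on_differentiable[OF smooth_on_dd[OF fs] I(2)] smooth_on_differentiable[OF smooth_on_dd[OF gs] I(2)]]
      f g by (simp add: smooth_dd2_def)
  finally show ?thesis using smooth_on_add[OF I(1) fs gs] by (simp add: smooth_dd2_def)
qed

lemma smooth_dd2_zero: "smooth_dd2 I (\<lambda>t. 0) 0"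
proof -
  have "(\<lambda>t::real. dd 1 (\<lambda>t. 0::real) t) = (\<lambda>t. 0)" by simp
  then show ?thesis by (simp add: smooth_dd2_def smooth_on_const)
qed

lemma smooth_dd2_sum:
  assumes I: "open I" "0 \<in> I" and f: "\<And>i. i \<in> A \<Longrightarrow> smooth_dd2 I (f i) (c i)"
  shows "smooth_dd2 I (\<lambda>t. \<Sum>i\<in>A. f i t) (\<Sum>i\<in>A. c i)"
  using f
proof (induction A rule: infinite_finite_induct)
  case (insert i A)
  then show ?case using smooth_dd2_add[OF I, of "f i" "c i"] by simp
qed (simp_all add: smooth_dd2_zero)

lemma smooth_dd2_cmult:
  assumes I: "open I" "0 \<in> I" and f: "smooth_dd2 I f c"
  shows "smooth_dd2 I (\<lambda>t. r * f t) (r * c)"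
proof -
  have fs: "smooth_on I f" using f by (auto simp: smooth_dd2_def)
  have "dd 1 (\<lambda>t. dd 1 (\<lambda>t. r * f t) t) 0 = dd 1 (\<lambda>t. r * dd 1 f t) 0"
    by (rule dd_cong[OF I]) (rule dd_cmult[OF smooth_on_differentiable[OF fs]])
  also have "\<dots> = r * c"
    using dd_cmult[OF smooth_on_differentiable[OF smooth_on_dd[OF fs] I(2)]] f by (simp add: smooth_dd2_def)
  finally show ?thesis using smooth_on_mult[OF I(1) smooth_on_const fs] by (simp add: smooth_dd2_def)
qed

text \<open>With two factors vanishing at 0, the Leibniz rule keeps only the terms in which each of
  them is differentiated once. Thus derivatives of the weight and second derivatives of the
  curvature, in particular the acceleration of the metric, drop out.\<close>

lemma smooth_dd2_product:
  assumes I: "open I" "0 \<in> I" and a: "smooth_on I a" and f: "smooth_on I f" and g: "smooth_on I g"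
    and 0: "f 0 = 0" "g 0 = 0"
  shows "smooth_dd2 I (\<lambda>t. a t * f t * g t) (2 * a 0 * dd 1 f 0 * dd 1 g 0)"
proof -
  note d = smooth_on_differentiable and m = smooth_on_mult[OF I(1)] and D = smooth_on_dd
  have "dd 1 (\<lambda>t. dd 1 (\<lambda>t. a t * f t * g t) t) 0
      = dd 1 (\<lambda>t. a t * f t * dd 1 g t + (a t * dd 1 f t + dd 1 a t * f t) * g t) 0"
    by (rule dd_cong[OF I]) (simp add: dd_mult[OF d[OF m[OF a f]] d[OF g]] dd_mult[OF d[OF a] d[OF f]])
  also have "\<dots> = dd 1 (\<lambda>t. a t * f t * dd 1 g t) 0 + dd 1 (\<lambda>t. (a t * dd 1 f t + dd 1 a t * f t) * g t) 0"
    by (rule dd_add; rule d[OF _ I(2)]; intro smooth_on_add m I(1) a f g D)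
  also have "dd 1 (\<lambda>t. a t * f t * dd 1 g t) 0 = a 0 * dd 1 f 0 * dd 1 g 0"
    using dd_mult[OF d[OF m[OF a f] I(2)] d[OF D[OF g] I(2)], of 1 1] dd_mult[OF d[OF a I(2)] d[OF f I(2)], of 1]
    by (simp add: 0)
  also have "dd 1 (\<lambda>t. (a t * dd 1 f t + dd 1 a t * f t) * g t) 0 = a 0 * dd 1 f 0 * dd 1 g 0"
    using dd_mult[OF d[OF smooth_on_add[OF I(1) m[OF a D[OF f]] m[OF D[OF a] f]] I(2)] d[OF g I(2)], of 1]
    by (simp add: 0)
  finally show ?thesis using m[OF m[OF a f] g] by (simp add: smooth_dd2_def)
qed

lemma christoffel_cong:
  assumes "open U" "x \<in> U" "\<And>y. y \<in> U \<Longrightarrow> F y = G y"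
  shows "christoffel F x k i j = christoffel G x k i j"
proof -
  have "pd l (\<lambda>y. F y $ a $ b) x = pd l (\<lambda>y. G y $ a $ b) x" for l a b
    unfolding pd_def by (rule dd_cong[OF assms(1,2)]) (simp add: assms(3))
  then show ?thesis by (simp add: christoffel_def ginv_def assms)
qed

lemma Gam_cong:
  assumes "open U" "x \<in> U" "\<And>y. y \<in> U \<Longrightarrow> F y = G y"
  shows "Gam F x u v = Gam G x u v"
  unfolding Gam_def by (simp add: christoffel_cong[OF assms])

section \<open>Time derivatives of the connection and of the curvature\<close>

locale metric_family = flat_TT U G H for U :: "(real ^ 'n::finite) set" and G H +
  fixes I :: "real set" and F :: "real \<Rightarrow> real ^ 'n \<Rightarrow> real ^ 'n ^ 'n"
  assumes I: "open I" "0 \<in> I" and F: "jsm I U F" and spd_F: "\<And>t x. t \<in> I \<Longrightarrow> x \<in> U \<Longrightarrow> spd (F t x)"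
    and F0: "\<And>x. x \<in> U \<Longrightarrow> F 0 x = G x" and F': "\<And>x. x \<in> U \<Longrightarrow> dd 1 (\<lambda>t. F t x) 0 = H x"
begin

lemma metric_t: "t \<in> I \<Longrightarrow> metric_on U (F t)"
  using open_dom jsm_slice(1)[OF I(1) open_dom F] spd_F by (simp add: metric_on_def)

lemma Gam_F0: "x \<in> U \<Longrightarrow> Gam (F 0) x u v = Gam G x u v"
  by (rule Gam_cong[OF open_dom]) (assumption, rule F0)

lemma jsm_GF: "jsm I U (\<lambda>t x. Gam (F t) x u v)"
  by (rule jsm_Gam[OF I(1) open_dom F spd_F])

text \<open>The variation of the connection. Unlike the Christoffel symbols it is a tensor, with the
  lowered form given in \<open>lowered_CC\<close>.\<close>

definition CC where "CC y u v = dd 1 (\<lambda>t. Gam (F t) y u v) 0"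

lemma smooth_CC: "smooth_on U (\<lambda>y. CC y u v)"
  unfolding CC_def using jsm_slice(1)[OF I(1) open_dom jsm_dd(2)[OF I(1) open_dom jsm_GF] I(2)] .

lemma dd_time_ip:
  assumes x: "x \<in> U" and a: "smooth_on I a"
  shows "dd 1 (\<lambda>t. ip (F t x) z (a t)) 0 = ip (H x) z (a 0) + ip (G x) z (dd 1 a 0)"
proof -
  have sm: "smooth_on I (\<lambda>t. F t x)" by (rule jsm_slice(2)[OF I(1) open_dom F x])
  have "dd 1 (\<lambda>t. ip (F t x) z (a t)) 0 = dd 1 (\<lambda>t. ip (F t x) z (a 0)) 0 + ip (F 0 x) z (dd 1 a 0)"
    by (rule dd_apply[OF I(1), where S = "\<lambda>t w. ip (F t x) z w"]) (rule linear_ip smooth_on_ip[OF I(1) sm] a I)+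
  also have "dd 1 (\<lambda>t. ip (F t x) z (a 0)) 0 = ip (dd 1 (\<lambda>t. F t x) 0) z (a 0)"
  proof (rule dd_bounded_linear[OF smooth_on_differentiable[OF sm I(2)], of "\<lambda>M. ip M z (a 0)"])
    show "bounded_linear (\<lambda>M. ip M z (a 0))"
      by (intro linear_conv_bounded_linear[THEN iffD1] linearI)
         (simp_all add: matrix_vector_mult_add_rdistrib inner_right_distrib flip: scaleR_matrix_vector_assoc)
  qed
  finally show ?thesis by (simp add: F0[OF x] F'[OF x])
qed

text \<open>Time derivative of the Koszul formula. Differentiating the metric on its left side
  produces a term h(z, Gamma(v, w)), which together with symmetry turns the partial derivatives of h
  on the right into covariant ones.\<close>

lemma lowered_CC:
  assumes x: "x \<in> U"
  shows "2 * ip (G x) z (CC x v w) = NN G H x [v, w, z] + NN G H x [w, v, z] - NN G H x [z, v, w]"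
proof -
  have smF: "smooth_on I (\<lambda>t. Gam (F t) x v w)" by (rule jsm_slice(2)[OF I(1) open_dom jsm_GF x])
  have jip: "jsm I U (\<lambda>t y. ip (F t y) a b)" for a b
    unfolding jsm_def by (rule smooth_on_ip[OF open_IU[OF I(1) open_dom] F[unfolded jsm_def]])
  \<comment> \<open>Time and space derivatives are exchanged so that the velocity of the metric
    becomes \<open>H\<close> before it is differentiated in space.\<close>
  have T: "dd 1 (\<lambda>t. dd a (\<lambda>y. ip (F t y) b c) x) 0 = dd a (\<lambda>y. ip (H y) b c) x" for a b c
  proof -
    have "dd 1 (\<lambda>t. dd a (\<lambda>y. ip (F t y) b c) x) 0 = dd a (\<lambda>y. dd 1 (\<lambda>t. ip (F t y) b c) 0) x"
      by (rule dd_time_space_commute[OF I(1) open_dom jip I(2) x])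
    also have "\<dots> = dd a (\<lambda>y. ip (H y) b c) x"
      by (rule dd_cong[OF open_dom x]) (use dd_time_ip[OF _ smooth_on_const[of I c], of _ b] in \<open>simp\<close>)
    finally show ?thesis .
  qed
  have dT: "(\<lambda>t. dd a (\<lambda>y. ip (F t y) b c) x) differentiable (at 0)" for a b c
    by (rule smooth_on_differentiable[OF jsm_slice(2)[OF I(1) open_dom jsm_dd(1)[OF I(1) open_dom jip] x] I(2)])
  have dL: "(\<lambda>t. ip (F t x) z (Gam (F t) x v w)) differentiable (at 0)"
  proof (rule smooth_on_differentiable[OF _ I(2)])
    show "smooth_on I (\<lambda>t. ip (F t x) z (Gam (F t) x v w))"
      by (rule smooth_on_apply[OF I(1), where S = "\<lambda>t w. ip (F t x) z w"])
         (rule linear_ip smooth_on_ip[OF I(1) jsm_slice(2)[OF I(1) open_dom F x]] smF)+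
  qed
  have "dd 1 (\<lambda>t. 2 * ip (F t x) z (Gam (F t) x v w)) 0
     = dd 1 (\<lambda>t. dd v (\<lambda>y. ip (F t y) w z) x + dd w (\<lambda>y. ip (F t y) v z) x - dd z (\<lambda>y. ip (F t y) v w) x) 0"
    by (rule dd_cong[OF I]) (rule metric_on.koszul[OF metric_t x])
  also have "\<dots> = dd v (\<lambda>y. ip (H y) w z) x + dd w (\<lambda>y. ip (H y) v z) x - dd z (\<lambda>y. ip (H y) v w) x"
    using dd_diff[OF differentiable_add[OF dT dT] dT, where v = 1] dd_add[OF dT dT, where v = 1] by (simp add: T)
  also have "dd 1 (\<lambda>t. 2 * ip (F t x) z (Gam (F t) x v w)) 0 = 2 * (ip (H x) z (Gam G x v w) + ip (G x) z (CC x v w))"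
    using dd_cmult[OF dL, where v = 1 and c = 2] dd_time_ip[OF x smF, of z] by (simp add: CC_def Gam_F0[OF x])
  finally show ?thesis
    using ten2_sym[OF x, of z "Gam G x v w"] ten2_sym[OF x, of v "Gam G x w z"] ten2_sym[OF x, of w "Gam G x v z"]
      sym[OF x, where u = w and v = v] sym[OF x, where u = z and v = v] sym[OF x, where u = z and v = w]
    by (simp add: NN_def ten2_def)
qed

lemma dd_lowered:
  assumes x: "x \<in> U"
  shows "ip (G x) z (dd u (\<lambda>y. CC y v w) x) = dd u (\<lambda>y. ip (G y) z (CC y v w)) x
     - ip (G x) (Gam G x u z) (CC x v w) - ip (G x) z (Gam G x u (CC x v w))"
proof -
  have "dd u (\<lambda>y. ip (G y) z (CC y v w)) x = dd u (\<lambda>y. ip (G y) z (CC x v w)) x + ip (G x) z (dd u (\<lambda>y. CC y v w) x)"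
    by (rule dd_apply[OF open_dom, where S = "\<lambda>y w. ip (G y) z w"])
       (rule linear_ip smooth_on_ip[OF open_dom smooth_G] smooth_CC x)+
  then show ?thesis using metric_compat[OF x, where u = u and v = z and w = "CC x v w"] by simp
qed

text \<open>With C the variation of the connection, the variation of curvature is (nabla_u C)(v, w)
  - (nabla_v C)(u, w). Inserting the lowered form of C gives six second derivatives of h; the pair
  nabla_u nabla_v h(w, z) - nabla_v nabla_u h(w, z) cancels by flatness and the other four form
  \<open>rm1\<close>.\<close>

lemma linearized_curv:
  assumes x: "x \<in> U"
  shows "ip (G x) z (dd 1 (\<lambda>t. connection.curv (Gam (F t)) x u v w) 0) = rm1 G H x u v w z"
proof -
  have conn: "connection U (Gam (F t))" if "t \<in> I" for t
  proof -
    interpret Ft: metric_on U "F t" by (rule metric_t[OF that])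
    show ?thesis by (rule Ft.connection_axioms)
  qed
  have e: "connection.curv (Gam (F t)) x u v w = dd u (\<lambda>y. Gam (F t) y v w) x - dd v (\<lambda>y. Gam (F t) y u w) x
      + Gam (F t) x u (Gam (F t) x v w) - Gam (F t) x v (Gam (F t) x u w)" if "t \<in> I" for t
    by (rule connection.curv_def[OF conn[OF that]])
  have s1: "smooth_on I (\<lambda>t. dd a (\<lambda>y. Gam (F t) y b w) x)" for a b
    by (rule jsm_slice(2)[OF I(1) open_dom jsm_dd(1)[OF I(1) open_dom jsm_GF] x])
  have sG: "smooth_on I (\<lambda>t. Gam (F t) x a b)" for a b by (rule jsm_slice(2)[OF I(1) open_dom jsm_GF x])
  have s2: "smooth_on I (\<lambda>t. Gam (F t) x a (Gam (F t) x b w))" for a b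
    by (rule smooth_on_apply[OF I(1), where S = "\<lambda>t w. Gam (F t) x a w"])
       (rule metric_on.linear_Gam[OF metric_t] sG, assumption?)+
  have d2: "dd 1 (\<lambda>t. Gam (F t) x a (Gam (F t) x b w)) 0 = CC x a (Gam G x b w) + Gam G x a (CC x b w)" for a b
  proof -
    have "dd 1 (\<lambda>t. Gam (F t) x a (Gam (F t) x b w)) 0
       = dd 1 (\<lambda>t. Gam (F t) x a (Gam (F 0) x b w)) 0 + Gam (F 0) x a (dd 1 (\<lambda>t. Gam (F t) x b w) 0)"
      by (rule dd_apply[OF I(1), where S = "\<lambda>t w. Gam (F t) x a w"])
         (rule metric_on.linear_Gam[OF metric_t] sG I(2), assumption?)+
    then show ?thesis by (simp add: CC_def Gam_F0[OF x])
  qed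
  have d1: "dd 1 (\<lambda>t. dd a (\<lambda>y. Gam (F t) y b w) x) 0 = dd a (\<lambda>y. CC y b w) x" for a b
    unfolding CC_def by (rule dd_time_space_commute[OF I(1) open_dom jsm_GF I(2) x])
  note D = smooth_on_differentiable[OF s1 I(2)] smooth_on_differentiable[OF s2 I(2)]
  have "dd 1 (\<lambda>t. connection.curv (Gam (F t)) x u v w) 0 = dd 1 (\<lambda>t. dd u (\<lambda>y. Gam (F t) y v w) x - dd v (\<lambda>y. Gam (F t) y u w) x
      + Gam (F t) x u (Gam (F t) x v w) - Gam (F t) x v (Gam (F t) x u w)) 0"
    by (rule dd_cong[OF I e])
  also have "\<dots> = dd u (\<lambda>y. CC y v w) x - dd v (\<lambda>y. CC y u w) x + (CC x u (Gam G x v w) + Gam G x u (CC x v w))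
      - (CC x v (Gam G x u w) + Gam G x v (CC x u w))"
    using dd_diff[OF differentiable_add[OF differentiable_diff[OF D(1) D(1)] D(2)] D(2), where v = 1]
      dd_add[OF differentiable_diff[OF D(1) D(1)] D(2), where v = 1] dd_diff[OF D(1) D(1), where v = 1] by (simp add: d1 d2)
  finally have L: "dd 1 (\<lambda>t. connection.curv (Gam (F t)) x u v w) 0 = \<dots>" .
  have dN: "(\<lambda>y. NN G H y [a, b, c]) differentiable (at x)" for a b c
    by (rule smooth_on_differentiable[OF N_smooth x])
  have dC: "2 * dd u (\<lambda>y. ip (G y) z (CC y v w)) x = dd u (\<lambda>y. NN G H y [v, w, z]) x + dd u (\<lambda>y. NN G H y [w, v, z]) x
     - dd u (\<lambda>y. NN G H y [z, v, w]) x" for u v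
  proof -
    have "dd u (\<lambda>y. ip (G y) z (CC y v w)) x = dd u (\<lambda>y. (1/2) * (NN G H y [v, w, z] + NN G H y [w, v, z] - NN G H y [z, v, w])) x"
    proof (rule dd_cong[OF open_dom x])
      fix y assume "y \<in> U"
      from lowered_CC[OF this, of z v w]
      show "ip (G y) z (CC y v w) = (1/2) * (NN G H y [v, w, z] + NN G H y [w, v, z] - NN G H y [z, v, w])" by simp
    qed
    also have "\<dots> = (1/2) * (dd u (\<lambda>y. NN G H y [v, w, z]) x + dd u (\<lambda>y. NN G H y [w, v, z]) x - dd u (\<lambda>y. NN G H y [z, v, w]) x)"
      using dd_cmult[OF differentiable_diff[OF differentiable_add[OF dN dN] dN], where v = u and c = "1/2"]
        dd_diff[OF differentiable_add[OF dN dN] dN, where v = u] dd_add[OF dN dN, where v = u] by simp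
    finally show ?thesis by simp
  qed
  have eN: "dd u (\<lambda>y. NN G H y [a, b, c]) x = HH G H x [u, a, b, c]
     + NN G H x [Gam G x u a, b, c] + NN G H x [a, Gam G x u b, c] + NN G H x [a, b, Gam G x u c]" for u a b c
    by (simp add: HH_def)
  have "2 * ip (G x) z (dd 1 (\<lambda>t. connection.curv (Gam (F t)) x u v w) 0) =
    2 * ip (G x) z (dd u (\<lambda>y. CC y v w) x) - 2 * ip (G x) z (dd v (\<lambda>y. CC y u w) x)
     + (2 * ip (G x) z (CC x u (Gam G x v w)) + 2 * ip (G x) z (Gam G x u (CC x v w)))
     - (2 * ip (G x) z (CC x v (Gam G x u w)) + 2 * ip (G x) z (Gam G x v (CC x u w)))"
    unfolding L by (simp add: inner_diff_right inner_add_right matrix_vector_right_distrib matrix_vector_mult_diff_distrib algebra_simps)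
  also have "\<dots> = HH G H x [u, w, v, z] - HH G H x [u, z, v, w] - HH G H x [v, w, u, z] + HH G H x [v, z, u, w]"
    using dC[of u v] dC[of v u] lowered_CC[OF x, of z u "Gam G x v w"] lowered_CC[OF x, of z v "Gam G x u w"]
      lowered_CC[OF x, of "Gam G x u z" v w] lowered_CC[OF x, of "Gam G x v z" u w]
      N_sym[OF x] H_sym12[OF x, of u v w z] sym[OF x, where u = u and v = v]
    unfolding dd_lowered[OF x] eN by simp
  finally show ?thesis by (simp add: rm1_def)
qed

lemma riem_up_dd:
  assumes x: "x \<in> U"
  shows "dd 1 (\<lambda>t. riem_up (F t) x i j k l) 0 = dd 1 (\<lambda>t. connection.curv (Gam (F t)) x (axis i 1) (axis j 1) (axis k 1)) 0 $ l"
proof -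
  have e: "connection.curv (Gam (F t)) x (axis i 1) (axis j 1) (axis k 1) = (\<chi> l. riem_up (F t) x i j k l)" if "t \<in> I" for t
    using metric_on.riem_up_curv[OF metric_t[OF that] x] by (simp add: vec_eq_iff)
  have "smooth_on I (\<lambda>t. \<chi> l. riem_up (F t) x i j k l)"
    using jsm_slice(2)[OF I(1) open_dom jsm_riem_up[OF I(1) open_dom F spd_F] x] by (intro smooth_on_vecI I(1)) simp
  from dd_nth[OF smooth_on_differentiable[OF this I(2)], where v = 1 and i = l]
  have "dd 1 (\<lambda>t. riem_up (F t) x i j k l) 0 = dd 1 (\<lambda>t. \<chi> l. riem_up (F t) x i j k l) 0 $ l" by simp
  also have "dd 1 (\<lambda>t. \<chi> l. riem_up (F t) x i j k l) 0 = dd 1 (\<lambda>t. connection.curv (Gam (F t)) x (axis i 1) (axis j 1) (axis k 1)) 0"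
    by (rule dd_cong[OF I]) (rule e[symmetric])
  finally show ?thesis .
qed

text \<open>\<open>F 0\<close> is known to agree with \<open>G\<close> on \<open>U\<close> only, so
  the curvatures are compared through derivatives at points of this open set.\<close>

lemma curvature_at_0:
  assumes x: "x \<in> U"
  shows "riem_up (F 0) x i j k l = 0" "riem (F 0) x i j k l = 0" "ricci (F 0) x j k = 0" "scal (F 0) x = 0"
proof -
  have c: "connection.curv (Gam (F 0)) x u v w = 0" for u v w
  proof -
    interpret F0: metric_on U "F 0" by (rule metric_t[OF I(2)])
    have "dd u (\<lambda>y. Gam (F 0) y v w) x = dd u (\<lambda>y. Gam G y v w) x" for u v w
      by (rule dd_cong[OF open_dom x]) (rule Gam_F0)
    then have "F0.curv x u v w = curv x u v w"
      by (simp add: F0.curv_def curv_def Gam_F0[OF x])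
    then show ?thesis using flat0[OF x] by simp
  qed
  show r: "riem_up (F 0) x i j k l = 0" for i j k l
    using metric_on.riem_up_curv[OF metric_t[OF I(2)] x, of i j k l] by (simp add: c)
  show "riem (F 0) x i j k l = 0" by (simp add: riem_def r)
  show e: "ricci (F 0) x j k = 0" for j k by (simp add: ricci_def r)
  show "scal (F 0) x = 0" by (simp add: scal_def e)
qed

text \<open>Raising, lowering and contracting use the moving metric, but its derivative is always
  multiplied by a curvature that vanishes at time 0. So these operations pass to the linearization
  with the fixed metric.\<close>

lemma curvature_dd:
  assumes x: "x \<in> U"
  shows "dd 1 (\<lambda>t. riem (F t) x i j k l) 0 = rm1 G H x (axis i 1) (axis j 1) (axis k 1) (axis l 1)"
    and "dd 1 (\<lambda>t. ricci (F t) x j k) 0 = ric1 G H x (axis j 1) (axis k 1)"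
    and "dd 1 (\<lambda>t. scal (F t) x) 0 = trM (G x) (ric1 G H x)"
proof -
  note js = jsm_slice(2)[OF I(1) open_dom _ x]
  have su: "smooth_on I (\<lambda>t. riem_up (F t) x i j k l)" for i j k l by (rule js[OF jsm_riem_up[OF I(1) open_dom F spd_F]])
  note du = smooth_on_differentiable[OF su I(2)]
  have sF: "smooth_on I (\<lambda>t. F t x $ i $ j)" for i j by (rule js[OF jsm_entry[OF I(1) open_dom F spd_F]])
  note dF = smooth_on_differentiable[OF sF I(2)]
  have sr: "smooth_on I (\<lambda>t. ricci (F t) x j k)" for j k by (rule js[OF jsm_ricci[OF I(1) open_dom F spd_F]])
  note dr = smooth_on_differentiable[OF sr I(2)]
  have sg: "smooth_on I (\<lambda>t. ginv (F t) x j k)" for j k by (rule js[OF jsm_ginv[OF I(1) open_dom F spd_F]])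
  note dg = smooth_on_differentiable[OF sg I(2)]
  define R where "R u v w = dd 1 (\<lambda>t. connection.curv (Gam (F t)) x u v w) 0" for u v w
  have ru: "dd 1 (\<lambda>t. riem_up (F t) x i j k l) 0 = R (axis i 1) (axis j 1) (axis k 1) $ l" for i j k l
    unfolding R_def by (rule riem_up_dd[OF x])
  have "dd 1 (\<lambda>t. riem (F t) x i j k l) 0 = (\<Sum>m\<in>UNIV. F 0 x $ l $ m * dd 1 (\<lambda>t. riem_up (F t) x i j k m) 0)"
    unfolding riem_def
    by (subst dd_sum, rule differentiable_mult[OF dF du]) (simp add: dd_mult[OF dF du] curvature_at_0[OF x])
  also have "\<dots> = ip (G x) (axis l 1) (R (axis i 1) (axis j 1) (axis k 1))"
    by (simp add: F0[OF x] ru inner_axis' matrix_vector_mult_def)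
  also have "\<dots> = rm1 G H x (axis i 1) (axis j 1) (axis k 1) (axis l 1)"
    unfolding R_def by (rule linearized_curv[OF x])
  finally show "dd 1 (\<lambda>t. riem (F t) x i j k l) 0 = rm1 G H x (axis i 1) (axis j 1) (axis k 1) (axis l 1)" .
  have "dd 1 (\<lambda>t. ricci (F t) x j k) 0 = (\<Sum>i\<in>UNIV. R (axis i 1) (axis j 1) (axis k 1) $ i)" for j k
    unfolding ricci_def by (subst dd_sum, rule du) (simp add: ru)
  also have "\<dots> j k = trM (G x) (\<lambda>p q. ip (G x) q (R p (axis j 1) (axis k 1)))" for j k
    by (rule trM_endo[OF spd_G[OF x], symmetric])
  also have "\<dots> j k = ric1 G H x (axis j 1) (axis k 1)" for j k
    unfolding ric1_def R_def linearized_curv[OF x] ..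
  finally show ric: "dd 1 (\<lambda>t. ricci (F t) x j k) 0 = ric1 G H x (axis j 1) (axis k 1)" for j k .
  have dm: "(\<lambda>t. ginv (F t) x j k * ricci (F t) x j k) differentiable (at 0)" for j k by (rule differentiable_mult[OF dg dr])
  have "dd 1 (\<lambda>t. scal (F t) x) 0 = (\<Sum>j\<in>UNIV. \<Sum>k\<in>UNIV. dd 1 (\<lambda>t. ginv (F t) x j k * ricci (F t) x j k) 0)"
    unfolding scal_def by (subst dd_sum, simp add: differentiable_sum dm) (simp add: dd_sum[OF dm])
  also have "\<dots> = trM (G x) (ric1 G H x)"
    by (simp only: dd_mult[OF dg dr]) (simp add: curvature_at_0[OF x] ric trM_def ginv_def F0[OF x])
  finally show "dd 1 (\<lambda>t. scal (F t) x) 0 = trM (G x) (ric1 G H x)" .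
qed

lemma linear_rm1:
  assumes x: "x \<in> U"
  shows "linear (\<lambda>u. rm1 G H x u v w z)" "linear (\<lambda>v. rm1 G H x u v w z)" "linear (\<lambda>w. rm1 G H x u v w z)" "linear (\<lambda>z. rm1 G H x u v w z)"
  unfolding rm1_def divide_inverse
  by (intro linear_multc linear_compose_sub linear_compose_add H_linear[OF x])+

lemma linear_ric1:
  assumes x: "x \<in> U" shows "linear (\<lambda>v. ric1 G H x v w)" "linear (\<lambda>w. ric1 G H x v w)"
  unfolding ric1_def by (intro linear_trM linear_rm1 x)+

text \<open>Each term is a weight times a product of two curvature components vanishing at 0, so
  \<open>smooth_dd2_product\<close> applies to every summand. The scalar curvature term contributes
  nothing because the trace of \<open>ric1\<close> is 0; this is how \<tau> disappears.\<close>

theorem second_derivative_density: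
  assumes x: "x \<in> U" and E: "frame (G x) E"
  shows "dd 1 (\<lambda>t. dd 1 (\<lambda>t. (riem_norm2 (F t) x + s * ricci_norm2 (F t) x + \<tau> * (scal (F t) x)\<^sup>2) * sqrt (det (F t x))) t) 0
    = 2 * sqrt (det (G x)) * ((\<Sum>a\<in>UNIV. \<Sum>b\<in>UNIV. \<Sum>c\<in>UNIV. \<Sum>d\<in>UNIV. (rm1 G H x (E a) (E b) (E c) (E d))\<^sup>2)
       + s * (\<Sum>a\<in>UNIV. \<Sum>b\<in>UNIV. (ric1 G H x (E a) (E b))\<^sup>2))"
proof -
  note js = jsm_slice(2)[OF I(1) open_dom _ x]
  define w where "w t = sqrt (det (F t x))" for t
  have sw: "smooth_on I w" unfolding w_def by (rule js[OF jsm_sqrt_det[OF I(1) open_dom F spd_F]])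
  have sr: "smooth_on I (\<lambda>t. ricci (F t) x j k)" for j k by (rule js[OF jsm_ricci[OF I(1) open_dom F spd_F]])
  have sR: "smooth_on I (\<lambda>t. riem (F t) x i j k l)" for i j k l by (rule js[OF jsm_riem[OF I(1) open_dom F spd_F]])
  have ss: "smooth_on I (\<lambda>t. scal (F t) x)" by (rule js[OF jsm_scal[OF I(1) open_dom F spd_F]])
  have sg: "smooth_on I (\<lambda>t. ginv (F t) x j k)" for j k by (rule js[OF jsm_ginv[OF I(1) open_dom F spd_F]])
  note m = smooth_on_mult[OF I(1)]
  note S = smooth_dd2_sum[OF I]
  let ?g = "\<lambda>i p t. ginv (F t) x i p" and ?R = "\<lambda>i j k l t. riem (F t) x i j k l" and ?r = "\<lambda>i j t. ricci (F t) x i j"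
  have 1: "smooth_dd2 I (\<lambda>t. riem_norm2 (F t) x * w t) (2 * w 0 * (\<Sum>a\<in>UNIV. \<Sum>b\<in>UNIV. \<Sum>c\<in>UNIV. \<Sum>d\<in>UNIV. (rm1 G H x (E a) (E b) (E c) (E d))\<^sup>2))"
  proof -
    \<comment> \<open>The four inverse metrics and the volume density are collected into the weight,
      leaving the two curvature components as the vanishing factors.\<close>
    have "smooth_dd2 I (\<lambda>t. \<Sum>i\<in>UNIV. \<Sum>j\<in>UNIV. \<Sum>k\<in>UNIV. \<Sum>l\<in>UNIV. \<Sum>p\<in>UNIV. \<Sum>q\<in>UNIV. \<Sum>r\<in>UNIV. \<Sum>u\<in>UNIV.
        (?g i p t * ?g j q t * ?g k r t * ?g l u t * w t) * ?R i j k l t * ?R p q r u t)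
      (\<Sum>i\<in>UNIV. \<Sum>j\<in>UNIV. \<Sum>k\<in>UNIV. \<Sum>l\<in>UNIV. \<Sum>p\<in>UNIV. \<Sum>q\<in>UNIV. \<Sum>r\<in>UNIV. \<Sum>u\<in>UNIV.
        2 * (?g i p 0 * ?g j q 0 * ?g k r 0 * ?g l u 0 * w 0) * dd 1 (?R i j k l) 0 * dd 1 (?R p q r u) 0)"
      by (rule S smooth_dd2_product[OF I] m sg sw sR curvature_at_0(2)[OF x])+
    moreover have "(\<Sum>i\<in>UNIV. \<Sum>j\<in>UNIV. \<Sum>k\<in>UNIV. \<Sum>l\<in>UNIV. \<Sum>p\<in>UNIV. \<Sum>q\<in>UNIV. \<Sum>r\<in>UNIV. \<Sum>u\<in>UNIV.
        2 * (?g i p 0 * ?g j q 0 * ?g k r 0 * ?g l u 0 * w 0) * dd 1 (?R i j k l) 0 * dd 1 (?R p q r u) 0)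
      = 2 * w 0 * (\<Sum>a\<in>UNIV. \<Sum>b\<in>UNIV. \<Sum>c\<in>UNIV. \<Sum>d\<in>UNIV. (rm1 G H x (E a) (E b) (E c) (E d))\<^sup>2)"
    proof -
      have "(\<Sum>a\<in>UNIV. \<Sum>b\<in>UNIV. \<Sum>c\<in>UNIV. \<Sum>d\<in>UNIV. (rm1 G H x (E a) (E b) (E c) (E d))\<^sup>2)
        = (\<Sum>i\<in>UNIV. \<Sum>j\<in>UNIV. \<Sum>k\<in>UNIV. \<Sum>l\<in>UNIV. \<Sum>p\<in>UNIV. \<Sum>q\<in>UNIV. \<Sum>r\<in>UNIV. \<Sum>u\<in>UNIV.
          matrix_inv (G x) $ i $ p * matrix_inv (G x) $ j $ q * matrix_inv (G x) $ k $ r * matrix_inv (G x) $ l $ u *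
          rm1 G H x (axis i 1) (axis j 1) (axis k 1) (axis l 1) * rm1 G H x (axis p 1) (axis q 1) (axis r 1) (axis u 1))"
        unfolding trM4_regroup by (subst trM4_frame[OF E]) (simp_all add: linear_rm1[OF x] power2_eq_square)
      then show ?thesis
        unfolding curvature_dd[OF x] ginv_def F0[OF x] by (simp only: sum_distrib_left mult_ac)
    qed
    moreover have "riem_norm2 (F t) x * w t = (\<Sum>i\<in>UNIV. \<Sum>j\<in>UNIV. \<Sum>k\<in>UNIV. \<Sum>l\<in>UNIV. \<Sum>p\<in>UNIV. \<Sum>q\<in>UNIV. \<Sum>r\<in>UNIV. \<Sum>u\<in>UNIV.
        (?g i p t * ?g j q t * ?g k r t * ?g l u t * w t) * ?R i j k l t * ?R p q r u t)" for t
      unfolding riem_norm2_def sum_distrib_right by (simp only: mult_ac)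
    ultimately show ?thesis by (simp only:)
  qed
  have 2: "smooth_dd2 I (\<lambda>t. ricci_norm2 (F t) x * w t) (2 * w 0 * (\<Sum>a\<in>UNIV. \<Sum>b\<in>UNIV. (ric1 G H x (E a) (E b))\<^sup>2))"
  proof -
    have "smooth_dd2 I (\<lambda>t. \<Sum>i\<in>UNIV. \<Sum>j\<in>UNIV. \<Sum>p\<in>UNIV. \<Sum>q\<in>UNIV. (?g i p t * ?g j q t * w t) * ?r i j t * ?r p q t)
      (\<Sum>i\<in>UNIV. \<Sum>j\<in>UNIV. \<Sum>p\<in>UNIV. \<Sum>q\<in>UNIV. 2 * (?g i p 0 * ?g j q 0 * w 0) * dd 1 (?r i j) 0 * dd 1 (?r p q) 0)"
      by (rule S smooth_dd2_product[OF I] m sg sw sr curvature_at_0(3)[OF x])+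
    moreover have "(\<Sum>i\<in>UNIV. \<Sum>j\<in>UNIV. \<Sum>p\<in>UNIV. \<Sum>q\<in>UNIV. 2 * (?g i p 0 * ?g j q 0 * w 0) * dd 1 (?r i j) 0 * dd 1 (?r p q) 0)
      = 2 * w 0 * (\<Sum>a\<in>UNIV. \<Sum>b\<in>UNIV. (ric1 G H x (E a) (E b))\<^sup>2)"
    proof -
      have "(\<Sum>a\<in>UNIV. \<Sum>b\<in>UNIV. (ric1 G H x (E a) (E b))\<^sup>2)
        = (\<Sum>i\<in>UNIV. \<Sum>j\<in>UNIV. \<Sum>p\<in>UNIV. \<Sum>q\<in>UNIV.
          matrix_inv (G x) $ i $ p * matrix_inv (G x) $ j $ q * ric1 G H x (axis i 1) (axis j 1) * ric1 G H x (axis p 1) (axis q 1))"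
        unfolding trM2_regroup by (subst trM2_frame[OF E]) (simp_all add: linear_ric1[OF x] power2_eq_square)
      then show ?thesis
        unfolding curvature_dd[OF x] ginv_def F0[OF x] by (simp only: sum_distrib_left mult_ac)
    qed
    moreover have "ricci_norm2 (F t) x * w t = (\<Sum>i\<in>UNIV. \<Sum>j\<in>UNIV. \<Sum>p\<in>UNIV. \<Sum>q\<in>UNIV. (?g i p t * ?g j q t * w t) * ?r i j t * ?r p q t)" for t
      unfolding ricci_norm2_def sum_distrib_right by (simp only: mult_ac)
    ultimately show ?thesis by (simp only:)
  qed
  have tr: "trM (G x) (ric1 G H x) = 0"
    using trM_frame[OF E, of "ric1 G H x"] pointwise_identity(1)[OF x E] by (simp add: bilinear_def linear_ric1[OF x])
  have 3: "smooth_dd2 I (\<lambda>t. w t * scal (F t) x * scal (F t) x) 0"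
    using smooth_dd2_product[OF I sw ss ss curvature_at_0(4)[OF x] curvature_at_0(4)[OF x]] by (simp add: curvature_dd[OF x] tr)
  have "smooth_dd2 I (\<lambda>t. riem_norm2 (F t) x * w t + s * (ricci_norm2 (F t) x * w t) + \<tau> * (w t * scal (F t) x * scal (F t) x))
    (2 * w 0 * (\<Sum>a\<in>UNIV. \<Sum>b\<in>UNIV. \<Sum>c\<in>UNIV. \<Sum>d\<in>UNIV. (rm1 G H x (E a) (E b) (E c) (E d))\<^sup>2)
     + s * (2 * w 0 * (\<Sum>a\<in>UNIV. \<Sum>b\<in>UNIV. (ric1 G H x (E a) (E b))\<^sup>2)) + \<tau> * 0)"
    by (intro smooth_dd2_add[OF I] smooth_dd2_cmult[OF I] 1 2 3)
  moreover have "(\<lambda>t. riem_norm2 (F t) x * w t + s * (ricci_norm2 (F t) x * w t) + \<tau> * (w t * scal (F t) x * scal (F t) x))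
    = (\<lambda>t. (riem_norm2 (F t) x + s * ricci_norm2 (F t) x + \<tau> * (scal (F t) x)\<^sup>2) * sqrt (det (F t x)))"
    by (rule ext) (simp add: w_def power2_eq_square algebra_simps)
  ultimately show ?thesis by (simp add: smooth_dd2_def w_def F0[OF x] algebra_simps)
qed

end

section \<open>Change of charts\<close>

text \<open>A local isometry between coordinate domains; used for the transition maps, where
  \<open>isometric\<close> is the transformation law of the metric.\<close>

locale metric_map = dom: metric_on U G + cod: metric_on V G'
  for U V :: "(real ^ 'n::finite) set" and G G' +
  fixes \<phi> :: "real ^ 'n \<Rightarrow> real ^ 'n"
  assumes phi_smooth: "smooth_on U \<phi>" and phi_into: "\<phi> ` U \<subseteq> V"
    and isometric: "\<And>x u v. x \<in> U \<Longrightarrow> ip (G x) u v = ip (G' (\<phi> x)) (dd u \<phi> x) (dd v \<phi> x)"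
begin

lemma phi_V: "x \<in> U \<Longrightarrow> \<phi> x \<in> V"
  using phi_into by auto

lemma linear_J: "x \<in> U \<Longrightarrow> linear (\<lambda>v. dd v \<phi> x)"
  by (rule dd_linear[OF smooth_on_differentiable[OF phi_smooth]])

text \<open>A vector killed by the Jacobian would have length 0. In equal dimensions the Jacobian is
  then onto, so test vectors on the target side are images.\<close>

lemma inj_J:
  assumes x: "x \<in> U" shows "inj (\<lambda>v. dd v \<phi> x)"
proof -
  have "v = 0" if "dd v \<phi> x = 0" for v
  proof (rule ccontr)
    assume "v \<noteq> 0"
    then have "0 < ip (G x) v v" using dom.spd_G[OF x] by (auto simp: spd_def)
    then show False using isometric[OF x, of v v] that by simp
  qed
  then show ?thesis using linear_injective_0[OF linear_J[OF x]] by blast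
qed

lemma surj_J: "x \<in> U \<Longrightarrow> surj (\<lambda>v. dd v \<phi> x)"
  by (rule linear_injective_imp_surjective[OF linear_J inj_J]) simp_all

lemma dd_ip_pullback:
  assumes x: "x \<in> U"
  shows "dd u (\<lambda>y. ip (G y) v w) x = dd (dd u \<phi> x) (\<lambda>z. ip (G' z) (dd v \<phi> x) (dd w \<phi> x)) (\<phi> x)
    + ip (G' (\<phi> x)) (dd u (\<lambda>y. dd v \<phi> y) x) (dd w \<phi> x) + ip (G' (\<phi> x)) (dd v \<phi> x) (dd u (\<lambda>y. dd w \<phi> y) x)"
proof -
  let ?T = "\<lambda>y. ten2 G' (\<phi> y)"
  have T0: "stens (Suc (Suc 0)) V (ten2 G')" by (rule stens_ten2[OF cod.open_dom cod.smooth_G])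
  have T: "stens (length [v, w]) U ?T"
    using T0 phi_V unfolding stens_def
    by (auto intro!: smooth_on_compose[OF dom.open_dom cod.open_dom phi_into phi_smooth])
  have "dd u (\<lambda>y. ip (G y) v w) x = dd u (\<lambda>y. ?T y (map (\<lambda>v. dd v \<phi> y) [v, w])) x"
    by (rule dd_cong[OF dom.open_dom x]) (simp add: ten2_def isometric)
  also have "\<dots> = dd u (\<lambda>y. ?T y (map (\<lambda>v. dd v \<phi> x) [v, w])) x + dermap (\<lambda>v. dd v \<phi> x) (\<lambda>v. dd u (\<lambda>y. dd v \<phi> y) x) (?T x) [v, w]"
    by (rule dd_stens_map[OF dom.open_dom x smooth_on_dd[OF phi_smooth] T])
  also have "dd u (\<lambda>y. ?T y (map (\<lambda>v. dd v \<phi> x) [v, w])) x = dd (dd u \<phi> x) (\<lambda>z. ten2 G' z (map (\<lambda>v. dd v \<phi> x) [v, w])) (\<phi> x)"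
    by (rule dd_compose[where g = "\<lambda>z. ten2 G' z (map (\<lambda>v. dd v \<phi> x) [v, w])",
          OF smooth_on_differentiable[OF phi_smooth x] stens_diff[OF T0 _ phi_V[OF x]]]) simp
  finally show ?thesis by (simp add: ten2_def)
qed

text \<open>Comparison of the two Koszul formulas against an image vector
  \<open>dd w \<phi> x\<close>. Pulling back the metric adds six Hessian terms; by symmetry of the
  Hessian four cancel and two equal terms remain.\<close>

lemma Gam_transform:
  assumes x: "x \<in> U"
  shows "dd (Gam G x u v) \<phi> x = Gam G' (\<phi> x) (dd u \<phi> x) (dd v \<phi> x) + dd u (\<lambda>y. dd v \<phi> y) x"
proof (rule spd_eqI[OF cod.spd_G[OF phi_V[OF x]]])
  fix w' :: "real ^ 'n"
  obtain w where w: "w' = dd w \<phi> x" using surj_J[OF x] by (metis surjD)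
  have s: "dd a (\<lambda>y. dd b \<phi> y) x = dd b (\<lambda>y. dd a \<phi> y) x" for a b
    by (rule dd_symmetric[OF dom.open_dom x phi_smooth])
  have "2 * ip (G' (\<phi> x)) w' (dd (Gam G x u v) \<phi> x) = 2 * ip (G x) w (Gam G x u v)"
    by (simp add: isometric[OF x] w)
  also have "\<dots> = 2 * ip (G' (\<phi> x)) w' (Gam G' (\<phi> x) (dd u \<phi> x) (dd v \<phi> x)) + 2 * ip (G' (\<phi> x)) w' (dd u (\<lambda>y. dd v \<phi> y) x)"
    unfolding dom.koszul[OF x] dd_ip_pullback[OF x] w cod.koszul[OF phi_V[OF x]]
    using s[of u v] s[of u w] s[of v w]
      cod.ip_sym[OF phi_V[OF x], of "dd u (\<lambda>y. dd v \<phi> y) x" "dd w \<phi> x"]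
      cod.ip_sym[OF phi_V[OF x], of "dd u (\<lambda>y. dd w \<phi> y) x" "dd v \<phi> x"]
      cod.ip_sym[OF phi_V[OF x], of "dd v (\<lambda>y. dd w \<phi> y) x" "dd u \<phi> x"]
    by simp
  finally show "ip (G' (\<phi> x)) w' (dd (Gam G x u v) \<phi> x)
     = ip (G' (\<phi> x)) w' (Gam G' (\<phi> x) (dd u \<phi> x) (dd v \<phi> x) + dd u (\<lambda>y. dd v \<phi> y) x)"
    by (simp add: matrix_vector_right_distrib inner_add_right)
qed

sublocale connection_map U V "Gam G" "Gam G'" \<phi>
  by (intro connection_map.intro connection_map_axioms.intro dom.connection_axioms cod.connection_axioms
      phi_smooth phi_into Gam_transform)

lemma frame_push:
  assumes x: "x \<in> U" and E: "frame (G x) E"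
  shows "frame (G' (\<phi> x)) (\<lambda>a. dd (E a) \<phi> x)"
  by (rule frame_map[OF E]) (rule isometric[OF x])

lemma rm_transform:
  assumes x: "x \<in> U"
  shows "dom.rm x u v w z = cod.rm (\<phi> x) (dd u \<phi> x) (dd v \<phi> x) (dd w \<phi> x) (dd z \<phi> x)"
  by (simp add: dom.rm_def cod.rm_def isometric[OF x] curv_transform[OF x])

text \<open>The norms are sums of squares over an orthonormal frame, and the Jacobian carries such a
  frame to another.\<close>

lemma norms_transform:
  assumes x: "x \<in> U"
  shows "riem_norm2 G x = riem_norm2 G' (\<phi> x)" "ricci_norm2 G x = ricci_norm2 G' (\<phi> x)" "scal G x = scal G' (\<phi> x)"
proof -
  obtain E where E: "frame (G x) E" using spd_frame_exists[OF dom.spd_G[OF x]] .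
  note E' = frame_push[OF x E]
  have r: "dom.ric x v w = cod.ric (\<phi> x) (dd v \<phi> x) (dd w \<phi> x)" for v w
    unfolding dom.ric_frame[OF x E] cod.ric_frame[OF phi_V[OF x] E'] rm_transform[OF x] ..
  show "riem_norm2 G x = riem_norm2 G' (\<phi> x)"
    unfolding dom.norms_frame(1)[OF x E] cod.norms_frame(1)[OF phi_V[OF x] E'] rm_transform[OF x] ..
  show "ricci_norm2 G x = ricci_norm2 G' (\<phi> x)"
    unfolding dom.norms_frame(2)[OF x E] cod.norms_frame(2)[OF phi_V[OF x] E'] r ..
  show "scal G x = scal G' (\<phi> x)"
    unfolding dom.norms_frame(3)[OF x E] cod.norms_frame(3)[OF phi_V[OF x] E'] r ..
qed

lemma trT_transform:
  assumes T: "stens (Suc (Suc k)) V T" and x: "x \<in> U" and l: "length vs = k"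
    and S: "\<And>vs. length vs = Suc (Suc k) \<Longrightarrow> S x vs = T (\<phi> x) (map (\<lambda>v. dd v \<phi> x) vs)"
  shows "dom.trT S x vs = cod.trT T (\<phi> x) (map (\<lambda>v. dd v \<phi> x) vs)"
proof -
  have B: "bilinear (\<lambda>p q. T (\<phi> x) (p # q # map (\<lambda>v. dd v \<phi> x) vs))"
    using stens_mlin[OF T phi_V[OF x]] l by (simp add: bilinear_def)
  have "dom.trT S x vs = trM (G x) (\<lambda>p q. T (\<phi> x) (dd p \<phi> x # dd q \<phi> x # map (\<lambda>v. dd v \<phi> x) vs))"
    unfolding dom.trT_def by (rule trM_cong) (simp add: S l)
  also have "\<dots> = cod.trT T (\<phi> x) (map (\<lambda>v. dd v \<phi> x) vs)"
    unfolding cod.trT_def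
    by (rule trM_pullback[OF dom.spd_G[OF x] linear_J[OF x] isometric[OF x] B])
  finally show ?thesis .
qed

text \<open>\<open>XX\<close> is built from h by covariant differentiation, products and traces,
  each of which commutes with pullback along a local isometry.\<close>

lemma XX_transform:
  assumes H: "metric_tensor U G H" and H': "metric_tensor V G' H'" and x: "x \<in> U"
    and HH': "\<And>x u v. x \<in> U \<Longrightarrow> ip (H x) u v = ip (H' (\<phi> x)) (dd u \<phi> x) (dd v \<phi> x)"
  shows "XX G H x [v] = XX G' H' (\<phi> x) [dd v \<phi> x]"
proof -
  interpret H: metric_tensor U G H by (rule H)
  interpret H': metric_tensor V G' H' by (rule H')
  let ?J = "\<lambda>x. map (\<lambda>v. dd v \<phi> x)"
  have T: "ten2 H y vs = ten2 H' (\<phi> y) (?J y vs)" if "y \<in> U" "length vs = Suc (Suc 0)" for y vs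
    using HH'[OF that(1)] that(2) by (simp add: ten2_def)
  have N: "NN G H y vs = NN G' H' (\<phi> y) (?J y vs)" if "y \<in> U" "length vs = 3" for y vs
    unfolding NN_def
    by (rule cov_transform[OF stens_ten2[OF cod.open_dom H'.smooth_H] that(1) _ T]) (simp_all add: that(2) numeral_3_eq_3)
  have HH: "HH G H y vs = HH G' H' (\<phi> y) (?J y vs)" if "y \<in> U" "length vs = 4" for y vs
    unfolding HH_def
    by (rule cov_transform[OF H'.stens_N that(1) _ N]) (simp_all add: that(2))
  have W: "WW G H x vs = WW G' H' (\<phi> x) (?J x vs)" if "length vs = Suc (Suc 5)" for vs
    using that by (simp add: WW_def N[OF x] HH[OF x])
  have T7: "stens (Suc (Suc 5)) V (WW G' H')" using H'.stens_WW by simp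
  have T5: "stens (Suc (Suc 3)) V (cod.trT (WW G' H'))" using cod.stens_trT[OF T7] by (simp add: eval_nat_numeral)
  have T3: "stens (Suc (Suc 1)) V (cod.trT (cod.trT (WW G' H')))" using cod.stens_trT[OF T5] by (simp add: eval_nat_numeral)
  have 1: "dom.trT (WW G H) x vs = cod.trT (WW G' H') (\<phi> x) (?J x vs)" if "length vs = Suc (Suc 3)" for vs
    by (rule trT_transform[OF T7 x], use that in simp, rule W)
  have 2: "dom.trT (dom.trT (WW G H)) x vs = cod.trT (cod.trT (WW G' H')) (\<phi> x) (?J x vs)" if "length vs = Suc (Suc 1)" for vs
    by (rule trT_transform[OF T5 x], use that in simp, rule 1)
  have "dom.trT (dom.trT (dom.trT (WW G H))) x [v] = cod.trT (cod.trT (cod.trT (WW G' H'))) (\<phi> x) (?J x [v])"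
    by (rule trT_transform[OF T3 x], simp, rule 2)
  then show ?thesis by (simp add: XX_def)
qed

end

section \<open>Change of variables\<close>

text \<open>The library proves the change of variables formula only for well-ordered index types. Every
  finite type has a well-ordered copy.\<close>

typedef 'n wo = "UNIV :: 'n set" by simp

instantiation wo :: (finite) finite
begin
instance
proof
  have "(UNIV :: 'a wo set) = Abs_wo ` UNIV" by (metis Abs_wo_cases UNIV_eq_I rangeI)
  then show "finite (UNIV :: 'a wo set)" using finite_imageI[OF finite[of "UNIV :: 'a set"], of Abs_wo] by metis
qed
end

definition wo_index :: "'n::finite wo \<Rightarrow> nat" where
  "wo_index = (SOME f. inj f)"

lemma inj_wo_index: "inj (wo_index :: 'n::finite wo \<Rightarrow> nat)"
proof -
  from finite_imp_inj_to_nat_seg[OF finite[of "UNIV :: 'n wo set"]]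
  obtain f :: "'n wo \<Rightarrow> nat" and n where "f ` UNIV = {i. i < n} \<and> inj f" by (elim exE)
  then have "inj f" by simp
  then show ?thesis unfolding wo_index_def by (rule someI[of "\<lambda>f. inj f" f])
qed

instantiation wo :: (finite) wellorder
begin
definition less_eq_wo :: "'a wo \<Rightarrow> 'a wo \<Rightarrow> bool" where "less_eq_wo x y \<longleftrightarrow> wo_index x \<le> wo_index y"
definition less_wo :: "'a wo \<Rightarrow> 'a wo \<Rightarrow> bool" where "less_wo x y \<longleftrightarrow> wo_index x < wo_index y"
instance
proof
  fix x y z :: "'a wo"
  show "x < y \<longleftrightarrow> x \<le> y \<and> \<not> y \<le> x" "x \<le> x" "x \<le> y \<or> y \<le> x" by (auto simp: less_eq_wo_def less_wo_def)
  show "x \<le> y \<Longrightarrow> y \<le> z \<Longrightarrow> x \<le> z" by (simp add: less_eq_wo_def)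
  show "x \<le> y \<Longrightarrow> y \<le> x \<Longrightarrow> x = y" using inj_wo_index by (auto simp: less_eq_wo_def dest: injD)
next
  fix P :: "'a wo \<Rightarrow> bool" and a
  assume step: "\<And>x. (\<And>y. y < x \<Longrightarrow> P y) \<Longrightarrow> P x"
  show "P a"
  proof (rule measure_induct_rule[where f = wo_index and P = P])
    fix x :: "'a wo" assume "\<And>y. wo_index y < wo_index x \<Longrightarrow> P y"
    then show "P x" by - (rule step, simp add: less_wo_def)
  qed
qed
end

lemma bij_Rep_wo: "bij Rep_wo"
  by (rule bijI') (auto simp: Rep_wo_inject intro: Abs_wo_inverse[symmetric])

lemma bij_Abs_wo: "bij Abs_wo"
  by (rule bijI') (auto simp: Abs_wo_inject intro: Rep_wo_inverse[symmetric])

lemma Rep_Abs_wo [simp]: "Rep_wo (Abs_wo i) = i"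
  by (rule Abs_wo_inverse) simp

text \<open>Conjugation by the bijection of index types matches the permutations of the Leibniz
  formula and preserves their signs.\<close>

lemma det_wo:
  fixes M :: "real ^ 'n ^ 'n::finite"
  shows "det (\<chi> i j. M $ Rep_wo i $ Rep_wo j) = det M"
proof -
  have iR: "inj Rep_wo" and iA: "inj Abs_wo" using bij_Rep_wo bij_Abs_wo by (auto simp: bij_def)
  have sR: "range Rep_wo = UNIV" and sA: "range Abs_wo = UNIV" using bij_Rep_wo bij_Abs_wo by (auto simp: bij_def)
  have mp: "map_permutation UNIV Rep_wo p = Rep_wo \<circ> p \<circ> Abs_wo" if "p permutes UNIV" for p :: "'n wo \<Rightarrow> 'n wo"
  proof
    fix i :: 'n
    show "map_permutation UNIV Rep_wo p i = (Rep_wo \<circ> p \<circ> Abs_wo) i"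
      using map_permutation_apply[OF iR, of "Abs_wo i" p] by simp
  qed
  have mq: "map_permutation UNIV Abs_wo q = Abs_wo \<circ> q \<circ> Rep_wo" for q :: "'n \<Rightarrow> 'n"
  proof
    fix i :: "'n wo"
    show "map_permutation UNIV Abs_wo q i = (Abs_wo \<circ> q \<circ> Rep_wo) i"
      using map_permutation_apply[OF iA, of "Rep_wo i" q] by (simp add: Rep_wo_inverse)
  qed
  show ?thesis unfolding det_def
  proof (rule sum.reindex_bij_witness[where i = "map_permutation UNIV Abs_wo" and j = "map_permutation UNIV Rep_wo"])
    fix p :: "'n wo \<Rightarrow> 'n wo" assume "p \<in> {p. p permutes UNIV}"
    then have p: "p permutes UNIV" by simp
    show "map_permutation UNIV Rep_wo p \<in> {p. p permutes UNIV}"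
      using map_permutation_permutes[OF _ p, of Rep_wo UNIV] bij_Rep_wo by simp
    show "map_permutation UNIV Abs_wo (map_permutation UNIV Rep_wo p) = p"
      unfolding mp[OF p] mq by (simp add: fun_eq_iff Rep_wo_inverse)
    have "(\<Prod>i\<in>UNIV. M $ i $ (Rep_wo \<circ> p \<circ> Abs_wo) i) = (\<Prod>i\<in>UNIV. M $ Rep_wo i $ Rep_wo (p i))"
      by (rule prod.reindex_bij_witness[where i = Rep_wo and j = Abs_wo]) (simp_all add: Rep_wo_inverse)
    then show "of_int (sign (map_permutation UNIV Rep_wo p)) * (\<Prod>i\<in>UNIV. M $ i $ map_permutation UNIV Rep_wo p i)
       = of_int (sign p) * (\<Prod>i\<in>UNIV. (\<chi> i j. M $ Rep_wo i $ Rep_wo j) $ i $ p i)"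
      using sign_map_permutation[OF iR p finite] by (simp add: mp[OF p])
  next
    fix q :: "'n \<Rightarrow> 'n" assume "q \<in> {p. p permutes UNIV}"
    then have q: "q permutes UNIV" by simp
    show q': "map_permutation UNIV Abs_wo q \<in> {p. p permutes UNIV}"
      using map_permutation_permutes[OF _ q, of Abs_wo UNIV] bij_Abs_wo by simp
    then show "map_permutation UNIV Rep_wo (map_permutation UNIV Abs_wo q) = q"
      unfolding mq by (subst mp) (simp_all add: mq fun_eq_iff)
  qed
qed

definition to_wo :: "real ^ 'n::finite \<Rightarrow> real ^ 'n wo" where "to_wo x = (\<chi> i. x $ Rep_wo i)"
definition of_wo :: "real ^ 'n wo \<Rightarrow> real ^ 'n::finite" where "of_wo y = (\<chi> i. y $ Abs_wo i)"

lemma wo_inverse [simp]: "of_wo (to_wo x) = x" "to_wo (of_wo y) = y"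
  by (simp_all add: to_wo_def of_wo_def vec_eq_iff Rep_wo_inverse)

lemma bounded_linear_wo: "bounded_linear (to_wo :: real ^ 'n::finite \<Rightarrow> _)" "bounded_linear (of_wo :: _ \<Rightarrow> real ^ 'n::finite)"
  by (intro linear_conv_bounded_linear[THEN iffD1] linearI; simp add: to_wo_def of_wo_def vec_eq_iff)+

lemma wo_measurable [measurable]: "to_wo \<in> borel \<rightarrow>\<^sub>M borel" "of_wo \<in> borel \<rightarrow>\<^sub>M borel"
  by (intro borel_measurable_continuous_onI linear_continuous_on bounded_linear_wo)+

lemma prod_Basis_vec:
  fixes v w :: "real ^ 'k::finite"
  shows "(\<Prod>b\<in>Basis. (v - w) \<bullet> b) = (\<Prod>i\<in>UNIV. v $ i - w $ i)"
proof -
  have B: "(Basis :: (real ^ 'k) set) = range (\<lambda>i. axis i 1)" by (auto simp: Basis_vec_def)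
  have "inj (\<lambda>i. axis i 1 :: real ^ 'k)" by (rule injI) (simp add: axis_eq_axis)
  from prod.reindex[OF this, of "\<lambda>b. (v - w) \<bullet> b"] show ?thesis
    unfolding B by (simp add: inner_axis)
qed

text \<open>Lebesgue measure is determined by its values on boxes, and reindexing coordinates only
  permutes the factors of their volumes.\<close>

lemma lborel_wo: "(lborel :: (real ^ 'n::finite wo) measure) = distr lborel borel to_wo"
proof (rule lborel_eqI)
  fix l u :: "real ^ 'n wo" assume le: "\<And>b. b \<in> Basis \<Longrightarrow> l \<bullet> b \<le> u \<bullet> b"
  have box: "to_wo -` box l u = box (of_wo l) (of_wo u)"
    by (auto simp: mem_box_cart to_wo_def of_wo_def) (metis Rep_Abs_wo Rep_wo_inverse)+
  note P = prod_Basis_vec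
  have le': "of_wo l $ i \<le> of_wo u $ i" for i
    using le[of "axis (Abs_wo i) 1"] by (simp add: of_wo_def inner_axis axis_in_Basis_iff)
  have "emeasure (distr lborel borel to_wo) (box l u) = emeasure lborel (box (of_wo l) (of_wo u))"
    by (simp add: emeasure_distr box)
  also have "\<dots> = ennreal (\<Prod>b\<in>Basis. (of_wo u - of_wo l) \<bullet> b)"
    by (rule emeasure_lborel_box) (use le' in \<open>auto simp: Basis_vec_def inner_axis\<close>)
  also have "(\<Prod>b\<in>Basis. (of_wo u - of_wo l) \<bullet> b) = (\<Prod>i\<in>UNIV. of_wo u $ i - of_wo l $ i)" by (rule P)
  also have "\<dots> = (\<Prod>i\<in>UNIV. u $ i - l $ i)"
    by (rule prod.reindex_bij_witness[where i = Rep_wo and j = Abs_wo]) (simp_all add: Rep_wo_inverse of_wo_def)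
  also have "\<dots> = (\<Prod>b\<in>Basis. (u - l) \<bullet> b)" by (rule P[symmetric])
  finally show "emeasure (distr lborel borel to_wo) (box l u) = ennreal (\<Prod>b\<in>Basis. (u - l) \<bullet> b)" .
qed simp

text \<open>Translates between nonnegative Lebesgue integrals, in which the volume is defined, and
  absolute integrability, in which the change of variables is available.\<close>

lemma nn_integral_iff_absolutely_integrable:
  fixes f :: "'a::euclidean_space \<Rightarrow> real"
  assumes m: "(\<lambda>x. indicator S x * f x) \<in> borel_measurable borel" and nn: "\<And>x. x \<in> S \<Longrightarrow> 0 \<le> f x"
  shows "f absolutely_integrable_on S \<and> integral S f = r \<longleftrightarrow>
    (\<integral>\<^sup>+x. ennreal (indicator S x * f x) \<partial>lborel) = ennreal r \<and> 0 \<le> r"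
proof
  assume L: "f absolutely_integrable_on S \<and> integral S f = r"
  then have h: "(f has_integral r) S"
    using set_lebesgue_integral_eq_integral(1) integrable_integral by blast
  show "(\<integral>\<^sup>+x. ennreal (indicator S x * f x) \<partial>lborel) = ennreal r \<and> 0 \<le> r"
    using nn_integral_has_integral_lebesgue[OF nn h] has_integral_nonneg[OF h nn] by simp
next
  assume R: "(\<integral>\<^sup>+x. ennreal (indicator S x * f x) \<partial>lborel) = ennreal r \<and> 0 \<le> r"
  have "((\<lambda>x. indicator S x * f x) has_integral r) UNIV"
    by (rule nn_integral_has_integral[OF m]) (use R nn in \<open>auto simp: indicator_def\<close>)
  moreover have "(\<lambda>x. indicator S x * f x) = (\<lambda>x. if x \<in> S then f x else 0)" by (auto simp: indicator_def)
  ultimately have h: "(f has_integral r) S" by (simp add: has_integral_restrict_UNIV)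
  then have "f absolutely_integrable_on S"
    using nn by (intro nonnegative_absolutely_integrable_1) auto
  then show "f absolutely_integrable_on S \<and> integral S f = r" using h by (simp add: integral_unique)
qed

lemma nn_change_of_variables_wellorder:
  fixes \<phi> :: "real ^ 'n::{finite,wellorder} \<Rightarrow> real ^ 'n::_" and f :: "real ^ 'n::_ \<Rightarrow> real"
  assumes S: "S \<in> sets borel" and der: "\<And>x. x \<in> S \<Longrightarrow> (\<phi> has_derivative \<phi>' x) (at x)" and inj: "inj_on \<phi> S"
    and m1: "(\<lambda>x. indicator (\<phi> ` S) x * f x) \<in> borel_measurable borel"
    and m2: "(\<lambda>x. indicator S x * (\<bar>det (matrix (\<phi>' x))\<bar> * f (\<phi> x))) \<in> borel_measurable borel"
    and nn: "\<And>x. x \<in> S \<Longrightarrow> 0 \<le> f (\<phi> x)"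
  shows "(\<integral>\<^sup>+x. ennreal (indicator (\<phi> ` S) x * f x) \<partial>lborel) = (\<integral>\<^sup>+x. ennreal (indicator S x * (\<bar>det (matrix (\<phi>' x))\<bar> * f (\<phi> x))) \<partial>lborel)"
proof -
  have "S \<in> sets lebesgue" using S by simp
  \<comment> \<open>The formula is for vector-valued functions; the scalar integrand is viewed in
    \<open>real ^ 1\<close>.\<close>
  from has_absolute_integral_change_of_variables[OF this has_derivative_at_withinI[OF der] inj, of "\<lambda>x. (vec (f x) :: real ^ 1)" "vec r" for r]
  have cov: "(\<lambda>x. \<bar>det (matrix (\<phi>' x))\<bar> * f (\<phi> x)) absolutely_integrable_on S \<and>
      integral S (\<lambda>x. \<bar>det (matrix (\<phi>' x))\<bar> * f (\<phi> x)) = r \<longleftrightarrow>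
     f absolutely_integrable_on (\<phi> ` S) \<and> integral (\<phi> ` S) f = r" for r
    by (simp add: absolutely_integrable_on_1_iff integral_on_1_eq)
  \<comment> \<open>The two integrals take the same finite values. This also settles the infinite
    case, since if one side were finite the other would have to be equal to it.\<close>
  have E: "(\<integral>\<^sup>+x. ennreal (indicator (\<phi> ` S) x * f x) \<partial>lborel) = ennreal r \<and> 0 \<le> r \<longleftrightarrow>
     (\<integral>\<^sup>+x. ennreal (indicator S x * (\<bar>det (matrix (\<phi>' x))\<bar> * f (\<phi> x))) \<partial>lborel) = ennreal r \<and> 0 \<le> r" for r
    using nn_integral_iff_absolutely_integrable[OF m1, of r] nn_integral_iff_absolutely_integrable[OF m2, of r] cov[of r] nn
    by auto
  show ?thesis
  proof (cases "\<integral>\<^sup>+x. ennreal (indicator (\<phi> ` S) x * f x) \<partial>lborel")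
    case (real r)
    then show ?thesis using E[of r] by simp
  next
    case top
    show ?thesis
    proof (cases "\<integral>\<^sup>+x. ennreal (indicator S x * (\<bar>det (matrix (\<phi>' x))\<bar> * f (\<phi> x))) \<partial>lborel")
      case (real r)
      then show ?thesis using E[of r] by simp
    qed (simp add: top)
  qed
qed

lemma nn_change_of_variables:
  fixes \<phi> :: "real ^ 'n::finite \<Rightarrow> real ^ 'n" and f :: "real ^ 'n \<Rightarrow> real"
  assumes S: "S \<in> sets borel" and der: "\<And>x. x \<in> S \<Longrightarrow> (\<phi> has_derivative \<phi>' x) (at x)" and inj: "inj_on \<phi> S"
    and m1: "(\<lambda>x. indicator (\<phi> ` S) x * f x) \<in> borel_measurable borel"
    and m2: "(\<lambda>x. indicator S x * (\<bar>det (matrix (\<phi>' x))\<bar> * f (\<phi> x))) \<in> borel_measurable borel"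
    and nn: "\<And>x. x \<in> S \<Longrightarrow> 0 \<le> f (\<phi> x)"
  shows "(\<integral>\<^sup>+x. ennreal (indicator (\<phi> ` S) x * f x) \<partial>lborel) = (\<integral>\<^sup>+x. ennreal (indicator S x * (\<bar>det (matrix (\<phi>' x))\<bar> * f (\<phi> x))) \<partial>lborel)"
proof -
  define \<psi> where "\<psi> = to_wo \<circ> \<phi> \<circ> of_wo"
  define \<psi>' where "\<psi>' y = to_wo \<circ> \<phi>' (of_wo y) \<circ> of_wo" for y
  define T where "T = of_wo -` S"
  have T: "T \<in> sets borel" unfolding T_def using measurable_sets[OF wo_measurable(2) S] by simp
  have d: "(\<psi> has_derivative \<psi>' y) (at y)" if "y \<in> T" for y
    unfolding \<psi>_def \<psi>'_def
    by (rule diff_chain_at[OF bounded_linear_imp_has_derivative[OF bounded_linear_wo(2)]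
          diff_chain_at[OF der bounded_linear_imp_has_derivative[OF bounded_linear_wo(1)]], unfolded o_assoc])
       (use that in \<open>simp add: T_def\<close>)
  have i: "inj_on \<psi> T"
    using inj by (auto simp: \<psi>_def T_def inj_on_def) (metis wo_inverse)
  have im: "y \<in> \<psi> ` T \<longleftrightarrow> of_wo y \<in> \<phi> ` S" for y
  proof
    assume "y \<in> \<psi> ` T" then show "of_wo y \<in> \<phi> ` S" by (auto simp: \<psi>_def T_def)
  next
    assume "of_wo y \<in> \<phi> ` S"
    then obtain x where x: "x \<in> S" "of_wo y = \<phi> x" by auto
    then have "y = \<psi> (to_wo x)" by (simp add: \<psi>_def flip: x(2))
    then show "y \<in> \<psi> ` T" using x by (auto simp: T_def)
  qed
  have det: "det (matrix (\<psi>' y)) = det (matrix (\<phi>' (of_wo y)))" for y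
  proof -
    have ax: "of_wo (axis j 1) = axis (Rep_wo j) 1" for j :: "'n wo"
      by (auto simp: of_wo_def vec_eq_iff axis_def Rep_wo_inverse)
    have "matrix (\<psi>' y) = (\<chi> i j. matrix (\<phi>' (of_wo y)) $ Rep_wo i $ Rep_wo j)"
      by (simp add: matrix_def \<psi>'_def ax vec_eq_iff) (simp add: to_wo_def)
    then show ?thesis by (simp add: det_wo)
  qed
  have m1': "(\<lambda>y. indicator (\<psi> ` T) y * f (of_wo y)) \<in> borel_measurable borel"
    using measurable_compose[OF wo_measurable(2) m1] by (simp add: indicator_def im)
  have m2': "(\<lambda>y. indicator T y * (\<bar>det (matrix (\<psi>' y))\<bar> * f (of_wo (\<psi> y)))) \<in> borel_measurable borel"
    using measurable_compose[OF wo_measurable(2) m2] by (simp add: indicator_def det T_def \<psi>_def)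
  have "(\<integral>\<^sup>+y. ennreal (indicator (\<psi> ` T) y * f (of_wo y)) \<partial>lborel) = (\<integral>\<^sup>+y. ennreal (indicator T y * (\<bar>det (matrix (\<psi>' y))\<bar> * f (of_wo (\<psi> y)))) \<partial>lborel)"
    by (rule nn_change_of_variables_wellorder[OF T d i m1' m2']) (use nn in \<open>auto simp: T_def \<psi>_def\<close>)
  moreover have "(\<integral>\<^sup>+y. ennreal (indicator (\<psi> ` T) y * f (of_wo y)) \<partial>lborel) = (\<integral>\<^sup>+x. ennreal (indicator (\<phi> ` S) x * f x) \<partial>lborel)"
    unfolding lborel_wo
    by (subst nn_integral_distr) (use m1' in \<open>simp_all add: indicator_def im\<close>)
  moreover have "(\<integral>\<^sup>+y. ennreal (indicator T y * (\<bar>det (matrix (\<psi>' y))\<bar> * f (of_wo (\<psi> y)))) \<partial>lborel)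
     = (\<integral>\<^sup>+x. ennreal (indicator S x * (\<bar>det (matrix (\<phi>' x))\<bar> * f (\<phi> x))) \<partial>lborel)"
    unfolding lborel_wo
    by (subst nn_integral_distr) (use m2' in \<open>simp_all add: indicator_def det T_def \<psi>_def\<close>)
  ultimately show ?thesis by simp
qed

section \<open>The divergence theorem in a chart\<close>

lemma dd_det_at_identity:
  fixes M :: "'a::real_normed_vector \<Rightarrow> real ^ 'n ^ 'n::finite"
  assumes d: "\<And>i j. (\<lambda>y. M y $ i $ j) differentiable (at x)" and id: "M x = mat 1"
  shows "dd v (\<lambda>y. det (M y)) x = (\<Sum>i\<in>UNIV. dd v (\<lambda>y. M y $ i $ i) x)"
proof -
  have P: "((\<lambda>y. \<Prod>i\<in>UNIV. M y $ i $ p i) has_derivative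
      (\<lambda>v. \<Sum>i\<in>UNIV. dd v (\<lambda>y. M y $ i $ p i) x * (\<Prod>j\<in>UNIV - {i}. M x $ j $ p j))) (at x)" for p
    by (rule has_derivative_prod) (rule has_derivative_dd[OF d])
  \<comment> \<open>A permutation other than the identity moves at least two indices, so after one
    factor is removed an off-diagonal entry of the identity matrix remains.\<close>
  have z: "(\<Prod>j\<in>UNIV - {i}. M x $ j $ p j) = 0" if p: "p permutes UNIV" "p \<noteq> id" for p i
  proof -
    obtain k where k: "p k \<noteq> k" using p(2) by (auto simp: fun_eq_iff)
    have "\<exists>j. j \<noteq> i \<and> p j \<noteq> j"
    proof (cases "k = i")
      case True
      have "p (p k) \<noteq> p k" using k permutes_inj[OF p(1)] by (auto dest: injD)
      then show ?thesis using k True by blast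
    qed (use k in blast)
    then obtain j where "j \<noteq> i" "p j \<noteq> j" by blast
    then show ?thesis by (intro prod_zero) (auto simp: id mat_def intro!: bexI[of _ j])
  qed
  have dP: "(\<lambda>y. of_int (sign p) * (\<Prod>i\<in>UNIV. M y $ i $ p i)) differentiable (at x)" for p
    by (rule differentiable_mult[OF differentiable_const differentiableI[OF P]])
  have fin: "finite {p :: 'n \<Rightarrow> 'n. p permutes UNIV}" by (rule finite_permutations) simp
  have "dd v (\<lambda>y. det (M y)) x = (\<Sum>p | p permutes UNIV. of_int (sign p) *
      (\<Sum>i\<in>UNIV. dd v (\<lambda>y. M y $ i $ p i) x * (\<Prod>j\<in>UNIV - {i}. M x $ j $ p j)))"
    unfolding det_def by (subst dd_sum, rule dP) (simp add: dd_cmult[OF differentiableI[OF P]] dd_eqI[OF P])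
  also have "\<dots> = (\<Sum>p\<in>{id}. of_int (sign p) *
      (\<Sum>i\<in>UNIV. dd v (\<lambda>y. M y $ i $ p i) x * (\<Prod>j\<in>UNIV - {i}. M x $ j $ p j)))"
    by (rule sum.mono_neutral_right[OF fin]) (auto simp: permutes_id z)
  finally show ?thesis by (simp add: id mat_def)
qed

text \<open>Jacobi's formula. Multiplication by the fixed inverse of \<open>F x\<close> reduces it
  to the derivative at the identity matrix, where it is the trace.\<close>

lemma dd_det:
  fixes F :: "'a::real_normed_vector \<Rightarrow> real ^ 'n ^ 'n::finite"
  assumes d: "\<And>i j. (\<lambda>y. F y $ i $ j) differentiable (at x)" and spd: "spd (F x)"
  shows "dd v (\<lambda>y. det (F y)) x = det (F x) * (\<Sum>p\<in>UNIV. \<Sum>q\<in>UNIV. matrix_inv (F x) $ p $ q * dd v (\<lambda>y. F y $ p $ q) x)"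
proof -
  let ?g = "matrix_inv (F x)"
  have dm: "(\<lambda>y. ?g $ i $ k * F y $ k $ j) differentiable (at x)" for i j k
    by (rule differentiable_mult[OF differentiable_const d])
  have ent: "(?g ** F y) $ i $ j = (\<Sum>k\<in>UNIV. ?g $ i $ k * F y $ k $ j)" for y i j
    by (simp add: matrix_matrix_mult_def)
  have dM: "(\<lambda>y. (?g ** F y) $ i $ j) differentiable (at x)" for i j
    unfolding ent by (intro differentiable_sum ballI dm finite)
  have "det (F x) * det ?g = 1"
    using spd_mult_inv[OF spd] by (metis det_I det_mul)
  then have e: "det (F y) = det (F x) * det (?g ** F y)" for y
    by (simp add: det_mul)
  have dd: "(\<lambda>y. det (?g ** F y)) differentiable (at x)"
  proof -
    have "(\<lambda>y. (\<Prod>i\<in>UNIV. (?g ** F y) $ i $ p i)) differentiable (at x)" for p :: "'n \<Rightarrow> 'n"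
      by (rule differentiableI[OF has_derivative_prod]) (rule has_derivative_dd[OF dM])
    then show ?thesis unfolding det_def
      by (intro differentiable_sum ballI differentiable_mult differentiable_const finite_permutations finite)
  qed
  have "dd v (\<lambda>y. det (F y)) x = det (F x) * dd v (\<lambda>y. det (?g ** F y)) x"
    by (subst e) (rule dd_cmult[OF dd])
  also have "dd v (\<lambda>y. det (?g ** F y)) x = (\<Sum>i\<in>UNIV. dd v (\<lambda>y. (?g ** F y) $ i $ i) x)"
    by (rule dd_det_at_identity[OF dM spd_inv_mult[OF spd]])
  also have "\<dots> = (\<Sum>i\<in>UNIV. \<Sum>k\<in>UNIV. ?g $ i $ k * dd v (\<lambda>y. F y $ k $ i) x)"
    unfolding ent by (simp add: dd_sum[OF dm] dd_cmult[OF d])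
  also have "\<dots> = (\<Sum>p\<in>UNIV. \<Sum>q\<in>UNIV. ?g $ p $ q * dd v (\<lambda>y. F y $ p $ q) x)"
    by (subst sum.swap) (simp add: spd_inv_sym[OF spd])
  finally show ?thesis .
qed

context metric_on
begin

text \<open>By Jacobi's formula and metric compatibility the logarithmic derivative of the volume
  density is the trace of the connection.\<close>

lemma dd_sqrt_det:
  assumes x: "x \<in> U"
  shows "dd v (\<lambda>y. sqrt (det (G y))) x = sqrt (det (G x)) * (\<Sum>p\<in>UNIV. Gam G x v (axis p 1) $ p)"
proof -
  note dG = smooth_on_differentiable[OF smooth_G_entry x]
  have pos: "det (G x) > 0" by (rule spd_det[OF spd_G[OF x]])
  have sd: "smooth_on U (\<lambda>y. det (G y))" by (rule smooth_on_det[OF open_dom smooth_G_entry])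
  have "dd v (\<lambda>y. det (G y)) x = det (G x) * trM (G x) (\<lambda>p q. ip (G x) (Gam G x v p) q + ip (G x) p (Gam G x v q))"
    unfolding dd_det[OF dG spd_G[OF x]] trM_def
    using metric_compat[OF x, where u = v] by (simp flip: ip_axis)
  also have "trM (G x) (\<lambda>p q. ip (G x) (Gam G x v p) q + ip (G x) p (Gam G x v q))
      = 2 * trM (G x) (\<lambda>p q. ip (G x) q (Gam G x v p))"
    unfolding trM_add using trM_flip[OF spd_G[OF x], of "\<lambda>p q. ip (G x) q (Gam G x v p)"]
    by (simp add: ip_sym[OF x])
  also have "trM (G x) (\<lambda>p q. ip (G x) q (Gam G x v p)) = (\<Sum>p\<in>UNIV. Gam G x v (axis p 1) $ p)"
    by (rule trM_endo[OF spd_G[OF x]])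
  finally have 1: "dd v (\<lambda>y. det (G y)) x = det (G x) * (2 * (\<Sum>p\<in>UNIV. Gam G x v (axis p 1) $ p))" .
  have "((\<lambda>y. sqrt (det (G y))) has_derivative (\<lambda>v. (inverse (sqrt (det (G x))) / 2) * dd v (\<lambda>y. det (G y)) x)) (at x)"
    using has_derivative_real_sqrt[OF pos has_derivative_dd[OF smooth_on_differentiable[OF sd x]]]
    by (simp add: field_simps)
  then have "dd v (\<lambda>y. sqrt (det (G y))) x = (inverse (sqrt (det (G x))) / 2) * dd v (\<lambda>y. det (G y)) x"
    by (rule dd_eqI)
  also have "\<dots> = (inverse (sqrt (det (G x))) / 2) * (det (G x) * (2 * (\<Sum>p\<in>UNIV. Gam G x v (axis p 1) $ p)))"
    by (simp only: 1)
  also have "\<dots> = sqrt (det (G x)) * (\<Sum>p\<in>UNIV. Gam G x v (axis p 1) $ p)"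
  proof -
    have "inverse (sqrt (det (G x))) / 2 * (det (G x) * 2) = sqrt (det (G x))"
      using pos by (simp add: real_div_sqrt flip: divide_inverse_commute)
    from arg_cong[OF this, of "\<lambda>z. z * (\<Sum>p\<in>UNIV. Gam G x v (axis p 1) $ p)"]
    show ?thesis by (simp only: mult.assoc)
  qed
  finally show ?thesis .
qed

text \<open>The k-th component of the vector density belonging to the covector field
  \<open>X\<close>: the trace evaluates to g^{kq} X_q. Its ordinary coordinate divergence is the
  covariant divergence times the volume density.\<close>

definition flux :: "(real ^ 'n \<Rightarrow> (real ^ 'n) list \<Rightarrow> real) \<Rightarrow> 'n \<Rightarrow> real ^ 'n \<Rightarrow> real" where
  "flux X k x = sqrt (det (G x)) * trM (G x) (\<lambda>p q. p $ k * X x [q])"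

lemma smooth_flux:
  assumes X: "stens 1 U X" shows "smooth_on U (flux X k)"
  unfolding flux_def
  by (intro smooth_on_mult smooth_trM smooth_on_const open_dom smooth_scalars stens_smooth[OF X]) simp

text \<open>The derivative of the density contributes the trace of the connection, and this cancels
  the connection term that arises from raising the index of \<open>X\<close>.\<close>

lemma divergence_flux:
  assumes X: "stens 1 U X" and x: "x \<in> U"
  shows "(\<Sum>k\<in>UNIV. pd k (flux X k) x) = sqrt (det (G x)) * trM (G x) (\<lambda>p q. cov (Gam G) X x [p, q])"
proof -
  define t where "t v = (\<Sum>p\<in>UNIV. Gam G x v (axis p 1) $ p)" for v
  let ?w = "sqrt (det (G x))"
  let ?Y = "\<lambda>k y. trM (G y) (\<lambda>p q. p $ k * X y [q])"
  have linX: "linear (\<lambda>q. X x [q])" using stens_mlin[OF X x] by simp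
  have dX: "(\<lambda>y. X y [q]) differentiable (at x)" for q by (rule stens_diff[OF X _ x]) simp
  have lnth: "linear (\<lambda>p :: real ^ 'n. p $ k)" for k by (rule bounded_linear.linear[OF bounded_linear_vec_nth])
  have dY: "dd v (?Y k) x = trM (G x) (\<lambda>p q. p $ k * cov (Gam G) X x [v, q]) - trM (G x) (\<lambda>p q. Gam G x v p $ k * X x [q])" for v k
  proof -
    have "dd v (?Y k) x = trM (G x) (\<lambda>p q. dd v (\<lambda>y. p $ k * X y [q]) x - Gam G x v p $ k * X x [q] - p $ k * X x [Gam G x v q])"
      by (rule dd_trM[OF x]) (intro linear_multc lnth linear_cmult linX differentiable_mult differentiable_const dX)+
    also have "\<dots> = trM (G x) (\<lambda>p q. p $ k * cov (Gam G) X x [v, q] - Gam G x v p $ k * X x [q])"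
      by (simp add: dd_cmult[OF dX] algebra_simps)
    finally show ?thesis by (simp only: trM_diff)
  qed
  have dw: "(\<lambda>y. sqrt (det (G y))) differentiable (at x)" by (rule smooth_on_differentiable[OF smooth_scalars(4) x])
  have dYd: "?Y k differentiable (at x)" for k
    by (rule smooth_on_differentiable[OF smooth_trM x])
       (intro smooth_on_mult smooth_on_const open_dom stens_smooth[OF X]; simp)
  have "pd k (flux X k) x = ?w * dd (axis k 1) (?Y k) x + ?w * t (axis k 1) * ?Y k x" for k
    unfolding pd_def flux_def[abs_def] by (simp add: dd_mult[OF dw dYd] dd_sqrt_det[OF x] t_def)
  then have "(\<Sum>k\<in>UNIV. pd k (flux X k) x) = ?w * ((\<Sum>k\<in>UNIV. dd (axis k 1) (?Y k) x) + (\<Sum>k\<in>UNIV. t (axis k 1) * ?Y k x))"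
    by (simp add: sum.distrib sum_distrib_left distrib_left mult.assoc)
  moreover have S: "(\<Sum>k\<in>UNIV. trM (G x) (B k)) = trM (G x) (\<lambda>p q. \<Sum>k\<in>UNIV. B k p q)" for B :: "'n \<Rightarrow> real ^ 'n \<Rightarrow> real ^ 'n \<Rightarrow> real"
    unfolding trM_def sum_distrib_left by (subst sum.swap, rule sum.cong[OF refl], rule sum.swap)
  have "(\<Sum>k\<in>UNIV. dd (axis k 1) (?Y k) x) = trM (G x) (\<lambda>p q. cov (Gam G) X x [p, q]) - trM (G x) (\<lambda>p q. t p * X x [q])"
  proof -
    have "(\<Sum>k\<in>UNIV. p $ k * cov (Gam G) X x [axis k 1, q]) = cov (Gam G) X x [p, q]" for p q
    proof -
      have "linear (\<lambda>p. cov (Gam G) X x [p, q])"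
        using stens_mlin[OF stens_cov[OF X] x] by (simp del: cov.simps)
      from linear_expand[OF this, of p] show ?thesis by (simp del: cov.simps)
    qed
    moreover have "(\<Sum>k\<in>UNIV. Gam G x (axis k 1) p $ k * X x [q]) = t p * X x [q]" for p q
      by (simp add: t_def sum_distrib_right sym[OF x, where u = p])
    ultimately show ?thesis unfolding dY sum_subtractf S by simp
  qed
  moreover have "(\<Sum>k\<in>UNIV. t (axis k 1) * ?Y k x) = trM (G x) (\<lambda>p q. t p * X x [q])"
  proof -
    have tsum: "t p = (\<Sum>k\<in>UNIV. p $ k * t (axis k 1))" for p
    proof -
      have "linear (\<lambda>p. t p)" unfolding t_def
        by (intro linear_compose_sum ballI linear_compose[OF linear_Gam(1) lnth, unfolded o_def])
      from linear_expand[OF this, of p] show ?thesis by simp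
    qed
    have "(\<Sum>k\<in>UNIV. t (axis k 1) * ?Y k x) = trM (G x) (\<lambda>p q. \<Sum>k\<in>UNIV. t (axis k 1) * (p $ k * X x [q]))"
      unfolding S[symmetric] trM_cmul ..
    also have "(\<lambda>p q. \<Sum>k\<in>UNIV. t (axis k 1) * (p $ k * X x [q])) = (\<lambda>p q. t p * X x [q])"
    proof (intro ext)
      fix p q
      have "(\<Sum>k\<in>UNIV. t (axis k 1) * (p $ k * X x [q])) = (\<Sum>k\<in>UNIV. p $ k * t (axis k 1)) * X x [q]"
        unfolding sum_distrib_right by (intro sum.cong refl) (simp only: mult_ac)
      then show "(\<Sum>k\<in>UNIV. t (axis k 1) * (p $ k * X x [q])) = t p * X x [q]" using tsum[of p] by simp
    qed
    finally show ?thesis .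
  qed
  ultimately show ?thesis by simp
qed

lemma divergence_flux_mult:
  assumes X: "stens 1 U X" and x: "x \<in> U" and r: "r differentiable (at x)"
  shows "(\<Sum>k\<in>UNIV. pd k (\<lambda>y. r y * flux X k y) x)
    = sqrt (det (G x)) * (r x * trM (G x) (\<lambda>p q. cov (Gam G) X x [p, q]) + trM (G x) (\<lambda>p q. dd p r x * X x [q]))"
proof -
  have df: "flux X k differentiable (at x)" for k by (rule smooth_on_differentiable[OF smooth_flux[OF X] x])
  have S: "(\<Sum>k\<in>UNIV. trM (G x) (B k)) = trM (G x) (\<lambda>p q. \<Sum>k\<in>UNIV. B k p q)" for B :: "'n \<Rightarrow> real ^ 'n \<Rightarrow> real ^ 'n \<Rightarrow> real"
    unfolding trM_def sum_distrib_left by (subst sum.swap, rule sum.cong[OF refl], rule sum.swap)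
  have "(\<Sum>k\<in>UNIV. dd (axis k 1) r x * flux X k x) = sqrt (det (G x)) * trM (G x) (\<lambda>p q. \<Sum>k\<in>UNIV. dd (axis k 1) r x * (p $ k * X x [q]))"
    unfolding S[symmetric] trM_cmul flux_def sum_distrib_left by (intro sum.cong refl) (simp only: mult_ac)
  also have "(\<lambda>p q. \<Sum>k\<in>UNIV. dd (axis k 1) r x * (p $ k * X x [q])) = (\<lambda>p q. dd p r x * X x [q])"
  proof (intro ext)
    fix p q
    show "(\<Sum>k\<in>UNIV. dd (axis k 1) r x * (p $ k * X x [q])) = dd p r x * X x [q]"
      by (subst dd_basis[OF r, of p]) (simp add: sum_distrib_left sum_distrib_right mult_ac)
  qed
  finally have 1: "(\<Sum>k\<in>UNIV. dd (axis k 1) r x * flux X k x) = sqrt (det (G x)) * trM (G x) (\<lambda>p q. dd p r x * X x [q])" .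
  have "(\<Sum>k\<in>UNIV. pd k (\<lambda>y. r y * flux X k y) x) = r x * (\<Sum>k\<in>UNIV. pd k (flux X k) x) + (\<Sum>k\<in>UNIV. dd (axis k 1) r x * flux X k x)"
    by (simp add: pd_def dd_mult[OF r df] sum.distrib sum_distrib_left)
  then show ?thesis unfolding 1 divergence_flux[OF X x] by (simp add: algebra_simps)
qed

end

text \<open>Translating \<open>f\<close> does not change its integral; differentiate in the translation.\<close>

lemma integral_dd_zero:
  fixes f :: "real ^ 'n::finite \<Rightarrow> real"
  assumes U: "open U" "cbox a b \<subseteq> U" and f: "Ck_on 1 U f" and 0: "\<And>x. x \<in> U \<Longrightarrow> x \<notin> cbox a b \<Longrightarrow> f x = 0"
  shows "integral (cbox a b) (\<lambda>x. dd e f x) = 0"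
proof -
  \<comment> \<open>Extension by 0 to the whole space. It is of class C^1 because the open sets
    \<open>U\<close> and the complement of the box cover the space, and on the latter it
    vanishes.\<close>
  define F where "F x = (if x \<in> U then f x else 0)" for x
  have FU: "Ck_on 1 U F" using Ck_on_cong[OF U(1), of F f 1] f by (simp add: F_def)
  have F0: "F x = 0" if "x \<notin> cbox a b" for x using 0 that by (simp add: F_def)
  have oc: "open (- cbox a b)" by (rule open_Compl) (rule closed_cbox)
  have FC: "Ck_on 1 (- cbox a b) F" using Ck_on_cong[OF oc, of F "\<lambda>x. 0" 1] F0 Ck_on_const by auto
  have F: "Ck_on 1 UNIV F"
  proof (rule Ck_on_local)
    fix x show "\<exists>T. open T \<and> x \<in> T \<and> Ck_on 1 T F"
      using U FU FC oc by (cases "x \<in> U") (blast, metis ComplI subsetD)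
  qed
  have Fd: "F differentiable (at x)" for x using F by simp
  have Fc: "continuous_on UNIV F" using Ck_on_mono[OF F, of 0] by simp
  have dFc: "continuous_on UNIV (\<lambda>x. dd e F x)" using F by simp
  have dF0: "dd e F x = 0" if "x \<notin> cbox a b" for x
  proof -
    have "dd e F x = dd e (\<lambda>x. 0) x" by (rule dd_cong[OF oc]) (use that F0 in auto)
    then show ?thesis by simp
  qed
  \<comment> \<open>A margin by which no translate of the support along \<open>t *\<^sub>R e\<close>
    with |t| at most 1 can leave the enlarged box: each coordinate moves by at most
    \<open>norm e\<close>.\<close>
  define N :: "real ^ 'n" where "N = (\<chi> i. norm e)"
  define B where "B = cbox (a - N) (b + N)"
  have AB: "cbox a b \<subseteq> B" by (auto simp: B_def N_def mem_box_cart intro: order_trans[OF _ add_increasing2] diff_le_eq[THEN iffD2])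
     (smt (verit) norm_ge_zero)+
  have inB: "x \<in> B" if "x + t *\<^sub>R e \<in> cbox a b" "\<bar>t\<bar> \<le> 1" for x t
  proof -
    have "\<bar>t * e $ i\<bar> \<le> norm e" for i
    proof -
      have "\<bar>t\<bar> * \<bar>e $ i\<bar> \<le> 1 * norm e" using that(2) by (intro mult_mono component_le_norm_cart) auto
      then show ?thesis by (simp add: abs_mult)
    qed
    then show ?thesis using that(1) unfolding B_def N_def mem_box_cart
      by (simp add: abs_le_iff) (smt (verit))
  qed
  have const: "integral B (\<lambda>x. F (x + t *\<^sub>R e)) = integral B F" if t: "\<bar>t\<bar> \<le> 1" for t
  proof -
    have c: "continuous_on B (\<lambda>x. F (x + t *\<^sub>R e))" for t
      by (rule continuous_on_compose2[OF Fc]) (auto intro!: continuous_intros)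
    have "integral B (\<lambda>x. F (x + t *\<^sub>R e)) = (LINT x|lborel. indicator B x *\<^sub>R F (x + t *\<^sub>R e))" if "\<bar>t\<bar> \<le> 1" for t
      using set_borel_integral_eq_integral(2)[of B "\<lambda>x. F (x + t *\<^sub>R e)"] borel_integrable_compact[OF _ c, of t] compact_cbox
      by (simp add: set_integrable_def set_lebesgue_integral_def B_def)
    moreover have "(LINT x|lborel. indicator B x *\<^sub>R F (x + t *\<^sub>R e)) = (LINT x|lborel. F (x + t *\<^sub>R e))" if t: "\<bar>t\<bar> \<le> 1" for t
    proof (rule Bochner_Integration.integral_cong[OF refl])
      fix x show "indicator B x *\<^sub>R F (x + t *\<^sub>R e) = F (x + t *\<^sub>R e)"
        using F0 inB[OF _ t, of x] by (auto simp: indicator_def)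
    qed
    moreover have "(LINT x|lborel. F (x + t *\<^sub>R e)) = (LINT x|lborel. F x)" for t
    proof -
      have "(LINT x|lborel. F x) = (LINT x|distr lborel borel ((+) (t *\<^sub>R e)). F x)" by (simp add: lborel_distr_plus)
      also have "\<dots> = (LINT x|lborel. F (t *\<^sub>R e + x))"
        by (rule integral_distr) (use Fc in \<open>auto intro: borel_measurable_continuous_onI\<close>)
      finally show ?thesis by (simp add: add.commute)
    qed
    ultimately have "integral B (\<lambda>x. F (x + t *\<^sub>R e)) = (LINT x|lborel. F x)" if "\<bar>t\<bar> \<le> 1" for t
      using that by (simp only:)
    from this[OF t] this[of 0] show ?thesis by simp
  qed
  have "((\<lambda>t. integral B (\<lambda>x. F (x + t *\<^sub>R e))) has_field_derivative integral B (\<lambda>x. dd e F (x + 0 *\<^sub>R e))) (at 0 within {-1<..<1})"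
    unfolding B_def
  proof (rule leibniz_rule_field_derivative)
    fix t :: real and x :: "real ^ 'n"
    have "((\<lambda>t. x + t *\<^sub>R e) has_derivative (\<lambda>h. h *\<^sub>R e)) (at t)" by (auto intro!: derivative_eq_intros)
    from has_derivative_compose[OF this has_derivative_dd[OF Fd]]
    have "((\<lambda>t. F (x + t *\<^sub>R e)) has_derivative (\<lambda>h. dd (h *\<^sub>R e) F (x + t *\<^sub>R e))) (at t)" .
    then show "((\<lambda>t. F (x + t *\<^sub>R e)) has_real_derivative dd e F (x + t *\<^sub>R e)) (at t within {-1<..<1})"
      by - (rule has_field_derivative_at_within, simp add: has_field_derivative_def dd_scale_dir[OF Fd] mult_commute_abs)
  next
    fix t show "(\<lambda>x. F (x + t *\<^sub>R e)) integrable_on cbox (a - N) (b + N)"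
      by (rule integrable_continuous) (rule continuous_on_compose2[OF Fc], auto intro!: continuous_intros)
  next
    show "continuous_on ({-1<..<1} \<times> cbox (a - N) (b + N)) (\<lambda>(t, x). dd e F (x + t *\<^sub>R e))"
      unfolding split_beta by (rule continuous_on_compose2[OF dFc]) (auto intro!: continuous_intros)
  qed auto
  then have "((\<lambda>t. integral B (\<lambda>x. F (x + t *\<^sub>R e))) has_field_derivative integral B (\<lambda>x. dd e F x)) (at 0)"
    by (simp add: at_within_open[of "0::real" "{-1<..<1}"])
  moreover have "((\<lambda>t. integral B (\<lambda>x. F (x + t *\<^sub>R e))) has_field_derivative 0) (at 0)"
    by (rule DERIV_cong_ev[THEN iffD2, OF refl _ refl DERIV_const[of "integral B F"]])
       (auto simp: eventually_nhds intro!: exI[of _ "{-1<..<1}"] const)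
  ultimately have "integral B (\<lambda>x. dd e F x) = 0" by (rule DERIV_unique)
  moreover have "integral B (\<lambda>x. dd e F x) = integral (cbox a b) (\<lambda>x. dd e F x)"
  proof -
    have "integral B (\<lambda>x. if x \<in> cbox a b then dd e F x else 0) = integral (cbox a b) (\<lambda>x. dd e F x)"
      using integral_restrict_Int[of B "cbox a b" "\<lambda>x. dd e F x"] AB by (simp add: Int_absorb1 Int_absorb2 Int_commute)
    moreover have "integral B (\<lambda>x. if x \<in> cbox a b then dd e F x else 0) = integral B (\<lambda>x. dd e F x)"
      by (rule integral_cong) (simp add: dF0)
    ultimately show ?thesis by simp
  qed
  moreover have "integral (cbox a b) (\<lambda>x. dd e F x) = integral (cbox a b) (\<lambda>x. dd e f x)"
    by (rule integral_cong) (rule dd_cong[OF U(1)], use U(2) in \<open>auto simp: F_def\<close>)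
  ultimately show ?thesis by simp
qed

section \<open>Cut-off functions of class C^1\<close>

lemma Ck_on_max_square: "Ck_on 1 UNIV (\<lambda>s::real. (max 0 s)\<^sup>2)"
proof -
  have d: "((\<lambda>s. (max 0 s)\<^sup>2) has_derivative (\<lambda>h. h * (2 * max 0 s))) (at s)" for s :: real
  proof (cases s "0::real" rule: linorder_cases)
    case less
    have "((\<lambda>s::real. 0) has_derivative (\<lambda>h. h * (2 * max 0 s))) (at s)" using less by simp
    then show ?thesis
      by (rule has_derivative_transform_within_open[of _ _ _ _ "{..<0}"]) (use less in auto)
  next
    case greater
    have "((\<lambda>s::real. s\<^sup>2) has_derivative (\<lambda>h. h * (2 * max 0 s))) (at s)"
      using greater by (auto intro!: derivative_eq_intros)
    then show ?thesis
      by (rule has_derivative_transform_within_open[of _ _ _ _ "{0<..}"]) (use greater in auto)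
  next
    case equal
    have "((\<lambda>h. (max 0 h)\<^sup>2 / h) \<longlongrightarrow> 0) (at (0::real))"
    proof (rule tendsto_sandwich[where f = "\<lambda>h. - \<bar>h\<bar>" and h = "\<lambda>h. \<bar>h\<bar>"])
      show "\<forall>\<^sub>F h in at (0::real). - \<bar>h\<bar> \<le> (max 0 h)\<^sup>2 / h" "\<forall>\<^sub>F h in at (0::real). (max 0 h)\<^sup>2 / h \<le> \<bar>h\<bar>"
        by (rule always_eventually, auto simp: max_def power2_eq_square)+
    qed (auto intro!: tendsto_eq_intros)
    then have "((\<lambda>s. (max 0 s)\<^sup>2) has_real_derivative 0) (at (0::real))"
      by (simp add: has_field_derivative_iff)
    then show ?thesis using equal by (simp add: has_field_derivative_def lambda_zero)
  qed
  have "continuous_on UNIV (\<lambda>s. dd v (\<lambda>s::real. (max 0 s)\<^sup>2) s)" for v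
    unfolding dd_eqI[OF d] by (intro continuous_intros)
  then show ?thesis using d by (simp add: differentiableI[OF d])
qed

text \<open>Squared positive parts vanish to second order on the faces of the box, which makes the
  product C^1. One derivative is enough, since partition functions are differentiated only once, in
  the divergence theorem.\<close>

definition bump :: "real ^ 'n \<Rightarrow> real ^ 'n \<Rightarrow> real ^ 'n::finite \<Rightarrow> real" where
  "bump a b x = (\<Prod>i\<in>UNIV. (max 0 (x $ i - a $ i))\<^sup>2 * (max 0 (b $ i - x $ i))\<^sup>2)"

lemma Ck_on_bump:
  fixes a b :: "real ^ 'n::finite"
  shows "Ck_on 1 UNIV (bump a b)"
proof -
  have l: "Ck_on 1 UNIV (\<lambda>x :: real ^ 'n. x $ i - a $ i)" "Ck_on 1 UNIV (\<lambda>x :: real ^ 'n. b $ i - x $ i)" for i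
    by (intro Ck_on_diff Ck_on_const Ck_on_linear bounded_linear_vec_nth open_UNIV)+
  show ?thesis unfolding bump_def[abs_def]
    by (intro Ck_on_prod Ck_on_mult open_UNIV Ck_on_compose[OF open_UNIV open_UNIV _ _ Ck_on_max_square] subset_UNIV l)
qed

lemma bump_nonneg: "0 \<le> bump a b x"
  by (auto simp: bump_def intro!: prod_nonneg)

lemma bump_pos: "x \<in> box a b \<Longrightarrow> 0 < bump a b x"
  unfolding bump_def mem_box_cart by (intro prod_pos mult_pos_pos zero_less_power ballI) (auto simp: less_max_iff_disj)

lemma bump_zero: "x \<notin> box a b \<Longrightarrow> bump a b x = 0"
proof -
  assume "x \<notin> box a b"
  then obtain i where "x $ i \<le> a $ i \<or> b $ i \<le> x $ i" by (auto simp: mem_box_cart not_less)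
  then have "(max 0 (x $ i - a $ i))\<^sup>2 * (max 0 (b $ i - x $ i))\<^sup>2 = 0" by (auto simp: max_def)
  then show ?thesis unfolding bump_def by (intro prod_zero) auto
qed

section \<open>Charts and the Riemannian volume\<close>

definition cinv :: "('a, 'n) chart \<Rightarrow> real ^ 'n \<Rightarrow> 'a" where
  "cinv c = inv_into (fst c) (snd c)"

locale manifold =
  fixes A :: "('a::t2_space, 'n::finite) chart set"
  assumes manifold: "closed_connected_manifold A"
begin

lemma atlas: "smooth_atlas A" and compact_M: "compact (UNIV :: 'a set)"
  using manifold by (auto simp: closed_connected_manifold_def)

lemma chart:
  assumes c: "c \<in> A"
  shows open_dom_chart: "open (fst c)" and open_img_chart: "open (img_chart c)"
    and inj_chart: "inj_on (snd c) (fst c)" and continuous_chart: "continuous_on (fst c) (snd c)"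
    and continuous_cinv: "continuous_on (img_chart c) (cinv c)"
proof -
  have "is_chart c" using atlas c by (simp add: smooth_atlas_def)
  then obtain \<psi> where o: "open (fst c)" "open (img_chart c)" and h: "homeomorphism (fst c) (img_chart c) (snd c) \<psi>"
    by (auto simp: is_chart_def)
  show "open (fst c)" "open (img_chart c)" by (fact o)+
  show i: "inj_on (snd c) (fst c)" by (rule inj_on_inverseI[where g = \<psi>]) (use h in \<open>auto simp: homeomorphism_def\<close>)
  show "continuous_on (fst c) (snd c)" using h by (auto simp: homeomorphism_def)
  have "cinv c x = \<psi> x" if "x \<in> img_chart c" for x
    using that h i by (auto simp: cinv_def homeomorphism_def)
  then show "continuous_on (img_chart c) (cinv c)"
    using h continuous_on_cong[OF refl, of "img_chart c" "cinv c" \<psi>] by (auto simp: homeomorphism_def)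
qed

lemma cinv_snd: "c \<in> A \<Longrightarrow> p \<in> fst c \<Longrightarrow> cinv c (snd c p) = p"
  unfolding cinv_def by (rule inv_into_f_f[OF inj_chart])

lemma snd_cinv: "x \<in> img_chart c \<Longrightarrow> snd c (cinv c x) = x"
  unfolding cinv_def by (rule f_inv_into_f)

lemma cinv_in: "x \<in> img_chart c \<Longrightarrow> cinv c x \<in> fst c"
  unfolding cinv_def by (rule inv_into_into)

lemma in_some_chart: "\<exists>c\<in>A. p \<in> fst c"
  using atlas unfolding smooth_atlas_def by blast

lemma transition_cinv: "transition c d x = snd d (cinv c x)"
  by (simp add: transition_def cinv_def)

lemma overlap_iff: "c \<in> A \<Longrightarrow> x \<in> overlap c d \<longleftrightarrow> x \<in> img_chart c \<and> cinv c x \<in> fst d"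
proof
  assume c: "c \<in> A"
  { assume "x \<in> overlap c d"
    then obtain p where "p \<in> fst c" "p \<in> fst d" "x = snd c p" unfolding overlap_def by blast
    then show "x \<in> img_chart c \<and> cinv c x \<in> fst d" by (simp add: cinv_snd[OF c]) }
  { assume x: "x \<in> img_chart c \<and> cinv c x \<in> fst d"
    then have "cinv c x \<in> fst c \<inter> fst d" "x = snd c (cinv c x)" by (simp_all add: snd_cinv cinv_in)
    then show "x \<in> overlap c d" unfolding overlap_def by (rule rev_image_eqI) }
qed

lemma overlap_subset: "overlap c d \<subseteq> img_chart c"
  by (auto simp: overlap_def)

lemma open_overlap:
  assumes "c \<in> A" "d \<in> A" shows "open (overlap c d)"
proof -
  have "overlap c d = img_chart c \<inter> cinv c -` fst d"
    by (rule set_eqI) (simp only: overlap_iff[OF assms(1)] Int_iff vimage_eq)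
  then show ?thesis
    using continuous_open_preimage[OF continuous_cinv[OF assms(1)] open_img_chart[OF assms(1)] open_dom_chart[OF assms(2)]] by simp
qed

lemma transition_in:
  assumes "c \<in> A" "d \<in> A" "x \<in> overlap c d"
  shows "transition c d x \<in> img_chart d" "cinv d (transition c d x) = cinv c x"
    "transition c d x \<in> overlap d c" "transition d c (transition c d x) = x"
proof -
  have x: "x \<in> img_chart c" "cinv c x \<in> fst d" using assms overlap_iff by auto
  show 1: "transition c d x \<in> img_chart d" using x by (simp add: transition_cinv)
  show 2: "cinv d (transition c d x) = cinv c x" using x assms by (simp add: transition_cinv cinv_snd)
  show "transition c d x \<in> overlap d c" using 1 2 x assms by (simp add: overlap_iff cinv_in)
  show "transition d c (transition c d x) = x"
    unfolding transition_cinv[of d c] 2 by (rule snd_cinv[OF x(1)])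
qed

lemma smooth_transition: "c \<in> A \<Longrightarrow> d \<in> A \<Longrightarrow> smooth_on (overlap c d) (transition c d)"
  using atlas by (simp add: smooth_atlas_def)

lemma jacobian_mult: "f differentiable (at x) \<Longrightarrow> jacobian_matrix f x *v u = dd u f x"
  unfolding jacobian_matrix_def
  by (rule matrix_works) (simp add: linear_matrix_vector_mul_eq linear_frechet_derivative)

text \<open>The matrix law read as an equality of bilinear forms, the shape in which local
  isometries are stated.\<close>

lemma tensor_law:
  assumes h: "sym_tensor A h" and cd: "c \<in> A" "d \<in> A" and x: "x \<in> overlap c d"
  shows "ip (h c x) u v = ip (h d (transition c d x)) (dd u (transition c d) x) (dd v (transition c d) x)"
proof -
  let ?J = "jacobian_matrix (transition c d) x"
  have d: "transition c d differentiable (at x)" by (rule smooth_on_differentiable[OF smooth_transition[OF cd] x])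
  have "h c x = transpose ?J ** h d (transition c d x) ** ?J" using h cd x by (simp add: sym_tensor_def)
  then have "ip (h c x) u v = u \<bullet> (transpose ?J *v (h d (transition c d x) *v (?J *v v)))"
    by (simp only: matrix_vector_mul_assoc matrix_mul_assoc)
  also have "\<dots> = (h d (transition c d x) *v (?J *v v)) \<bullet> (?J *v u)"
    by (simp add: inner_commute[of u] dot_lmul_matrix)
  finally show ?thesis by (simp add: jacobian_mult[OF d] inner_commute)
qed

text \<open>Invariance under transitions makes the chart picked by \<open>SOME\<close>
  irrelevant.\<close>

lemma scalar_field_chart:
  assumes S: "\<And>c d x. c \<in> A \<Longrightarrow> d \<in> A \<Longrightarrow> x \<in> overlap c d \<Longrightarrow> S c x = S d (transition c d x)"
    and c: "c \<in> A" "p \<in> fst c"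
  shows "scalar_field A S p = S c (snd c p)"
proof -
  define d where "d = (SOME d. d \<in> A \<and> p \<in> fst d)"
  have "d \<in> A \<and> p \<in> fst d" unfolding d_def by (rule someI_ex) (use c in blast)
  then have d: "d \<in> A" "p \<in> fst d" by auto
  have "snd d p \<in> overlap d c" using c d by (auto simp: overlap_def)
  from S[OF d(1) c(1) this] show ?thesis
    unfolding scalar_field_def Let_def d_def[symmetric]
    by (simp add: transition_cinv cinv_snd[OF d])
qed

lemma continuous_on_M:
  assumes "\<And>c. c \<in> A \<Longrightarrow> continuous_on (img_chart c) (\<lambda>x. f (cinv c x))"
  shows "continuous_on UNIV (f :: 'a \<Rightarrow> 'b::topological_space)"
proof -
  have "continuous (at p) f" for p
  proof -
    obtain c where c: "c \<in> A" "p \<in> fst c" using in_some_chart by blast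
    have "continuous_on (fst c) (\<lambda>p. f (cinv c (snd c p)))"
      by (rule continuous_on_compose2[OF assms[OF c(1)] continuous_chart[OF c(1)]]) simp
    then have "continuous_on (fst c) f"
      by (rule continuous_on_cong[THEN iffD1, rotated 2]) (simp_all add: cinv_snd[OF c(1)])
    then show ?thesis using c open_dom_chart[OF c(1)] by (simp add: continuous_on_eq_continuous_at)
  qed
  then show ?thesis by (simp add: continuous_on_eq_continuous_at)
qed

text \<open>Constant outside the image of the chart, so that the inverse chart becomes Borel
  measurable on all of coordinate space and measures can be pushed forward along it.\<close>

definition cinv0 :: "('a, 'n) chart \<Rightarrow> real ^ 'n \<Rightarrow> 'a" where
  "cinv0 c x = (if x \<in> img_chart c then cinv c x else undefined)"

lemma cinv0_measurable: "c \<in> A \<Longrightarrow> cinv0 c \<in> borel_measurable borel"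
proof (rule borel_measurableI)
  fix S :: "'a set" assume c: "c \<in> A" and S: "open S"
  have "cinv0 c -` S = (img_chart c \<inter> cinv c -` S) \<union> (if undefined \<in> S then - img_chart c else {})"
  proof (rule set_eqI)
    fix x show "x \<in> cinv0 c -` S \<longleftrightarrow> x \<in> (img_chart c \<inter> cinv c -` S) \<union> (if undefined \<in> S then - img_chart c else {})"
      by (cases "x \<in> img_chart c") (simp_all add: cinv0_def)
  qed
  moreover have "open (img_chart c \<inter> cinv c -` S)"
    by (rule continuous_open_preimage[OF continuous_cinv[OF c] open_img_chart[OF c] S])
  moreover have "- img_chart c \<in> sets borel" using open_img_chart[OF c] by (simp add: borel_open)
  ultimately show "cinv0 c -` S \<inter> space borel \<in> sets borel" by (simp add: borel_open)
qed

lemma image_chart_eq: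
  assumes c: "c \<in> A" and B: "B \<subseteq> fst c"
  shows "snd c ` B = img_chart c \<inter> cinv0 c -` B"
proof (intro set_eqI iffI)
  fix x assume "x \<in> snd c ` B"
  then obtain p where p: "p \<in> B" "x = snd c p" by auto
  then have "p \<in> fst c" using B by auto
  then show "x \<in> img_chart c \<inter> cinv0 c -` B" using p by (simp add: cinv0_def cinv_snd[OF c])
next
  fix x assume x: "x \<in> img_chart c \<inter> cinv0 c -` B"
  then have 1: "x \<in> img_chart c" and "cinv0 c x \<in> B" by simp_all
  then have "cinv c x \<in> B" by (simp only: cinv0_def if_True)
  then show "x \<in> snd c ` B" by (rule rev_image_eqI) (rule snd_cinv[OF 1, symmetric])
qed

lemma image_chart_borel:
  assumes c: "c \<in> A" and B: "B \<in> sets borel" "B \<subseteq> fst c"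
  shows "snd c ` B \<in> sets borel"
proof -
  have "cinv0 c -` B \<in> sets borel" using measurable_sets[OF cinv0_measurable[OF c] B(1)] by simp
  then show ?thesis unfolding image_chart_eq[OF c B(2)] using open_img_chart[OF c] by (auto simp: borel_open)
qed

end

section \<open>Existence and uniqueness of the Riemannian volume\<close>

definition chart_volume :: "('a, 'n::finite) tensor2 \<Rightarrow> ('a, 'n) chart \<Rightarrow> 'a set \<Rightarrow> ennreal" where
  "chart_volume g c B = (\<integral>\<^sup>+x. ennreal (indicator (snd c ` B) x * sqrt (det (g c x))) \<partial>lborel)"

definition is_volume :: "('a::topological_space, 'n::finite) chart set \<Rightarrow> ('a, 'n) tensor2 \<Rightarrow> 'a measure \<Rightarrow> bool" where
  "is_volume A g \<mu> \<longleftrightarrow> sets \<mu> = sets borel \<and>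
     (\<forall>c\<in>A. \<forall>B\<in>sets borel. B \<subseteq> dom_chart c \<longrightarrow> emeasure \<mu> B = chart_volume g c B)"

lemma volume_measure_the: "volume_measure A g = (THE \<mu>. is_volume A g \<mu>)"
proof -
  have "(\<lambda>x. ennreal (sqrt (det (g c x))) * indicator (snd c ` B) x) = (\<lambda>x. ennreal (indicator (snd c ` B) x * sqrt (det (g c x))))" for c B
    by (auto simp: indicator_def)
  then show ?thesis unfolding volume_measure_def is_volume_def chart_volume_def by simp
qed

text \<open>The defining property sees a metric only through its determinants. Rescaling a metric to
  a prescribed determinant therefore fixes its whole volume measure.\<close>

lemma volume_measure_cong:
  assumes "\<And>c x. c \<in> A \<Longrightarrow> x \<in> img_chart c \<Longrightarrow> det (g c x) = det (h c x)"
  shows "volume_measure A g = volume_measure A h"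
proof -
  have "chart_volume g c B = chart_volume h c B" if "c \<in> A" "B \<subseteq> dom_chart c" for c B
    unfolding chart_volume_def
  proof (rule nn_integral_cong)
    fix x
    show "ennreal (indicator (snd c ` B) x * sqrt (det (g c x))) = ennreal (indicator (snd c ` B) x * sqrt (det (h c x)))"
    proof (cases "x \<in> snd c ` B")
      case True
      then have "x \<in> img_chart c" using image_mono[OF that(2), of "snd c"] by blast
      then show ?thesis using assms[OF that(1)] by simp
    qed simp
  qed
  then have "is_volume A g = is_volume A h" by (auto simp: is_volume_def fun_eq_iff)
  then show ?thesis by (simp add: volume_measure_the)
qed

locale riem_manifold = manifold A for A :: "('a::t2_space, 'n::finite) chart set" +
  fixes g :: "('a, 'n) tensor2"
  assumes riem: "riemannian_metric A g"
begin

lemma sym_g: "sym_tensor A g"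
  using riem by (simp add: riemannian_metric_def)

lemma chart_metric: "c \<in> A \<Longrightarrow> metric_on (img_chart c) (g c)"
proof (rule metric_on.intro)
  assume c: "c \<in> A"
  show "open (img_chart c)" by (rule open_img_chart[OF c])
  show "smooth_on (img_chart c) (g c)" using riem c unfolding riemannian_metric_def sym_tensor_def by blast
  fix x assume x: "x \<in> img_chart c"
  have "transpose (g c x) = g c x" using riem c x unfolding riemannian_metric_def sym_tensor_def by metis
  moreover have "0 < ip (g c x) v v" if "v \<noteq> 0" for v
    using riem c x that unfolding riemannian_metric_def by metis
  ultimately show "spd (g c x)" by (simp add: spd_def)
qed

lemma transition_metric_map:
  assumes cd: "c \<in> A" "d \<in> A"
  shows "metric_map (overlap c d) (img_chart d) (g c) (g d) (transition c d)"
proof -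
  interpret c: metric_on "img_chart c" "g c" by (rule chart_metric[OF cd(1)])
  interpret d: metric_on "img_chart d" "g d" by (rule chart_metric[OF cd(2)])
  have sub: "x \<in> img_chart c" if "x \<in> overlap c d" for x using overlap_subset that by (rule subsetD)
  have 1: "metric_on (overlap c d) (g c)"
    by (rule metric_on.intro[OF open_overlap[OF cd] smooth_on_subset[OF c.smooth_G overlap_subset] c.spd_G[OF sub]])
  show ?thesis
  proof (rule metric_map.intro[OF 1 d.metric_on_axioms], rule metric_map_axioms.intro)
    show "smooth_on (overlap c d) (transition c d)" by (rule smooth_transition[OF cd])
    show "transition c d ` overlap c d \<subseteq> img_chart d" using transition_in(1)[OF cd] by blast
  qed (rule tensor_law[OF sym_g cd])
qed

lemma dens_measurable:
  assumes c: "c \<in> A" and B: "B \<in> sets borel" "B \<subseteq> fst c"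
  shows "(\<lambda>x. indicator (snd c ` B) x * sqrt (det (g c x))) \<in> borel_measurable borel"
proof -
  interpret c: metric_on "img_chart c" "g c" by (rule chart_metric[OF c])
  have 1: "(\<lambda>x. indicator (img_chart c) x *\<^sub>R sqrt (det (g c x))) \<in> borel_measurable borel"
    by (rule borel_measurable_continuous_on_indicator)
       (use open_img_chart[OF c] smooth_on_continuous[OF c.smooth_scalars(4)] in \<open>auto simp: borel_open\<close>)
  have 2: "(indicator (snd c ` B) :: _ \<Rightarrow> real) \<in> borel_measurable borel"
    using image_chart_borel[OF c B] by simp
  have "(\<lambda>x. indicator (snd c ` B) x * (indicator (img_chart c) x *\<^sub>R sqrt (det (g c x)))) \<in> borel_measurable borel"
    by (rule borel_measurable_times[OF 2 1])
  moreover have "(\<lambda>x. indicator (snd c ` B) x * (indicator (img_chart c) x *\<^sub>R sqrt (det (g c x))))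
     = (\<lambda>x. indicator (snd c ` B) x * sqrt (det (g c x)))"
  proof
    fix x show "indicator (snd c ` B) x * (indicator (img_chart c) x *\<^sub>R sqrt (det (g c x))) = indicator (snd c ` B) x * sqrt (det (g c x))"
      using image_mono[OF B(2), of "snd c"] by (cases "x \<in> snd c ` B") (simp_all add: subset_iff)
  qed
  ultimately show ?thesis by simp
qed

text \<open>Change of variables for the transition map: the determinant of the metric changes by the
  square of the Jacobian determinant, so its root absorbs exactly the Jacobian factor.\<close>

lemma chart_volume_eq:
  assumes cd: "c \<in> A" "d \<in> A" and B: "B \<in> sets borel" "B \<subseteq> fst c" "B \<subseteq> fst d"
  shows "chart_volume g c B = chart_volume g d B"
proof -
  let ?\<phi> = "transition c d" and ?S = "snd c ` B"
  interpret m: metric_map "overlap c d" "img_chart d" "g c" "g d" ?\<phi> by (rule transition_metric_map[OF cd])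
  have S: "?S \<subseteq> overlap c d" using B by (auto simp: overlap_def)
  have im: "?\<phi> ` ?S = snd d ` B"
    using B cd by (force simp: transition_cinv cinv_snd image_image subset_iff)
  have inj: "inj_on ?\<phi> ?S"
    by (rule inj_on_inverseI[where g = "transition d c"]) (use S transition_in(4)[OF cd] in auto)
  have der: "(?\<phi> has_derivative frechet_derivative ?\<phi> (at x)) (at x)" if "x \<in> ?S" for x
    by (rule has_derivative_dd) (rule smooth_on_differentiable[OF smooth_transition[OF cd]], use S that in auto)
  have det: "\<bar>det (matrix (frechet_derivative ?\<phi> (at x)))\<bar> * sqrt (det (g d (?\<phi> x))) = sqrt (det (g c x))" if x: "x \<in> overlap c d" for x
  proof -
    have "g c x = transpose (jacobian_matrix ?\<phi> x) ** g d (?\<phi> x) ** jacobian_matrix ?\<phi> x"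
      using sym_g cd x by (simp add: sym_tensor_def)
    then have "det (g c x) = (det (jacobian_matrix ?\<phi> x))\<^sup>2 * det (g d (?\<phi> x))"
      by (simp add: det_mul det_transpose power2_eq_square mult_ac)
    then show ?thesis by (simp add: real_sqrt_mult jacobian_matrix_def)
  qed
  have e: "indicator ?S x * (\<bar>det (matrix (frechet_derivative ?\<phi> (at x)))\<bar> * sqrt (det (g d (?\<phi> x)))) = indicator ?S x * sqrt (det (g c x))" for x
  proof (cases "x \<in> ?S")
    case True
    then show ?thesis using det[of x] S by auto
  qed simp
  have "(\<integral>\<^sup>+x. ennreal (indicator (?\<phi> ` ?S) x * sqrt (det (g d x))) \<partial>lborel)
     = (\<integral>\<^sup>+x. ennreal (indicator ?S x * (\<bar>det (matrix (frechet_derivative ?\<phi> (at x)))\<bar> * sqrt (det (g d (?\<phi> x))))) \<partial>lborel)"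
  proof (rule nn_change_of_variables[OF image_chart_borel[OF cd(1) B(1,2)] der inj])
    show "(\<lambda>x. indicator (?\<phi> ` ?S) x * sqrt (det (g d x))) \<in> borel_measurable borel"
      unfolding im by (rule dens_measurable[OF cd(2) B(1,3)])
    show "(\<lambda>x. indicator ?S x * (\<bar>det (matrix (frechet_derivative ?\<phi> (at x)))\<bar> * sqrt (det (g d (?\<phi> x))))) \<in> borel_measurable borel"
      unfolding e by (rule dens_measurable[OF cd(1) B(1,2)])
    fix x assume "x \<in> ?S"
    then have "?\<phi> x \<in> img_chart d" using S transition_in(1)[OF cd] by auto
    then show "0 \<le> sqrt (det (g d (?\<phi> x)))" using spd_det[OF m.cod.spd_G] by (simp add: less_imp_le)
  qed
  then show ?thesis unfolding e im chart_volume_def by simp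
qed

text \<open>The part of the volume carried by \<open>D\<close>, pushed to the manifold. Points
  outside the image of the chart have density 0, so the arbitrary value of \<open>cinv0\<close>
  there is harmless.\<close>

definition chart_measure :: "('a, 'n) chart \<Rightarrow> 'a set \<Rightarrow> 'a measure" where
  "chart_measure c D = distr (density lborel (\<lambda>x. ennreal (indicator (snd c ` D) x * sqrt (det (g c x))))) borel (cinv0 c)"

lemma emeasure_chart_measure:
  assumes c: "c \<in> A" and D: "D \<in> sets borel" "D \<subseteq> fst c" and B: "B \<in> sets borel"
  shows "emeasure (chart_measure c D) B = chart_volume g c (B \<inter> D)"
proof -
  have m: "cinv0 c \<in> density lborel (\<lambda>x. ennreal (indicator (snd c ` D) x * sqrt (det (g c x)))) \<rightarrow>\<^sub>M borel"
    using cinv0_measurable[OF c] by simp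
  have v: "cinv0 c -` B \<in> sets borel" using measurable_sets[OF cinv0_measurable[OF c] B] by simp
  have "emeasure (chart_measure c D) B = emeasure (density lborel (\<lambda>x. ennreal (indicator (snd c ` D) x * sqrt (det (g c x))))) (cinv0 c -` B)"
    unfolding chart_measure_def by (subst emeasure_distr[OF m B]) simp
  also have "\<dots> = (\<integral>\<^sup>+x. ennreal (indicator (snd c ` D) x * sqrt (det (g c x))) * indicator (cinv0 c -` B) x \<partial>lborel)"
    by (rule emeasure_density) (use dens_measurable[OF c D] v in auto)
  also have "\<dots> = chart_volume g c (B \<inter> D)"
    unfolding chart_volume_def
  proof (rule nn_integral_cong)
    fix x
    have "x \<in> snd c ` (B \<inter> D) \<longleftrightarrow> x \<in> snd c ` D \<and> x \<in> cinv0 c -` B"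
      using image_chart_eq[OF c, of "B \<inter> D"] image_chart_eq[OF c D(2)] D(2) by auto
    then show "ennreal (indicator (snd c ` D) x * sqrt (det (g c x))) * indicator (cinv0 c -` B) x
       = ennreal (indicator (snd c ` (B \<inter> D)) x * sqrt (det (g c x)))"
      by (auto simp: indicator_def)
  qed
  finally show ?thesis .
qed

lemma chart_volume_sum:
  assumes c: "c \<in> A" and B: "B \<in> sets borel" "B \<subseteq> fst c" and D: "\<And>i. i < m \<Longrightarrow> D i \<in> sets borel"
    and disj: "disjoint_family_on D {..<m}" and cover: "(\<Union>i<m. D i) = UNIV"
  shows "chart_volume g c B = (\<Sum>i<(m::nat). chart_volume g c (B \<inter> D i))"
proof -
  have "(\<Sum>i<m. chart_volume g c (B \<inter> D i)) = (\<integral>\<^sup>+x. (\<Sum>i<m. ennreal (indicator (snd c ` (B \<inter> D i)) x * sqrt (det (g c x)))) \<partial>lborel)"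
    unfolding chart_volume_def
    by (rule nn_integral_sum[symmetric]) (use dens_measurable[OF c, of "B \<inter> D i" for i] B D in \<open>auto intro!: measurable_compose[OF _ measurable_ennreal]\<close>)
  also have "\<dots> = chart_volume g c B" unfolding chart_volume_def
  proof (rule nn_integral_cong)
    fix x
    show "(\<Sum>i<m. ennreal (indicator (snd c ` (B \<inter> D i)) x * sqrt (det (g c x)))) = ennreal (indicator (snd c ` B) x * sqrt (det (g c x)))"
    proof (cases "x \<in> snd c ` B")
      case True
      then obtain p where p: "p \<in> B" "x = snd c p" by auto
      obtain i where i: "i < m" "p \<in> D i" using cover by blast
      have "x \<in> snd c ` (B \<inter> D j) \<longleftrightarrow> j = i" if j: "j < m" for j
      proof
        assume "x \<in> snd c ` (B \<inter> D j)"
        then obtain q where q: "q \<in> B" "q \<in> D j" "x = snd c q" by auto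
        then have "q = p" using p inj_chart[OF c] B(2) by (auto dest: inj_onD)
        then show "j = i" using q i j disj by (auto simp: disjoint_family_on_def)
      qed (use p i in auto)
      then have "(\<Sum>j<m. ennreal (indicator (snd c ` (B \<inter> D j)) x * sqrt (det (g c x)))) = (\<Sum>j<m. if j = i then ennreal (sqrt (det (g c x))) else 0)"
        by (intro sum.cong refl) (simp add: indicator_def)
      then show ?thesis using i True by simp
    next
      case False
      then have "x \<notin> snd c ` (B \<inter> D j)" for j by auto
      then show ?thesis using False by simp
    qed
  qed
  finally show ?thesis by simp
qed

text \<open>A finite Borel partition into sets that each lie in one chart domain. Because the pieces
  are disjoint, chart measures can be added without correcting for overlaps.\<close>

lemma volume_pieces:
  obtains m :: nat and D cs where "\<And>i. i < m \<Longrightarrow> D i \<in> sets borel" "\<And>i. i < m \<Longrightarrow> cs i \<in> A" "\<And>i. i < m \<Longrightarrow> D i \<subseteq> fst (cs i)"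
    "disjoint_family_on D {..<m}" "(\<Union>i<m. D i) = (UNIV :: 'a set)"
proof -
  have "\<forall>T\<in>fst ` A. open T" using open_dom_chart by auto
  moreover have "UNIV \<subseteq> \<Union>(fst ` A)" using in_some_chart by auto
  ultimately obtain K where K: "K \<subseteq> fst ` A" "finite K" "UNIV \<subseteq> \<Union>K"
    using compactE[OF compact_M] by metis
  obtain ts where ts: "set ts = K" using finite_list[OF K(2)] by blast
  \<comment> \<open>Each member of a finite subcover without the earlier ones.\<close>
  define D where "D i = ts ! i - (\<Union>j<i. ts ! j)" for i
  have "\<exists>c. c \<in> A \<and> fst c = ts ! i" if "i < length ts" for i
    using K(1) ts nth_mem[OF that] by (metis imageE subsetD)
  then obtain cs where cs: "\<And>i. i < length ts \<Longrightarrow> cs i \<in> A \<and> fst (cs i) = ts ! i" by metis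
  have b: "ts ! i \<in> sets borel" if "i < length ts" for i using cs[OF that] open_dom_chart borel_open by metis
  show thesis
  proof (rule that[of "length ts" D cs])
    show "D i \<in> sets borel" if "i < length ts" for i unfolding D_def using b that by (intro sets.Diff sets.finite_UN) auto
    show "cs i \<in> A" "D i \<subseteq> fst (cs i)" if "i < length ts" for i using cs[OF that] by (auto simp: D_def)
    show "disjoint_family_on D {..<length ts}"
      unfolding disjoint_family_on_def D_def by (auto, metis lessThan_iff linorder_neqE_nat)
    show "(\<Union>i<length ts. D i) = UNIV"
    proof (intro set_eqI iffI UNIV_I)
      fix p :: 'a
      obtain i0 where "i0 < length ts" "p \<in> ts ! i0" using K(3) ts by (metis UNIV_I UnionE in_set_conv_nth subsetD)
      then have ex: "\<exists>i. i < length ts \<and> p \<in> ts ! i" by blast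
      define i where "i = (LEAST i. i < length ts \<and> p \<in> ts ! i)"
      have i: "i < length ts \<and> p \<in> ts ! i" unfolding i_def by (rule LeastI_ex[OF ex])
      have "p \<notin> ts ! j" if j: "j < i" for j
      proof
        assume "p \<in> ts ! j"
        then have "i \<le> j" unfolding i_def using i j by (intro Least_le) (simp add: i_def)
        then show False using j by simp
      qed
      then show "p \<in> (\<Union>i<length ts. D i)" using i by (auto simp: D_def)
    qed
  qed
qed

text \<open>Existence: the chart measures of the pieces are summed, and agreement with any other
  chart is \<open>chart_volume_eq\<close> on each piece. Uniqueness: any Borel set is the disjoint
  union of its intersections with the pieces, where the value is prescribed.\<close>

lemma is_volume_volume_measure: "is_volume A g (volume_measure A g)"
proof -
  obtain m :: nat and D cs where D: "\<And>i. i < m \<Longrightarrow> D i \<in> sets borel" and cs: "\<And>i. i < m \<Longrightarrow> cs i \<in> A" "\<And>i. i < m \<Longrightarrow> D i \<subseteq> fst (cs i)"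
    and disj: "disjoint_family_on D {..<m}" and cover: "(\<Union>i<m. D i) = (UNIV :: 'a set)"
    using volume_pieces by metis
  define M where "M B = (\<Sum>i<m. emeasure (chart_measure (cs i) (D i)) B)" for B
  define \<mu> where "\<mu> = measure_of UNIV (sets (borel :: 'a measure)) M"
  have sa: "sigma_algebra UNIV (sets (borel :: 'a measure))"
    using sets.sigma_algebra_axioms[of "borel :: 'a measure"] by simp
  have em: "emeasure \<mu> B = M B" if "B \<in> sets borel" for B
    unfolding \<mu>_def
  proof (rule emeasure_measure_of_sigma[OF sa _ _ that])
    show "positive (sets borel) M" by (simp add: positive_def M_def)
    show "countably_additive (sets borel) M"
    proof (rule countably_additiveI)
      fix F :: "nat \<Rightarrow> 'a set" assume F: "range F \<subseteq> sets borel" "disjoint_family F"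
      have "(\<Sum>n. M (F n)) = (\<Sum>i<m. \<Sum>n. emeasure (chart_measure (cs i) (D i)) (F n))"
        unfolding M_def by (rule suminf_sum) simp
      also have "\<dots> = M (\<Union>n. F n)" unfolding M_def
        by (intro sum.cong refl suminf_emeasure) (use F in \<open>auto simp: chart_measure_def\<close>)
      finally show "(\<Sum>n. M (F n)) = M (\<Union>n. F n)" .
    qed
  qed
  have s\<mu>: "sets \<mu> = sets borel" unfolding \<mu>_def using sigma_algebra.sets_measure_of_eq[OF sa] by simp
  have Msum: "M B = (\<Sum>i<m. chart_volume g (cs i) (B \<inter> D i))" if "B \<in> sets borel" for B
    unfolding M_def by (intro sum.cong refl emeasure_chart_measure cs D that) auto
  have vol: "is_volume A g \<mu>"
    unfolding is_volume_def
  proof (intro conjI ballI impI s\<mu>)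
    fix c B assume c: "c \<in> A" and B: "B \<in> sets borel" "B \<subseteq> fst c"
    have "chart_volume g c B = (\<Sum>i<m. chart_volume g c (B \<inter> D i))"
      by (rule chart_volume_sum[OF c B D disj cover])
    also have "\<dots> = (\<Sum>i<m. chart_volume g (cs i) (B \<inter> D i))"
      proof (intro sum.cong refl)
      fix i assume "i \<in> {..<m}"
      then have i: "i < m" by simp
      have 1: "B \<inter> D i \<in> sets borel" using B(1) D[OF i] by (rule sets.Int)
      have 2: "B \<inter> D i \<subseteq> fst c" "B \<inter> D i \<subseteq> fst (cs i)" using B(2) cs(2)[OF i] by blast+
      show "chart_volume g c (B \<inter> D i) = chart_volume g (cs i) (B \<inter> D i)"
        by (rule chart_volume_eq[OF c cs(1)[OF i] 1 2])
    qed
    finally show "emeasure \<mu> B = chart_volume g c B" by (simp add: em B Msum)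
  qed
  have uniq: "\<nu> = \<mu>" if \<nu>: "is_volume A g \<nu>" for \<nu>
  proof (rule measure_eqI)
    show "sets \<nu> = sets \<mu>" using \<nu> s\<mu> by (simp add: is_volume_def)
    fix B assume "B \<in> sets \<nu>"
    then have B: "B \<in> sets borel" using \<nu> by (simp add: is_volume_def)
    have "emeasure \<nu> B = emeasure \<nu> (\<Union>i<m. B \<inter> D i)" using cover by (intro arg_cong[where f = "emeasure \<nu>"]) auto
    also have "\<dots> = (\<Sum>i<m. emeasure \<nu> (B \<inter> D i))"
      by (rule sum_emeasure[symmetric]) (use \<nu> B D disj in \<open>auto simp: is_volume_def disjoint_family_on_def\<close>)
    also have "\<dots> = (\<Sum>i<m. chart_volume g (cs i) (B \<inter> D i))"
    proof (intro sum.cong refl)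
      fix i assume "i \<in> {..<m}"
      then have i: "i < m" by simp
      have "B \<inter> D i \<in> sets borel" "B \<inter> D i \<subseteq> fst (cs i)" "cs i \<in> A"
        using sets.Int[OF B D[OF i]] cs(1)[OF i] cs(2)[OF i] by blast+
      then show "emeasure \<nu> (B \<inter> D i) = chart_volume g (cs i) (B \<inter> D i)" using \<nu> by (simp add: is_volume_def)
    qed
    finally show "emeasure \<nu> B = emeasure \<mu> B" by (simp add: em B Msum)
  qed
  show ?thesis unfolding volume_measure_the by (rule theI[of "is_volume A g", OF vol uniq])
qed

abbreviation "vol \<equiv> volume_measure A g"

lemma sets_vol: "sets vol = sets borel"
  using is_volume_volume_measure by (simp add: is_volume_def)

lemma measurable_vol: "f \<in> borel_measurable borel \<Longrightarrow> f \<in> borel_measurable vol"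
  by (simp add: measurable_cong_sets[OF sets_vol refl])

lemma integral_chart:
  fixes f :: "'a \<Rightarrow> real"
  assumes c: "c \<in> A" and f: "f \<in> borel_measurable borel" and 0: "\<And>p. p \<notin> fst c \<Longrightarrow> f p = 0"
  shows "(LINT p|vol. f p) = (LINT x|lborel. indicator (img_chart c) x * sqrt (det (g c x)) * f (cinv c x))"
proof -
  interpret c: metric_on "img_chart c" "g c" by (rule chart_metric[OF c])
  have db: "fst c \<in> sets borel" using open_dom_chart[OF c] by (simp add: borel_open)
  \<comment> \<open>Restricted to the chart domain, the volume is the pushforward of the coordinate
    density; integrals are then transported through density and pushforward.\<close>
  have "density vol (\<lambda>p. ennreal (indicator (fst c) p)) = chart_measure c (fst c)"
  proof (rule measure_eqI)
    show "sets (density vol (\<lambda>p. ennreal (indicator (fst c) p))) = sets (chart_measure c (fst c))"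
      by (simp add: chart_measure_def sets_vol)
    fix B assume "B \<in> sets (density vol (\<lambda>p. ennreal (indicator (fst c) p)))"
    then have B: "B \<in> sets borel" by (simp add: sets_vol)
    have "emeasure (density vol (\<lambda>p. ennreal (indicator (fst c) p))) B = (\<integral>\<^sup>+p. ennreal (indicator (fst c) p) * indicator B p \<partial>vol)"
      by (rule emeasure_density) (use B db in \<open>auto simp: sets_vol intro!: measurable_vol\<close>)
    also have "\<dots> = (\<integral>\<^sup>+p. indicator (B \<inter> fst c) p \<partial>vol)"
      by (rule nn_integral_cong) (auto simp: indicator_def)
    also have "\<dots> = emeasure vol (B \<inter> fst c)" using B db by (intro nn_integral_indicator) (simp add: sets_vol)
    also have "\<dots> = chart_volume g c (B \<inter> fst c)"
      using is_volume_volume_measure c B db by (simp add: is_volume_def)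
    also have "\<dots> = emeasure (chart_measure c (fst c)) B"
      by (rule emeasure_chart_measure[OF c db _ B, symmetric]) simp
    finally show "emeasure (density vol (\<lambda>p. ennreal (indicator (fst c) p))) B = emeasure (chart_measure c (fst c)) B" .
  qed
  note eq = this
  have "(LINT p|vol. f p) = (LINT p|vol. indicator (fst c) p *\<^sub>R f p)"
    by (rule Bochner_Integration.integral_cong) (auto simp: 0 indicator_def)
  also have "\<dots> = (LINT p|density vol (\<lambda>p. ennreal (indicator (fst c) p)). f p)"
    by (rule integral_density[symmetric]) (use f db in \<open>auto intro!: measurable_vol\<close>)
  also have "\<dots> = (LINT p|chart_measure c (fst c). f p)" by (simp only: eq)
  also have "\<dots> = (LINT x|density lborel (\<lambda>x. ennreal (indicator (img_chart c) x * sqrt (det (g c x)))). f (cinv0 c x))"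
    unfolding chart_measure_def by (rule integral_distr) (use cinv0_measurable[OF c] f in auto)
  also have "\<dots> = (LINT x|lborel. (indicator (img_chart c) x * sqrt (det (g c x))) *\<^sub>R f (cinv0 c x))"
  proof (rule integral_density)
    show "(\<lambda>x. f (cinv0 c x)) \<in> borel_measurable lborel"
      using measurable_compose[OF cinv0_measurable[OF c] f] by simp
    show "(\<lambda>x. indicator (img_chart c) x * sqrt (det (g c x))) \<in> borel_measurable lborel"
      using dens_measurable[OF c db] by simp
    show "AE x in lborel. 0 \<le> indicator (img_chart c) x * sqrt (det (g c x))"
      using spd_det[OF c.spd_G] by (auto simp: indicator_def less_imp_le)
  qed
  also have "\<dots> = (LINT x|lborel. indicator (img_chart c) x * sqrt (det (g c x)) * f (cinv c x))"
    by (rule Bochner_Integration.integral_cong) (auto simp: cinv0_def indicator_def)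
  finally show ?thesis .
qed

end

section \<open>Partitions of unity and the divergence theorem\<close>

lemma Ck_on_1D:
  assumes "Ck_on 1 S f"
  shows "x \<in> S \<Longrightarrow> f differentiable (at x)" "continuous_on S (\<lambda>x. dd v f x)"
  using assms unfolding One_nat_def Ck_on.simps by blast+

context manifold
begin

text \<open>An index is a chart together with a box in its image. The bump lives on that box and is
  extended by 0 over the manifold; its support lies in the compact set \<open>core\<close>.\<close>

definition beta :: "('a, 'n) chart \<times> (real ^ 'n) \<times> (real ^ 'n) \<Rightarrow> 'a \<Rightarrow> real" where
  "beta = (\<lambda>(c, a, b) p. if p \<in> fst c then bump a b (snd c p) else 0)"

definition core :: "('a, 'n) chart \<times> (real ^ 'n) \<times> (real ^ 'n) \<Rightarrow> 'a set" where
  "core = (\<lambda>(c, a, b). cinv c ` cbox a b)"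

definition chart_box :: "('a, 'n) chart \<times> (real ^ 'n) \<times> (real ^ 'n) \<Rightarrow> bool" where
  "chart_box = (\<lambda>(c, a, b). c \<in> A \<and> cbox a b \<subseteq> img_chart c)"

definition cover :: "(('a, 'n) chart \<times> (real ^ 'n) \<times> (real ^ 'n)) set \<Rightarrow> bool" where
  "cover P \<longleftrightarrow> finite P \<and> (\<forall>i\<in>P. chart_box i) \<and> (\<forall>p. \<exists>i\<in>P. beta i p > 0)"

definition rho where
  "rho P i p = beta i p / (\<Sum>j\<in>P. beta j p)"

text \<open>The Hausdorff property enters here: the compact image of the box is closed, so the
  region where \<open>beta\<close> is 0 contains an open set around every point off the
  core.\<close>

lemma closed_core: "chart_box i \<Longrightarrow> closed (core i)"
proof -
  obtain c a b where i: "i = (c, a, b)" by (cases i)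
  assume "chart_box i"
  then have c: "c \<in> A" "cbox a b \<subseteq> img_chart c" by (simp_all add: i chart_box_def)
  have "compact (core i)" unfolding core_def i prod.case
    by (rule compact_continuous_image[OF continuous_on_subset[OF continuous_cinv[OF c(1)] c(2)] compact_cbox])
  then show ?thesis by (rule compact_imp_closed)
qed

lemma beta_core:
  assumes i: "chart_box i" and p: "p \<notin> core i" shows "beta i p = 0"
proof -
  obtain c a b where e: "i = (c, a, b)" by (cases i)
  have c: "c \<in> A" using i by (simp add: e chart_box_def)
  have "bump a b (snd c p) = 0" if "p \<in> fst c"
  proof (rule bump_zero)
    show "snd c p \<notin> box a b"
    proof
      assume "snd c p \<in> box a b"
      then have "snd c p \<in> cbox a b" using box_subset_cbox by blast
      then have "cinv c (snd c p) \<in> core i" by (auto simp: core_def e)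
      then show False using p cinv_snd[OF c that] by simp
    qed
  qed
  then show ?thesis by (simp add: beta_def e)
qed

lemma open_off_core:
  assumes i: "chart_box i" and d: "d \<in> A" shows "open (img_chart d \<inter> cinv d -` (- core i))"
  by (rule continuous_open_preimage[OF continuous_cinv[OF d] open_img_chart[OF d] open_Compl[OF closed_core[OF i]]])

lemma core_subset: "chart_box (c, a, b) \<Longrightarrow> core (c, a, b) \<subseteq> fst c"
proof
  assume box: "chart_box (c, a, b)"
  fix p assume "p \<in> core (c, a, b)"
  then obtain x where x: "x \<in> cbox a b" "p = cinv c x" unfolding core_def prod.case by (elim imageE)
  have "x \<in> img_chart c" using box x(1) unfolding chart_box_def prod.case by (elim conjE) (rule subsetD)
  then show "p \<in> fst c" unfolding x(2) by (rule cinv_in)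
qed

lemma beta_nonneg: "0 \<le> beta i p"
  by (cases i) (simp add: beta_def bump_nonneg)

text \<open>Seen from another chart \<open>d\<close>, the function is either a bump composed with a
  transition map, over the domain of its own chart, or 0, off the core. These two open regions cover
  the image of \<open>d\<close>.\<close>

lemma Ck_on_beta:
  assumes i: "chart_box i" and d: "d \<in> A" shows "Ck_on 1 (img_chart d) (\<lambda>x. beta i (cinv d x))"
proof (rule Ck_on_local)
  obtain c a b where e: "i = (c, a, b)" by (cases i)
  have c: "c \<in> A" using i by (simp add: e chart_box_def)
  fix x assume x: "x \<in> img_chart d"
  show "\<exists>T. open T \<and> x \<in> T \<and> Ck_on 1 T (\<lambda>x. beta i (cinv d x))"
  proof (cases "cinv d x \<in> fst c")
    case True
    have "x \<in> overlap d c" using x True by (simp add: overlap_iff[OF d])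
    moreover have "Ck_on 1 (overlap d c) (\<lambda>x. beta i (cinv d x))"
    proof (rule Ck_on_congD[OF open_overlap[OF d c]])
      show "Ck_on 1 (overlap d c) (\<lambda>x. bump a b (transition d c x))"
        by (rule Ck_on_compose[OF open_overlap[OF d c] open_UNIV subset_UNIV smooth_on_Ck[OF smooth_transition[OF d c]] Ck_on_bump])
      show "beta i (cinv d y) = bump a b (transition d c y)" if "y \<in> overlap d c" for y
        using that by (simp add: overlap_iff[OF d] beta_def e transition_cinv)
    qed
    ultimately show ?thesis using open_overlap[OF d c] by blast
  next
    case False
    then have "cinv d x \<notin> core i" using core_subset[of c a b] i unfolding e by (auto dest: subsetD)
    then have "x \<in> img_chart d \<inter> cinv d -` (- core i)" using x by simp
    moreover have "Ck_on 1 (img_chart d \<inter> cinv d -` (- core i)) (\<lambda>x. beta i (cinv d x))"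
      by (rule Ck_on_congD[OF open_off_core[OF i d] _ Ck_on_const[of 1 _ 0]]) (simp add: beta_core[OF i])
    ultimately show ?thesis using open_off_core[OF i d] by blast
  qed
qed

lemma continuous_beta: "chart_box i \<Longrightarrow> continuous_on UNIV (beta i)"
  by (rule continuous_on_M) (use Ck_on_mono[OF Ck_on_beta, of i _ 0] in simp)

lemma cover_exists: "\<exists>P. cover P"
proof -
  have ex: "\<exists>i. chart_box i \<and> beta i p > 0" for p
  proof -
    obtain c where c: "c \<in> A" "p \<in> fst c" using in_some_chart by blast
    obtain a b where ab: "cbox a b \<subseteq> img_chart c" "snd c p \<in> box a b"
      by (rule open_contains_cbox[OF open_img_chart[OF c(1)], of "snd c p"]) (use c in auto)
    then have "chart_box (c, a, b)" "beta (c, a, b) p > 0"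
      using c bump_pos[OF ab(2)] by (simp_all add: chart_box_def beta_def)
    then show ?thesis by (intro exI[of _ "(c, a, b)"] conjI)
  qed
  then obtain I where I: "\<And>p. chart_box (I p)" "\<And>p. beta (I p) p > 0" by metis
  have op: "open {q. beta (I p) q > 0}" for p
    using open_Collect_less[OF continuous_on_const continuous_beta[OF I(1)], of 0 p] by simp
  obtain C where C: "finite C" "UNIV \<subseteq> (\<Union>p\<in>C. {q. beta (I p) q > 0})"
  proof (rule compactE_image[OF compact_M, of UNIV "\<lambda>p. {q. beta (I p) q > 0}"])
    show "UNIV \<subseteq> (\<Union>p\<in>UNIV. {q. beta (I p) q > 0})" using I(2) by auto
  qed (use op in auto)
  have "cover (I ` C)" unfolding cover_def
  proof (intro conjI ballI allI)
    show "finite (I ` C)" using C by simp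
    show "chart_box i" if "i \<in> I ` C" for i using that I by auto
    fix p
    have "p \<in> (\<Union>p\<in>C. {q. beta (I p) q > 0})" using C(2) by blast
    then show "\<exists>i\<in>I ` C. beta i p > 0" by auto
  qed
  then show ?thesis by blast
qed

context
  fixes P assumes P: "cover P"
begin

lemma P_finite: "finite P" and P_box: "i \<in> P \<Longrightarrow> chart_box i"
  using P by (auto simp: cover_def)

lemma P_D: "(c, a, b) \<in> P \<Longrightarrow> c \<in> A" "(c, a, b) \<in> P \<Longrightarrow> cbox a b \<subseteq> img_chart c"
  using P_box[of "(c, a, b)"] by (simp_all add: chart_box_def)

lemma beta_sum_pos: "(\<Sum>j\<in>P. beta j p) > 0"
proof -
  obtain i where "i \<in> P" "beta i p > 0" using P unfolding cover_def by blast
  then show ?thesis using P_finite beta_nonneg by (intro sum_pos2[of P i]) auto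
qed

lemma rho_sum: "(\<Sum>i\<in>P. rho P i p) = 1"
  using beta_sum_pos[of p] by (simp add: rho_def flip: sum_divide_distrib)

lemma rho_nonneg: "0 \<le> rho P i p"
  using beta_sum_pos[of p] beta_nonneg[of i p] by (simp add: rho_def)

lemma rho_core: "i \<in> P \<Longrightarrow> p \<notin> core i \<Longrightarrow> rho P i p = 0"
  using beta_core[OF P_box] by (simp add: rho_def)

lemma Ck_on_rho:
  assumes i: "i \<in> P" and d: "d \<in> A" shows "Ck_on 1 (img_chart d) (\<lambda>x. rho P i (cinv d x))"
proof -
  have o: "open (img_chart d)" by (rule open_img_chart[OF d])
  have s: "Ck_on 1 (img_chart d) (\<lambda>x. \<Sum>j\<in>P. beta j (cinv d x))"
    by (intro Ck_on_sum o Ck_on_beta P_box d)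
  have "Ck_on 1 (img_chart d) (\<lambda>x. (\<Sum>j\<in>P. beta j (cinv d x)) powr (- 1))"
    by (rule Ck_on_compose[OF o open_greaterThan _ s Ck_on_powr]) (use beta_sum_pos in auto)
  from Ck_on_mult[OF o Ck_on_beta[OF P_box[OF i] d] this]
  show ?thesis using beta_sum_pos by (simp add: rho_def powr_minus divide_inverse less_imp_le)
qed

lemma continuous_rho: "i \<in> P \<Longrightarrow> continuous_on UNIV (rho P i)"
  by (rule continuous_on_M) (use Ck_on_mono[OF Ck_on_rho, of i _ 0] in simp)

end

end

section \<open>Integrals over the manifold as weighted sums over boxes\<close>

definition functional_density :: "real \<Rightarrow> real \<Rightarrow> (real ^ 'n \<Rightarrow> real ^ 'n ^ 'n) \<Rightarrow> real ^ 'n::finite \<Rightarrow> real" where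
  "functional_density s \<tau> G x = riem_norm2 G x + s * ricci_norm2 G x + \<tau> * (scal G x)\<^sup>2"

locale finite_riem_manifold = riem_manifold A g for A :: "('a::t2_space, 'n::finite) chart set" and g +
  assumes volume_finite: "emeasure vol UNIV = 1"
begin

lemma space_vol: "space vol = UNIV"
  using sets_eq_imp_space_eq[OF sets_vol] by simp

lemma integrable_continuous_M:
  fixes f :: "'a \<Rightarrow> real"
  assumes f: "continuous_on UNIV f" shows "integrable vol f"
proof -
  interpret finite_measure vol by (rule finite_measureI) (simp add: space_vol volume_finite)
  have "compact (f ` UNIV)" by (rule compact_continuous_image[OF f compact_M])
  then obtain B where "\<And>p. norm (f p) \<le> B" using compact_imp_bounded bounded_iff by (metis rangeI)
  then show ?thesis
    by (intro integrable_const_bound[of _ B]) (auto intro!: measurable_vol borel_measurable_continuous_onI f)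
qed

text \<open>From here on integration over the manifold is integration of continuous functions over
  compact boxes.\<close>

lemma integral_chart_box:
  fixes h :: "'a \<Rightarrow> real"
  assumes box: "chart_box (c, a, b)" and h: "continuous_on UNIV h" and 0: "\<And>p. p \<notin> core (c, a, b) \<Longrightarrow> h p = 0"
  shows "(LINT p|vol. h p) = integral (cbox a b) (\<lambda>x. h (cinv c x) * sqrt (det (g c x)))"
proof -
  have c: "c \<in> A" "cbox a b \<subseteq> img_chart c" using box by (simp_all add: chart_box_def)
  interpret c: metric_on "img_chart c" "g c" by (rule chart_metric[OF c(1)])
  have 00: "h (cinv c x) = 0" if "x \<in> img_chart c" "x \<notin> cbox a b" for x
  proof (rule 0)
    show "cinv c x \<notin> core (c, a, b)"
    proof
      assume "cinv c x \<in> core (c, a, b)"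
      then obtain y where y: "y \<in> cbox a b" "cinv c x = cinv c y" by (auto simp: core_def)
      then have "x = y" using snd_cinv[OF that(1)] snd_cinv[of y c] c(2) by (metis subsetD)
      then show False using y that by simp
    qed
  qed
  have cont: "continuous_on (cbox a b) (\<lambda>x. h (cinv c x) * sqrt (det (g c x)))"
    by (intro continuous_on_mult continuous_on_compose2[OF h] continuous_on_subset[OF continuous_cinv[OF c(1)] c(2)]
        continuous_on_subset[OF smooth_on_continuous[OF c.smooth_scalars(4)] c(2)]) simp
  have "(LINT p|vol. h p) = (LINT x|lborel. indicator (img_chart c) x * sqrt (det (g c x)) * h (cinv c x))"
    by (rule integral_chart[OF c(1) borel_measurable_continuous_onI[OF h]]) (rule 0, use core_subset[OF box] in \<open>auto dest: subsetD\<close>)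
  also have "\<dots> = (LINT x:cbox a b|lborel. h (cinv c x) * sqrt (det (g c x)))"
    unfolding set_lebesgue_integral_def
  proof (rule Bochner_Integration.integral_cong[OF refl])
    fix x
    show "indicator (img_chart c) x * sqrt (det (g c x)) * h (cinv c x) = indicator (cbox a b) x *\<^sub>R (h (cinv c x) * sqrt (det (g c x)))"
      using 00[of x] c(2) by (cases "x \<in> img_chart c"; cases "x \<in> cbox a b") (simp_all add: subset_iff)
  qed
  also have "\<dots> = integral (cbox a b) (\<lambda>x. h (cinv c x) * sqrt (det (g c x)))"
    by (rule set_borel_integral_eq_integral(2))
       (unfold set_integrable_def, rule borel_integrable_compact[OF compact_cbox cont])
  finally show ?thesis .
qed

lemma integral_partition:
  fixes f :: "'a \<Rightarrow> real"
  assumes P: "cover P" and f: "continuous_on UNIV f"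
  shows "(LINT p|vol. f p) = (\<Sum>(c, a, b)\<in>P. integral (cbox a b) (\<lambda>x. rho P (c, a, b) (cinv c x) * (f (cinv c x) * sqrt (det (g c x)))))"
proof -
  have cont: "continuous_on UNIV (\<lambda>p. rho P i p * f p)" if "i \<in> P" for i
    by (rule continuous_on_mult[OF continuous_rho[OF P that] f])
  have "(LINT p|vol. f p) = (LINT p|vol. (\<Sum>i\<in>P. rho P i p * f p))"
    by (simp add: rho_sum[OF P] flip: sum_distrib_right)
  also have "\<dots> = (\<Sum>i\<in>P. LINT p|vol. rho P i p * f p)"
    by (rule Bochner_Integration.integral_sum) (rule integrable_continuous_M[OF cont])
  also have "\<dots> = (\<Sum>(c, a, b)\<in>P. integral (cbox a b) (\<lambda>x. rho P (c, a, b) (cinv c x) * (f (cinv c x) * sqrt (det (g c x)))))"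
  proof (intro sum.cong refl)
    fix i assume i: "i \<in> P"
    obtain c a b where e: "i = (c, a, b)" by (cases i)
    have "(LINT p|vol. rho P i p * f p) = integral (cbox a b) (\<lambda>x. rho P i (cinv c x) * f (cinv c x) * sqrt (det (g c x)))"
      by (rule integral_chart_box) (use P_box[OF P i] cont[OF i] rho_core[OF P i] e in auto)
    then show "(LINT p|vol. rho P i p * f p) = (case i of (c, a, b) \<Rightarrow>
       integral (cbox a b) (\<lambda>x. rho P (c, a, b) (cinv c x) * (f (cinv c x) * sqrt (det (g c x)))))"
      by (simp add: e mult.assoc)
  qed
  finally show ?thesis .
qed

text \<open>The weights \<open>rho\<close> and the boxes do not involve the metric. Along a curve of
  metrics all time dependence therefore sits in a smooth integrand over fixed compact boxes.\<close>

lemma functional_formula: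
  assumes P: "cover P"
  shows "curv_functional A s \<tau> g = (\<Sum>(c, a, b)\<in>P. integral (cbox a b)
     (\<lambda>x. rho P (c, a, b) (cinv c x) * (functional_density s \<tau> (g c) x * sqrt (det (g c x)))))"
proof -
  note T = metric_map.norms_transform[OF transition_metric_map]
  have 1: "scalar_field A (\<lambda>c. riem_norm2 (g c)) p = riem_norm2 (g c) (snd c p)" if "c \<in> A" "p \<in> fst c" for c p
    by (rule scalar_field_chart[OF _ that]) (rule T(1))
  have 2: "scalar_field A (\<lambda>c. ricci_norm2 (g c)) p = ricci_norm2 (g c) (snd c p)" if "c \<in> A" "p \<in> fst c" for c p
    by (rule scalar_field_chart[OF _ that]) (rule T(2))
  have 3: "scalar_field A (\<lambda>c x. (scal (g c) x)\<^sup>2) p = (scal (g c) (snd c p))\<^sup>2" if "c \<in> A" "p \<in> fst c" for c p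
    by (rule scalar_field_chart[OF _ that]) (rule arg_cong[OF T(3)])
  define f1 where "f1 = scalar_field A (\<lambda>c. riem_norm2 (g c))"
  define f2 where "f2 = scalar_field A (\<lambda>c. ricci_norm2 (g c))"
  define f3 where "f3 = scalar_field A (\<lambda>c x. (scal (g c) x)\<^sup>2)"
  have e: "f1 (cinv c x) = riem_norm2 (g c) x" "f2 (cinv c x) = ricci_norm2 (g c) x" "f3 (cinv c x) = (scal (g c) x)\<^sup>2"
    if c: "c \<in> A" and x: "x \<in> img_chart c" for c x
    unfolding f1_def f2_def f3_def using 1[OF c cinv_in[OF x]] 2[OF c cinv_in[OF x]] 3[OF c cinv_in[OF x]] snd_cinv[OF x] by simp_all
  have cont: "continuous_on UNIV f1" "continuous_on UNIV f2" "continuous_on UNIV f3"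
  proof -
    have h: "continuous_on (img_chart c) (\<lambda>x. f1 (cinv c x))" "continuous_on (img_chart c) (\<lambda>x. f2 (cinv c x))" "continuous_on (img_chart c) (\<lambda>x. f3 (cinv c x))"
      if c: "c \<in> A" for c
    proof -
      interpret c: metric_on "img_chart c" "g c" by (rule chart_metric[OF c])
      note sc = c.smooth_scalars[THEN smooth_on_continuous]
      show "continuous_on (img_chart c) (\<lambda>x. f1 (cinv c x))"
        by (rule continuous_on_cong[THEN iffD1, OF refl _ sc(1)]) (simp only: e[OF c])
      show "continuous_on (img_chart c) (\<lambda>x. f2 (cinv c x))"
        by (rule continuous_on_cong[THEN iffD1, OF refl _ sc(2)]) (simp only: e[OF c])
      show "continuous_on (img_chart c) (\<lambda>x. f3 (cinv c x))"
        by (rule continuous_on_cong[THEN iffD1, OF refl _ continuous_on_power[OF sc(3), of 2]]) (simp only: e[OF c])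
    qed
    show "continuous_on UNIV f1" by (rule continuous_on_M) (rule h(1))
    show "continuous_on UNIV f2" by (rule continuous_on_M) (rule h(2))
    show "continuous_on UNIV f3" by (rule continuous_on_M) (rule h(3))
  qed
  have i: "integrable vol f1" "integrable vol f2" "integrable vol f3" by (intro integrable_continuous_M cont)+
  have "curv_functional A s \<tau> g = (LINT p|vol. f1 p) + s * (LINT p|vol. f2 p) + \<tau> * (LINT p|vol. f3 p)"
    by (simp add: curv_functional_def f1_def f2_def f3_def)
  also have "\<dots> = (LINT p|vol. f1 p + s * f2 p + \<tau> * f3 p)" using i by simp
  also have "\<dots> = (\<Sum>(c, a, b)\<in>P. integral (cbox a b) (\<lambda>x. rho P (c, a, b) (cinv c x) * ((f1 (cinv c x) + s * f2 (cinv c x) + \<tau> * f3 (cinv c x)) * sqrt (det (g c x)))))"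
    by (rule integral_partition[OF P]) (intro continuous_on_add continuous_on_mult continuous_on_const cont)
  also have "\<dots> = (\<Sum>(c, a, b)\<in>P. integral (cbox a b) (\<lambda>x. rho P (c, a, b) (cinv c x) * (functional_density s \<tau> (g c) x * sqrt (det (g c x)))))"
  proof (rule sum.cong[OF refl], clarify, rule integral_cong)
    fix c1 c2 a b x assume i: "((c1, c2), a, b) \<in> P" and x: "x \<in> cbox a b"
    show "rho P ((c1, c2), a, b) (cinv (c1, c2) x) * ((f1 (cinv (c1, c2) x) + s * f2 (cinv (c1, c2) x) + \<tau> * f3 (cinv (c1, c2) x)) * sqrt (det (g (c1, c2) x)))
      = rho P ((c1, c2), a, b) (cinv (c1, c2) x) * (functional_density s \<tau> (g (c1, c2)) x * sqrt (det (g (c1, c2) x)))"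
      using e[OF P_D(1)[OF P i] subsetD[OF P_D(2)[OF P i] x]] by (simp add: functional_density_def)
  qed
  finally show ?thesis .
qed

text \<open>In its box each \<open>rho\<close> times the flux vanishes on the boundary, which trades
  the weighted divergence for minus the pairing of d rho with \<open>X\<close>. These pairings sum
  to 0 because the weights sum to 1. As the boxes lie in different charts, the summation is possible
  only after the pairings have been made into functions on the manifold.\<close>

lemma divergence_theorem:
  assumes P: "cover P" and X: "\<And>c. c \<in> A \<Longrightarrow> stens 1 (img_chart c) (X c)"
    and law: "\<And>c d x v. c \<in> A \<Longrightarrow> d \<in> A \<Longrightarrow> x \<in> overlap c d \<Longrightarrow> X c x [v] = X d (transition c d x) [dd v (transition c d) x]"
  shows "(\<Sum>(c, a, b)\<in>P. integral (cbox a b) (\<lambda>x. rho P (c, a, b) (cinv c x) *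
     (sqrt (det (g c x)) * trM (g c x) (\<lambda>p q. cov (Gam (g c)) (X c) x [p, q])))) = 0"
proof -
  \<comment> \<open>The metric pairing of d rho_i with \<open>X\<close>, in the chart
    \<open>d\<close>.\<close>
  define sig where "sig i d x = trM (g d x) (\<lambda>p q. dd p (\<lambda>y. rho P i (cinv d y)) x * X d x [q])" for i d x
  have rd: "(\<lambda>y. rho P i (cinv d y)) differentiable (at x)" if "i \<in> P" "d \<in> A" "x \<in> img_chart d" for i d x
    by (rule Ck_on_1D(1)[OF Ck_on_rho[OF P that(1,2)] that(3)])
  have sig_law: "sig i c x = sig i d (transition c d x)" if i: "i \<in> P" and cd: "c \<in> A" "d \<in> A" and x: "x \<in> overlap c d" for i c d x
  proof -
    interpret m: metric_map "overlap c d" "img_chart d" "g c" "g d" "transition c d" by (rule transition_metric_map[OF cd])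
    let ?\<phi> = "transition c d"
    have y: "?\<phi> x \<in> img_chart d" by (rule m.phi_V[OF x])
    have "dd p (\<lambda>y. rho P i (cinv c y)) x = dd (dd p ?\<phi> x) (\<lambda>z. rho P i (cinv d z)) (?\<phi> x)" for p
    proof -
      have "dd p (\<lambda>y. rho P i (cinv c y)) x = dd p (\<lambda>y. rho P i (cinv d (?\<phi> y))) x"
        by (rule dd_cong[OF open_overlap[OF cd] x]) (simp add: transition_in(2)[OF cd])
      also have "\<dots> = dd (dd p ?\<phi> x) (\<lambda>z. rho P i (cinv d z)) (?\<phi> x)"
        by (rule dd_compose[OF smooth_on_differentiable[OF m.phi_smooth x] rd[OF i cd(2) y]])
      finally show ?thesis .
    qed
    then have "sig i c x = trM (g c x) (\<lambda>p q. dd (dd p ?\<phi> x) (\<lambda>z. rho P i (cinv d z)) (?\<phi> x) * X d (?\<phi> x) [dd q ?\<phi> x])"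
      unfolding sig_def by (simp add: law[OF cd x])
    also have "\<dots> = sig i d (?\<phi> x)" unfolding sig_def
    proof (rule trM_pullback[OF m.dom.spd_G[OF x] m.linear_J[OF x] m.isometric[OF x]])
      have "linear (\<lambda>q. X d (?\<phi> x) [q])" using stens_mlin[OF X[OF cd(2)] y] by simp
      then show "bilinear (\<lambda>p q. dd p (\<lambda>z. rho P i (cinv d z)) (?\<phi> x) * X d (?\<phi> x) [q])"
        by (rule bilinear_mult[OF dd_linear[OF rd[OF i cd(2) y]]])
    qed
    finally show ?thesis .
  qed
  \<comment> \<open>The pairing as a function on the manifold; \<open>sig_law\<close> makes it
    independent of the chart.\<close>
  define sg where "sg i = scalar_field A (sig i)" for i
  have sg: "sg i (cinv c x) = sig i c x" if "i \<in> P" "c \<in> A" "x \<in> img_chart c" for i c x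
    unfolding sg_def using scalar_field_chart[of "sig i", OF sig_law[OF that(1)] that(2) cinv_in[OF that(3)]] snd_cinv[OF that(3)] by simp
  have sg_cont: "continuous_on UNIV (sg i)" if i: "i \<in> P" for i
  proof (rule continuous_on_M)
    fix c assume c: "c \<in> A"
    interpret c: metric_on "img_chart c" "g c" by (rule chart_metric[OF c])
    have d1: "continuous_on (img_chart c) (\<lambda>x. dd p (\<lambda>y. rho P i (cinv c y)) x)" for p
      by (rule Ck_on_1D(2)[OF Ck_on_rho[OF P i c]])
    have d2: "continuous_on (img_chart c) (\<lambda>x. X c x [q])" for q
      by (rule smooth_on_continuous[OF stens_smooth[OF X[OF c]]]) simp
    have "continuous_on (img_chart c) (sig i c)"
      unfolding sig_def[abs_def] trM_def
      by (intro continuous_on_sum continuous_on_mult d1 d2 smooth_on_continuous[OF c.smooth_ginv[unfolded ginv_def]])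
    then show "continuous_on (img_chart c) (\<lambda>x. sg i (cinv c x))"
      by (rule continuous_on_cong[THEN iffD1, OF refl, rotated]) (simp add: sg[OF i c])
  qed
  have sg_0: "sg i p = 0" if i: "i \<in> P" and p: "p \<notin> core i" for i p
  proof -
    obtain d where d: "d \<in> A" "p \<in> fst d" using in_some_chart by blast
    have x: "snd d p \<in> img_chart d" using d by simp
    have x2: "snd d p \<in> img_chart d \<inter> cinv d -` (- core i)" using x p cinv_snd[OF d] by simp
    have "dd v (\<lambda>y. rho P i (cinv d y)) (snd d p) = dd v (\<lambda>y. 0) (snd d p)" for v
      by (rule dd_cong[OF open_off_core[OF P_box[OF P i] d(1)] x2]) (simp add: rho_core[OF P i])
    then have "sig i d (snd d p) = 0" by (simp add: sig_def trM_zero)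
    then show ?thesis using sg[OF i d(1) x] cinv_snd[OF d] by simp
  qed
  \<comment> \<open>All pairings at \<open>p\<close> are written in one chart around
    \<open>p\<close>, where the constant sum of the weights is differentiated.\<close>
  have sg_sum: "(\<Sum>i\<in>P. sg i p) = 0" for p
  proof -
    obtain d where d: "d \<in> A" "p \<in> fst d" using in_some_chart by blast
    have x: "snd d p \<in> img_chart d" using d by simp
    have "sg i p = sig i d (snd d p)" if "i \<in> P" for i using sg[OF that d(1) x] cinv_snd[OF d] by simp
    then have "(\<Sum>i\<in>P. sg i p) = (\<Sum>i\<in>P. sig i d (snd d p))" by simp
    also have "\<dots> = trM (g d (snd d p)) (\<lambda>v q. \<Sum>i\<in>P. dd v (\<lambda>y. rho P i (cinv d y)) (snd d p) * X d (snd d p) [q])"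
      unfolding sig_def trM_def sum_distrib_left by (subst sum.swap, rule sum.cong[OF refl], rule sum.swap)
    also have "\<dots> = 0"
    proof -
      have "(\<Sum>i\<in>P. dd v (\<lambda>y. rho P i (cinv d y)) (snd d p)) = dd v (\<lambda>y. \<Sum>i\<in>P. rho P i (cinv d y)) (snd d p)" for v
        by (rule dd_sum[symmetric]) (rule rd[OF _ d(1) x])
      then have "(\<Sum>i\<in>P. dd v (\<lambda>y. rho P i (cinv d y)) (snd d p)) = 0" for v by (simp add: rho_sum[OF P])
      then show ?thesis by (simp add: trM_zero flip: sum_distrib_right)
    qed
    finally show ?thesis .
  qed
  \<comment> \<open>Product rule for the divergence of \<open>rho\<close> times the flux, whose
    integral over the box is 0.\<close>
  have loc: "integral (cbox a b) (\<lambda>x. rho P (c, a, b) (cinv c x) * (sqrt (det (g c x)) * trM (g c x) (\<lambda>p q. cov (Gam (g c)) (X c) x [p, q])))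
     = - (LINT p|vol. sg (c, a, b) p)" if i: "(c, a, b) \<in> P" for c a b
  proof -
    note c = P_D[OF P i]
    let ?U = "img_chart c" and ?r = "\<lambda>y. rho P (c, a, b) (cinv c y)"
    interpret c: metric_on "img_chart c" "g c" by (rule chart_metric[OF c(1)])
    note Xc = X[OF c(1)]
    have r0: "?r x = 0" if "x \<in> ?U" "x \<notin> cbox a b" for x
    proof (rule rho_core[OF P i])
      show "cinv c x \<notin> core (c, a, b)"
      proof
        assume "cinv c x \<in> core (c, a, b)"
        then obtain y where y: "y \<in> cbox a b" "cinv c x = cinv c y" by (auto simp: core_def)
        then have "x = y" using snd_cinv[OF that(1)] snd_cinv[of y c] c(2) by (metis subsetD)
        then show False using y that by simp
      qed
    qed
    have C1: "Ck_on 1 ?U (\<lambda>y. ?r y * c.flux (X c) k y)" for k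
      by (rule Ck_on_mult[OF c.open_dom Ck_on_rho[OF P i c(1)] smooth_on_Ck[OF c.smooth_flux[OF Xc]]])
    have z: "integral (cbox a b) (\<lambda>x. pd k (\<lambda>y. ?r y * c.flux (X c) k y) x) = 0" for k
      unfolding pd_def by (rule integral_dd_zero[OF c.open_dom c(2) C1]) (simp add: r0)
    have ci: "(\<lambda>x. pd k (\<lambda>y. ?r y * c.flux (X c) k y) x) integrable_on cbox a b" for k
      unfolding pd_def by (rule integrable_continuous, rule continuous_on_subset[OF Ck_on_1D(2)[OF C1] c(2)])
    have "0 = (\<Sum>k\<in>UNIV. integral (cbox a b) (\<lambda>x. pd k (\<lambda>y. ?r y * c.flux (X c) k y) x))" by (simp add: z)
    also have "\<dots> = integral (cbox a b) (\<lambda>x. \<Sum>k\<in>UNIV. pd k (\<lambda>y. ?r y * c.flux (X c) k y) x)"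
      by (rule integral_sum[symmetric]) (simp_all add: ci)
    also have "\<dots> = integral (cbox a b) (\<lambda>x. ?r x * (sqrt (det (g c x)) * trM (g c x) (\<lambda>p q. cov (Gam (g c)) (X c) x [p, q]))
       + sg (c, a, b) (cinv c x) * sqrt (det (g c x)))"
    proof (rule integral_cong)
      fix x assume "x \<in> cbox a b"
      then have x: "x \<in> ?U" using c(2) by blast
      show "(\<Sum>k\<in>UNIV. pd k (\<lambda>y. ?r y * c.flux (X c) k y) x) = ?r x * (sqrt (det (g c x)) * trM (g c x) (\<lambda>p q. cov (Gam (g c)) (X c) x [p, q]))
       + sg (c, a, b) (cinv c x) * sqrt (det (g c x))"
        unfolding c.divergence_flux_mult[OF Xc x rd[OF i c(1) x]] sg[OF i c(1) x] sig_def by (simp only: distrib_left mult_ac)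
    qed
    also have "\<dots> = integral (cbox a b) (\<lambda>x. ?r x * (sqrt (det (g c x)) * trM (g c x) (\<lambda>p q. cov (Gam (g c)) (X c) x [p, q])))
       + integral (cbox a b) (\<lambda>x. sg (c, a, b) (cinv c x) * sqrt (det (g c x)))"
    proof (rule Henstock_Kurzweil_Integration.integral_add; rule integrable_continuous)
      have cr: "continuous_on (cbox a b) ?r" 
        by (rule continuous_on_subset[OF _ c(2)]) (use Ck_on_mono[OF Ck_on_rho[OF P i c(1)], of 0] in simp)
      have cw: "continuous_on (cbox a b) (\<lambda>x. sqrt (det (g c x)))" by (rule continuous_on_subset[OF smooth_on_continuous[OF c.smooth_scalars(4)] c(2)])
      have "smooth_on ?U (\<lambda>x. cov (Gam (g c)) (X c) x [p, q])" for p q by (rule stens_smooth[OF c.stens_cov[OF Xc]]) simp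
      then have "smooth_on ?U (\<lambda>x. trM (g c x) (\<lambda>p q. cov (Gam (g c)) (X c) x [p, q]))" by (rule c.smooth_trM)
      then have ct: "continuous_on (cbox a b) (\<lambda>x. trM (g c x) (\<lambda>p q. cov (Gam (g c)) (X c) x [p, q]))"
        using continuous_on_subset[OF smooth_on_continuous c(2)] by blast
      show "continuous_on (cbox a b) (\<lambda>x. ?r x * (sqrt (det (g c x)) * trM (g c x) (\<lambda>p q. cov (Gam (g c)) (X c) x [p, q])))"
        by (intro continuous_on_mult cr cw ct)
      show "continuous_on (cbox a b) (\<lambda>x. sg (c, a, b) (cinv c x) * sqrt (det (g c x)))"
        by (intro continuous_on_mult cw continuous_on_compose2[OF sg_cont[OF i] continuous_on_subset[OF continuous_cinv[OF c(1)] c(2)]]) simp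
    qed
    also have "integral (cbox a b) (\<lambda>x. sg (c, a, b) (cinv c x) * sqrt (det (g c x))) = (LINT p|vol. sg (c, a, b) p)"
      by (rule integral_chart_box[OF P_box[OF P i] sg_cont[OF i] sg_0[OF i], symmetric])
    finally show ?thesis by simp
  qed
  have "(\<Sum>(c, a, b)\<in>P. integral (cbox a b) (\<lambda>x. rho P (c, a, b) (cinv c x) *
     (sqrt (det (g c x)) * trM (g c x) (\<lambda>p q. cov (Gam (g c)) (X c) x [p, q])))) = (\<Sum>i\<in>P. - (LINT p|vol. sg i p))"
    by (rule sum.cong[OF refl]) (clarify, rule loc)
  also have "\<dots> = - (LINT p|vol. (\<Sum>i\<in>P. sg i p))"
    by (subst Bochner_Integration.integral_sum) (simp_all add: integrable_continuous_M[OF sg_cont] sum_negf)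
  finally show ?thesis by (simp add: sg_sum)
qed

end

section \<open>The second derivative along a curve of metrics\<close>

text \<open>|Ric'|^2 as a nested trace, free of frames, since frames are chosen point by
  point.\<close>

definition ric1_norm2 :: "(real ^ 'n \<Rightarrow> real ^ 'n ^ 'n) \<Rightarrow> (real ^ 'n \<Rightarrow> real ^ 'n ^ 'n) \<Rightarrow> real ^ 'n::finite \<Rightarrow> real" where
  "ric1_norm2 G H x = trM (G x) (\<lambda>a a'. trM (G x) (\<lambda>b b'. ric1 G H x a b * ric1 G H x a' b'))"

context metric_family
begin

lemma ric1_norm2_frame:
  assumes x: "x \<in> U" and E: "frame (G x) E"
  shows "ric1_norm2 G H x = (\<Sum>b\<in>UNIV. \<Sum>c\<in>UNIV. (ric1 G H x (E b) (E c))\<^sup>2)"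
  unfolding ric1_norm2_def power2_eq_square by (rule trM2_frame[OF E]) (rule linear_ric1[OF x])+

lemma ric1_norm2_nonneg: "x \<in> U \<Longrightarrow> 0 \<le> ric1_norm2 G H x"
proof -
  assume x: "x \<in> U"
  obtain E where E: "frame (G x) E" using spd_frame_exists[OF spd_G[OF x]] .
  show ?thesis unfolding ric1_norm2_frame[OF x E] by (intro sum_nonneg) simp
qed

lemma jsm_density: "jsm I U (\<lambda>t x. functional_density s \<tau> (F t) x * sqrt (det (F t x)))"
proof -
  note IU = I(1) open_dom
  note cl = jsm_riem_norm2 jsm_ricci_norm2 jsm_scal jsm_sqrt_det
  show ?thesis
    unfolding functional_density_def power2_eq_square
    by (intro jsm_mult[OF IU] jsm_add[OF IU] jsm_const[OF IU] cl[OF IU F spd_F])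
qed

lemma density_second_derivative:
  assumes x: "x \<in> U"
  shows "dd 1 (\<lambda>t. dd 1 (\<lambda>t. functional_density s \<tau> (F t) x * sqrt (det (F t x))) t) 0 =
    2 * (sqrt (det (G x)) * trM (G x) (\<lambda>p q. cov (Gam G) (XX G H) x [p, q]))
    + 2 * (4 + s) * (sqrt (det (G x)) * ric1_norm2 G H x)"
proof -
  obtain E where E: "frame (G x) E" using spd_frame_exists[OF spd_G[OF x]] .
  show ?thesis
    unfolding functional_density_def second_derivative_density[OF x E] pointwise_identity(2)[OF x E] ric1_norm2_frame[OF x E]
    by (simp add: algebra_simps)
qed

end

lemma integral_derivative:
  fixes \<Phi> :: "real \<Rightarrow> real ^ 'n::finite \<Rightarrow> real"
  assumes U: "open U" "cbox a b \<subseteq> U" and \<Phi>: "jsm {-\<epsilon><..<\<epsilon>} U \<Phi>" and r: "continuous_on (cbox a b) r" and t: "t \<in> {-\<epsilon><..<\<epsilon>}"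
  shows "((\<lambda>t. integral (cbox a b) (\<lambda>x. r x * \<Phi> t x)) has_real_derivative integral (cbox a b) (\<lambda>x. r x * dd 1 (\<lambda>s. \<Phi> s x) t)) (at t)"
proof -
  let ?I = "{-\<epsilon><..<\<epsilon>}"
  have I: "open ?I" by simp
  note \<Phi>' = jsm_dd(2)[OF I U(1) \<Phi>, of 1]
  have "((\<lambda>t. integral (cbox a b) (\<lambda>x. r x * \<Phi> t x)) has_field_derivative integral (cbox a b) (\<lambda>x. r x * dd 1 (\<lambda>s. \<Phi> s x) t)) (at t within ?I)"
  proof (rule leibniz_rule_field_derivative[OF _ _ _ t])
    show "convex ?I" by simp
    fix s x assume s: "s \<in> ?I" and x: "x \<in> cbox a b"
    have "(\<lambda>s. \<Phi> s x) differentiable (at s)"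
      by (rule smooth_on_differentiable[OF jsm_slice(2)[OF I U(1) \<Phi>] s]) (use x U(2) in blast)
    then obtain D where D: "((\<lambda>s. \<Phi> s x) has_real_derivative D) (at s)"
      using real_differentiable_def by blast
    have "dd 1 (\<lambda>s. \<Phi> s x) s = D" using dd_eqI[OF has_field_derivative_imp_has_derivative[OF D], of 1] by simp
    then have "((\<lambda>s. r x * \<Phi> s x) has_field_derivative r x * dd 1 (\<lambda>s. \<Phi> s x) s) (at s)"
      using DERIV_cmult[OF D] by simp
    then show "((\<lambda>s. r x * \<Phi> s x) has_field_derivative r x * dd 1 (\<lambda>s. \<Phi> s x) s) (at s within ?I)"
      by (rule has_field_derivative_at_within)
  next
    fix s assume s: "s \<in> ?I"
    show "(\<lambda>x. r x * \<Phi> s x) integrable_on cbox a b"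
      by (intro integrable_continuous continuous_on_mult r
          continuous_on_subset[OF smooth_on_continuous[OF jsm_slice(1)[OF I U(1) \<Phi> s]] U(2)])
  next
    have 1: "continuous_on (?I \<times> cbox a b) (\<lambda>p. dd 1 (\<lambda>s. \<Phi> s (snd p)) (fst p))"
      by (rule continuous_on_subset[OF smooth_on_continuous[OF \<Phi>'[unfolded jsm_def]]]) (use U(2) in auto)
    have 2: "continuous_on (?I \<times> cbox a b) (\<lambda>p. r (snd p))"
      by (rule continuous_on_compose2[OF r]) (auto intro: continuous_intros)
    show "continuous_on (?I \<times> cbox a b) (\<lambda>(t, x). r x * dd 1 (\<lambda>s. \<Phi> s x) t)"
      using continuous_on_mult[OF 2 1] by (simp add: case_prod_unfold)
  qed
  then show ?thesis using at_within_open[OF t I] by simp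
qed

locale flat_TT_manifold = finite_riem_manifold A g for A :: "('a::t2_space, 'n::finite) chart set" and g +
  fixes h :: "('a, 'n) tensor2"
  assumes flat_g: "constant_sectional_curvature A g 0" and TT_h: "TT_tensor A g h"
begin

lemma sym_h: "sym_tensor A h"
  using TT_h by (simp add: TT_tensor_def)

lemma chart_tensor: "c \<in> A \<Longrightarrow> metric_tensor (img_chart c) (g c) (h c)"
proof (rule metric_tensor.intro[OF chart_metric], assumption, rule metric_tensor_axioms.intro)
  assume c: "c \<in> A"
  show "smooth_on (img_chart c) (h c)" using sym_h c unfolding sym_tensor_def by blast
  show "transpose (h c x) = h c x" if "x \<in> img_chart c" for x using sym_h c that unfolding sym_tensor_def by metis
qed

lemma chart_flat_TT: "c \<in> A \<Longrightarrow> flat_TT (img_chart c) (g c) (h c)"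
proof (rule flat_TT.intro[OF chart_tensor], assumption, rule flat_TT_axioms.intro)
  assume c: "c \<in> A"
  fix x assume x: "x \<in> img_chart c"
  show "connection.curv (Gam (g c)) x u v w = 0" for u v w
    by (rule metric_on.flat[OF chart_metric[OF c] x])
       (use flat_g c x in \<open>unfold constant_sectional_curvature_def, blast\<close>)
  show "div2 (g c) (h c) x j = 0" for j using TT_h c x unfolding TT_tensor_def by blast
  show "tr2 (g c) (h c) x = 0" using TT_h c x unfolding TT_tensor_def by blast
qed

lemma XX_law:
  assumes cd: "c \<in> A" "d \<in> A" and x: "x \<in> overlap c d"
  shows "XX (g c) (h c) x [v] = XX (g d) (h d) (transition c d x) [dd v (transition c d) x]"
proof -
  interpret m: metric_map "overlap c d" "img_chart d" "g c" "g d" "transition c d" by (rule transition_metric_map[OF cd])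
  interpret c: metric_tensor "img_chart c" "g c" "h c" by (rule chart_tensor[OF cd(1)])
  have sub: "y \<in> img_chart c" if "y \<in> overlap c d" for y using overlap_subset that by (rule subsetD)
  have 1: "metric_tensor (overlap c d) (g c) (h c)"
    by (rule metric_tensor.intro[OF m.dom.metric_on_axioms], rule metric_tensor_axioms.intro[OF smooth_on_subset[OF c.smooth_H overlap_subset] c.H_sym[OF sub]])
  show ?thesis by (rule m.XX_transform[OF 1 chart_tensor[OF cd(2)] x]) (rule tensor_law[OF sym_h cd])
qed

text \<open>2 (4 + s) times the integral of |Ric'|^2, written over the boxes of \<open>P\<close>. No
  curve occurs in it, which is what makes the second variation depend on \<open>h\<close>
  alone.\<close>

definition second_derivative :: "(('a, 'n) chart \<times> (real ^ 'n) \<times> (real ^ 'n)) set \<Rightarrow> real \<Rightarrow> real" where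
  "second_derivative P s = (\<Sum>(c, a, b)\<in>P. integral (cbox a b) (\<lambda>x. rho P (c, a, b) (cinv c x) *
     (2 * (4 + s) * (sqrt (det (g c x)) * ric1_norm2 (g c) (h c) x))))"

context
  fixes \<gamma> \<epsilon>
  assumes \<epsilon>: "\<epsilon> > 0" and unit: "\<And>t. t \<in> {-\<epsilon><..<\<epsilon>} \<Longrightarrow> unit_volume_metric A (\<gamma> t)"
    and smooth: "\<And>c. c \<in> A \<Longrightarrow> smooth_on ({-\<epsilon><..<\<epsilon>} \<times> img_chart c) (\<lambda>(t, x). \<gamma> t c x)"
    and \<gamma>0: "\<And>c x. c \<in> A \<Longrightarrow> x \<in> img_chart c \<Longrightarrow> \<gamma> 0 c x = g c x"
    and \<gamma>': "\<And>c x. c \<in> A \<Longrightarrow> x \<in> img_chart c \<Longrightarrow> ((\<lambda>t. \<gamma> t c x) has_vector_derivative h c x) (at 0)"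
begin

lemma curve_metric: "t \<in> {-\<epsilon><..<\<epsilon>} \<Longrightarrow> finite_riem_manifold A (\<gamma> t)"
  using unit[of t] manifold
  by (simp add: unit_volume_metric_def finite_riem_manifold_def riem_manifold_def manifold_def
      riem_manifold_axioms_def finite_riem_manifold_axioms_def)

lemma curve_family:
  assumes c: "c \<in> A" shows "metric_family (img_chart c) (g c) (h c) {-\<epsilon><..<\<epsilon>} (\<lambda>t. \<gamma> t c)"
proof (rule metric_family.intro[OF chart_flat_TT[OF c]], rule metric_family_axioms.intro)
  show "open {-\<epsilon><..<\<epsilon>}" "0 \<in> {-\<epsilon><..<\<epsilon>}" using \<epsilon> by simp_all
  show "jsm {-\<epsilon><..<\<epsilon>} (img_chart c) (\<lambda>t. \<gamma> t c)" using smooth[OF c] by (simp add: jsm_def case_prod_unfold)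
  show "spd (\<gamma> t c x)" if "t \<in> {-\<epsilon><..<\<epsilon>}" "x \<in> img_chart c" for t x
    by (rule metric_on.spd_G[OF riem_manifold.chart_metric[OF finite_riem_manifold.axioms(1)[OF curve_metric[OF that(1)]] c] that(2)])
  show "\<gamma> 0 c x = g c x" if "x \<in> img_chart c" for x by (rule \<gamma>0[OF c that])
  show "dd 1 (\<lambda>t. \<gamma> t c x) 0 = h c x" if "x \<in> img_chart c" for x
    using dd_eqI[OF \<gamma>'[OF c that, unfolded has_vector_derivative_def], of 1] by simp
qed

text \<open>Differentiation twice under the box integrals gives a divergence plus the multiple of
  |Ric'|^2 at each point; the divergence theorem removes the first part.\<close>

lemma curve_second_derivative:
  assumes P: "cover P"
  shows "has_second_derivative (\<lambda>t. curv_functional A s \<tau> (\<gamma> t)) (second_derivative P s) 0"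
proof -
  let ?I = "{-\<epsilon><..<\<epsilon>}"
  have I: "open ?I" "0 \<in> ?I" using \<epsilon> by simp_all
  define \<Phi> where "\<Phi> c t x = functional_density s \<tau> (\<gamma> t c) x * sqrt (det (\<gamma> t c x))" for c t x
  define r where "r i x = rho P i (cinv (fst i) x)" for i x
  \<comment> \<open>The weighted sum of box integrals as an operation on densities. The functional
    is \<open>S\<close> of the metric density, and \<open>deriv\<close> says that \<open>S\<close>
    may be exchanged with time differentiation, which is used twice.\<close>
  define S where "S \<Psi> = (\<Sum>(c, a, b)\<in>P. integral (cbox a b) (\<lambda>x. r (c, a, b) x * \<Psi> c x))" for \<Psi> :: "('a, 'n) chart \<Rightarrow> real ^ 'n \<Rightarrow> real"
  have rc: "continuous_on (cbox a b) (r (c, a, b))" if i: "(c, a, b) \<in> P" for c a b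
    unfolding r_def fst_conv
    by (rule continuous_on_subset[OF _ P_D(2)[OF P i]]) (use Ck_on_mono[OF Ck_on_rho[OF P i P_D(1)[OF P i]], of 0] in simp)
  have js: "jsm ?I (img_chart c) (\<Phi> c)" if c: "c \<in> A" for c
    unfolding \<Phi>_def[abs_def] by (rule metric_family.jsm_density[OF curve_family[OF c]])
  have deriv: "((\<lambda>t. S (\<lambda>c. \<Psi> c t)) has_real_derivative S (\<lambda>c x. dd 1 (\<lambda>t. \<Psi> c t x) t)) (at t)"
    if \<Psi>: "\<And>c. c \<in> A \<Longrightarrow> jsm ?I (img_chart c) (\<Psi> c)" and t: "t \<in> ?I" for \<Psi> :: "('a, 'n) chart \<Rightarrow> real \<Rightarrow> real ^ 'n \<Rightarrow> real" and t
    unfolding S_def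
  proof (rule DERIV_sum)
    fix i assume i: "i \<in> P"
    obtain c a b where e: "i = (c, a, b)" by (cases i)
    note c = P_D[OF P i[unfolded e]]
    show "((\<lambda>t. case i of (c, a, b) \<Rightarrow> integral (cbox a b) (\<lambda>x. r (c, a, b) x * \<Psi> c t x)) has_real_derivative
       (case i of (c, a, b) \<Rightarrow> integral (cbox a b) (\<lambda>x. r (c, a, b) x * dd 1 (\<lambda>t. \<Psi> c t x) t))) (at t)"
      unfolding e prod.case
      by (rule integral_derivative[OF open_img_chart[OF c(1)] c(2) \<Psi>[OF c(1)] rc[OF i[unfolded e]] t])
  qed
  have formula: "curv_functional A s \<tau> (\<gamma> t) = S (\<lambda>c. \<Phi> c t)" if t: "t \<in> ?I" for t
    unfolding S_def r_def fst_conv \<Phi>_def by (rule finite_riem_manifold.functional_formula[OF curve_metric[OF t] P])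
  let ?f' = "\<lambda>t. S (\<lambda>c x. dd 1 (\<lambda>t. \<Phi> c t x) t)"
  have d1: "((\<lambda>t. curv_functional A s \<tau> (\<gamma> t)) has_real_derivative ?f' t) (at t)" if t: "t \<in> ?I" for t
  proof (rule DERIV_cong_ev[THEN iffD2, OF refl _ refl])
    show "eventually (\<lambda>t. curv_functional A s \<tau> (\<gamma> t) = S (\<lambda>c. \<Phi> c t)) (nhds t)"
      unfolding eventually_nhds by (rule exI[of _ ?I]) (use I t formula in auto)
    show "((\<lambda>t. S (\<lambda>c. \<Phi> c t)) has_real_derivative ?f' t) (at t)" by (rule deriv[OF js t])
  qed
  have d2: "(?f' has_real_derivative S (\<lambda>c x. dd 1 (\<lambda>t. dd 1 (\<lambda>t. \<Phi> c t x) t) 0)) (at 0)"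
    by (rule deriv[OF jsm_dd(2)[OF I(1) open_img_chart js] I(2)]) (assumption+)
  have "S (\<lambda>c x. dd 1 (\<lambda>t. dd 1 (\<lambda>t. \<Phi> c t x) t) 0) = second_derivative P s"
  proof -
    let ?div = "\<lambda>c x. sqrt (det (g c x)) * trM (g c x) (\<lambda>p q. cov (Gam (g c)) (XX (g c) (h c)) x [p, q])"
    let ?ric = "\<lambda>c x. 2 * (4 + s) * (sqrt (det (g c x)) * ric1_norm2 (g c) (h c) x)"
    have split: "integral (cbox a b) (\<lambda>x. r (c, a, b) x * dd 1 (\<lambda>t. dd 1 (\<lambda>t. \<Phi> c t x) t) 0)
      = 2 * integral (cbox a b) (\<lambda>x. r (c, a, b) x * ?div c x) + integral (cbox a b) (\<lambda>x. r (c, a, b) x * ?ric c x)"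
      if i: "(c, a, b) \<in> P" for c a b
    proof -
      note c = P_D[OF P i]
      interpret m: metric_family "img_chart c" "g c" "h c" ?I "\<lambda>t. \<gamma> t c" by (rule curve_family[OF c(1)])
      have e: "dd 1 (\<lambda>t. dd 1 (\<lambda>t. \<Phi> c t x) t) 0 = 2 * ?div c x + ?ric c x" if "x \<in> cbox a b" for x
        unfolding \<Phi>_def by (rule m.density_second_derivative) (use that c(2) in blast)
      have i1: "(\<lambda>x. r (c, a, b) x * dd 1 (\<lambda>t. dd 1 (\<lambda>t. \<Phi> c t x) t) 0) integrable_on cbox a b"
        by (intro integrable_continuous continuous_on_mult rc[OF i] continuous_on_subset[OF smooth_on_continuous c(2)]
            jsm_slice(1)[OF I(1) m.open_dom jsm_dd(2)[OF I(1) m.open_dom jsm_dd(2)[OF I(1) m.open_dom js[OF c(1)]]] I(2)])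
      have "smooth_on (img_chart c) (\<lambda>x. cov (Gam (g c)) (XX (g c) (h c)) x [p, q])" for p q
        by (rule stens_smooth[OF m.stens_cov[OF m.stens_XX]]) simp
      then have "smooth_on (img_chart c) (\<lambda>x. trM (g c x) (\<lambda>p q. cov (Gam (g c)) (XX (g c) (h c)) x [p, q]))" by (rule m.smooth_trM)
      then have i2: "(\<lambda>x. r (c, a, b) x * ?div c x) integrable_on cbox a b"
        by (intro integrable_continuous continuous_on_mult rc[OF i] continuous_on_subset[OF smooth_on_continuous c(2)] m.smooth_scalars(4))
      \<comment> \<open>The Ricci part is rewritten as a difference of two integrands already known
        to be integrable.\<close>
      have "integral (cbox a b) (\<lambda>x. r (c, a, b) x * ?ric c x)
        = integral (cbox a b) (\<lambda>x. r (c, a, b) x * dd 1 (\<lambda>t. dd 1 (\<lambda>t. \<Phi> c t x) t) 0 - 2 * (r (c, a, b) x * ?div c x))"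
        by (rule integral_cong) (simp only: e, simp add: algebra_simps)
      also have "\<dots> = integral (cbox a b) (\<lambda>x. r (c, a, b) x * dd 1 (\<lambda>t. dd 1 (\<lambda>t. \<Phi> c t x) t) 0)
         - integral (cbox a b) (\<lambda>x. 2 * (r (c, a, b) x * ?div c x))"
        by (rule Henstock_Kurzweil_Integration.integral_diff[OF i1 integrable_on_mult_right[OF i2]])
      finally show ?thesis by simp
    qed
    have "S (\<lambda>c x. dd 1 (\<lambda>t. dd 1 (\<lambda>t. \<Phi> c t x) t) 0) = 2 * S ?div + S ?ric"
      unfolding S_def sum_distrib_left sum.distrib[symmetric]
      by (rule sum.cong[OF refl]) (clarify, rule split)
    moreover have "S ?div = 0" unfolding S_def r_def fst_conv
      by (rule divergence_theorem[OF P metric_tensor.stens_XX[OF chart_tensor] XX_law])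
    moreover have "S ?ric = second_derivative P s" unfolding S_def r_def fst_conv second_derivative_def ..
    ultimately show ?thesis by simp
  qed
  with d2 have d2: "(?f' has_real_derivative second_derivative P s) (at 0)" by simp
  show ?thesis unfolding has_second_derivative_def
  proof (intro exI conjI)
    show "\<forall>\<^sub>F t in nhds 0. ((\<lambda>t. curv_functional A s \<tau> (\<gamma> t)) has_real_derivative ?f' t) (at t)"
      unfolding eventually_nhds by (rule exI[of _ ?I]) (use I d1 in auto)
  qed (rule d2)
qed

lemma second_derivative_sign:
  assumes P: "cover P"
  shows "s > -4 \<Longrightarrow> second_derivative P s \<ge> 0" "s < -4 \<Longrightarrow> second_derivative P s \<le> 0"
proof -
  have nn: "0 \<le> rho P (c, a, b) (cinv c x) * (sqrt (det (g c x)) * ric1_norm2 (g c) (h c) x)"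
    if i: "(c, a, b) \<in> P" and x: "x \<in> cbox a b" for c a b x
  proof -
    have x': "x \<in> img_chart c" using P_D(2)[OF P i] x by blast
    interpret m: metric_family "img_chart c" "g c" "h c" "{-\<epsilon><..<\<epsilon>}" "\<lambda>t. \<gamma> t c" by (rule curve_family[OF P_D(1)[OF P i]])
    show ?thesis
      using spd_det[OF m.spd_G[OF x']] m.ric1_norm2_nonneg[OF x'] rho_nonneg[OF P] by simp
  qed
  define J where "J = (\<Sum>(c, a, b)\<in>P. integral (cbox a b) (\<lambda>x. rho P (c, a, b) (cinv c x) * (sqrt (det (g c x)) * ric1_norm2 (g c) (h c) x)))"
  have "0 \<le> J" unfolding J_def
  proof (rule sum_nonneg)
    fix i assume i: "i \<in> P"
    obtain c a b where e: "i = (c, a, b)" by (cases i)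
    \<comment> \<open>A function that is not integrable has integral 0, so the sign is right in
      either case.\<close>
    show "0 \<le> (case i of (c, a, b) \<Rightarrow> integral (cbox a b) (\<lambda>x. rho P (c, a, b) (cinv c x) * (sqrt (det (g c x)) * ric1_norm2 (g c) (h c) x)))"
      unfolding e prod.case using nn[OF i[unfolded e]]
      by (metis (lifting) Henstock_Kurzweil_Integration.integral_nonneg not_integrable_integral order_refl)
  qed
  moreover have "second_derivative P s = 2 * (4 + s) * J"
    unfolding J_def second_derivative_def sum_distrib_left
    by (rule sum.cong[OF refl]) (simp add: mult.left_commute case_prod_unfold flip: integral_mult_right)
  ultimately show "s > -4 \<Longrightarrow> second_derivative P s \<ge> 0" "s < -4 \<Longrightarrow> second_derivative P s \<le> 0"
    by (simp_all add: mult_nonpos_nonneg)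
qed

end

end

section \<open>Existence of unit-volume curves\<close>

lemma det_scaleR_matrix:
  fixes M :: "real ^ 'n ^ 'n::finite" shows "det (k *\<^sub>R M) = k ^ CARD('n) * det M"
  by (simp add: det_def prod.distrib sum_distrib_left mult.left_commute)

lemma
  fixes T J M N :: "real ^ 'n ^ 'n::finite"
  shows matrix_mult3_add: "T ** (M + N) ** J = T ** M ** J + T ** N ** J"
    and matrix_mult3_scaleR: "T ** (k *\<^sub>R M) ** J = k *\<^sub>R (T ** M ** J)"
  by (simp_all add: matrix_matrix_mult_def vec_eq_iff sum.distrib distrib_left distrib_right sum_distrib_left sum_distrib_right mult_ac)

text \<open>The quotient of the two forms is continuous on the compact set of points of
  \<open>K\<close> paired with unit vectors; both sides scale quadratically in
  \<open>v\<close>.\<close>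

lemma quadratic_form_bound:
  fixes G H :: "real ^ 'n \<Rightarrow> real ^ 'n ^ 'n::finite"
  assumes K: "compact K" and G: "continuous_on K G" and H: "continuous_on K H" and spd: "\<And>x. x \<in> K \<Longrightarrow> spd (G x)"
  shows "\<exists>C. \<forall>x\<in>K. \<forall>v. \<bar>ip (H x) v v\<bar> \<le> C * ip (G x) v v"
proof -
  let ?S = "K \<times> sphere (0 :: real ^ 'n) 1"
  define q where "q p = ip (H (fst p)) (snd p) (snd p) / ip (G (fst p)) (snd p) (snd p)" for p
  have pos: "ip (G x) v v > 0" if "x \<in> K" "v \<noteq> 0" for x v
    using spd[OF that(1)] that(2) by (simp add: spd_def)
  have cont: "continuous_on ?S (\<lambda>p. ip (F (fst p)) (snd p) (snd p))" if F: "continuous_on K F" for F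
    unfolding ip_sums
    by (intro continuous_intros continuous_on_compose2[OF F]) auto
  have "continuous_on ?S q" unfolding q_def
  proof (intro continuous_on_divide cont G H ballI)
    fix p assume "p \<in> ?S"
    then have "fst p \<in> K" "norm (snd p) = 1" by (simp_all add: mem_Times_iff)
    moreover from this have "snd p \<noteq> 0" by (metis norm_zero zero_neq_one)
    ultimately show "ip (G (fst p)) (snd p) (snd p) \<noteq> 0" using pos[of "fst p" "snd p"] by simp
  qed
  then have "compact (q ` ?S)" by (rule compact_continuous_image) (intro compact_Times K compact_sphere)
  then have "bounded (q ` ?S)" by (rule compact_imp_bounded)
  then obtain C where "\<forall>y\<in>q ` ?S. norm y \<le> C" unfolding bounded_iff by (elim exE)
  then have C: "\<bar>q p\<bar> \<le> C" if "p \<in> ?S" for p using imageI[OF that, of q] unfolding real_norm_def by (elim bspec)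
  show ?thesis
  proof (intro exI ballI allI)
    fix x v assume x: "x \<in> K"
    show "\<bar>ip (H x) v v\<bar> \<le> C * ip (G x) v v"
    proof (cases "v = 0")
      case False
      define w where "w = (1 / norm v) *\<^sub>R v"
      have v: "v = norm v *\<^sub>R w" using False by (simp add: w_def)
      have w: "norm w = 1" "w \<noteq> 0" using False by (simp_all add: w_def)
      have "ip M (k *\<^sub>R w) (k *\<^sub>R w) = k\<^sup>2 * ip M w w" for M k
        by (simp add: matrix_vector_mult_scaleR power2_eq_square)
      from this[where k = "norm v"] have sc: "ip M v v = (norm v)\<^sup>2 * ip M w w" for M
        unfolding v[symmetric] .
      have "\<bar>q (x, w)\<bar> \<le> C" by (rule C) (use x w in simp)
      then have "\<bar>ip (H x) w w\<bar> \<le> C * ip (G x) w w"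
        using pos[OF x w(2)] by (simp add: q_def abs_divide pos_divide_le_eq)
      then have "(norm v)\<^sup>2 * \<bar>ip (H x) w w\<bar> \<le> (norm v)\<^sup>2 * (C * ip (G x) w w)" by (rule mult_left_mono) simp
      then show ?thesis unfolding sc by (simp add: abs_mult mult.left_commute)
    qed simp
  qed
qed

context flat_TT_manifold
begin

text \<open>Finitely many compact boxes supply local constants. Since both forms are tensors, the
  bound at a point may be checked in the chart of a box whose core contains it, and so holds in
  every chart with one constant.\<close>

lemma perturbation_bound: "\<exists>C>0. \<forall>c\<in>A. \<forall>x\<in>img_chart c. \<forall>v. \<bar>ip (h c x) v v\<bar> \<le> C * ip (g c x) v v"
proof -
  obtain P where P: "cover P" using cover_exists by blast
  have pos: "ip (g c x) v v \<ge> 0" if "c \<in> A" "x \<in> img_chart c" for c x v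
    using metric_on.spd_G[OF chart_metric[OF that(1)] that(2)] by (cases "v = 0") (auto simp: spd_def less_imp_le)
  have "\<exists>C. \<forall>x\<in>cbox a b. \<forall>v. \<bar>ip (h c x) v v\<bar> \<le> C * ip (g c x) v v" if i: "(c, a, b) \<in> P" for c a b
  proof -
    note c = P_D[OF P i]
    interpret c: metric_tensor "img_chart c" "g c" "h c" by (rule chart_tensor[OF c(1)])
    show ?thesis
      by (rule quadratic_form_bound[OF compact_cbox continuous_on_subset[OF smooth_on_continuous[OF c.smooth_G] c(2)]
          continuous_on_subset[OF smooth_on_continuous[OF c.smooth_H] c(2)]]) (rule c.spd_G[OF subsetD[OF c(2)]])
  qed
  then obtain C where C: "\<And>c a b x v. (c, a, b) \<in> P \<Longrightarrow> x \<in> cbox a b \<Longrightarrow> \<bar>ip (h c x) v v\<bar> \<le> C c a b * ip (g c x) v v"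
    by metis
  \<comment> \<open>Dominates every local constant; the summand 1 makes it positive.\<close>
  define B where "B = (\<Sum>(c, a, b)\<in>P. \<bar>C c a b\<bar>) + 1"
  have B: "B > 0" unfolding B_def by (rule add_nonneg_pos[OF sum_nonneg]) auto
  show ?thesis
  proof (intro exI conjI ballI allI)
    show "B > 0" by (rule B)
    fix c x v assume c: "c \<in> A" and x: "x \<in> img_chart c"
    obtain i where i: "i \<in> P" "beta i (cinv c x) > 0" using P unfolding cover_def by blast
    obtain d a b where e: "i = (d, a, b)" by (cases i)
    note d = P_D[OF P i(1)[unfolded e]]
    have "cinv c x \<in> core (d, a, b)"
      using beta_core[OF P_box[OF P i(1)], of "cinv c x"] i(2) e by auto
    then obtain y where y: "y \<in> cbox a b" "cinv c x = cinv d y" unfolding core_def prod.case by (elim imageE)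
    have yd: "y \<in> img_chart d" by (rule subsetD[OF d(2) y(1)])
    have xo: "x \<in> overlap c d" unfolding overlap_iff[OF c] using x y(2) cinv_in[OF yd] by simp
    have ty: "transition c d x = y" unfolding transition_cinv y(2) by (rule snd_cinv[OF yd])
    let ?w = "dd v (transition c d) x"
    have "\<bar>ip (h c x) v v\<bar> = \<bar>ip (h d y) ?w ?w\<bar>" using tensor_law[OF sym_h c d(1) xo] ty by simp
    also have "\<dots> \<le> C d a b * ip (g d y) ?w ?w" by (rule C[OF i(1)[unfolded e] y(1)])
    also have "\<dots> \<le> B * ip (g d y) ?w ?w"
    proof (rule mult_right_mono[OF _ pos[OF d(1) yd]])
      have "\<bar>C d a b\<bar> \<le> (\<Sum>(c, a, b)\<in>P. \<bar>C c a b\<bar>)"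
        using member_le_sum[OF i(1), of "\<lambda>(c, a, b). \<bar>C c a b\<bar>"] P_finite[OF P] e by auto
      then show "C d a b \<le> B" by (simp add: B_def)
    qed
    also have "ip (g d y) ?w ?w = ip (g c x) v v" using tensor_law[OF sym_g c d(1) xo] ty by simp
    finally show "\<bar>ip (h c x) v v\<bar> \<le> B * ip (g c x) v v" .
  qed
qed

definition shifted :: "real \<Rightarrow> ('a, 'n) tensor2" where
  "shifted t c x = g c x + t *\<^sub>R h c x"

text \<open>The exponent is 1/n because scaling an n by n matrix by k multiplies its determinant by
  k^n.\<close>

definition conformal_factor :: "real \<Rightarrow> ('a, 'n) chart \<Rightarrow> real ^ 'n \<Rightarrow> real" where
  "conformal_factor t c x = (det (g c x) / det (shifted t c x)) powr (1 / real CARD('n))"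

text \<open>Rescaling \<open>g + t h\<close> pointwise so that its volume form agrees with that of \<open>g\<close> does not change
  the velocity at \<open>0\<close>, because \<open>h\<close> is trace-free.\<close>

definition TT_curve :: "real \<Rightarrow> ('a, 'n) tensor2" where
  "TT_curve t c x = conformal_factor t c x *\<^sub>R shifted t c x"

lemma spd_shifted: "\<exists>\<epsilon>>0. \<forall>t\<in>{-\<epsilon><..<\<epsilon>}. \<forall>c\<in>A. \<forall>x\<in>img_chart c. spd (shifted t c x)"
proof -
  obtain C where C: "C > 0" "\<And>c x v. c \<in> A \<Longrightarrow> x \<in> img_chart c \<Longrightarrow> \<bar>ip (h c x) v v\<bar> \<le> C * ip (g c x) v v"
    using perturbation_bound by blast
  show ?thesis
  proof (intro exI conjI ballI)
    \<comment> \<open>For |t| < 1/C the term t h is strictly dominated by g, so the sum stays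
      positive definite.\<close>
    show "1 / C > 0" using C by simp
    fix t c x assume t: "t \<in> {- (1 / C)<..<1 / C}" and c: "c \<in> A" and x: "x \<in> img_chart c"
    interpret c: metric_tensor "img_chart c" "g c" "h c" by (rule chart_tensor[OF c])
    have tC: "\<bar>t\<bar> * C < 1" using t C(1) by (simp add: abs_less_iff pos_less_divide_eq pos_less_minus_divide_eq minus_less_iff mult.commute abs_if field_simps split: if_splits)
    have "0 < ip (shifted t c x) v v" if "v \<noteq> 0" for v
    proof -
      have gp: "0 < ip (g c x) v v" using c.spd_G[OF x] that by (simp add: spd_def)
      have "\<bar>t * ip (h c x) v v\<bar> \<le> \<bar>t\<bar> * (C * ip (g c x) v v)"
        unfolding abs_mult by (rule mult_left_mono[OF C(2)[OF c x]]) simp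
      also have "\<dots> < ip (g c x) v v" using mult_strict_right_mono[OF tC gp] by (simp add: mult_ac)
      finally show ?thesis
        by (simp add: shifted_def matrix_vector_mult_add_rdistrib inner_add_right flip: scaleR_matrix_vector_assoc)
    qed
    moreover have "transpose (shifted t c x) = shifted t c x"
      using c.spd_G[OF x] c.H_sym[OF x] by (simp add: shifted_def spd_def vec_eq_iff transpose_def)
    ultimately show "spd (shifted t c x)" by (simp add: spd_def)
  qed
qed

lemma shifted_law:
  assumes cd: "c \<in> A" "d \<in> A" and x: "x \<in> overlap c d"
  shows "shifted t c x = transpose (jacobian_matrix (transition c d) x) ** shifted t d (transition c d x) ** jacobian_matrix (transition c d) x"
proof -
  have "k c x = transpose (jacobian_matrix (transition c d) x) ** k d (transition c d x) ** jacobian_matrix (transition c d) x"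
    if "sym_tensor A k" for k using that cd x by (simp add: sym_tensor_def)
  from this[OF sym_g] this[OF sym_h] show ?thesis
    unfolding shifted_def by (simp only: matrix_mult3_add matrix_mult3_scaleR)
qed

text \<open>Both determinants change by the same squared Jacobian determinant, so the ratio is a
  scalar and the rescaled family is again a tensor.\<close>

lemma conformal_factor_law:
  assumes cd: "c \<in> A" "d \<in> A" and x: "x \<in> overlap c d"
  shows "conformal_factor t c x = conformal_factor t d (transition c d x)"
proof -
  let ?J = "det (jacobian_matrix (transition c d) x)"
  have l: "det (shifted t c x) = ?J\<^sup>2 * det (shifted t d (transition c d x))" for t
    by (subst shifted_law[OF cd x]) (simp add: det_mul det_transpose power2_eq_square mult_ac)
  have l0: "det (g c x) = ?J\<^sup>2 * det (g d (transition c d x))" using l[of 0] by (simp add: shifted_def)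
  have "x \<in> img_chart c" using x overlap_subset by (rule subsetD[rotated])
  then have "det (g c x) > 0" using metric_on.spd_G[OF chart_metric[OF cd(1)]] by (blast intro: spd_det)
  then have "?J\<^sup>2 \<noteq> 0" using l0 by auto
  then show ?thesis unfolding conformal_factor_def l l0 by simp
qed

lemma shifted_smooth:
  assumes c: "c \<in> A" and I: "open I" shows "smooth_on (I \<times> img_chart c) (\<lambda>p. shifted (fst p) c (snd p))"
proof -
  interpret c: metric_tensor "img_chart c" "g c" "h c" by (rule chart_tensor[OF c])
  have o: "open (I \<times> img_chart c)" by (rule open_Times[OF I c.open_dom])
  note js = jsm_static[OF I c.open_dom, unfolded jsm_def]
  show ?thesis unfolding shifted_def
    by (intro smooth_on_add smooth_on_scaleR o js c.smooth_G c.smooth_H smooth_on_linear bounded_linear_fst)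
qed

context
  fixes \<epsilon> assumes spd_\<epsilon>: "\<And>t c x. t \<in> {-\<epsilon><..<\<epsilon>} \<Longrightarrow> c \<in> A \<Longrightarrow> x \<in> img_chart c \<Longrightarrow> spd (shifted t c x)"
begin

lemma ratio_pos: "t \<in> {-\<epsilon><..<\<epsilon>} \<Longrightarrow> c \<in> A \<Longrightarrow> x \<in> img_chart c \<Longrightarrow> det (g c x) / det (shifted t c x) > 0"
  by (intro divide_pos_pos spd_det spd_\<epsilon> metric_on.spd_G[OF chart_metric])

lemma TT_curve_smooth:
  assumes c: "c \<in> A" shows "jsm {-\<epsilon><..<\<epsilon>} (img_chart c) (\<lambda>t. TT_curve t c)"
proof -
  interpret c: metric_tensor "img_chart c" "g c" "h c" by (rule chart_tensor[OF c])
  have I: "open {-\<epsilon><..<\<epsilon>}" by simp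
  have o: "open ({-\<epsilon><..<\<epsilon>} \<times> img_chart c)" by (rule open_Times[OF I c.open_dom])
  note sh = shifted_smooth[OF c I]
  note g = jsm_static[OF I c.open_dom c.smooth_G, unfolded jsm_def]
  have mem: "fst p \<in> {-\<epsilon><..<\<epsilon>}" "snd p \<in> img_chart c" if "p \<in> {-\<epsilon><..<\<epsilon>} \<times> img_chart c" for p using that by (simp_all add: mem_Times_iff)
  show ?thesis unfolding jsm_def TT_curve_def conformal_factor_def
    by (intro smooth_on_scaleR[OF o _ sh] smooth_on_powr[OF o] smooth_on_divide[OF o] smooth_on_det[OF o] smooth_on_nth[OF o] g sh
        spd_det[OF spd_\<epsilon>[OF mem(1) c mem(2)]] ratio_pos[OF mem(1) c mem(2)])
qed

text \<open>The rescaled metric has the determinant of \<open>g\<close> in every chart, hence the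
  same volume measure and total volume 1.\<close>

lemma TT_curve_unit:
  assumes t: "t \<in> {-\<epsilon><..<\<epsilon>}" shows "unit_volume_metric A (TT_curve t)"
proof -
  have spd: "spd (TT_curve t c x)" if "c \<in> A" "x \<in> img_chart c" for c x
    unfolding TT_curve_def by (rule spd_scaleR[OF _ spd_\<epsilon>[OF t that]]) (use ratio_pos[OF t that] in \<open>simp add: conformal_factor_def less_le\<close>)
  have "det (g c x) = det (TT_curve t c x)" if "c \<in> A" "x \<in> img_chart c" for c x
  proof -
    have "conformal_factor t c x ^ CARD('n) = det (g c x) / det (shifted t c x)"
    proof -
      have "(y powr (1 / real CARD('n))) ^ CARD('n) = y" if "y > 0" for y :: real
        using that by (subst powr_realpow[symmetric]) (simp_all add: powr_powr)
      from this[OF ratio_pos[OF t that]] show ?thesis unfolding conformal_factor_def .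
    qed
    then show ?thesis using spd_det[OF spd_\<epsilon>[OF t that]] by (simp add: TT_curve_def det_scaleR_matrix)
  qed
  then have "volume_measure A g = volume_measure A (TT_curve t)" by (rule volume_measure_cong)
  moreover have "riemannian_metric A (TT_curve t)"
    unfolding riemannian_metric_def sym_tensor_def
  proof (intro conjI ballI allI impI)
    fix c assume c: "c \<in> A"
    show "smooth_on (img_chart c) (TT_curve t c)"
      using jsm_slice(1)[OF _ open_img_chart[OF c] TT_curve_smooth[OF c] t] by simp
    show "transpose (TT_curve t c x) = TT_curve t c x" if "x \<in> img_chart c" for x
      using spd[OF c that] unfolding spd_def by blast
    show "0 < ip (TT_curve t c x) v v" if "x \<in> img_chart c" "v \<noteq> 0" for x v
      using spd[OF c that(1)] that(2) unfolding spd_def by blast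
    fix d x assume d: "d \<in> A" and x: "x \<in> overlap c d"
    show "TT_curve t c x = transpose (jacobian_matrix (transition c d) x) ** TT_curve t d (transition c d x) ** jacobian_matrix (transition c d) x"
      unfolding TT_curve_def conformal_factor_law[OF c d x] shifted_law[OF c d x]
      by (rule matrix_mult3_scaleR[symmetric])
  qed
  ultimately show ?thesis using volume_finite by (simp add: unit_volume_metric_def)
qed

lemma TT_curve_velocity:
  assumes \<epsilon>: "\<epsilon> > 0" and c: "c \<in> A" and x: "x \<in> img_chart c"
  shows "TT_curve 0 c x = g c x" "((\<lambda>t. TT_curve t c x) has_vector_derivative h c x) (at 0)"
proof -
  interpret c: metric_tensor "img_chart c" "g c" "h c" by (rule chart_tensor[OF c])
  have dg: "det (g c x) > 0" by (rule spd_det[OF c.spd_G[OF x]])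
  have s0: "shifted 0 c x = g c x" by (simp add: shifted_def)
  have f0: "conformal_factor 0 c x = 1" using dg by (simp add: conformal_factor_def s0)
  show "TT_curve 0 c x = g c x" by (simp add: TT_curve_def f0 s0)
  have ds: "((\<lambda>t. shifted t c x) has_vector_derivative h c x) (at 0)"
    unfolding shifted_def by (auto intro!: derivative_eq_intros)
  have e: "((\<lambda>t. shifted t c x $ i $ j) has_real_derivative h c x $ i $ j) (at 0)" for i j
    unfolding shifted_def by (auto intro!: derivative_eq_intros)
  have ed: "(\<lambda>t. shifted t c x $ i $ j) differentiable (at 0)" for i j
    using e real_differentiable_def by blast
  have "dd 1 (\<lambda>t. shifted t c x $ i $ j) 0 = h c x $ i $ j" for i j
    using dd_eqI[OF has_field_derivative_imp_has_derivative[OF e], where v = 1] by simp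
  moreover have "tr2 (g c) (h c) x = 0" using TT_h c x unfolding TT_tensor_def by blast
  \<comment> \<open>Jacobi's formula: the derivative is det g times the trace of h, which is 0. The
    conformal factor is therefore stationary at time 0.\<close>
  ultimately have d0: "dd 1 (\<lambda>t. det (shifted t c x)) 0 = 0"
    using dd_det[OF ed, where v = 1] c.spd_G[OF x] by (simp add: s0 tr2_def ginv_def)
  have I: "open (UNIV :: real set)" by simp
  have "smooth_on (UNIV \<times> img_chart c) (\<lambda>p. det (shifted (fst p) c (snd p)))"
    by (intro smooth_on_det smooth_on_nth shifted_smooth[OF c I] open_Times I c.open_dom)
  then have "smooth_on UNIV (\<lambda>t. det (shifted t c x))"
    using jsm_slice(2)[OF I c.open_dom, of "\<lambda>t x. det (shifted t c x)" x] x by (simp add: jsm_def)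
  then have "(\<lambda>t. det (shifted t c x)) differentiable (at 0)" by (rule smooth_on_differentiable) simp
  then obtain D where D: "((\<lambda>t. det (shifted t c x)) has_real_derivative D) (at 0)"
    using real_differentiable_def by blast
  have "D = 0" using d0 dd_eqI[OF has_field_derivative_imp_has_derivative[OF D], of 1] by simp
  with D have "((\<lambda>t. det (g c x) / det (shifted t c x)) has_real_derivative 0) (at 0)"
    using DERIV_divide[OF DERIV_const, of "\<lambda>t. det (shifted t c x)" 0 0 UNIV "det (g c x)"] dg by (simp add: s0)
  from DERIV_fun_powr[OF this] have "((\<lambda>t. conformal_factor t c x) has_real_derivative 0) (at 0)"
    using dg by (simp add: conformal_factor_def s0)
  then have "((\<lambda>t. TT_curve t c x) has_vector_derivative (conformal_factor 0 c x *\<^sub>R h c x + 0 *\<^sub>R shifted 0 c x)) (at 0)"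
    unfolding TT_curve_def by (rule has_vector_derivative_scaleR[OF _ ds])
  then show "((\<lambda>t. TT_curve t c x) has_vector_derivative h c x) (at 0)" by (simp add: f0)
qed

end

lemma unit_volume_curve_exists: "\<exists>\<gamma>. unit_volume_curve A g h \<gamma>"
proof -
  obtain \<epsilon> where \<epsilon>: "\<epsilon> > 0" "\<And>t c x. t \<in> {-\<epsilon><..<\<epsilon>} \<Longrightarrow> c \<in> A \<Longrightarrow> x \<in> img_chart c \<Longrightarrow> spd (shifted t c x)"
    using spd_shifted by blast
  have "unit_volume_curve A g h TT_curve"
    unfolding unit_volume_curve_def
  proof (intro conjI exI[of _ \<epsilon>] ballI)
    show "\<epsilon> > 0" by (rule \<epsilon>)
    show "unit_volume_metric A (TT_curve t)" if "t \<in> {-\<epsilon><..<\<epsilon>}" for t by (rule TT_curve_unit[OF \<epsilon>(2) that])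
    show "smooth_on ({-\<epsilon><..<\<epsilon>} \<times> img_chart c) (\<lambda>(t, x). TT_curve t c x)" if "c \<in> A" for c
      using TT_curve_smooth[OF \<epsilon>(2) that] by (simp add: jsm_def case_prod_unfold)
    show "TT_curve 0 c x = g c x" if "c \<in> A" "x \<in> img_chart c" for c x
      by (rule TT_curve_velocity(1)[OF \<epsilon>(2,1) that])
    show "((\<lambda>t. TT_curve t c x) has_vector_derivative h c x) (at 0)" if "c \<in> A" "x \<in> img_chart c" for c x
      by (rule TT_curve_velocity(2)[OF \<epsilon>(2,1) that])
  qed
  then show ?thesis by blast
qed

end

text \<open>Two first derivatives agree on a neighbourhood of \<open>t\<close>, so their derivatives
  at \<open>t\<close> agree as well.\<close>

lemma has_second_derivative_unique:
  assumes "has_second_derivative f D t" "has_second_derivative f D' t" shows "D = D'"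
proof -
  obtain f1 f2 where 1: "\<forall>\<^sub>F u in nhds t. (f has_real_derivative f1 u) (at u)" "(f1 has_real_derivative D) (at t)"
    and 2: "\<forall>\<^sub>F u in nhds t. (f has_real_derivative f2 u) (at u)" "(f2 has_real_derivative D') (at t)"
    using assms unfolding has_second_derivative_def by blast
  have "\<forall>\<^sub>F u in nhds t. f1 u = f2 u" using eventually_conj[OF 1(1) 2(1)] by eventually_elim (blast intro: DERIV_unique)
  then have "(f1 has_real_derivative D') (at t)" using DERIV_cong_ev[OF refl _ refl] 2(2) by blast
  with 1(2) show ?thesis by (rule DERIV_unique)
qed

context flat_TT_manifold
begin

lemma unit_volume_curve_derivative:
  assumes P: "cover P" and \<gamma>: "unit_volume_curve A g h \<gamma>"
  shows "has_second_derivative (\<lambda>t. curv_functional A s \<tau> (\<gamma> t)) (second_derivative P s) 0"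
    and "s > -4 \<Longrightarrow> second_derivative P s \<ge> 0" "s < -4 \<Longrightarrow> second_derivative P s \<le> 0"
proof -
  obtain \<epsilon> where 1: "\<epsilon> > 0" "\<And>t. t \<in> {-\<epsilon><..<\<epsilon>} \<Longrightarrow> unit_volume_metric A (\<gamma> t)"
    "\<And>c. c \<in> A \<Longrightarrow> smooth_on ({-\<epsilon><..<\<epsilon>} \<times> img_chart c) (\<lambda>(t, x). \<gamma> t c x)"
    using \<gamma> unfolding unit_volume_curve_def by blast
  have 2: "\<And>c x. c \<in> A \<Longrightarrow> x \<in> img_chart c \<Longrightarrow> \<gamma> 0 c x = g c x"
    "\<And>c x. c \<in> A \<Longrightarrow> x \<in> img_chart c \<Longrightarrow> ((\<lambda>t. \<gamma> t c x) has_vector_derivative h c x) (at 0)"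
    using \<gamma> unfolding unit_volume_curve_def by blast+
  show "has_second_derivative (\<lambda>t. curv_functional A s \<tau> (\<gamma> t)) (second_derivative P s) 0"
    by (rule curve_second_derivative[OF 1 2 P])
  show "s > -4 \<Longrightarrow> second_derivative P s \<ge> 0" by (rule second_derivative_sign(1)[OF 1 2 P])
  show "s < -4 \<Longrightarrow> second_derivative P s \<le> 0" by (rule second_derivative_sign(2)[OF 1 2 P])
qed

text \<open>The computed value works for every curve. Any other value with this property must equal
  it, because at least one curve exists and a second derivative along it is unique.\<close>

lemma second_variation_eq:
  assumes P: "cover P" shows "second_variation A s \<tau> g h = second_derivative P s"
  unfolding second_variation_def
proof (rule the_equality)
  show "\<forall>\<gamma>. unit_volume_curve A g h \<gamma> \<longrightarrow> has_second_derivative (\<lambda>t. curv_functional A s \<tau> (\<gamma> t)) (second_derivative P s) 0"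
    using unit_volume_curve_derivative(1)[OF P] by blast
  fix D assume "\<forall>\<gamma>. unit_volume_curve A g h \<gamma> \<longrightarrow> has_second_derivative (\<lambda>t. curv_functional A s \<tau> (\<gamma> t)) D 0"
  then show "D = second_derivative P s"
    using unit_volume_curve_derivative(1)[OF P] unit_volume_curve_exists has_second_derivative_unique by blast
qed

end

theorem theorem1p3:
  fixes A :: "('a::t2_space, 'n::finite) chart set"
    and g :: "('a, 'n) tensor2"
    and s \<tau> :: real
  assumes "CARD('n) \<ge> 3"
    and "closed_connected_manifold A"
    and "unit_volume_metric A g"
    and "constant_sectional_curvature A g 0"
  shows "\<forall>h. TT_tensor A g h \<longrightarrow>
           (s > -4 \<longrightarrow> second_variation A s \<tau> g h \<ge> 0) \<and>
           (s < -4 \<longrightarrow> second_variation A s \<tau> g h \<le> 0)"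
proof (intro allI impI)
  fix h assume h: "TT_tensor A g h"
  interpret flat_TT_manifold A g h
    using assms(2-4) h
    by (simp add: flat_TT_manifold_def flat_TT_manifold_axioms_def unit_volume_metric_def finite_riem_manifold_def
        riem_manifold_def manifold_def riem_manifold_axioms_def finite_riem_manifold_axioms_def)
  obtain P where P: "cover P" using cover_exists by blast
  obtain \<gamma> where \<gamma>: "unit_volume_curve A g h \<gamma>" using unit_volume_curve_exists by blast
  show "(s > -4 \<longrightarrow> second_variation A s \<tau> g h \<ge> 0) \<and> (s < -4 \<longrightarrow> second_variation A s \<tau> g h \<le> 0)"
    unfolding second_variation_eq[OF P] using unit_volume_curve_derivative(2,3)[OF P \<gamma>] by blast
qed

end
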